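(* Let $\gamma\in L^\infty_+(\Gamma)$. For every $f\in L^2(\Gamma)$ there exists a sequence $(g_n)_{n\in\mathbb{N}}\subset L^2(\partial\Omega)$ such that the corresponding solutions satisfy $u_\gamma^{(g_n)}|_\Gamma\to f$ in $L^2(\Gamma)$.
   Context: Let $\Omega\subset\mathbb{R}^d$ ($d\ge 2$) be a bounded domain with Lipschitz boundary $\partial\Omega$, and let $\Omega_1$ be an open set with $\overline{\Omega_1}\subset\Omega$ such that $\Gamma:=\partial\Omega_1$ is Lipschitz and $\Omega_2:=\Omega\setminus\overline{\Omega_1}$ is connected. Let $\sigma=\sigma_1\chi_{\Omega_1}+\sigma_2\chi_{\Omega_2}$ with constants $\sigma_1,\sigma_2>0$. $L^\infty_+(\Gamma)$ denotes the set of functions in $L^\infty(\Gamma)$ with positive essential infimum. For $\gamma\in L^\infty_+(\Gamma)$ and $g\in L^2(\partial\Omega)$, let $u=u_\gamma^{(g)}\in H^1(\Omega)$ be the unique solution of $\int_\Omega\sigma\nabla u\cdot\nabla w\,dx+\int_\Gamma\gamma uw\,ds=\int_{\partial\Omega}gw\,ds$ for all $w\in H^1(\Omega)$. *)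

theory Defs
  imports "HOL-Analysis.Analysis"
begin

text \<open>An open set is Lipschitz if it is bounded and near every boundary point it is,
  in a suitable orthonormal coordinate system (vertical direction e), the region below
  the graph of a Lipschitz function of the horizontal coordinates (the projection onto
  the hyperplane orthogonal to e).\<close>
definition lipschitz_open :: "'a::euclidean_space set \<Rightarrow> bool" where
  "lipschitz_open U \<longleftrightarrow> open U \<and> bounded U \<and>
     (\<forall>x\<in>frontier U. \<exists>r>0. \<exists>e. norm e = 1 \<and>
        (\<exists>L h. L-lipschitz_on UNIV (h :: 'a \<Rightarrow> real) \<and>
           U \<inter> ball x r = {y \<in> ball x r. y \<bullet> e < h (y - (y \<bullet> e) *\<^sub>R e)}))"

definition hausdorff_pre :: "nat \<Rightarrow> real \<Rightarrow> 'a::metric_space set \<Rightarrow> ennreal" where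
  "hausdorff_pre s \<delta> A =
     (INF C \<in> {C :: nat \<Rightarrow> 'a set. A \<subseteq> (\<Union>i. C i) \<and> (\<forall>i. bounded (C i) \<and> diameter (C i) \<le> \<delta>)}.
        (\<Sum>i. ennreal (unit_ball_vol (real s) * (diameter (C i) / 2) ^ s)))"

definition hausdorff :: "nat \<Rightarrow> 'a::metric_space set \<Rightarrow> ennreal" where
  "hausdorff s A = (SUP \<delta> \<in> {0<..}. hausdorff_pre s \<delta> A)"

definition surface_measure :: "'a::euclidean_space set \<Rightarrow> 'a measure" where
  "surface_measure S =
     restrict_space (measure_of UNIV (sets borel) (hausdorff (DIM('a) - 1))) S"

definition L2 :: "'a measure \<Rightarrow> ('a \<Rightarrow> real) \<Rightarrow> bool" where
  "L2 M f \<longleftrightarrow> f \<in> borel_measurable M \<and> (\<integral>\<^sup>+ x. ennreal ((f x)\<^sup>2) \<partial>M) < \<infinity>"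

definition Linf_pos :: "'a measure \<Rightarrow> ('a \<Rightarrow> real) \<Rightarrow> bool" where
  "Linf_pos M g \<longleftrightarrow> g \<in> borel_measurable M \<and>
     (\<exists>c C. 0 < c \<and> (AE x in M. c \<le> g x \<and> g x \<le> C))"

definition C1_grad :: "('a::euclidean_space \<Rightarrow> real) \<Rightarrow> ('a \<Rightarrow> 'a) \<Rightarrow> bool" where
  "C1_grad \<phi> d\<phi> \<longleftrightarrow> (\<forall>x. (\<phi> has_derivative (\<lambda>h. d\<phi> x \<bullet> h)) (at x)) \<and> continuous_on UNIV d\<phi>"

definition test_fun :: "'a::euclidean_space set \<Rightarrow> ('a \<Rightarrow> real) \<Rightarrow> ('a \<Rightarrow> 'a) \<Rightarrow> bool" where
  "test_fun U \<phi> d\<phi> \<longleftrightarrow> C1_grad \<phi> d\<phi> \<and> compact (closure {x. \<phi> x \<noteq> 0}) \<and> closure {x. \<phi> x \<noteq> 0} \<subseteq> U"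

definition weak_grad :: "'a::euclidean_space set \<Rightarrow> ('a \<Rightarrow> real) \<Rightarrow> ('a \<Rightarrow> 'a) \<Rightarrow> bool" where
  "weak_grad U u G \<longleftrightarrow> L2 (lebesgue_on U) u \<and> G \<in> borel_measurable (lebesgue_on U) \<and>
     (\<integral>\<^sup>+ x. ennreal ((norm (G x))\<^sup>2) \<partial>lebesgue_on U) < \<infinity> \<and>
     (\<forall>\<phi> d\<phi>. test_fun U \<phi> d\<phi> \<longrightarrow>
        (\<forall>i\<in>Basis. (\<integral>x. u x * (d\<phi> x \<bullet> i) \<partial>lebesgue_on U) = - (\<integral>x. (G x \<bullet> i) * \<phi> x \<partial>lebesgue_on U)))"

text \<open>t is the trace on S of u \<in> H^1(U): the L^2(S)-limit of restrictions to S of C^1 functions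
  converging to u in H^1(U) (trace operator as continuous extension of restriction).\<close>
definition trace_on :: "'a::euclidean_space set \<Rightarrow> 'a set \<Rightarrow> ('a \<Rightarrow> real) \<Rightarrow> ('a \<Rightarrow> real) \<Rightarrow> bool" where
  "trace_on U S u t \<longleftrightarrow> (\<exists>G. weak_grad U u G \<and> L2 (surface_measure S) t \<and>
     (\<exists>\<phi> d\<phi>. (\<forall>n. C1_grad (\<phi> n) (d\<phi> n)) \<and>
        (\<lambda>n. \<integral>\<^sup>+ x. ennreal ((\<phi> n x - u x)\<^sup>2 + (norm (d\<phi> n x - G x))\<^sup>2) \<partial>lebesgue_on U) \<longlonglongrightarrow> 0 \<and>
        (\<lambda>n. \<integral>\<^sup>+ x. ennreal ((\<phi> n x - t x)\<^sup>2) \<partial>surface_measure S) \<longlonglongrightarrow> 0))"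

definition weak_solution ::
  "'a::euclidean_space set \<Rightarrow> 'a set \<Rightarrow> real \<Rightarrow> real \<Rightarrow> ('a \<Rightarrow> real) \<Rightarrow> ('a \<Rightarrow> real) \<Rightarrow> ('a \<Rightarrow> real) \<Rightarrow> bool" where
  "weak_solution \<Omega> \<Omega>1 \<sigma>1 \<sigma>2 \<gamma> g u \<longleftrightarrow>
     (\<exists>G u\<Gamma>. weak_grad \<Omega> u G \<and> trace_on \<Omega> (frontier \<Omega>1) u u\<Gamma> \<and>
       (\<forall>w Gw w\<Gamma> w\<Omega>. weak_grad \<Omega> w Gw \<and> trace_on \<Omega> (frontier \<Omega>1) w w\<Gamma> \<and>
            trace_on \<Omega> (frontier \<Omega>) w w\<Omega> \<longrightarrow>
          (\<integral>x. (if x \<in> \<Omega>1 then \<sigma>1 else \<sigma>2) * (G x \<bullet> Gw x) \<partial>lebesgue_on \<Omega>)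
          + (\<integral>x. \<gamma> x * u\<Gamma> x * w\<Gamma> x \<partial>surface_measure (frontier \<Omega>1))
          = (\<integral>x. g x * w\<Omega> x \<partial>surface_measure (frontier \<Omega>))))"

end

theory Submission
  imports Defs "HOL-Complex_Analysis.Complex_Analysis"
begin

text \<open>The traces of solutions form a subspace of \<open>L\<^sup>2(\<Gamma>)\<close>, so it suffices that an \<open>f\<close> orthogonal to all
  of them is zero. Let \<open>v\<close> solve the problem with the source \<open>f\<close> on the interface and no flux on the outer
  boundary. Testing \<open>v\<close> against the solution with boundary datum \<open>v\<close> shows that \<open>v\<close> also vanishes on the
  outer boundary, so its extension by zero is weakly harmonic across this boundary. Unique
  continuation then gives \<open>v = 0\<close> outside the inclusion, hence \<open>v = 0\<close> on \<open>\<Gamma>\<close>; testing the equation with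
  \<open>v\<close> itself leaves \<open>\<nabla>v = 0\<close>, and then the equation reads \<open>\<integral> f w = 0\<close> for all \<open>w\<close>.

  Unique continuation is obtained without Weyl's lemma: cutting \<open>v\<close> off and testing with the fundamental
  solution regularized as \<open>|y|\<^sup>2 + \<epsilon>\<^sup>2\<close> represents \<open>v\<close> as a potential of sources in an annulus, which is
  analytic along lines. Traces and the needed parts of the divergence theorem are derived from the
  two-sided bounds \<open>c r ^ (d - 1) \<le> H (\<Gamma> \<inter> ball x r) \<le> C r ^ (d - 1)\<close> for the surface measure \<open>H\<close> alone,
  without the area formula.\<close>

section \<open>Bounds for the Hausdorff measure\<close>

text \<open>There is no ready-made space \<open>H^1\<close>: \<open>trace_on\<close> is a relation
  defined by C^1 approximation, and gradients and traces are separate functions. Everything is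
  therefore done first for C^1 functions with the energy as inner product, and a solution is what a
  minimizing sequence converges to; \<open>H1lim\<close> ties function, gradient and interface trace
  to one sequence. Coercivity rests on a Poincare inequality that starts inside the inclusion. Crude
  surface bounds suffice because boundary integrals are never evaluated by parts. The divergence
  theorem only serves to bound a volume integral by the boundary integral of an absolute value;
  neither a normal field nor a sharp constant occurs. Unique continuation must start from an open
  set where the function is already known to vanish.\<close>

lemma hausdorff_lower:
  fixes A :: "'a::euclidean_space set"
  assumes m: "m \<ge> 1" and \<delta>: "0 < \<delta>" and B: "0 \<le> B"
    and cov: "\<And>y \<rho>. (\<And>i. 0 < \<rho> i \<and> \<rho> i \<le> \<delta>) \<Longrightarrow> A \<subseteq> (\<Union>i. cball (y i) (\<rho> i)) \<Longrightarrow>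
                ennreal B \<le> (\<Sum>i::nat. ennreal (\<rho> i ^ m))"
  shows "ennreal (unit_ball_vol (real m) / 2 ^ m * B) \<le> hausdorff m A"
proof -
  \<comment> \<open>A set of diameter \<open>D\<close> is put into a ball of radius about
    \<open>D\<close> around one of its own points, not \<open>D / 2\<close>; this costs the factor
    \<open>2 ^ m\<close>.\<close>
  define w where "w = unit_ball_vol (real m) / 2 ^ m"
  have w: "w > 0" by (simp add: w_def)
  have "ennreal (w * B) \<le> hausdorff_pre m (\<delta>/2) A"
    unfolding hausdorff_pre_def
  proof (rule INF_greatest)
    fix C :: "nat \<Rightarrow> 'a set"
    assume "C \<in> {C. A \<subseteq> (\<Union>i. C i) \<and> (\<forall>i. bounded (C i) \<and> diameter (C i) \<le> \<delta> / 2)}"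
    then have AC: "A \<subseteq> (\<Union>i. C i)" and bC: "\<And>i. bounded (C i)" and dC: "\<And>i. diameter (C i) \<le> \<delta>/2" by auto
    have eq: "unit_ball_vol (real m) * (diameter (C i) / 2) ^ m = w * diameter (C i) ^ m" for i
      by (simp add: w_def power_divide)
    show "ennreal (w * B) \<le> (\<Sum>i. ennreal (unit_ball_vol (real m) * (diameter (C i) / 2) ^ m))"
      unfolding eq
    proof (rule ennreal_le_epsilon)
      fix \<epsilon> :: real assume \<epsilon>: "0 < \<epsilon>"
      \<comment> \<open>Covering sets may be single points while \<open>cov\<close> wants positive
        radii, so each radius is raised slightly; the errors \<open>\<epsilon> * (1/2)^Suc i\<close>
        add up to \<open>\<epsilon>\<close>.\<close>
      have "\<exists>\<rho>. 0 < \<rho> \<and> \<rho> \<le> \<delta> \<and> diameter (C i) \<le> \<rho> \<and> w * \<rho> ^ m \<le> w * diameter (C i) ^ m + \<epsilon> * (1/2)^Suc i" for i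
      proof -
        define D where "D = diameter (C i)"
        have D: "0 \<le> D" "D \<le> \<delta>/2" using diameter_ge_0[OF bC] dC by (auto simp: D_def)
        have "continuous (at D) (\<lambda>t. w * t ^ m)" by (intro continuous_intros)
        moreover have "\<epsilon> * (1/2)^Suc i > 0" using \<epsilon> by simp
        ultimately obtain \<eta> where \<eta>: "\<eta> > 0" "\<And>t. \<bar>t - D\<bar> < \<eta> \<Longrightarrow> \<bar>w * t ^ m - w * D ^ m\<bar> < \<epsilon> * (1/2)^Suc i"
          unfolding continuous_at_eps_delta dist_real_def by blast
        define \<rho> where "\<rho> = D + min (\<eta>/2) (\<delta>/2)"
        have "\<bar>\<rho> - D\<bar> < \<eta>" using \<eta> \<delta> by (auto simp: \<rho>_def)
        from \<eta>(2)[OF this] have "w * \<rho> ^ m \<le> w * D ^ m + \<epsilon> * (1/2)^Suc i" by linarith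
        moreover have "0 < \<rho>" "\<rho> \<le> \<delta>" "D \<le> \<rho>" using \<eta> \<delta> D by (auto simp: \<rho>_def)
        ultimately show ?thesis unfolding D_def by blast
      qed
      then obtain \<rho> where \<rho>: "\<And>i. 0 < \<rho> i" "\<And>i. \<rho> i \<le> \<delta>" "\<And>i. diameter (C i) \<le> \<rho> i"
        "\<And>i. w * \<rho> i ^ m \<le> w * diameter (C i) ^ m + \<epsilon> * (1/2)^Suc i" by metis
      define y where "y i = (SOME z. z \<in> C i)" for i
      have "C i \<subseteq> cball (y i) (\<rho> i)" for i
      proof
        fix z assume z: "z \<in> C i"
        then have "y i \<in> C i" unfolding y_def by (rule someI)
        with z show "z \<in> cball (y i) (\<rho> i)"
          using diameter_bounded_bound[OF bC, of "y i" i z] \<rho>(3)[of i] by auto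
      qed
      then have "(\<Union>i. C i) \<subseteq> (\<Union>i. cball (y i) (\<rho> i))" by (intro UN_mono) auto
      then have "A \<subseteq> (\<Union>i. cball (y i) (\<rho> i))" by (rule order_trans[OF AC])
      with cov[of \<rho> y] \<rho>(1,2) have "ennreal B \<le> (\<Sum>i. ennreal (\<rho> i ^ m))" by simp
      then have "ennreal w * ennreal B \<le> ennreal w * (\<Sum>i. ennreal (\<rho> i ^ m))" by (rule mult_left_mono) simp
      also have "\<dots> = (\<Sum>i. ennreal (w * \<rho> i ^ m))"
        using w \<rho>(1) by (subst ennreal_suminf_cmult[symmetric]) (simp add: ennreal_mult less_imp_le)
      also have "\<dots> \<le> (\<Sum>i. ennreal (w * diameter (C i) ^ m) + ennreal (\<epsilon> * (1/2)^Suc i))"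
      proof (intro suminf_le)
        fix i
        have "0 \<le> w * diameter (C i) ^ m" using w diameter_ge_0[OF bC[of i]] by simp
        then show "ennreal (w * \<rho> i ^ m) \<le> ennreal (w * diameter (C i) ^ m) + ennreal (\<epsilon> * (1/2)^Suc i)"
          using ennreal_leI[OF \<rho>(4)[of i]] \<epsilon> by simp
      qed auto
      also have "\<dots> = (\<Sum>i. ennreal (w * diameter (C i) ^ m)) + (\<Sum>i. ennreal (\<epsilon> * (1/2)^Suc i))"
        by (intro suminf_add[symmetric]) auto
      also have "(\<Sum>i. ennreal (\<epsilon> * (1/2)^Suc i)) = ennreal \<epsilon>"
        using sums_mult[OF power_half_series, of \<epsilon>] \<epsilon> by (intro suminf_ennreal_eq) auto
      finally show "ennreal (w * B) \<le> (\<Sum>i. ennreal (w * diameter (C i) ^ m)) + ennreal \<epsilon>"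
        using w B by (simp add: ennreal_mult)
    qed
  qed
  also have "\<dots> \<le> hausdorff m A"
    unfolding hausdorff_def using \<delta> by (intro SUP_upper) auto
  finally show ?thesis by (simp add: w_def)
qed

text \<open>The Hausdorff measure is a supremum over the scale, so covers by equal balls are
  demanded at every small radius; each one bounds the premeasure at its own scale, with the same
  \<open>B\<close>.\<close>

lemma hausdorff_upper:
  fixes A :: "'a::euclidean_space set"
  assumes m: "m \<ge> 1" and s: "0 < s"
    and cov: "\<And>\<rho>. 0 < \<rho> \<Longrightarrow> \<rho> \<le> s \<Longrightarrow>
       \<exists>P. finite P \<and> A \<subseteq> (\<Union>p\<in>P. cball p \<rho>) \<and> real (card P) * \<rho> ^ m \<le> B"
  shows "hausdorff m A \<le> ennreal (unit_ball_vol (real m) * B)"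
  unfolding hausdorff_def
proof (rule SUP_least)
  fix \<delta> :: real assume "\<delta> \<in> {0<..}"
  then have \<delta>: "\<delta> > 0" by simp
  define \<rho> where "\<rho> = min (\<delta>/2) s"
  have \<rho>: "0 < \<rho>" "\<rho> \<le> s" "2 * \<rho> \<le> \<delta>" using \<delta> s by (auto simp: \<rho>_def)
  from cov[OF \<rho>(1,2)] obtain P where P: "finite P" "A \<subseteq> (\<Union>p\<in>P. cball p \<rho>)" "real (card P) * \<rho> ^ m \<le> B"
    by blast
  obtain g where g: "bij_betw g {0..<card P} P" using ex_bij_betw_nat_finite[OF P(1)] by blast
  \<comment> \<open>The finite cover is padded with empty sets: their diameter is 0, and
    \<open>m \<ge> 1\<close> makes the corresponding terms vanish.\<close>
  define C where "C i = (if i < card P then cball (g i) \<rho> else {})" for i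
  have "A \<subseteq> (\<Union>i. C i)"
  proof
    fix x assume "x \<in> A"
    then obtain p where p: "p \<in> P" "x \<in> cball p \<rho>" using P by blast
    then obtain i where "i < card P" "p = g i" using g unfolding bij_betw_def by force
    then show "x \<in> (\<Union>i. C i)" using p by (auto simp: C_def intro!: exI[of _ i])
  qed
  moreover have "bounded (C i) \<and> diameter (C i) \<le> \<delta>" for i
    using \<rho> \<delta> by (auto simp: C_def)
  ultimately have "hausdorff_pre m \<delta> A \<le> (\<Sum>i. ennreal (unit_ball_vol (real m) * (diameter (C i) / 2) ^ m))"
    unfolding hausdorff_pre_def by (intro INF_lower) auto
  also have "\<dots> = (\<Sum>i. if i < card P then ennreal (unit_ball_vol (real m) * \<rho> ^ m) else 0)"
    using \<rho> m by (intro arg_cong[where f = suminf]) (auto simp: C_def fun_eq_iff)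
  also have "\<dots> = (\<Sum>i<card P. ennreal (unit_ball_vol (real m) * \<rho> ^ m))"
    by (subst suminf_finite[of "{..<card P}"]) auto
  also have "\<dots> = ennreal (real (card P) * (unit_ball_vol (real m) * \<rho> ^ m))"
    using \<rho> by (simp add: ennreal_mult less_imp_le ennreal_of_nat_eq_real_of_nat)
  also have "\<dots> \<le> ennreal (unit_ball_vol (real m) * B)"
    using mult_left_mono[OF P(3), of "unit_ball_vol (real m)"]
    by (intro ennreal_leI) (simp add: algebra_simps)
  finally show "hausdorff_pre m \<delta> A \<le> ennreal (unit_ball_vol (real m) * B)" .
qed

section \<open>Hausdorff measure of a Lipschitz graph\<close>

text \<open>\<open>k y\<close> is the signed height of the graph above \<open>y\<close>. The rule
  \<open>shift\<close> expresses the graph property without coordinates: the vertical line through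
  \<open>y\<close> meets the level set \<open>k = 0\<close> exactly at
  \<open>y + k y *\<^sub>R e\<close>.\<close>

locale graph_chart =
  fixes k :: "'a::euclidean_space \<Rightarrow> real" and e :: 'a and K :: real
  assumes e: "norm e = 1"
    and lip: "K-lipschitz_on UNIV k"
    and shift: "\<And>y t. k (y + t *\<^sub>R e) = k y - t"
begin

lemma lipD: "\<bar>k y - k z\<bar> \<le> K * dist y z"
  using lipschitz_onD[OF lip, of y z] by (simp add: dist_real_def)

lemma K_ge_1: "K \<ge> 1"
  using lipD[of "0 + 1 *\<^sub>R e" 0] shift[of 0 1] e by (simp add: dist_norm)

lemma cont: "continuous_on S k"
  using lipschitz_on_continuous_on[OF lip] continuous_on_subset by blast

definition lower_const :: real where
  "lower_const = unit_ball_vol (real (DIM('a) - 1)) / 2 ^ (DIM('a) - 1) * (1 / (3 * 3 ^ DIM('a) * (1 + K) ^ DIM('a)))"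

definition upper_const :: real where
  "upper_const = unit_ball_vol (real (DIM('a) - 1)) * (6 ^ DIM('a) * (1 + K) ^ (DIM('a) - 1))"

lemma lower_const_pos: "lower_const > 0" and upper_const_pos: "upper_const > 0"
  using K_ge_1 by (auto simp: lower_const_def upper_const_def)

text \<open>Comparison of volumes. If balls cover the patch of surface, vertical stacks of enlarged
  balls cover a solid ball. A ball of radius \<open>\<rho>\<close> needs a stack of about
  \<open>2 * s / \<rho>\<close> balls, of total volume of order \<open>s * \<rho> ^ (d - 1)\<close>,
  so the sum of the \<open>\<rho> ^ (d - 1)\<close> is at least a multiple of
  \<open>s ^ (d - 1)\<close>.\<close>

lemma hausdorff_ge:
  assumes dim: "DIM('a) \<ge> 2" and x: "k x = 0" and s: "s > 0"
    and S: "\<And>y. y \<in> ball x s \<Longrightarrow> k y = 0 \<Longrightarrow> y \<in> S"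
  shows "ennreal (lower_const * s ^ (DIM('a) - 1)) \<le> hausdorff (DIM('a) - 1) (S \<inter> ball x s)"
proof -
  define d where "d = DIM('a)"
  define vb where "vb = unit_ball_vol (real d)"
  have vb: "vb > 0" by (simp add: vb_def)
  have d: "d \<ge> 2" using dim by (simp add: d_def)
  have sd: "s ^ d = s * s ^ (d - 1)" using d by (cases d) auto
  define B where "B = s ^ (d - 1) / (3 * 3 ^ d * (1 + K) ^ d)"
  have "ennreal (unit_ball_vol (real (d - 1)) / 2 ^ (d - 1) * B) \<le> hausdorff (d - 1) (S \<inter> ball x s)"
  proof (rule hausdorff_lower[OF _ s])
    show "1 \<le> d - 1" using d by simp
    show "0 \<le> B" using s K_ge_1 by (simp add: B_def)
    fix y :: "nat \<Rightarrow> 'a" and \<rho> :: "nat \<Rightarrow> real"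
    assume \<rho>: "\<And>i. 0 < \<rho> i \<and> \<rho> i \<le> s" and cov: "S \<inter> ball x s \<subseteq> (\<Union>i. cball (y i) (\<rho> i))"
    \<comment> \<open>The stack covers heights from \<open>- s\<close> to \<open>s\<close> in steps
      of \<open>\<rho> i\<close>; the radius \<open>3 * \<rho> i\<close> absorbs the rounding of the
      height.\<close>
    define N where "N i = nat \<lfloor>2 * s / \<rho> i\<rfloor> + 1" for i
    define T where "T i = (\<Union>j<N i. ball (y i + (real j * \<rho> i - s) *\<^sub>R e) (3 * \<rho> i))" for i
    \<comment> \<open>The vertical projection \<open>w\<close> of \<open>z\<close> to the surface
      moves by \<open>\<bar>k z\<bar> \<le> K * dist x z\<close>; the factor \<open>1 + K\<close>
      keeps \<open>w\<close> in \<open>ball x s\<close>.\<close>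
    have "ball x (s / (1 + K)) \<subseteq> (\<Union>i. T i)"
    proof
      fix z assume z: "z \<in> ball x (s / (1 + K))"
      define w where "w = z + k z *\<^sub>R e"
      have kz: "\<bar>k z\<bar> \<le> K * dist x z" using lipD[of z x] x by (simp add: dist_commute)
      have z': "(1 + K) * dist x z < s" using z K_ge_1 by (simp add: field_simps)
      have "dist x w \<le> dist x z + dist z w" by (rule dist_triangle)
      also have "dist z w = \<bar>k z\<bar>" using e by (simp add: w_def dist_norm)
      finally have "dist x w \<le> (1 + K) * dist x z" using kz by (simp add: algebra_simps)
      then have "w \<in> ball x s" using z' by simp
      moreover have "k w = 0" by (simp add: w_def shift)
      ultimately obtain i where i: "w \<in> cball (y i) (\<rho> i)" using cov S by blast
      have "K * dist x z \<le> (1 + K) * dist x z" by (simp add: algebra_simps)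
      then have kzs: "\<bar>k z\<bar> < s" using kz z' by linarith
      have \<rho>i: "\<rho> i > 0" using \<rho> by auto
      define j where "j = nat \<lfloor>(s - k z) / \<rho> i\<rfloor>"
      have "0 \<le> (s - k z) / \<rho> i" using kzs \<rho>i by simp
      then have fl: "real j \<le> (s - k z) / \<rho> i" "(s - k z) / \<rho> i < real j + 1"
        unfolding j_def by linarith+
      have "(s - k z) / \<rho> i \<le> 2 * s / \<rho> i" using kzs \<rho>i by (intro divide_right_mono) auto
      then have "j \<le> nat \<lfloor>2 * s / \<rho> i\<rfloor>" unfolding j_def by (intro nat_mono floor_mono)
      then have jN: "j < N i" by (simp add: N_def)
      have fl': "real j * \<rho> i \<le> s - k z" "s - k z < real j * \<rho> i + \<rho> i"
        using fl \<rho>i by (auto simp: field_simps)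
      let ?c = "y i + (real j * \<rho> i - s) *\<^sub>R e"
      have "?c - z = (y i - w) + (real j * \<rho> i - s + k z) *\<^sub>R e"
        by (simp add: w_def algebra_simps)
      then have "dist ?c z \<le> norm (y i - w) + \<bar>real j * \<rho> i - s + k z\<bar>"
        using norm_triangle_ineq[of "y i - w" "(real j * \<rho> i - s + k z) *\<^sub>R e"] e
        unfolding dist_norm by (metis norm_scaleR mult.right_neutral)
      also have "\<dots> \<le> \<rho> i + \<rho> i" using i fl' by (intro add_mono) (auto simp: dist_norm)
      also have "\<dots> < 3 * \<rho> i" using \<rho>i by simp
      finally show "z \<in> (\<Union>i. T i)" using jN unfolding T_def by (auto intro!: exI[of _ i] bexI[of _ j])
    qed
    then have "emeasure lborel (ball x (s / (1 + K))) \<le> emeasure lborel (\<Union>i. T i)"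
      by (intro emeasure_mono) (auto simp: T_def intro!: sets.countable_UN)
    also have "\<dots> \<le> (\<Sum>i. emeasure lborel (T i))"
      by (intro emeasure_subadditive_countably) (auto simp: T_def)
    also have "\<dots> \<le> (\<Sum>i. ennreal (3 * s * vb * 3 ^ d) * ennreal (\<rho> i ^ (d - 1)))"
    proof (intro suminf_le)
      fix i
      have \<rho>i: "\<rho> i > 0" "\<rho> i \<le> s" using \<rho> by auto
      have "emeasure lborel (T i) \<le> (\<Sum>j<N i. emeasure lborel (ball (y i + (real j * \<rho> i - s) *\<^sub>R e) (3 * \<rho> i)))"
        unfolding T_def by (intro emeasure_subadditive_finite) auto
      also have "\<dots> = ennreal (real (N i) * (vb * (3 * \<rho> i) ^ d))"
        using \<rho>i vb by (simp add: emeasure_ball ennreal_mult ennreal_of_nat_eq_real_of_nat flip: vb_def d_def)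
      also have "\<dots> \<le> ennreal ((3 * s / \<rho> i) * (vb * (3 * \<rho> i) ^ d))"
      proof (intro ennreal_leI mult_right_mono)
        have "real (N i) \<le> 2 * s / \<rho> i + 1" using s \<rho>i unfolding N_def by (simp add: of_nat_nat)
        also have "\<dots> \<le> 3 * s / \<rho> i" using \<rho>i by (simp add: field_simps)
        finally show "real (N i) \<le> 3 * s / \<rho> i" .
      qed (use \<rho>i vb in auto)
      also have "(3 * s / \<rho> i) * (vb * (3 * \<rho> i) ^ d) = (3 * s * vb * 3 ^ d) * \<rho> i ^ (d - 1)"
        using \<rho>i d by (cases d) (auto simp: power_mult_distrib)
      finally show "emeasure lborel (T i) \<le> ennreal (3 * s * vb * 3 ^ d) * ennreal (\<rho> i ^ (d - 1))"
        using s vb \<rho>i by (simp add: ennreal_mult)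
    qed auto
    also have "\<dots> = ennreal (3 * s * vb * 3 ^ d) * (\<Sum>i. ennreal (\<rho> i ^ (d - 1)))"
      by simp
    also have "emeasure lborel (ball x (s / (1 + K))) = ennreal (3 * s * vb * 3 ^ d) * ennreal B"
      using s vb K_ge_1
      by (subst emeasure_ball) (auto simp: B_def power_divide sd field_simps simp flip: ennreal_mult vb_def d_def)
    finally show "ennreal B \<le> (\<Sum>i. ennreal (\<rho> i ^ (d - 1)))"
      using s vb by (subst (asm) ennreal_mult_le_mult_iff) auto
  qed
  then show ?thesis by (simp add: d_def B_def lower_const_def)
qed

text \<open>Packing counterpart of \<open>hausdorff_ge\<close>: over each point stands a column of
  about \<open>s / \<rho>'\<close> small balls. All of them are disjoint and lie in
  \<open>ball x (3 * s)\<close>, so the volume bounds the number of columns.\<close>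

lemma card_separated_le:
  assumes s: "0 < s" and \<rho>: "0 < \<rho>" "\<rho> \<le> s" and P: "finite P" "P \<subseteq> ball x s"
    and k0: "\<And>p. p \<in> P \<Longrightarrow> k p = 0"
    and sep: "\<And>p q. p \<in> P \<Longrightarrow> q \<in> P \<Longrightarrow> p \<noteq> q \<Longrightarrow> \<rho> \<le> dist p q"
  shows "real (card P) * \<rho> ^ (DIM('a) - 1) \<le> 6 ^ DIM('a) * (1 + K) ^ (DIM('a) - 1) * s ^ (DIM('a) - 1)"
proof -
  define d where "d = DIM('a)"
  define vb where "vb = unit_ball_vol (real d)"
  have vb: "vb > 0" by (simp add: vb_def)
  have d: "d > 0" by (simp add: d_def)
  \<comment> \<open>Centres in different columns are at least \<open>\<rho> / (1 + K)\<close> apart: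
    if their distance is \<open>t\<close>, their heights differ by at most \<open>K * t\<close>,
    hence the base points are at distance at most \<open>(1 + K) * t\<close>.\<close>
  define \<rho>' where "\<rho>' = \<rho> / (1 + K)"
  have \<rho>': "0 < \<rho>'" "\<rho>' \<le> s" "\<rho>' \<le> \<rho>"
  proof -
    show "0 < \<rho>'" using \<rho> K_ge_1 by (simp add: \<rho>'_def)
    show "\<rho>' \<le> \<rho>" using \<rho> K_ge_1 by (simp add: \<rho>'_def field_simps)
    then show "\<rho>' \<le> s" using \<rho> by simp
  qed
  define M where "M = nat \<lceil>s / \<rho>'\<rceil>"
  have M: "real M \<ge> s / \<rho>'" unfolding M_def using s \<rho>' by linarith
  have jM: "real j * \<rho>' \<le> s" if "j < M" for j
  proof -
    have "real j < s / \<rho>'" using that unfolding M_def by linarith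
    then show ?thesis using \<rho>' by (simp add: field_simps)
  qed
  define F where "F = (\<lambda>(p, j). ball (p + (real j * \<rho>') *\<^sub>R e) (\<rho>' / 2))"
  have dist_ge: "\<rho>' \<le> dist (p + (real i * \<rho>') *\<^sub>R e) (q + (real j * \<rho>') *\<^sub>R e)"
    if "p \<in> P" "q \<in> P" "(p, i) \<noteq> (q, j)" for p q i j
  proof (cases "p = q")
    case True
    then have "i \<noteq> j" using that by auto
    then have "1 \<le> \<bar>real i - real j\<bar>" by (cases i j rule: linorder_cases) auto
    then have "\<rho>' \<le> \<bar>real i * \<rho>' - real j * \<rho>'\<bar>"
      using \<rho>' by (simp add: abs_mult flip: left_diff_distrib)
    moreover have "dist (p + (real i * \<rho>') *\<^sub>R e) (p + (real j * \<rho>') *\<^sub>R e) = norm ((real i * \<rho>' - real j * \<rho>') *\<^sub>R e)"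
      by (simp add: dist_norm algebra_simps)
    ultimately show ?thesis using e True by simp
  next
    case False
    let ?a = "p + (real i * \<rho>') *\<^sub>R e" and ?b = "q + (real j * \<rho>') *\<^sub>R e"
    have 1: "\<bar>real i * \<rho>' - real j * \<rho>'\<bar> \<le> K * dist ?a ?b"
      using lipD[of ?a ?b] k0 that by (simp add: shift abs_minus_commute)
    have "\<rho> \<le> dist p q" using sep that False by auto
    also have "p - q = (?a - ?b) + (real j * \<rho>' - real i * \<rho>') *\<^sub>R e" by (simp add: algebra_simps)
    then have "dist p q \<le> dist ?a ?b + \<bar>real j * \<rho>' - real i * \<rho>'\<bar>"
      using norm_triangle_ineq[of "?a - ?b" "(real j * \<rho>' - real i * \<rho>') *\<^sub>R e"] e
      unfolding dist_norm by (metis norm_scaleR mult.right_neutral)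
    also have "\<dots> \<le> (1 + K) * dist ?a ?b" using 1 by (simp add: algebra_simps abs_minus_commute)
    finally show ?thesis using K_ge_1 by (simp add: \<rho>'_def field_simps)
  qed
  have disj: "disjoint_family_on F (P \<times> {..<M})"
    unfolding disjoint_family_on_def
  proof (intro ballI impI)
    fix a b assume ab: "a \<in> P \<times> {..<M}" "b \<in> P \<times> {..<M}" "a \<noteq> b"
    obtain p i q j where pq: "a = (p, i)" "b = (q, j)" by (cases a, cases b) auto
    show "F a \<inter> F b = {}"
    proof (rule ccontr)
      assume "F a \<inter> F b \<noteq> {}"
      then obtain z where "z \<in> F a" "z \<in> F b" by auto
      then have "dist (p + (real i * \<rho>') *\<^sub>R e) (q + (real j * \<rho>') *\<^sub>R e) < \<rho>'"
        unfolding F_def pq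
        using dist_triangle_half_l[of "p + (real i * \<rho>') *\<^sub>R e" z \<rho>' "q + (real j * \<rho>') *\<^sub>R e"] by auto
      with dist_ge[of p q i j] ab pq show False by auto
    qed
  qed
  have sub: "(\<Union>a\<in>P \<times> {..<M}. F a) \<subseteq> ball x (3 * s)"
  proof
    fix z assume "z \<in> (\<Union>a\<in>P \<times> {..<M}. F a)"
    then obtain p j where pj: "p \<in> P" "j < M" "dist (p + (real j * \<rho>') *\<^sub>R e) z < \<rho>' / 2" by (auto simp: F_def)
    have "dist x z \<le> dist x p + dist p (p + (real j * \<rho>') *\<^sub>R e) + dist (p + (real j * \<rho>') *\<^sub>R e) z"
      using dist_triangle[of x z p] dist_triangle[of p z "p + (real j * \<rho>') *\<^sub>R e"] by linarith
    also have "dist p (p + (real j * \<rho>') *\<^sub>R e) = real j * \<rho>'" using e \<rho>' by (simp add: dist_norm)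
    finally show "z \<in> ball x (3 * s)" using pj jM[OF pj(2)] P(2) \<rho>' by force
  qed
  have "ennreal (real (card P) * real M * (vb * (\<rho>' / 2) ^ d)) = (\<Sum>a\<in>P \<times> {..<M}. emeasure lborel (F a))"
    using \<rho>' vb by (simp add: F_def case_prod_beta emeasure_ball ennreal_mult ennreal_of_nat_eq_real_of_nat card_cartesian_product flip: vb_def d_def)
  also have "\<dots> = emeasure lborel (\<Union>a\<in>P \<times> {..<M}. F a)"
    using P disj by (intro sum_emeasure) (auto simp: F_def)
  also have "\<dots> \<le> emeasure lborel (ball x (3 * s))" using sub by (intro emeasure_mono) auto
  also have "\<dots> = ennreal (vb * (3 * s) ^ d)" using s by (simp add: emeasure_ball flip: vb_def d_def)
  finally have "real (card P) * real M * (vb * (\<rho>' / 2) ^ d) \<le> vb * (3 * s) ^ d"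
    using s vb by (subst (asm) ennreal_le_iff) auto
  then have "real (card P) * real M * \<rho>' ^ d \<le> (6 * s) ^ d"
    using vb by (simp add: power_divide field_simps power_mult_distrib flip: power_mult_distrib[of 2 3])
  moreover have "real (card P) * (s / \<rho>') * \<rho>' ^ d \<le> real (card P) * real M * \<rho>' ^ d"
    using M \<rho>' by (intro mult_right_mono mult_left_mono) auto
  ultimately have "real (card P) * (s / \<rho>') * \<rho>' ^ d \<le> (6 * s) ^ d" by linarith
  moreover have "real (card P) * (s / \<rho>') * \<rho>' ^ d = s * (real (card P) * \<rho>' ^ (d - 1))"
    using \<rho>' d by (cases d) auto
  moreover have "(6 * s) ^ d = s * (6 ^ d * s ^ (d - 1))"
    using d by (cases d) (auto simp: power_mult_distrib)
  ultimately have "real (card P) * \<rho>' ^ (d - 1) \<le> 6 ^ d * s ^ (d - 1)" using s by simp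
  then have "real (card P) * \<rho> ^ (d - 1) / (1 + K) ^ (d - 1) \<le> 6 ^ d * s ^ (d - 1)"
    by (simp add: \<rho>'_def power_divide)
  then show ?thesis using K_ge_1 by (simp add: d_def field_simps)
qed

text \<open>A maximal \<open>\<rho>\<close>-separated subset of the patch exists because
  \<open>card_separated_le\<close> bounds the size of all of them, and by maximality its
  \<open>\<rho>\<close>-balls cover the patch. This is the cover that \<open>hausdorff_upper\<close>
  asks for.\<close>

lemma hausdorff_le:
  assumes dim: "DIM('a) \<ge> 2" and s: "s > 0"
    and S: "\<And>y. y \<in> S \<Longrightarrow> y \<in> ball x s \<Longrightarrow> k y = 0"
  shows "hausdorff (DIM('a) - 1) (S \<inter> ball x s) \<le> ennreal (upper_const * s ^ (DIM('a) - 1))"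
proof -
  let ?m = "DIM('a) - 1" and ?A = "S \<inter> ball x s"
  define B where "B = 6 ^ DIM('a) * (1 + K) ^ ?m * s ^ ?m"
  have "hausdorff ?m ?A \<le> ennreal (unit_ball_vol (real ?m) * B)"
  proof (rule hausdorff_upper[OF _ s])
    show "1 \<le> ?m" using dim by simp
    fix \<rho> :: real assume \<rho>: "0 < \<rho>" "\<rho> \<le> s"
    define Q where "Q P \<longleftrightarrow> finite P \<and> P \<subseteq> ?A \<and> (\<forall>p\<in>P. \<forall>q\<in>P. p \<noteq> q \<longrightarrow> \<rho> \<le> dist p q)" for P
    have bnd: "real (card P) * \<rho> ^ ?m \<le> B" if "Q P" for P
      unfolding B_def using that S by (intro card_separated_le[OF s \<rho>, of P x]) (auto simp: Q_def subset_eq)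
    have "card P < nat \<lceil>B / \<rho> ^ ?m\<rceil> + 1" if "Q P" for P
    proof -
      have "real (card P) \<le> B / \<rho> ^ ?m" using bnd[OF that] \<rho> by (simp add: field_simps)
      then show ?thesis by linarith
    qed
    moreover have "Q {}" by (simp add: Q_def)
    ultimately obtain P where P: "Q P" "\<And>P'. Q P' \<Longrightarrow> card P' \<le> card P"
      using ex_has_greatest_nat[of Q "{}" card] by blast
    have "?A \<subseteq> (\<Union>p\<in>P. cball p \<rho>)"
    proof
      fix y assume y: "y \<in> ?A"
      show "y \<in> (\<Union>p\<in>P. cball p \<rho>)"
      proof (rule ccontr)
        assume n: "y \<notin> (\<Union>p\<in>P. cball p \<rho>)"
        then have "y \<notin> P" using \<rho> by force
        moreover have "Q (insert y P)" using P(1) n y by (auto simp: Q_def dist_commute) (force+)?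
        ultimately show False using P(2)[of "insert y P"] P(1) by (simp add: Q_def)
      qed
    qed
    then show "\<exists>P. finite P \<and> ?A \<subseteq> (\<Union>p\<in>P. cball p \<rho>) \<and> real (card P) * \<rho> ^ ?m \<le> B"
      using P bnd by (auto simp: Q_def intro!: exI[of _ P])
  qed
  then show ?thesis by (simp add: B_def upper_const_def mult.assoc)
qed

end

section \<open>Lipschitz surfaces\<close>

definition chart_at :: "'a::euclidean_space set \<Rightarrow> 'a \<Rightarrow> real \<Rightarrow> ('a \<Rightarrow> real) \<Rightarrow> 'a \<Rightarrow> real \<Rightarrow> bool" where
  "chart_at U p r k e K \<longleftrightarrow> r > 0 \<and> graph_chart k e K \<and> U \<inter> ball p r = {y \<in> ball p r. 0 < k y}"

lemma lipschitz_open_chart: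
  fixes U :: "'a::euclidean_space set"
  assumes "lipschitz_open U" "p \<in> frontier U"
  obtains r k e K where "chart_at U p r k e K"
proof -
  obtain r e L h where r: "r > 0" and e: "norm e = 1" and h: "L-lipschitz_on UNIV (h :: 'a \<Rightarrow> real)"
    and U: "U \<inter> ball p r = {y \<in> ball p r. y \<bullet> e < h (y - (y \<bullet> e) *\<^sub>R e)}"
    using assms unfolding lipschitz_open_def by blast
  have ee: "e \<bullet> e = 1" using e by (simp add: norm_eq_1)
  have L: "L \<ge> 0" using lipschitz_on_nonneg[OF h] .
  define k where "k y = h (y - (y \<bullet> e) *\<^sub>R e) - y \<bullet> e" for y
  have ip: "\<bar>v \<bullet> e\<bar> \<le> norm v" for v using Cauchy_Schwarz_ineq2[of v e] e by simp
  \<comment> \<open>The projection along \<open>e\<close> is counted with the crude Lipschitz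
    constant 2, and the subtracted height adds 1.\<close>
  have lip: "(2 * L + 1)-lipschitz_on UNIV k"
  proof (rule lipschitz_onI)
    fix y z :: 'a
    let ?P = "\<lambda>y. y - (y \<bullet> e) *\<^sub>R e"
    have "?P y - ?P z = (y - z) - ((y - z) \<bullet> e) *\<^sub>R e" by (simp add: algebra_simps inner_diff_left)
    then have "dist (?P y) (?P z) \<le> norm (y - z) + \<bar>(y - z) \<bullet> e\<bar>"
      using norm_triangle_ineq4[of "y - z" "((y - z) \<bullet> e) *\<^sub>R e"] e
      unfolding dist_norm by (metis norm_scaleR mult.right_neutral)
    also have "\<dots> \<le> 2 * dist y z" using ip[of "y - z"] by (simp add: dist_norm)
    finally have 1: "dist (?P y) (?P z) \<le> 2 * dist y z" .
    have "\<bar>h (?P y) - h (?P z)\<bar> \<le> L * dist (?P y) (?P z)"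
      using lipschitz_onD[OF h, of "?P y" "?P z"] by (simp add: dist_real_def)
    also have "\<dots> \<le> L * (2 * dist y z)" using 1 L by (intro mult_left_mono)
    finally have "\<bar>h (?P y) - h (?P z)\<bar> \<le> 2 * L * dist y z" by simp
    moreover have "\<bar>y \<bullet> e - z \<bullet> e\<bar> \<le> dist y z" using ip[of "y - z"] by (simp add: inner_diff_left dist_norm)
    ultimately show "dist (k y) (k z) \<le> (2 * L + 1) * dist y z"
      unfolding k_def dist_real_def by (simp add: algebra_simps)
  qed (use L in simp)
  have "graph_chart k e (2 * L + 1)"
  proof
    show "k (y + t *\<^sub>R e) = k y - t" for y t
      by (simp add: k_def inner_add_left ee algebra_simps)
  qed (use e lip in auto)
  moreover have "U \<inter> ball p r = {y \<in> ball p r. 0 < k y}" unfolding U k_def by auto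
  ultimately show ?thesis using that r unfolding chart_at_def by blast
qed

text \<open>Exchanges the two sides of the surface, so that a trace can also be taken from outside
  the inclusion.\<close>

lemma (in graph_chart) reflect: "graph_chart (\<lambda>y. - k y) (- e) K"
proof
  show "- k (y + t *\<^sub>R (- e)) = - k y - t" for y t
    using shift[of y "- t"] by simp
qed (use e lip in auto)

lemma (in graph_chart) frontier_chart:
  assumes U: "U \<inter> ball p r = {y \<in> ball p r. 0 < k y}"
  shows "frontier U \<inter> ball p r = {y \<in> ball p r. k y = 0}"
    and "ball p r - closure U = {y \<in> ball p r. k y < 0}"
proof -
  have cl: "y \<in> closure U \<longleftrightarrow> 0 \<le> k y" if y: "y \<in> ball p r" for y
  proof
    assume "y \<in> closure U"
    then have "y \<in> closure (U \<inter> ball p r)"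
      using y open_Int_closure_subset[of "ball p r" U] by (auto simp: Int_commute)
    also have "closure (U \<inter> ball p r) \<subseteq> {y. 0 \<le> k y}"
      unfolding U by (intro closure_minimal closed_Collect_le cont continuous_intros) auto
    finally show "0 \<le> k y" by simp
  next
    assume k: "0 \<le> k y"
    show "y \<in> closure U"
      unfolding closure_approachable
    proof (intro allI impI)
      fix \<epsilon> :: real assume "\<epsilon> > 0"
      \<comment> \<open>Moving by \<open>- t\<close> along \<open>e\<close> raises \<open>k\<close>
        by \<open>t\<close>, so a point with \<open>k y = 0\<close> is a limit of points of
        \<open>U\<close>. For a general Lipschitz function the zero set could contain a
        ball.\<close>
      define t where "t = min (\<epsilon> / 2) ((r - dist p y) / 2)"
      have t: "t > 0" "t < \<epsilon>" "t < r - dist p y" using \<open>\<epsilon> > 0\<close> y by (auto simp: t_def min_less_iff_disj)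
      let ?z = "y + (- t) *\<^sub>R e"
      have d: "dist y ?z = t" using e t by (simp add: dist_norm)
      have "?z \<in> ball p r" using dist_triangle[of p ?z y] d t by simp
      moreover have "0 < k ?z" using k t shift[of y "- t"] by simp
      ultimately have "?z \<in> U" using U by blast
      then show "\<exists>y'\<in>U. dist y' y < \<epsilon>" using d t by (metis dist_commute)
    qed
  qed
  have int: "y \<in> interior U \<longleftrightarrow> 0 < k y" if y: "y \<in> ball p r" for y
  proof
    assume "0 < k y"
    have "open (ball p r \<inter> {y. 0 < k y})"
      by (intro open_Int open_ball open_Collect_less cont continuous_intros)
    also have "ball p r \<inter> {y. 0 < k y} = U \<inter> ball p r" using U by blast
    finally have "open (U \<inter> ball p r)" .
    then show "y \<in> interior U" using \<open>0 < k y\<close> U y by (metis (mono_tags, lifting) Int_lower1 interior_maximal mem_Collect_eq subsetD)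
  next
    assume "y \<in> interior U"
    then show "0 < k y" using interior_subset[of U] U y by blast
  qed
  show "frontier U \<inter> ball p r = {y \<in> ball p r. k y = 0}"
    using cl int unfolding frontier_def by (auto simp del: mem_ball)
  show "ball p r - closure U = {y \<in> ball p r. k y < 0}"
    using cl by force
qed

section \<open>The Hausdorff measure on Borel sets and its concentration on a surface\<close>

definition hmeasure :: "'a::euclidean_space measure" where
  "hmeasure = measure_of UNIV (sets borel) (hausdorff (DIM('a) - 1))"

lemma space_hmeasure [simp]: "space hmeasure = UNIV"
  and sets_hmeasure [simp, measurable_cong]: "sets hmeasure = sets borel"
  unfolding hmeasure_def
  using sets.sigma_sets_eq[of borel] by (auto simp: space_measure_of_conv sets_measure_of_conv)

text \<open>Concentrating the measure on \<open>S\<close>, rather than restricting its space, keeps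
  \<open>UNIV\<close> and the Borel sets, so product measures and balls need no intersection with
  \<open>S\<close>. \<open>nn_integral_surface\<close> translates to
  \<open>surface_measure\<close>.\<close>

definition surf :: "'a::euclidean_space set \<Rightarrow> 'a measure" where
  "surf S = density hmeasure (indicator S)"

lemma sets_surf [simp, measurable_cong]: "sets (surf S) = sets borel"
  and space_surf [simp]: "space (surf S) = UNIV"
  by (simp_all add: surf_def)

lemma surface_measure_eq: "surface_measure S = restrict_space hmeasure S"
  by (simp add: surface_measure_def hmeasure_def)

lemma emeasure_surf: "S \<in> sets borel \<Longrightarrow> A \<in> sets borel \<Longrightarrow> emeasure (surf S) A = emeasure hmeasure (S \<inter> A)"
  by (simp add: surf_def emeasure_density indicator_inter_arith[symmetric])

lemma AE_surf: "S \<in> sets borel \<Longrightarrow> AE x in surf S. x \<in> S"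
  unfolding surf_def by (subst AE_density) (auto simp: indicator_def)

lemma nn_integral_surface:
  "S \<in> sets borel \<Longrightarrow> f \<in> borel_measurable borel \<Longrightarrow>
     (\<integral>\<^sup>+x. f x \<partial>surface_measure S) = (\<integral>\<^sup>+x. f x \<partial>surf S)"
  unfolding surface_measure_eq surf_def
  by (subst nn_integral_restrict_space, simp, subst nn_integral_density)
     (auto simp: mult.commute cong: measurable_cong_sets)

text \<open>Countable additivity on Borel sets is made a case distinction: \<open>measure_of\<close>
  yields the Hausdorff measure in one case (\<open>emeasure_hmeasure\<close>) and the zero measure
  in the other (\<open>hmeasure_null\<close>).\<close>

definition hausdorff_ok :: "'a::euclidean_space itself \<Rightarrow> bool" where
  "hausdorff_ok _ \<longleftrightarrow> measure_space UNIV (sets borel) (hausdorff (DIM('a) - 1) :: 'a set \<Rightarrow> ennreal)"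

lemma emeasure_hmeasure:
  assumes "hausdorff_ok TYPE('a::euclidean_space)" "(A :: 'a set) \<in> sets borel"
  shows "emeasure hmeasure A = hausdorff (DIM('a) - 1) A"
  using assms sets.sigma_sets_eq[of "borel :: 'a measure"]
  unfolding hmeasure_def emeasure_measure_of_conv hausdorff_ok_def by simp

lemma hmeasure_null:
  assumes "\<not> hausdorff_ok TYPE('a::euclidean_space)"
  shows "emeasure hmeasure (A :: 'a set) = 0"
  using assms sets.sigma_sets_eq[of "borel :: 'a measure"]
  unfolding hmeasure_def emeasure_measure_of_conv hausdorff_ok_def by simp


lemma compact_radius_cover:
  fixes S :: "'a::metric_space set"
  assumes "compact S" "\<And>p. p \<in> S \<Longrightarrow> 0 < r p"
  obtains F where "finite F" "F \<subseteq> S" "S \<subseteq> (\<Union>p\<in>F. ball p (r p))"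
proof (rule compactE_image[OF assms(1), of S "\<lambda>p. ball p (r p)"])
  show "S \<subseteq> (\<Union>p\<in>S. ball p (r p))" using assms(2) by force
qed auto

lemma uniform_finite_bounds:
  assumes F: "finite F" "\<And>p. p \<in> F \<Longrightarrow> 0 < (r p :: real)"
  obtains r0 :: real where "0 < r0" "\<And>p. p \<in> F \<Longrightarrow> r0 \<le> r p"
proof
  \<comment> \<open>The 1 provides a value for the minimum when \<open>F\<close> is empty.\<close>
  show "0 < Min (insert 1 (r ` F))" using F by (subst Min_gr_iff) auto
  show "Min (insert 1 (r ` F)) \<le> r p" if "p \<in> F" for p using F that by (intro Min_le) auto
qed

text \<open>Ahlfors regularity of dimension \<open>DIM('a) - 1\<close>; this is all that the Green
  and trace estimates know about the measure on a boundary.\<close>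

locale surface =
  fixes S :: "'a::euclidean_space set" and c C r0 :: real
  assumes compact: "compact S"
    and pos: "0 < c" "0 \<le> C" "0 < r0"
    and lower: "\<And>x s. x \<in> S \<Longrightarrow> 0 < s \<Longrightarrow> s \<le> r0 \<Longrightarrow> ennreal (c * s ^ (DIM('a) - 1)) \<le> emeasure (surf S) (ball x s)"
    and upper: "\<And>x s. x \<in> S \<Longrightarrow> 0 < s \<Longrightarrow> s \<le> r0 \<Longrightarrow> emeasure (surf S) (ball x s) \<le> ennreal (C * s ^ (DIM('a) - 1))"
begin

lemma S_borel [measurable, simp]: "S \<in> sets borel"
  using compact by (intro borel_closed compact_imp_closed)

lemma finite_surf: "emeasure (surf S) UNIV < \<infinity>"
proof -
  obtain F where F: "finite F" "F \<subseteq> S" "S \<subseteq> (\<Union>p\<in>F. ball p r0)"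
    using compact_radius_cover[of S "\<lambda>_. r0"] compact pos by blast
  have "emeasure (surf S) UNIV \<le> emeasure (surf S) (\<Union>p\<in>F. ball p r0)"
    using AE_surf[OF S_borel]
  proof (rule emeasure_mono_AE[OF eventually_mono])
    show "x \<in> UNIV \<longrightarrow> x \<in> (\<Union>p\<in>F. ball p r0)" if "x \<in> S" for x using F(3) that by blast
  qed (simp add: borel_open open_UN)
  also have "\<dots> \<le> (\<Sum>p\<in>F. emeasure (surf S) (ball p r0))"
    using F by (intro emeasure_subadditive_finite) auto
  also have "\<dots> < \<infinity>"
    using F upper[of _ r0] pos by (auto simp: ennreal_sum_less_top intro!: le_less_trans[OF upper])
  finally show ?thesis .
qed

sublocale finite_measure "surf S"
  by (rule finite_measureI) (use finite_surf in simp)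

end

lemma surface_frontier:
  fixes U :: "'a::euclidean_space set"
  assumes dim: "DIM('a) \<ge> 2" and ok: "hausdorff_ok TYPE('a)" and U: "lipschitz_open U"
  obtains c C r0 where "surface (frontier U) c C r0"
proof -
  let ?S = "frontier U"
  have cS: "compact ?S" using U by (simp add: lipschitz_open_def compact_frontier_bounded)
  then have Sb: "?S \<in> sets borel" by (intro borel_closed compact_imp_closed)
  have "\<exists>r k e K. chart_at U p r k e K" if "p \<in> ?S" for p
    by (rule lipschitz_open_chart[OF U that]) (intro exI)
  then obtain r k e K where "\<forall>p\<in>?S. chart_at U p (r p) (k p) (e p) (K p)"
    by metis
  then have ch: "\<And>p. p \<in> ?S \<Longrightarrow> r p > 0" "\<And>p. p \<in> ?S \<Longrightarrow> graph_chart (k p) (e p) (K p)"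
     "\<And>p. p \<in> ?S \<Longrightarrow> U \<inter> ball p (r p) = {y \<in> ball p (r p). 0 < k p y}"
    by (auto simp: chart_at_def)
  \<comment> \<open>Half radii, so that a ball of radius at most \<open>r0\<close> about a point of
    the half ball stays inside the chart.\<close>
  obtain F where F: "finite F" "F \<subseteq> ?S" "?S \<subseteq> (\<Union>p\<in>F. ball p (r p / 2))"
    using compact_radius_cover[of ?S "\<lambda>p. r p / 2"] cS ch(1) by auto
  obtain r0 where r0: "0 < r0" "\<And>p. p \<in> F \<Longrightarrow> r0 \<le> r p / 2"
    by (rule uniform_finite_bounds[of F "\<lambda>p. r p / 2"]) (use F(1,2) ch(1) in \<open>auto simp: subset_eq\<close>)
  define lo up where "lo p = graph_chart.lower_const TYPE('a) (K p)"
    and "up p = graph_chart.upper_const TYPE('a) (K p)" for p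
  have lo: "lo p > 0" and up: "up p > 0" if "p \<in> F" for p
    using graph_chart.lower_const_pos[OF ch(2)] graph_chart.upper_const_pos[OF ch(2)] that F(2)
    by (auto simp: lo_def up_def)
  obtain c where c: "0 < c" "\<And>p. p \<in> F \<Longrightarrow> c \<le> lo p"
    by (rule uniform_finite_bounds[of F lo]) (use F(1) lo in auto)
  define C where "C = (\<Sum>p\<in>F. up p)"
  have C: "0 \<le> C" "\<And>p. p \<in> F \<Longrightarrow> up p \<le> C"
    using up F by (auto simp: C_def less_imp_le intro!: sum_nonneg member_le_sum)
  have "surface ?S c C r0"
  proof
    fix x :: 'a and s :: real assume x: "x \<in> ?S" and s: "0 < s" "s \<le> r0"
    obtain p where p: "p \<in> F" "x \<in> ball p (r p / 2)" using F x by blast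
    then have pS: "p \<in> ?S" using F by auto
    interpret graph_chart "k p" "e p" "K p" using ch(2)[OF pS] .
    have fr: "?S \<inter> ball p (r p) = {y \<in> ball p (r p). k p y = 0}"
      by (rule frontier_chart(1)) (rule ch(3)[OF pS])
    have sub: "ball x s \<subseteq> ball p (r p)"
      using p r0(2)[OF p(1)] s by (auto simp: dist_commute) (smt (verit) dist_triangle dist_commute)
    have em: "emeasure (surf ?S) (ball x s) = hausdorff (DIM('a) - 1) (?S \<inter> ball x s)"
      using Sb emeasure_hmeasure[OF ok, of "?S \<inter> ball x s"] by (simp add: emeasure_surf)
    have x0: "k p x = 0" using fr x p ch(1)[OF pS] by force
    have "ennreal (c * s ^ (DIM('a) - 1)) \<le> ennreal (lower_const * s ^ (DIM('a) - 1))"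
      using c(2)[OF p(1)] s by (intro ennreal_leI mult_right_mono) (auto simp: lo_def)
    also have "\<dots> \<le> hausdorff (DIM('a) - 1) (?S \<inter> ball x s)"
      using fr sub by (intro hausdorff_ge dim x0 s) blast
    finally show "ennreal (c * s ^ (DIM('a) - 1)) \<le> emeasure (surf ?S) (ball x s)" by (simp only: em)
    have "hausdorff (DIM('a) - 1) (?S \<inter> ball x s) \<le> ennreal (upper_const * s ^ (DIM('a) - 1))"
      using fr sub by (intro hausdorff_le dim s) blast
    also have "\<dots> \<le> ennreal (C * s ^ (DIM('a) - 1))"
      using C(2)[OF p(1)] s by (intro ennreal_leI mult_right_mono) (auto simp: up_def)
    finally show "emeasure (surf ?S) (ball x s) \<le> ennreal (C * s ^ (DIM('a) - 1))" by (simp only: em)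
  qed (use cS c C r0 in auto)
  then show ?thesis using that by blast
qed

section \<open>A substitute for the divergence theorem\<close>

lemma ennreal_mult_le_divide:
  assumes "0 < a" "0 \<le> b" "ennreal a * X \<le> ennreal b * Y"
  shows "X \<le> ennreal (b / a) * Y"
proof -
  have "ennreal (1 / a) * (ennreal a * X) \<le> ennreal (1 / a) * (ennreal b * Y)"
    using assms(3) by (rule mult_left_mono) simp
  then show ?thesis
    using assms(1,2) by (simp add: mult.assoc[symmetric] flip: ennreal_mult)
qed

lemma integrable_indicator_continuous:
  fixes f :: "'a::euclidean_space \<Rightarrow> 'b::euclidean_space"
  assumes f: "continuous_on UNIV f" and A: "A \<in> sets borel" "bounded A"
  shows "integrable lborel (\<lambda>x. indicator A x *\<^sub>R f x)"
proof -
  obtain R where R: "A \<subseteq> cball 0 R" using bounded_subset_ballD[OF A(2), of 0] ball_subset_cball by blast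
  have "integrable lborel (\<lambda>x. indicator (cball 0 R) x *\<^sub>R f x)"
    using f by (intro borel_integrable_compact) (auto intro: continuous_on_subset)
  then have "integrable lborel (\<lambda>x. indicator A x *\<^sub>R (indicator (cball 0 R) x *\<^sub>R f x))"
    using A by (intro integrable_mult_indicator[of A lborel]) auto
  also have "(\<lambda>x. indicator A x *\<^sub>R (indicator (cball 0 R) x *\<^sub>R f x)) = (\<lambda>x. indicator A x *\<^sub>R f x)"
    using R by (auto simp: fun_eq_iff indicator_def)
  finally show ?thesis .
qed

lemma integral_lebesgue_on_lborel:
  fixes f :: "'a::euclidean_space \<Rightarrow> 'b::{banach, second_countable_topology}"
  assumes "A \<in> sets borel" "f \<in> borel_measurable borel"
  shows "(\<integral>x. f x \<partial>lebesgue_on A) = (\<integral>x. indicator A x *\<^sub>R f x \<partial>lborel)"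
  using assms by (subst integral_restrict_space) (auto simp: set_lebesgue_integral_def intro!: integral_completion)

lemma C1_gradD:
  assumes "C1_grad \<phi> d\<phi>"
  shows C1_has_derivative: "(\<phi> has_derivative (\<lambda>h. d\<phi> x \<bullet> h)) (at x within A)"
    and C1_continuous: "continuous_on A \<phi>"
    and C1_continuous_grad: "continuous_on A d\<phi>"
    and C1_measurable: "\<phi> \<in> borel_measurable borel"
    and C1_grad_measurable: "d\<phi> \<in> borel_measurable borel"
proof -
  show *: "(\<phi> has_derivative (\<lambda>h. d\<phi> x \<bullet> h)) (at x within A)" for x A
    using assms unfolding C1_grad_def by (auto intro: has_derivative_at_withinI)
  show "continuous_on A \<phi>" for A
    by (rule has_derivative_continuous_on[OF *])
  then show "\<phi> \<in> borel_measurable borel" by (rule borel_measurable_continuous_onI)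
  show "continuous_on A d\<phi>" using assms continuous_on_subset unfolding C1_grad_def by blast
  show "d\<phi> \<in> borel_measurable borel" using assms borel_measurable_continuous_onI unfolding C1_grad_def by blast
qed

lemma C1_line_derivative:
  assumes "C1_grad \<phi> d\<phi>"
  shows "((\<lambda>t. \<phi> (x + t *\<^sub>R v)) has_real_derivative d\<phi> (x + t *\<^sub>R v) \<bullet> v) (at t within A)"
proof -
  have "((\<lambda>t. x + t *\<^sub>R v) has_derivative (\<lambda>h. h *\<^sub>R v)) (at t within A)"
    by (auto intro!: derivative_eq_intros)
  from diff_chain_within[OF this C1_has_derivative[OF assms]]
  show ?thesis unfolding has_field_derivative_def o_def
    by (rule has_derivative_eq_rhs) (auto simp: fun_eq_iff)
qed

context surface
begin

lemma Fubini_lborel: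
  fixes f :: "'a \<times> 'a \<Rightarrow> ennreal"
  assumes "f \<in> borel_measurable (borel \<Otimes>\<^sub>M borel)"
  shows "(\<integral>\<^sup>+z. \<integral>\<^sup>+x. f (x, z) \<partial>surf S \<partial>lborel) = (\<integral>\<^sup>+x. \<integral>\<^sup>+z. f (x, z) \<partial>lborel \<partial>surf S)"
proof -
  interpret P: pair_sigma_finite "surf S" "lborel :: 'a measure" ..
  have "sets (surf S \<Otimes>\<^sub>M (lborel :: 'a measure)) = sets (borel \<Otimes>\<^sub>M borel)"
    by (intro sets_pair_measure_cong) auto
  then show ?thesis using assms by (intro P.Fubini) (simp cong: measurable_cong_sets)
qed

text \<open>Lower regularity turns a Lebesgue integral over a thin tube around the surface into a double
  integral over the surface and small balls centred on it.\<close>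

lemma tube_bound:
  assumes A[measurable]: "A \<in> sets borel" and near: "\<And>z. z \<in> A \<Longrightarrow> \<exists>x\<in>S. dist x z \<le> \<tau>"
    and \<tau>: "0 < \<tau>" "\<tau> \<le> r0"
    and g[measurable]: "g \<in> borel_measurable borel" and h[measurable]: "h \<in> borel_measurable borel"
    and gh: "\<And>x z. x \<in> S \<Longrightarrow> dist x z < 2 * \<tau> \<Longrightarrow> g z \<le> h x"
  shows "ennreal (c * \<tau> ^ (DIM('a) - 1)) * (\<integral>\<^sup>+z. g z * indicator A z \<partial>lborel)
       \<le> ennreal (unit_ball_vol (DIM('a)) * (2 * \<tau>) ^ DIM('a)) * (\<integral>\<^sup>+x. h x \<partial>surf S)"
proof -
  \<comment> \<open>A symmetric kernel. For \<open>z\<close> in the tube its surface integral in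
    \<open>x\<close> is at least \<open>c * \<tau> ^ (d - 1)\<close>, since
    \<open>ball z (2 * \<tau>)\<close> contains a ball of radius \<open>\<tau>\<close> centred on
    the surface; for \<open>x\<close> on the surface its integral in \<open>z\<close> is the volume
    of a ball of radius \<open>2 * \<tau>\<close>.\<close>
  define I where "I = (\<lambda>(x::'a, z). indicator {p. dist (fst p) (snd p) < 2 * \<tau>} (x, z) :: ennreal)"
  have I_eq: "I (x, z) = indicator (ball x (2 * \<tau>)) z" "I (x, z) = indicator (ball z (2 * \<tau>)) x" for x z
    by (auto simp: I_def indicator_def dist_commute)
  have [measurable]: "I \<in> borel_measurable (borel \<Otimes>\<^sub>M borel)"
    unfolding I_def by (simp add: case_prod_beta) measurable
  have "ennreal (c * \<tau> ^ (DIM('a) - 1)) * (\<integral>\<^sup>+z. g z * indicator A z \<partial>lborel)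
      = (\<integral>\<^sup>+z. g z * indicator A z * ennreal (c * \<tau> ^ (DIM('a) - 1)) \<partial>lborel)"
    by (subst nn_integral_multc) (auto simp: mult.commute)
  also have "\<dots> \<le> (\<integral>\<^sup>+z. g z * indicator A z * (\<integral>\<^sup>+x. I (x, z) \<partial>surf S) \<partial>lborel)"
  proof (intro nn_integral_mono)
    fix z
    have "ennreal (c * \<tau> ^ (DIM('a) - 1)) \<le> (\<integral>\<^sup>+x. I (x, z) \<partial>surf S)" if z: "z \<in> A"
    proof -
      obtain x where x: "x \<in> S" "dist x z \<le> \<tau>" using near[OF z] by blast
      have "ennreal (c * \<tau> ^ (DIM('a) - 1)) \<le> emeasure (surf S) (ball x \<tau>)" using x \<tau> by (intro lower) auto
      also have "\<dots> \<le> emeasure (surf S) (ball z (2 * \<tau>))"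
        using x dist_triangle_less_add[of _ x \<tau> z \<tau>] by (intro emeasure_mono) (auto simp: dist_commute, smt (verit) dist_triangle dist_commute)
      finally show ?thesis by (simp add: I_eq(2) nn_integral_indicator)
    qed
    then show "g z * indicator A z * ennreal (c * \<tau> ^ (DIM('a) - 1)) \<le> g z * indicator A z * (\<integral>\<^sup>+x. I (x, z) \<partial>surf S)"
      by (cases "z \<in> A") (auto intro: mult_left_mono)
  qed
  also have "\<dots> = (\<integral>\<^sup>+z. \<integral>\<^sup>+x. g z * indicator A z * I (x, z) \<partial>surf S \<partial>lborel)"
    by (subst nn_integral_cmult) (auto simp: I_eq(2) intro!: borel_measurable_indicator)
  also have "\<dots> = (\<integral>\<^sup>+x. \<integral>\<^sup>+z. g z * indicator A z * I (x, z) \<partial>lborel \<partial>surf S)"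
    using Fubini_lborel[of "\<lambda>p. g (snd p) * indicator A (snd p) * I p"] by simp
  also have "\<dots> \<le> (\<integral>\<^sup>+x. ennreal (unit_ball_vol (DIM('a)) * (2 * \<tau>) ^ DIM('a)) * h x \<partial>surf S)"
  proof (rule nn_integral_mono_AE, rule eventually_mono[OF AE_surf[OF S_borel]])
    fix x assume x: "x \<in> S"
    have "(\<integral>\<^sup>+z. g z * indicator A z * I (x, z) \<partial>lborel) \<le> (\<integral>\<^sup>+z. h x * indicator (ball x (2 * \<tau>)) z \<partial>lborel)"
      using gh[OF x] by (intro nn_integral_mono) (auto simp: I_eq(1) indicator_def)
    also have "\<dots> = h x * emeasure lborel (ball x (2 * \<tau>))" by (subst nn_integral_cmult_indicator) auto
    finally show "(\<integral>\<^sup>+z. g z * indicator A z * I (x, z) \<partial>lborel) \<le> ennreal (unit_ball_vol (DIM('a)) * (2 * \<tau>) ^ DIM('a)) * h x"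
      using \<tau> by (simp add: emeasure_ball mult.commute)
  qed
  also have "\<dots> = ennreal (unit_ball_vol (DIM('a)) * (2 * \<tau>) ^ DIM('a)) * (\<integral>\<^sup>+x. h x \<partial>surf S)"
    by (subst nn_integral_cmult) auto
  finally show ?thesis .
qed

text \<open>A one-sided substitute for the divergence theorem: the difference quotient of the volume
  integral only sees the symmetric difference of \<open>\<Omega>\<close> and its translate, which lies in a tube.\<close>

lemma green:
  assumes f: "C1_grad f df" and \<Omega>: "open \<Omega>" "bounded \<Omega>" "frontier \<Omega> = S" and i: "norm i = 1"
  shows "ennreal \<bar>\<integral>x. df x \<bullet> i \<partial>lebesgue_on \<Omega>\<bar>
       \<le> ennreal (unit_ball_vol (DIM('a)) * 2 ^ DIM('a) / c) * (\<integral>\<^sup>+x. ennreal \<bar>f x\<bar> \<partial>surf S)"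
proof -
  define d where "d = DIM('a)"
  define vb where "vb = unit_ball_vol (real d)"
  have d: "d > 0" by (simp add: d_def)
  have vb: "vb > 0" by (simp add: vb_def)
  define Q where "Q = vb * 2 ^ d / c"
  have Q: "Q > 0" using vb pos by (simp add: Q_def)
  note [measurable] = C1_measurable[OF f] C1_grad_measurable[OF f]
  have [measurable]: "\<Omega> \<in> sets borel" using \<Omega> by auto
  obtain R where R: "R > 0" "\<Omega> \<subseteq> ball 0 R" using bounded_subset_ballD[OF \<Omega>(2)] by blast
  \<comment> \<open>Large enough for \<open>\<Omega>\<close>, its translates by at most
    \<open>r0\<close>, and all points within \<open>2 * r0\<close> of the surface.\<close>
  define B where "B = cball (0::'a) (R + r0 + r0 + r0)"
  have B: "compact B" "convex B" by (auto simp: B_def)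
  have SB: "x \<in> cball 0 R" if "x \<in> S" for x
  proof -
    have "x \<in> closure \<Omega>" using that \<Omega>(3) by (auto simp: frontier_def)
    also have "closure \<Omega> \<subseteq> cball 0 R" using R by (intro closure_minimal) auto
    finally show ?thesis .
  qed
  obtain M where M: "M > 0" "\<And>x. x \<in> B \<Longrightarrow> norm (df x) \<le> M"
    using compact_imp_bounded[OF compact_continuous_image[OF C1_continuous_grad[OF f] B(1)]]
    unfolding bounded_pos by auto
  define D where "D \<tau> = (\<integral>x. indicator \<Omega> x *\<^sub>R ((f (x + \<tau> *\<^sub>R i) - f x) / \<tau>) \<partial>lborel)" for \<tau>
  have int: "(\<integral>x. df x \<bullet> i \<partial>lebesgue_on \<Omega>) = (\<integral>x. indicator \<Omega> x *\<^sub>R (df x \<bullet> i) \<partial>lborel)"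
    by (rule integral_lebesgue_on_lborel) measurable
  define \<tau> where "\<tau> n = r0 / real (Suc n)" for n
  have \<tau>: "0 < \<tau> n" "\<tau> n \<le> r0" for n using pos by (auto simp: \<tau>_def field_simps)
  have \<tau>0: "\<tau> \<longlonglongrightarrow> 0" unfolding \<tau>_def using tendsto_mult[OF tendsto_const LIMSEQ_inverse_real_of_nat, of r0] by (simp add: divide_inverse)
  have lip: "\<bar>f (x + t *\<^sub>R i) - f x\<bar> \<le> M * t" if "x \<in> \<Omega>" "0 < t" "t \<le> r0" for x t
  proof -
    have "x \<in> ball 0 R" using R that by auto
    moreover have "norm (x + t *\<^sub>R i) \<le> norm x + t" using norm_triangle_ineq[of x "t *\<^sub>R i"] i that by simp
    ultimately have xB: "x \<in> B" "x + t *\<^sub>R i \<in> B" using that pos by (auto simp: B_def)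
    have "norm (f (x + t *\<^sub>R i) - f x) \<le> M * norm (x + t *\<^sub>R i - x)"
    proof (rule differentiable_bound[OF B(2) C1_has_derivative[OF f] _ xB(2,1)])
      fix y assume y: "y \<in> B"
      have "norm (df y \<bullet> h) \<le> M * norm h" for h
        using Cauchy_Schwarz_ineq2[of "df y" h] mult_right_mono[OF M(2)[OF y], of "norm h"] by simp
      then show "onorm (\<lambda>h. df y \<bullet> h) \<le> M" using M(1) by (intro onorm_bound) auto
    qed
    then show ?thesis using i that by simp
  qed
  have lim: "(\<lambda>n. D (\<tau> n)) \<longlonglongrightarrow> (\<integral>x. indicator \<Omega> x *\<^sub>R (df x \<bullet> i) \<partial>lborel)"
    unfolding D_def
  proof (rule integral_dominated_convergence[where w = "\<lambda>x. M * indicator \<Omega> x"])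
    have "emeasure lborel \<Omega> < \<infinity>" using emeasure_bounded_finite[OF \<Omega>(2)] .
    then show "integrable lborel (\<lambda>x. M * indicator \<Omega> x)" by simp
    show "AE x in lborel. (\<lambda>n. indicator \<Omega> x *\<^sub>R ((f (x + \<tau> n *\<^sub>R i) - f x) / \<tau> n)) \<longlonglongrightarrow> indicator \<Omega> x *\<^sub>R (df x \<bullet> i)"
    proof (intro AE_I2 tendsto_scaleR tendsto_const)
      fix x
      have "((\<lambda>t. (f (x + t *\<^sub>R i) - f x) / t) \<longlongrightarrow> df x \<bullet> i) (at 0)"
        using C1_line_derivative[OF f, of x i 0 UNIV] unfolding DERIV_def by simp
      moreover have "filterlim \<tau> (at 0) sequentially"
        using \<tau>0 \<tau>(1) by (simp add: filterlim_at less_imp_neq[symmetric])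
      ultimately show "(\<lambda>n. (f (x + \<tau> n *\<^sub>R i) - f x) / \<tau> n) \<longlonglongrightarrow> df x \<bullet> i"
        by (rule filterlim_compose)
    qed
    show "AE x in lborel. norm (indicator \<Omega> x *\<^sub>R ((f (x + \<tau> n *\<^sub>R i) - f x) / \<tau> n)) \<le> M * indicator \<Omega> x" for n
      using lip[OF _ \<tau>] \<tau>(1)[of n] by (intro AE_I2) (auto simp: indicator_def field_simps abs_divide)
  qed measurable
  \<comment> \<open>\<open>\<epsilon>\<close> bounds the oscillation of \<open>f\<close> over the
    balls of radius \<open>2 * t\<close> in \<open>tube_bound\<close>. The powers of
    \<open>t\<close> cancel: the quotient of the two constants there is of order \<open>t\<close>,
    and \<open>D t\<close> carries the factor \<open>1 / t\<close>.\<close>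
  have bnd: "ennreal \<bar>D t\<bar> \<le> ennreal Q * (\<integral>\<^sup>+x. ennreal (\<bar>f x\<bar> + \<epsilon>) \<partial>surf S)"
    if t: "0 < t" "t \<le> r0" and \<epsilon>: "0 \<le> \<epsilon>" "\<And>x z. x \<in> S \<Longrightarrow> dist x z < 2 * t \<Longrightarrow> \<bar>f z - f x\<bar> \<le> \<epsilon>" for t \<epsilon>
  proof -
    define A where "A = {x. (x - t *\<^sub>R i \<in> \<Omega>) \<noteq> (x \<in> \<Omega>)}"
    define \<Omega>' where "\<Omega>' = {x. x - t *\<^sub>R i \<in> \<Omega>}"
    have \<Omega>'_eq: "\<Omega>' = (\<lambda>x. t *\<^sub>R i + x) ` \<Omega>"
      by (auto simp: \<Omega>'_def image_iff algebra_simps intro!: bexI[of _ "_ - t *\<^sub>R i"])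
    have \<Omega>'b: "bounded \<Omega>'" unfolding \<Omega>'_eq using \<Omega>(2) by (rule bounded_translation)
    have [measurable]: "\<Omega>' \<in> sets borel" unfolding \<Omega>'_eq using \<Omega>(1) by (intro borel_open open_translation)
    have "A = (\<Omega> - \<Omega>') \<union> (\<Omega>' - \<Omega>)" by (auto simp: A_def \<Omega>'_def)
    then have A[measurable]: "A \<in> sets borel" by simp
    have shift: "(\<integral>x. indicator \<Omega> x *\<^sub>R f (x + t *\<^sub>R i) \<partial>lborel) = (\<integral>x. indicator \<Omega>' x *\<^sub>R f x \<partial>lborel)"
    proof -
      have "(\<integral>x. indicator \<Omega>' x *\<^sub>R f x \<partial>lborel) = (\<integral>x. indicator \<Omega>' x *\<^sub>R f x \<partial>distr lborel borel ((+) (t *\<^sub>R i)))"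
        by (simp add: lborel_distr_plus)
      also have "\<dots> = (\<integral>x. indicator \<Omega>' (t *\<^sub>R i + x) *\<^sub>R f (t *\<^sub>R i + x) \<partial>lborel)"
        by (subst integral_distr) auto
      also have "\<dots> = (\<integral>x. indicator \<Omega> x *\<^sub>R f (x + t *\<^sub>R i) \<partial>lborel)"
        by (intro Bochner_Integration.integral_cong) (auto simp: \<Omega>'_def indicator_def add.commute)
      finally show ?thesis by simp
    qed
    have i1: "integrable lborel (\<lambda>x. indicator \<Omega> x *\<^sub>R f (x + t *\<^sub>R i))"
      using \<Omega> by (intro integrable_indicator_continuous continuous_on_compose2[OF C1_continuous[OF f, of UNIV]] continuous_intros) auto
    have i2: "integrable lborel (\<lambda>x. indicator A' x *\<^sub>R f x)" if "A' \<in> sets borel" "bounded A'" for A'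
      using that by (intro integrable_indicator_continuous C1_continuous[OF f]) auto
    \<comment> \<open>The translation is moved from \<open>f\<close> to the domain, so the two
      integrals cancel off the symmetric difference \<open>A\<close>.\<close>
    have "t * D t = (\<integral>x. indicator \<Omega> x *\<^sub>R f (x + t *\<^sub>R i) - indicator \<Omega> x *\<^sub>R f x \<partial>lborel)"
      unfolding D_def integral_mult_right_zero[symmetric]
      using t by (intro Bochner_Integration.integral_cong) (auto simp: field_simps)
    also have "\<dots> = (\<integral>x. indicator \<Omega>' x *\<^sub>R f x \<partial>lborel) - (\<integral>x. indicator \<Omega> x *\<^sub>R f x \<partial>lborel)"
      using i1 i2[OF _ \<Omega>(2)] shift by simp
    also have "\<dots> = (\<integral>x. indicator \<Omega>' x *\<^sub>R f x - indicator \<Omega> x *\<^sub>R f x \<partial>lborel)"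
      using i2[OF _ \<Omega>(2)] i2[OF _ \<Omega>'b] by simp
    finally have "ennreal \<bar>t * D t\<bar> = ennreal (norm (\<integral>x. indicator \<Omega>' x *\<^sub>R f x - indicator \<Omega> x *\<^sub>R f x \<partial>lborel))" by simp
    also have "\<dots> \<le> (\<integral>\<^sup>+x. norm (indicator \<Omega>' x *\<^sub>R f x - indicator \<Omega> x *\<^sub>R f x) \<partial>lborel)"
      using i2[OF _ \<Omega>(2)] i2[OF _ \<Omega>'b] by (intro integral_norm_bound_ennreal Bochner_Integration.integrable_diff) auto
    also have "\<dots> = (\<integral>\<^sup>+x. ennreal \<bar>f x\<bar> * indicator A x \<partial>lborel)"
      by (intro nn_integral_cong) (auto simp: A_def \<Omega>'_def indicator_def)
    also have "\<dots> \<le> ennreal (vb * (2 * t) ^ d / (c * t ^ (d - 1))) * (\<integral>\<^sup>+x. ennreal (\<bar>f x\<bar> + \<epsilon>) \<partial>surf S)"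
    proof (rule ennreal_mult_le_divide)
      show "ennreal (c * t ^ (d - 1)) * (\<integral>\<^sup>+x. ennreal \<bar>f x\<bar> * indicator A x \<partial>lborel)
         \<le> ennreal (vb * (2 * t) ^ d) * (\<integral>\<^sup>+x. ennreal (\<bar>f x\<bar> + \<epsilon>) \<partial>surf S)"
        unfolding vb_def d_def
      proof (rule tube_bound[OF A _ t])
        fix z assume z: "z \<in> A"
        \<comment> \<open>A segment of length \<open>t\<close> with one end in
          \<open>\<Omega>\<close> and the other outside meets the frontier, which puts
          \<open>A\<close> into the tube of radius \<open>t\<close>.\<close>
        let ?J = "closed_segment (z - t *\<^sub>R i) z"
        have "?J \<inter> \<Omega> \<noteq> {}" "?J - \<Omega> \<noteq> {}" using z ends_in_segment by (auto simp: A_def)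
        then have "?J \<inter> frontier \<Omega> \<noteq> {}" by (intro connected_Int_frontier) auto
        then obtain x where x: "x \<in> S" "x \<in> ?J" using \<Omega> by auto
        have "dist x z \<le> dist (z - t *\<^sub>R i) z" using x(2) by (metis dist_in_closed_segment dist_commute)
        also have "\<dots> = t" using i t by (simp add: dist_norm)
        finally show "\<exists>x\<in>S. dist x z \<le> t" using x by blast
      next
        fix x z assume "x \<in> S" "dist x z < 2 * t"
        from \<epsilon>(2)[OF this] show "ennreal \<bar>f z\<bar> \<le> ennreal (\<bar>f x\<bar> + \<epsilon>)" by (intro ennreal_leI) linarith
      qed measurable
    qed (use pos t vb in auto)
    also have "vb * (2 * t) ^ d / (c * t ^ (d - 1)) = t * Q"
      using d t pos by (cases d) (auto simp: Q_def power_mult_distrib field_simps)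
    finally have "ennreal t * ennreal \<bar>D t\<bar> \<le> ennreal t * (ennreal Q * (\<integral>\<^sup>+x. ennreal (\<bar>f x\<bar> + \<epsilon>) \<partial>surf S))"
      using t Q by (simp add: abs_mult ennreal_mult mult.assoc)
    then show ?thesis using t by (subst (asm) ennreal_mult_le_mult_iff) auto
  qed
  have fin: "ennreal \<bar>\<integral>x. indicator \<Omega> x *\<^sub>R (df x \<bullet> i) \<partial>lborel\<bar> \<le> ennreal Q * (\<integral>\<^sup>+x. ennreal (\<bar>f x\<bar> + \<epsilon>) \<partial>surf S)"
    if \<epsilon>: "\<epsilon> > 0" for \<epsilon>
  proof (rule tendsto_upperbound)
    show "(\<lambda>n. ennreal \<bar>D (\<tau> n)\<bar>) \<longlonglongrightarrow> ennreal \<bar>\<integral>x. indicator \<Omega> x *\<^sub>R (df x \<bullet> i) \<partial>lborel\<bar>"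
      by (intro tendsto_intros lim)
    have "uniformly_continuous_on B f" using B(1) C1_continuous[OF f] by (rule compact_uniformly_continuous[rotated])
    then obtain \<delta> where \<delta>: "\<delta> > 0" "\<And>x z. x \<in> B \<Longrightarrow> z \<in> B \<Longrightarrow> dist z x < \<delta> \<Longrightarrow> dist (f z) (f x) < \<epsilon>"
      using \<epsilon> unfolding uniformly_continuous_on_def by metis
    have "\<forall>\<^sub>F n in sequentially. \<tau> n < \<delta> / 2" using \<tau>0 \<delta> by (intro order_tendstoD(2)) auto
    then show "\<forall>\<^sub>F n in sequentially. ennreal \<bar>D (\<tau> n)\<bar> \<le> ennreal Q * (\<integral>\<^sup>+x. ennreal (\<bar>f x\<bar> + \<epsilon>) \<partial>surf S)"
    proof (rule eventually_mono)
      fix n assume n: "\<tau> n < \<delta> / 2"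
      show "ennreal \<bar>D (\<tau> n)\<bar> \<le> ennreal Q * (\<integral>\<^sup>+x. ennreal (\<bar>f x\<bar> + \<epsilon>) \<partial>surf S)"
      proof (rule bnd[OF \<tau>])
        fix x z assume x: "x \<in> S" and z: "dist x z < 2 * \<tau> n"
        have "norm z \<le> norm x + dist x z" using norm_triangle_ineq[of x "z - x"] by (simp add: dist_norm norm_minus_commute)
        then have "x \<in> B" "z \<in> B" using SB[OF x] z \<tau>[of n] pos by (auto simp: B_def)
        moreover have "dist z x < \<delta>" using z n by (simp add: dist_commute)
        ultimately show "\<bar>f z - f x\<bar> \<le> \<epsilon>" using \<delta>(2)[of x z] by (simp add: dist_real_def)
      qed (use \<epsilon> in simp)
    qed
  qed simp
  have "ennreal \<bar>\<integral>x. indicator \<Omega> x *\<^sub>R (df x \<bullet> i) \<partial>lborel\<bar> \<le> ennreal Q * (\<integral>\<^sup>+x. ennreal \<bar>f x\<bar> \<partial>surf S)"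
  proof (rule ennreal_le_epsilon)
    fix \<epsilon>' :: real assume \<epsilon>': "\<epsilon>' > 0"
    define m where "m = measure (surf S) UNIV"
    have m: "emeasure (surf S) UNIV = ennreal m" "m \<ge> 0" by (auto simp: m_def emeasure_eq_measure)
    \<comment> \<open>\<open>m\<close> is the total mass of the surface, so the error
      \<open>Q * (\<epsilon> * m)\<close> stays below \<open>\<epsilon>'\<close>.\<close>
    define \<epsilon> where "\<epsilon> = \<epsilon>' / (Q * (m + 1))"
    have \<epsilon>: "\<epsilon> > 0" using \<epsilon>' Q m by (simp add: \<epsilon>_def)
    have "ennreal \<bar>\<integral>x. indicator \<Omega> x *\<^sub>R (df x \<bullet> i) \<partial>lborel\<bar> \<le> ennreal Q * (\<integral>\<^sup>+x. ennreal (\<bar>f x\<bar> + \<epsilon>) \<partial>surf S)"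
      by (rule fin[OF \<epsilon>])
    also have "(\<integral>\<^sup>+x. ennreal (\<bar>f x\<bar> + \<epsilon>) \<partial>surf S) = (\<integral>\<^sup>+x. ennreal \<bar>f x\<bar> \<partial>surf S) + ennreal (\<epsilon> * m)"
      using \<epsilon> m by (simp add: nn_integral_add ennreal_mult)
    also have "ennreal Q * ((\<integral>\<^sup>+x. ennreal \<bar>f x\<bar> \<partial>surf S) + ennreal (\<epsilon> * m)) = ennreal Q * (\<integral>\<^sup>+x. ennreal \<bar>f x\<bar> \<partial>surf S) + ennreal (Q * (\<epsilon> * m))"
      using Q \<epsilon> m by (simp add: distrib_left ennreal_mult)
    also have "ennreal (Q * (\<epsilon> * m)) \<le> ennreal \<epsilon>'"
    proof (rule ennreal_leI)
      have "Q * (\<epsilon> * m) = \<epsilon>' * (m / (m + 1))" using Q by (simp add: \<epsilon>_def)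
      also have "\<dots> \<le> \<epsilon>' * 1" using m \<epsilon>' by (intro mult_left_mono) auto
      finally show "Q * (\<epsilon> * m) \<le> \<epsilon>'" by simp
    qed
    finally show "ennreal \<bar>\<integral>x. indicator \<Omega> x *\<^sub>R (df x \<bullet> i) \<partial>lborel\<bar> \<le> ennreal Q * (\<integral>\<^sup>+x. ennreal \<bar>f x\<bar> \<partial>surf S) + ennreal \<epsilon>'"
      by (simp add: add_left_mono)
  qed
  then show ?thesis unfolding int Q_def vb_def d_def .
qed

end

section \<open>Trace inequality\<close>

text \<open>Values in \<open>ennreal\<close> let the estimates below be stated without integrability
  conditions.\<close>

definition nsq :: "'a::euclidean_space set \<Rightarrow> ('a \<Rightarrow> 'b::real_normed_vector) \<Rightarrow> ennreal" where
  "nsq A f = (\<integral>\<^sup>+x. ennreal ((norm (f x))\<^sup>2) * indicator A x \<partial>lborel)"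

lemma nn_integral_translate:
  fixes f :: "'a::euclidean_space \<Rightarrow> ennreal"
  assumes "f \<in> borel_measurable borel"
  shows "(\<integral>\<^sup>+x. f (x + c) \<partial>lborel) = (\<integral>\<^sup>+x. f x \<partial>lborel)"
proof -
  have "(\<integral>\<^sup>+x. f x \<partial>lborel) = (\<integral>\<^sup>+x. f x \<partial>distr lborel borel ((+) c))" by (simp add: lborel_distr_plus)
  also have "\<dots> = (\<integral>\<^sup>+x. f (x + c) \<partial>lborel)"
    using assms by (subst nn_integral_distr) (auto simp: add.commute)
  finally show ?thesis by simp
qed

text \<open>The fundamental theorem of calculus along the segment, followed by
  Cauchy-Schwarz.\<close>

lemma C1_line_diff:
  assumes \<phi>: "C1_grad \<phi> d\<phi>" and t: "0 \<le> t"
  shows "ennreal ((\<phi> (x + t *\<^sub>R v) - \<phi> x)\<^sup>2)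
       \<le> ennreal (t * (norm v)\<^sup>2) * (\<integral>\<^sup>+s. ennreal ((norm (d\<phi> (x + s *\<^sub>R v)))\<^sup>2) * indicator {0..t} s \<partial>lborel)"
proof (cases "t = 0")
  case False
  with t have t: "t > 0" by simp
  define a where "a = \<phi> (x + t *\<^sub>R v) - \<phi> x"
  define g where "g s = d\<phi> (x + s *\<^sub>R v) \<bullet> v" for s
  have cd: "continuous_on A (\<lambda>s. d\<phi> (x + s *\<^sub>R v))" for A
    by (intro continuous_on_compose2[OF C1_continuous_grad[OF \<phi>, of UNIV]] continuous_intros) auto
  then have cg: "continuous_on A g" for A unfolding g_def by (intro continuous_intros)
  have ftc: "integral\<^sup>L lborel (\<lambda>s. g s * indicator {0..t} s) = a"
  proof -
    have "isCont g s" for s using cg[of UNIV] by (simp add: continuous_on_eq_continuous_at)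
    then show ?thesis
      using integral_FTC_Icc_real[of 0 t "\<lambda>s. \<phi> (x + s *\<^sub>R v)" g] t C1_line_derivative[OF \<phi>, of x v _ UNIV]
      by (simp add: a_def g_def)
  qed
  have int: "integrable lborel (\<lambda>s. F s * indicator {0..t} s)" if "continuous_on UNIV F" for F :: "real \<Rightarrow> real"
    using integrable_indicator_continuous[OF that, of "{0..t}"] by (simp add: mult.commute)
  \<comment> \<open>\<open>b\<close> is the mean slope. Integrating
    \<open>2 * b * g s - b\<^sup>2 \<le> (g s)\<^sup>2\<close> over \<open>{0..t}\<close> gives
    \<open>a\<^sup>2 / t\<close> on the left, which is Cauchy-Schwarz for this integral.\<close>
  define b where "b = a / t"
  have "(2 * b) * a - b\<^sup>2 * t = (\<integral>s. (2 * b) * (g s * indicator {0..t} s) - b\<^sup>2 * indicator {0..t} s \<partial>lborel)"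
    using int[OF cg] t ftc by (subst Bochner_Integration.integral_diff) auto
  also have "\<dots> \<le> (\<integral>s. (norm v)\<^sup>2 * ((norm (d\<phi> (x + s *\<^sub>R v)))\<^sup>2 * indicator {0..t} s) \<partial>lborel)"
  proof (rule integral_mono)
    show "integrable lborel (\<lambda>s. (2 * b) * (g s * indicator {0..t} s) - b\<^sup>2 * indicator {0..t} s)"
      using int[OF cg] t by (intro Bochner_Integration.integrable_diff integrable_mult_right) auto
    show "integrable lborel (\<lambda>s. (norm v)\<^sup>2 * ((norm (d\<phi> (x + s *\<^sub>R v)))\<^sup>2 * indicator {0..t} s))"
      by (intro integrable_mult_right int continuous_intros cd)
    fix s
    have cs: "\<bar>g s\<bar> \<le> norm (d\<phi> (x + s *\<^sub>R v)) * norm v" unfolding g_def by (rule Cauchy_Schwarz_ineq2)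
    have "(g s)\<^sup>2 \<le> (norm v)\<^sup>2 * (norm (d\<phi> (x + s *\<^sub>R v)))\<^sup>2"
      using power_mono[OF cs, of 2] by (simp add: power_mult_distrib mult.commute)
    moreover have "2 * b * g s - b\<^sup>2 \<le> (g s)\<^sup>2" using zero_le_power2[of "g s - b"] by (simp add: power2_eq_square algebra_simps)
    ultimately show "2 * b * (g s * indicator {0..t} s) - b\<^sup>2 * indicator {0..t} s
       \<le> (norm v)\<^sup>2 * ((norm (d\<phi> (x + s *\<^sub>R v)))\<^sup>2 * indicator {0..t} s)"
      by (auto simp: indicator_def)
  qed
  also have "\<dots> = (norm v)\<^sup>2 * (\<integral>s. (norm (d\<phi> (x + s *\<^sub>R v)))\<^sup>2 * indicator {0..t} s \<partial>lborel)" by simp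
  finally have "t * (2 * b * a - b\<^sup>2 * t) \<le> t * ((norm v)\<^sup>2 * (\<integral>s. (norm (d\<phi> (x + s *\<^sub>R v)))\<^sup>2 * indicator {0..t} s \<partial>lborel))"
    using t by (intro mult_left_mono) auto
  moreover have "t * (2 * b * a - b\<^sup>2 * t) = a\<^sup>2" using t by (simp add: b_def power2_eq_square field_simps)
  ultimately have "a\<^sup>2 \<le> t * (norm v)\<^sup>2 * (\<integral>s. (norm (d\<phi> (x + s *\<^sub>R v)))\<^sup>2 * indicator {0..t} s \<partial>lborel)"
    by (simp only: mult.assoc)
  then have "ennreal (a\<^sup>2) \<le> ennreal (t * (norm v)\<^sup>2) * ennreal (\<integral>s. (norm (d\<phi> (x + s *\<^sub>R v)))\<^sup>2 * indicator {0..t} s \<partial>lborel)"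
    using t by (subst ennreal_mult[symmetric]) (auto intro!: ennreal_leI integral_nonneg_AE)
  also have "ennreal (\<integral>s. (norm (d\<phi> (x + s *\<^sub>R v)))\<^sup>2 * indicator {0..t} s \<partial>lborel)
      = (\<integral>\<^sup>+s. ennreal ((norm (d\<phi> (x + s *\<^sub>R v)))\<^sup>2 * indicator {0..t} s) \<partial>lborel)"
    by (intro nn_integral_eq_integral[symmetric] int continuous_intros cd) auto
  also have "\<dots> = (\<integral>\<^sup>+s. ennreal ((norm (d\<phi> (x + s *\<^sub>R v)))\<^sup>2) * indicator {0..t} s \<partial>lborel)"
    by (intro nn_integral_cong) (auto simp: indicator_def)
  finally show ?thesis by (simp add: a_def)
qed simp

lemma ennreal_square_le_double:
  fixes a b :: real
  assumes "ennreal ((a - b)\<^sup>2) \<le> E"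
  shows "ennreal (a\<^sup>2) \<le> 2 * ennreal (b\<^sup>2) + 2 * E"
proof -
  have "a\<^sup>2 \<le> 2 * b\<^sup>2 + 2 * (a - b)\<^sup>2" using zero_le_power2[of "a - 2 * b"] by (simp add: power2_eq_square algebra_simps)
  then have "ennreal (a\<^sup>2) \<le> ennreal (2 * b\<^sup>2 + 2 * (a - b)\<^sup>2)" by (rule ennreal_leI)
  also have "\<dots> = 2 * ennreal (b\<^sup>2) + 2 * ennreal ((a - b)\<^sup>2)" by (simp add: ennreal_mult)
  also have "\<dots> \<le> 2 * ennreal (b\<^sup>2) + 2 * E" using assms by (intro add_left_mono mult_left_mono) auto
  finally show ?thesis .
qed

lemma lborel_Fubini:
  fixes f :: "'a::euclidean_space \<times> 'b::euclidean_space \<Rightarrow> ennreal"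
  assumes "f \<in> borel_measurable (borel \<Otimes>\<^sub>M borel)"
  shows "(\<integral>\<^sup>+z. \<integral>\<^sup>+x. f (x, z) \<partial>lborel \<partial>lborel) = (\<integral>\<^sup>+x. \<integral>\<^sup>+z. f (x, z) \<partial>lborel \<partial>lborel)"
proof -
  have "sets (lborel \<Otimes>\<^sub>M (lborel :: 'b measure)) = sets (borel \<Otimes>\<^sub>M (borel :: 'b measure) :: ('a \<times> 'b) measure)"
    by (intro sets_pair_measure_cong) auto
  then show ?thesis using assms by (intro lborel_pair.Fubini) (simp cong: measurable_cong_sets)
qed

text \<open>\<open>C1_line_diff\<close> is integrated over \<open>A\<close>; for each fixed
  \<open>s\<close> a translation turns the inner integral into one over \<open>V\<close>. By this
  step the Poincare inequality moves from ball to ball.\<close>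

lemma nsq_translate_le:
  assumes \<phi>: "C1_grad \<phi> d\<phi>" and [measurable]: "A \<in> sets borel" "V \<in> sets borel"
    and AV: "\<And>x s. x \<in> A \<Longrightarrow> 0 \<le> s \<Longrightarrow> s \<le> 1 \<Longrightarrow> x + s *\<^sub>R v \<in> V"
  shows "(\<integral>\<^sup>+x. ennreal ((\<phi> (x + v))\<^sup>2) * indicator A x \<partial>lborel) \<le> 2 * nsq A \<phi> + ennreal (2 * (norm v)\<^sup>2) * nsq V d\<phi>"
proof -
  note [measurable] = C1_measurable[OF \<phi>] C1_grad_measurable[OF \<phi>]
  define E where "E x = (\<integral>\<^sup>+s. ennreal ((norm (d\<phi> (x + s *\<^sub>R v)))\<^sup>2) * indicator {0..1} (s::real) \<partial>lborel)" for x
  have [measurable]: "E \<in> borel_measurable borel"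
    unfolding E_def by measurable
  have "(\<integral>\<^sup>+x. ennreal ((\<phi> (x + v))\<^sup>2) * indicator A x \<partial>lborel)
      \<le> (\<integral>\<^sup>+x. 2 * (ennreal ((norm (\<phi> x))\<^sup>2) * indicator A x) + ennreal (2 * (norm v)\<^sup>2) * (E x * indicator A x) \<partial>lborel)"
  proof (intro nn_integral_mono)
    fix x
    have "ennreal ((\<phi> (x + v))\<^sup>2) \<le> 2 * ennreal ((\<phi> x)\<^sup>2) + 2 * (ennreal (1 * (norm v)\<^sup>2) * E x)"
      using C1_line_diff[OF \<phi>, of 1 x v] unfolding E_def by (intro ennreal_square_le_double) simp
    then show "ennreal ((\<phi> (x + v))\<^sup>2) * indicator A x
       \<le> 2 * (ennreal ((norm (\<phi> x))\<^sup>2) * indicator A x) + ennreal (2 * (norm v)\<^sup>2) * (E x * indicator A x)"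
      by (auto simp: indicator_def ennreal_mult mult.assoc)
  qed
  also have "\<dots> = 2 * nsq A \<phi> + ennreal (2 * (norm v)\<^sup>2) * (\<integral>\<^sup>+x. E x * indicator A x \<partial>lborel)"
    unfolding nsq_def by (simp add: nn_integral_add nn_integral_cmult)
  also have "(\<integral>\<^sup>+x. E x * indicator A x \<partial>lborel)
      = (\<integral>\<^sup>+x. \<integral>\<^sup>+s. ennreal ((norm (d\<phi> (x + s *\<^sub>R v)))\<^sup>2) * indicator {0..1} s * indicator A x \<partial>lborel \<partial>lborel)"
    unfolding E_def by (subst nn_integral_multc[symmetric]) auto
  also have "\<dots> = (\<integral>\<^sup>+s. \<integral>\<^sup>+x. ennreal ((norm (d\<phi> (x + s *\<^sub>R v)))\<^sup>2) * indicator {0..1} s * indicator A x \<partial>lborel \<partial>lborel)"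
    by (rule lborel_Fubini[of "\<lambda>(x, s). ennreal ((norm (d\<phi> (x + s *\<^sub>R v)))\<^sup>2) * indicator {0..1} s * indicator A x", symmetric, simplified])
  also have "\<dots> \<le> (\<integral>\<^sup>+s. nsq V d\<phi> * indicator {0..1} (s::real) \<partial>lborel)"
  proof (intro nn_integral_mono)
    fix s :: real
    have "(\<integral>\<^sup>+x. ennreal ((norm (d\<phi> (x + s *\<^sub>R v)))\<^sup>2) * indicator A x \<partial>lborel) \<le> nsq V d\<phi>" if "s \<in> {0..1}"
    proof -
      have "(\<integral>\<^sup>+x. ennreal ((norm (d\<phi> (x + s *\<^sub>R v)))\<^sup>2) * indicator A x \<partial>lborel)
          \<le> (\<integral>\<^sup>+x. ennreal ((norm (d\<phi> (x + s *\<^sub>R v)))\<^sup>2) * indicator V (x + s *\<^sub>R v) \<partial>lborel)"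
        using AV that by (intro nn_integral_mono) (auto simp: indicator_def)
      also have "\<dots> = nsq V d\<phi>" unfolding nsq_def
        by (rule nn_integral_translate[of "\<lambda>x. ennreal ((norm (d\<phi> x))\<^sup>2) * indicator V x"]) measurable
      finally show ?thesis .
    qed
    then show "(\<integral>\<^sup>+x. ennreal ((norm (d\<phi> (x + s *\<^sub>R v)))\<^sup>2) * indicator {0..1} s * indicator A x \<partial>lborel) \<le> nsq V d\<phi> * indicator {0..1} s"
      by (cases "s \<in> {0..1}") auto
  qed
  also have "\<dots> = nsq V d\<phi>" by (simp add: nn_integral_cmult)
  finally show ?thesis by (simp add: mult_left_mono add_left_mono)
qed

context graph_chart
begin

text \<open>A vertical line spends time at most \<open>\<eta>\<close> in the layer \<open>0 < k < \<eta>\<close>.\<close>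

lemma sweep:
  fixes F :: "'a \<Rightarrow> ennreal"
  assumes [measurable]: "T \<in> sets borel" "V \<in> sets borel" "F \<in> borel_measurable borel"
    and T: "\<And>y. y \<in> T \<Longrightarrow> 0 < k y \<and> k y < \<eta>" and TV: "\<And>y t. y \<in> T \<Longrightarrow> 0 \<le> t \<Longrightarrow> t \<le> \<delta> \<Longrightarrow> y - t *\<^sub>R e \<in> V"
    and \<eta>: "0 \<le> \<eta>"
  shows "(\<integral>\<^sup>+t. \<integral>\<^sup>+y. F (y - t *\<^sub>R e) * indicator T y * indicator {0..\<delta>} t \<partial>lborel \<partial>lborel)
       \<le> ennreal \<eta> * (\<integral>\<^sup>+y. F y * indicator V y \<partial>lborel)"
proof -
  have "(\<integral>\<^sup>+t. \<integral>\<^sup>+y. F (y - t *\<^sub>R e) * indicator T y * indicator {0..\<delta>} t \<partial>lborel \<partial>lborel)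
      = (\<integral>\<^sup>+t. \<integral>\<^sup>+y. F y * indicator T (y + t *\<^sub>R e) * indicator {0..\<delta>} t \<partial>lborel \<partial>lborel)"
  proof (rule nn_integral_cong)
    fix t
    show "(\<integral>\<^sup>+y. F (y - t *\<^sub>R e) * indicator T y * indicator {0..\<delta>} t \<partial>lborel)
        = (\<integral>\<^sup>+y. F y * indicator T (y + t *\<^sub>R e) * indicator {0..\<delta>} t \<partial>lborel)"
      using nn_integral_translate[of "\<lambda>y. F (y - t *\<^sub>R e) * indicator T y * indicator {0..\<delta>} t" "t *\<^sub>R e"] by simp
  qed
  also have "\<dots> = (\<integral>\<^sup>+y. \<integral>\<^sup>+t. F y * indicator T (y + t *\<^sub>R e) * indicator {0..\<delta>} t \<partial>lborel \<partial>lborel)"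
    by (rule lborel_Fubini[of "\<lambda>(y, t). F y * indicator T (y + t *\<^sub>R e) * indicator {0..\<delta>} t", simplified])
  also have "\<dots> \<le> (\<integral>\<^sup>+y. ennreal \<eta> * (F y * indicator V y) \<partial>lborel)"
  proof (intro nn_integral_mono)
    fix y
    have "(\<integral>\<^sup>+t. F y * indicator T (y + t *\<^sub>R e) * indicator {0..\<delta>} t \<partial>lborel)
        \<le> (\<integral>\<^sup>+t. F y * indicator V y * indicator {k y - \<eta>..k y} t \<partial>lborel)"
    proof (intro nn_integral_mono)
      fix t
      show "F y * indicator T (y + t *\<^sub>R e) * indicator {0..\<delta>} t \<le> F y * indicator V y * indicator {k y - \<eta>..k y} t"
        using T[of "y + t *\<^sub>R e"] TV[of "y + t *\<^sub>R e" t] by (auto simp: indicator_def shift)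
    qed
    also have "\<dots> = F y * indicator V y * ennreal \<eta>"
      using \<eta> by (subst nn_integral_cmult) auto
    finally show "(\<integral>\<^sup>+t. F y * indicator T (y + t *\<^sub>R e) * indicator {0..\<delta>} t \<partial>lborel) \<le> ennreal \<eta> * (F y * indicator V y)"
      by (simp add: mult.commute)
  qed
  also have "\<dots> = ennreal \<eta> * (\<integral>\<^sup>+y. F y * indicator V y \<partial>lborel)" by (subst nn_integral_cmult) auto
  finally show ?thesis .
qed

text \<open>\<open>\<phi> y\<close> is compared with \<open>\<phi> (y - t *\<^sub>R e)\<close> and
  the result is averaged over \<open>t\<close> in \<open>{0..\<delta>}\<close>; \<open>sweep\<close>
  bounds each average by \<open>\<eta>\<close> times an integral over \<open>V\<close>. The bound is
  linear in the thickness \<open>\<eta>\<close>, which makes up for the division by the radius in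
  \<open>trace_local\<close>.\<close>

lemma nsq_strip_le:
  assumes \<phi>: "C1_grad \<phi> d\<phi>" and m[measurable]: "T \<in> sets borel" "V \<in> sets borel"
    and T: "\<And>y. y \<in> T \<Longrightarrow> 0 < k y \<and> k y < \<eta>" and TV: "\<And>y t. y \<in> T \<Longrightarrow> 0 \<le> t \<Longrightarrow> t \<le> \<delta> \<Longrightarrow> y - t *\<^sub>R e \<in> V"
    and \<eta>: "0 \<le> \<eta>" and \<delta>: "0 < \<delta>"
  shows "nsq T \<phi> \<le> ennreal (2 * \<eta> / \<delta>) * nsq V \<phi> + ennreal (2 * \<delta> * \<eta>) * nsq V d\<phi>"
proof -
  note [measurable] = C1_measurable[OF \<phi>] C1_grad_measurable[OF \<phi>]
  define E where "E y = (\<integral>\<^sup>+s. ennreal ((norm (d\<phi> (y - s *\<^sub>R e)))\<^sup>2) * indicator {0..\<delta>} s \<partial>lborel)" for y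
  have [measurable]: "E \<in> borel_measurable borel" unfolding E_def by measurable
  have "ennreal \<delta> * nsq T \<phi> = (\<integral>\<^sup>+t. nsq T \<phi> * indicator {0..\<delta>} t \<partial>lborel)"
    using \<delta> by (simp add: nn_integral_cmult mult.commute)
  also have "\<dots> = (\<integral>\<^sup>+t. \<integral>\<^sup>+y. ennreal ((norm (\<phi> y))\<^sup>2) * indicator T y * indicator {0..\<delta>} t \<partial>lborel \<partial>lborel)"
    unfolding nsq_def by (subst nn_integral_multc) auto
  also have "\<dots> \<le> (\<integral>\<^sup>+t. \<integral>\<^sup>+y. 2 * (ennreal ((norm (\<phi> (y - t *\<^sub>R e)))\<^sup>2) * indicator T y * indicator {0..\<delta>} t)
        + ennreal (2 * \<delta>) * (E y * indicator T y * indicator {0..\<delta>} t) \<partial>lborel \<partial>lborel)"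
  proof (intro nn_integral_mono)
    fix t y
    have "ennreal ((\<phi> y)\<^sup>2) \<le> 2 * ennreal ((\<phi> (y - t *\<^sub>R e))\<^sup>2) + ennreal (2 * \<delta>) * E y" if t: "0 \<le> t" "t \<le> \<delta>"
    proof -
      have "ennreal ((\<phi> y - \<phi> (y - t *\<^sub>R e))\<^sup>2) \<le> ennreal (t * (norm (- e))\<^sup>2)
          * (\<integral>\<^sup>+s. ennreal ((norm (d\<phi> (y + s *\<^sub>R (- e))))\<^sup>2) * indicator {0..t} s \<partial>lborel)"
        using C1_line_diff[OF \<phi> t(1), of y "- e"] by (simp add: power2_commute)
      also have "\<dots> \<le> ennreal \<delta> * E y"
        unfolding E_def using t e by (intro mult_mono nn_integral_mono ennreal_leI) (auto simp: indicator_def)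
      finally have "ennreal ((\<phi> y)\<^sup>2) \<le> 2 * ennreal ((\<phi> (y - t *\<^sub>R e))\<^sup>2) + 2 * (ennreal \<delta> * E y)"
        by (rule ennreal_square_le_double)
      then show ?thesis using \<delta> by (simp add: ennreal_mult mult.assoc)
    qed
    then show "ennreal ((norm (\<phi> y))\<^sup>2) * indicator T y * indicator {0..\<delta>} t
      \<le> 2 * (ennreal ((norm (\<phi> (y - t *\<^sub>R e)))\<^sup>2) * indicator T y * indicator {0..\<delta>} t) + ennreal (2 * \<delta>) * (E y * indicator T y * indicator {0..\<delta>} t)"
      by (auto simp: indicator_def)
  qed
  also have "\<dots> = 2 * (\<integral>\<^sup>+t. \<integral>\<^sup>+y. ennreal ((norm (\<phi> (y - t *\<^sub>R e)))\<^sup>2) * indicator T y * indicator {0..\<delta>} t \<partial>lborel \<partial>lborel)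
        + ennreal (2 * \<delta>) * (\<integral>\<^sup>+t. (\<integral>\<^sup>+y. E y * indicator T y \<partial>lborel) * indicator {0..\<delta>} t \<partial>lborel)"
    by (simp add: nn_integral_add nn_integral_cmult nn_integral_multc)
  also have "(\<integral>\<^sup>+t. (\<integral>\<^sup>+y. E y * indicator T y \<partial>lborel) * indicator {0..\<delta>} t \<partial>lborel) = ennreal \<delta> * (\<integral>\<^sup>+y. E y * indicator T y \<partial>lborel)"
    using \<delta> by (subst nn_integral_cmult_indicator) (auto simp: mult.commute)
  also have "(\<integral>\<^sup>+y. E y * indicator T y \<partial>lborel)
      = (\<integral>\<^sup>+y. \<integral>\<^sup>+s. ennreal ((norm (d\<phi> (y - s *\<^sub>R e)))\<^sup>2) * indicator T y * indicator {0..\<delta>} s \<partial>lborel \<partial>lborel)"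
    unfolding E_def by (subst nn_integral_multc[symmetric]) (auto simp: mult_ac)
  also have "\<dots> = (\<integral>\<^sup>+s. \<integral>\<^sup>+y. ennreal ((norm (d\<phi> (y - s *\<^sub>R e)))\<^sup>2) * indicator T y * indicator {0..\<delta>} s \<partial>lborel \<partial>lborel)"
    by (rule lborel_Fubini[of "\<lambda>(y, s). ennreal ((norm (d\<phi> (y - s *\<^sub>R e)))\<^sup>2) * indicator T y * indicator {0..\<delta>} s", symmetric, simplified])
  also have "\<dots> \<le> ennreal \<eta> * nsq V d\<phi>"
    unfolding nsq_def by (rule sweep[OF m _ T TV \<eta>]) auto
  also have "(\<integral>\<^sup>+t. \<integral>\<^sup>+y. ennreal ((norm (\<phi> (y - t *\<^sub>R e)))\<^sup>2) * indicator T y * indicator {0..\<delta>} t \<partial>lborel \<partial>lborel)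
      \<le> ennreal \<eta> * nsq V \<phi>"
    unfolding nsq_def by (rule sweep[OF m _ T TV \<eta>]) auto
  finally have "ennreal \<delta> * nsq T \<phi> \<le> 2 * (ennreal \<eta> * nsq V \<phi>) + ennreal (2 * \<delta>) * (ennreal \<delta> * (ennreal \<eta> * nsq V d\<phi>))"
    by (simp add: mult_left_mono add_mono)
  also have "\<dots> = ennreal \<delta> * (ennreal (2 * \<eta> / \<delta>) * nsq V \<phi> + ennreal (2 * \<delta> * \<eta>) * nsq V d\<phi>)"
  proof -
    have "ennreal \<delta> * ennreal (2 * \<eta> / \<delta>) = 2 * ennreal \<eta>"
      using \<delta> \<eta> by (subst ennreal_mult[symmetric]) (auto simp: ennreal_mult)
    moreover have "ennreal \<delta> * ennreal (2 * \<delta> * \<eta>) = ennreal (2 * \<delta>) * ennreal \<delta> * ennreal \<eta>"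
      using \<delta> \<eta> by (simp add: mult_ac flip: ennreal_mult)
    ultimately show ?thesis by (simp only: distrib_left mult.assoc[symmetric])
  qed
  finally show ?thesis using \<delta> by (subst (asm) ennreal_mult_le_mult_iff) auto
qed

end


lemma ennreal_double_mult: "0 \<le> a \<Longrightarrow> 2 * (ennreal a * X) = ennreal (2 * a) * X"
  by (simp add: ennreal_mult mult.assoc)

lemma C1_const: "C1_grad (\<lambda>_. c) (\<lambda>_. 0)"
  by (simp add: C1_grad_def)

lemma nsq_const: "A \<in> sets borel \<Longrightarrow> nsq A (\<lambda>_. 1 :: real) = emeasure lborel A" "nsq A (\<lambda>_. 0) = 0"
  by (simp_all add: nsq_def)

lemma nsq_mono: "A \<subseteq> B \<Longrightarrow> nsq A f \<le> nsq B f"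
  unfolding nsq_def by (intro nn_integral_mono) (auto simp: indicator_def)

context surface
begin

text \<open>Upper regularity bounds a surface integral by a volume integral over the union of the
  balls \<open>ball (x - w) \<tau>\<close>; a suitable shift \<open>w\<close> moves them to one side of the surface.\<close>

lemma layer_bound:
  assumes [measurable]: "A \<in> sets borel" "T \<in> sets borel" "g \<in> borel_measurable borel" "h \<in> borel_measurable borel"
    and \<tau>: "0 < \<tau>" "2 * \<tau> \<le> r0"
    and AT: "\<And>x z. x \<in> S \<Longrightarrow> x \<in> A \<Longrightarrow> dist (x - w) z < \<tau> \<Longrightarrow> z \<in> T \<and> h x \<le> g z"
  shows "ennreal (unit_ball_vol (DIM('a)) * \<tau> ^ DIM('a)) * (\<integral>\<^sup>+x. h x * indicator A x \<partial>surf S)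
       \<le> ennreal (C * (2 * \<tau>) ^ (DIM('a) - 1)) * (\<integral>\<^sup>+z. g z * indicator T z \<partial>lborel)"
proof -
  define I where "I = (\<lambda>(x::'a, z). indicator {p. dist (fst p - w) (snd p) < \<tau>} (x, z) :: ennreal)"
  have I_eq: "I (x, z) = indicator (ball (x - w) \<tau>) z" "I (x, z) = indicator (ball (z + w) \<tau>) x" for x z
    by (auto simp: I_def indicator_def dist_norm algebra_simps norm_minus_commute)
  have [measurable]: "I \<in> borel_measurable (borel \<Otimes>\<^sub>M borel)"
    unfolding I_def by (simp add: case_prod_beta) measurable
  have "ennreal (unit_ball_vol (DIM('a)) * \<tau> ^ DIM('a)) * (\<integral>\<^sup>+x. h x * indicator A x \<partial>surf S)
      = (\<integral>\<^sup>+x. h x * indicator A x * ennreal (unit_ball_vol (DIM('a)) * \<tau> ^ DIM('a)) \<partial>surf S)"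
    by (subst nn_integral_multc) (auto simp: mult.commute)
  also have "\<dots> = (\<integral>\<^sup>+x. h x * indicator A x * (\<integral>\<^sup>+z. I (x, z) \<partial>lborel) \<partial>surf S)"
    using \<tau> by (simp add: I_eq(1) emeasure_ball)
  also have "\<dots> = (\<integral>\<^sup>+x. \<integral>\<^sup>+z. h x * indicator A x * I (x, z) \<partial>lborel \<partial>surf S)"
    by (subst nn_integral_cmult) (auto simp: I_eq(1) intro!: borel_measurable_indicator)
  also have "\<dots> = (\<integral>\<^sup>+z. \<integral>\<^sup>+x. h x * indicator A x * I (x, z) \<partial>surf S \<partial>lborel)"
    using Fubini_lborel[of "\<lambda>p. h (fst p) * indicator A (fst p) * I p"] by simp
  also have "\<dots> \<le> (\<integral>\<^sup>+z. ennreal (C * (2 * \<tau>) ^ (DIM('a) - 1)) * (g z * indicator T z) \<partial>lborel)"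
  proof (rule nn_integral_mono)
    fix z
    have em: "emeasure (surf S) (ball (z + w) \<tau>) \<le> ennreal (C * (2 * \<tau>) ^ (DIM('a) - 1))"
    \<comment> \<open>\<open>upper\<close> is available only for balls centred on the surface, hence
      the recentring with doubled radius.\<close>
    proof (cases "S \<inter> ball (z + w) \<tau> = {}")
      case True
      then show ?thesis by (simp add: emeasure_surf)
    next
      case False
      then obtain x where x: "x \<in> S" "dist (z + w) x < \<tau>" by auto
      have "ball (z + w) \<tau> \<subseteq> ball x (2 * \<tau>)"
      proof
        fix y assume "y \<in> ball (z + w) \<tau>"
        then show "y \<in> ball x (2 * \<tau>)" using x dist_triangle[of x y "z + w"] by (simp add: dist_commute)
      qed
      then have "emeasure (surf S) (ball (z + w) \<tau>) \<le> emeasure (surf S) (ball x (2 * \<tau>))"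
        by (intro emeasure_mono) auto
      also have "\<dots> \<le> ennreal (C * (2 * \<tau>) ^ (DIM('a) - 1))" using x \<tau> by (intro upper) auto
      finally show ?thesis .
    qed
    have "(\<integral>\<^sup>+x. h x * indicator A x * I (x, z) \<partial>surf S) \<le> (\<integral>\<^sup>+x. g z * indicator T z * indicator (ball (z + w) \<tau>) x \<partial>surf S)"
    proof (rule nn_integral_mono_AE, rule eventually_mono[OF AE_surf[OF S_borel]])
      fix x assume x: "x \<in> S"
      have "dist (x - w) z < \<tau>" if "dist (z + w) x < \<tau>"
        using that by (simp add: dist_norm algebra_simps norm_minus_commute)
      with AT[OF x, of z] show "h x * indicator A x * I (x, z) \<le> g z * indicator T z * indicator (ball (z + w) \<tau>) x"
        by (auto simp: I_eq(2) indicator_def)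
    qed
    also have "\<dots> = g z * indicator T z * emeasure (surf S) (ball (z + w) \<tau>)"
      by (subst nn_integral_cmult_indicator) auto
    also have "\<dots> \<le> g z * indicator T z * ennreal (C * (2 * \<tau>) ^ (DIM('a) - 1))"
      by (intro mult_left_mono em) auto
    finally show "(\<integral>\<^sup>+x. h x * indicator A x * I (x, z) \<partial>surf S) \<le> ennreal (C * (2 * \<tau>) ^ (DIM('a) - 1)) * (g z * indicator T z)"
      by (simp only: mult.commute)
  qed
  also have "\<dots> = ennreal (C * (2 * \<tau>) ^ (DIM('a) - 1)) * (\<integral>\<^sup>+z. g z * indicator T z \<partial>lborel)"
    by (subst nn_integral_cmult) auto
  finally show ?thesis .
qed

text \<open>\<open>layer_bound\<close> replaces the surface integral by \<open>1 / \<tau>\<close>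
  times an integral over a layer of thickness proportional to \<open>\<tau>\<close>, and
  \<open>nsq_strip_le\<close> returns the factor \<open>\<tau>\<close>. So the constant is
  independent of \<open>\<tau>\<close>, and \<open>\<tau>\<close> may be taken so small, depending
  on \<open>\<phi>\<close>, that \<open>\<phi>\<close> hardly varies across the layer.\<close>

lemma trace_local:
  assumes gc: "graph_chart k e K" and r: "0 < r" and k0: "\<And>x. x \<in> S \<Longrightarrow> x \<in> ball p r \<Longrightarrow> k x = 0"
    and V_def: "V = {y \<in> ball p r. 0 < k y}"
  obtains Q where "Q \<ge> 0" "\<And>\<phi> d\<phi>. C1_grad \<phi> d\<phi> \<Longrightarrow>
     (\<integral>\<^sup>+x. ennreal ((\<phi> x)\<^sup>2) * indicator (ball p (r/4)) x \<partial>surf S) \<le> ennreal Q * (nsq V \<phi> + nsq V d\<phi>)"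
proof -
  interpret graph_chart k e K by (rule gc)
  define d where "d = DIM('a)"
  define vb where "vb = unit_ball_vol (real d)"
  have d: "d > 0" by (simp add: d_def)
  have vb: "vb > 0" by (simp add: vb_def)
  define \<delta> where "\<delta> = r / 4"
  have \<delta>: "\<delta> > 0" using r by (simp add: \<delta>_def)
  \<comment> \<open>The value of \<open>C * (2 * \<tau>) ^ (d - 1) * (2 * \<eta>) / (vb * \<tau> ^
    d)\<close> for the \<open>\<eta>\<close> chosen below; \<open>\<tau>\<close> cancels.\<close>
  define Q0 where "Q0 = C * 2 ^ d * (2 * K + 2) / vb"
  define Q where "Q = Q0 * (2 / \<delta> + 2 * \<delta>)"
  have Q0: "Q0 \<ge> 0" using pos K_ge_1 vb by (simp add: Q0_def)
  then have Q: "Q \<ge> 0" using \<delta> by (simp add: Q_def)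
  have [measurable]: "k \<in> borel_measurable borel" using cont by (rule borel_measurable_continuous_onI)
  have Veq: "V = ball p r \<inter> {y. 0 < k y}" using V_def by auto
  have [measurable]: "V \<in> sets borel" unfolding Veq by measurable
  have "bounded V" by (rule bounded_subset[OF bounded_ball, of _ p r]) (auto simp: Veq)
  then have "emeasure lborel V < \<infinity>" by (rule emeasure_bounded_finite)
  then obtain m where m: "m \<ge> 0" "emeasure lborel V = ennreal m" by (cases "emeasure lborel V") auto
  have main: "(\<integral>\<^sup>+x. ennreal ((\<phi> x)\<^sup>2) * indicator (ball p (r/4)) x \<partial>surf S) \<le> ennreal Q * (nsq V \<phi> + nsq V d\<phi>) + ennreal (\<omega>\<^sup>2 * (Q * m))"
    if \<phi>: "C1_grad \<phi> d\<phi>" and \<omega>: "0 < \<omega>" for \<phi> d\<phi> \<omega>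
  proof -
    note [measurable] = C1_measurable[OF \<phi>] C1_grad_measurable[OF \<phi>]
    have "uniformly_continuous_on (cball p r) \<phi>"
      by (rule compact_uniformly_continuous[OF C1_continuous[OF \<phi>] compact_cball])
    then obtain \<rho> where \<rho>: "\<rho> > 0" "\<And>x z. x \<in> cball p r \<Longrightarrow> z \<in> cball p r \<Longrightarrow> dist z x < \<rho> \<Longrightarrow> dist (\<phi> z) (\<phi> x) < \<omega>"
      using \<omega> unfolding uniformly_continuous_on_def by metis
    define \<tau> where "\<tau> = min (r0 / 2) (min \<rho> (r / 4) / (K + 2))"
    have \<tau>: "0 < \<tau>" "2 * \<tau> \<le> r0" using pos \<rho> r K_ge_1 by (auto simp: \<tau>_def)
    have "\<tau> \<le> min \<rho> (r / 4) / (K + 2)" by (simp add: \<tau>_def)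
    then have \<tau>': "(K + 2) * \<tau> \<le> \<rho>" "(K + 2) * \<tau> \<le> r / 4" using K_ge_1 by (auto simp: field_simps)
    define \<eta> where "\<eta> = (2 * K + 2) * \<tau>"
    have \<eta>: "0 \<le> \<eta>" using \<tau> K_ge_1 by (simp add: \<eta>_def)
    \<comment> \<open>Half the radius: points of \<open>T\<close> can be moved vertically by up to
      \<open>\<delta> = r / 4\<close> without leaving \<open>ball p r\<close>.\<close>
    define T where "T = ball p (r / 2) \<inter> {y. 0 < k y \<and> k y < \<eta>}"
    have T[measurable]: "T \<in> sets borel" unfolding T_def by measurable
    have TV: "y - t *\<^sub>R e \<in> V" if "y \<in> T" "0 \<le> t" "t \<le> \<delta>" for y t
    proof -
      have "dist p (y - t *\<^sub>R e) \<le> dist p y + t" using dist_triangle[of p "y - t *\<^sub>R e" y] e that by (simp add: dist_norm)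
      moreover have "k (y - t *\<^sub>R e) = k y + t" using shift[of y "- t"] by simp
      ultimately show ?thesis using that r by (auto simp: T_def Veq \<delta>_def)
    qed
    have strip: "nsq T \<psi> \<le> ennreal (2 * \<eta> / \<delta>) * nsq V \<psi> + ennreal (2 * \<delta> * \<eta>) * nsq V d\<psi>" if "C1_grad \<psi> d\<psi>" for \<psi> d\<psi>
      by (rule nsq_strip_le[OF that T _ _ TV \<eta> \<delta>]) (auto simp: T_def)
    have "ennreal (vb * \<tau> ^ d) * (\<integral>\<^sup>+x. ennreal ((\<phi> x)\<^sup>2) * indicator (ball p (r/4)) x \<partial>surf S)
        \<le> ennreal (C * (2 * \<tau>) ^ (d - 1)) * (\<integral>\<^sup>+z. ennreal (2 * (\<phi> z)\<^sup>2 + 2 * \<omega>\<^sup>2) * indicator T z \<partial>lborel)"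
      unfolding vb_def d_def
    \<comment> \<open>At the shifted centre \<open>k\<close> equals \<open>(K + 1) * \<tau>\<close>,
      and within radius \<open>\<tau>\<close> it varies by less than \<open>K * \<tau>\<close>. So
      the whole ball lies in \<open>0 < k < \<eta>\<close>, on one side of the surface.\<close>
    proof (rule layer_bound[OF _ T _ _ \<tau>, where w = "((K + 1) * \<tau>) *\<^sub>R e"])
      fix x z assume x: "x \<in> S" "x \<in> ball p (r / 4)" and z: "dist (x - ((K + 1) * \<tau>) *\<^sub>R e) z < \<tau>"
      let ?b = "x - ((K + 1) * \<tau>) *\<^sub>R e"
      have kx: "k x = 0" using k0 x r by simp
      have kb: "k ?b = (K + 1) * \<tau>" using shift[of x "- ((K + 1) * \<tau>)"] kx by simp
      have "\<bar>k ?b - k z\<bar> \<le> K * dist ?b z" by (rule lipD)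
      also have "\<dots> < K * \<tau>" using z K_ge_1 by (intro mult_strict_left_mono) auto
      finally have kz: "0 < k z" "k z < \<eta>" using \<tau> unfolding kb \<eta>_def by (auto simp: algebra_simps abs_less_iff)
      have "dist x ?b = (K + 1) * \<tau>" using e \<tau> K_ge_1 by (simp add: dist_norm)
      then have xz: "dist x z < (K + 2) * \<tau>" using dist_triangle[of x z ?b] z by (simp add: algebra_simps)
      have pz: "dist p z < r / 2" using dist_triangle[of p z x] xz x \<tau>' by simp
      have "dist (\<phi> z) (\<phi> x) < \<omega>" using x pz r xz \<tau>' by (intro \<rho>(2)) (auto simp: dist_commute)
      then have "(\<phi> x - \<phi> z)\<^sup>2 \<le> \<omega>\<^sup>2" using abs_le_square_iff[of "\<phi> x - \<phi> z" \<omega>] \<omega> by (simp add: dist_real_def abs_minus_commute)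
      moreover have "(\<phi> x)\<^sup>2 \<le> 2 * (\<phi> z)\<^sup>2 + 2 * (\<phi> x - \<phi> z)\<^sup>2"
        using zero_le_power2[of "\<phi> x - 2 * \<phi> z"] by (simp add: power2_eq_square algebra_simps)
      ultimately have "(\<phi> x)\<^sup>2 \<le> 2 * (\<phi> z)\<^sup>2 + 2 * \<omega>\<^sup>2" by linarith
      then show "z \<in> T \<and> ennreal ((\<phi> x)\<^sup>2) \<le> ennreal (2 * (\<phi> z)\<^sup>2 + 2 * \<omega>\<^sup>2)"
        using kz pz by (auto simp: T_def simp del: ennreal_plus intro!: ennreal_leI)
    qed measurable
    also have "(\<integral>\<^sup>+z. ennreal (2 * (\<phi> z)\<^sup>2 + 2 * \<omega>\<^sup>2) * indicator T z \<partial>lborel)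
        = (\<integral>\<^sup>+z. 2 * (ennreal ((norm (\<phi> z))\<^sup>2) * indicator T z) + ennreal (2 * \<omega>\<^sup>2) * indicator T z \<partial>lborel)"
      by (intro nn_integral_cong) (auto simp: indicator_def ennreal_mult)
    also have "\<dots> = 2 * nsq T \<phi> + ennreal (2 * \<omega>\<^sup>2) * nsq T (\<lambda>_. 1::real)"
      unfolding nsq_const(1)[OF T] by (simp add: nsq_def nn_integral_add nn_integral_cmult)
    also have "\<dots> \<le> 2 * (ennreal (2 * \<eta> / \<delta>) * nsq V \<phi> + ennreal (2 * \<delta> * \<eta>) * nsq V d\<phi>)
        + ennreal (2 * \<omega>\<^sup>2) * (ennreal (2 * \<eta> / \<delta>) * ennreal m)"
      using strip[OF \<phi>] strip[OF C1_const[of 1]] m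
      by (intro add_mono mult_left_mono) (simp_all add: nsq_const)
    also have "\<dots> \<le> ennreal (2 * \<eta> * (2 / \<delta> + 2 * \<delta>)) * (nsq V \<phi> + nsq V d\<phi> + ennreal (\<omega>\<^sup>2 * m))"
    proof -
      have "2 * (ennreal (2 * \<eta> / \<delta>) * nsq V \<phi>) = ennreal (2 * \<eta> * (2 / \<delta>)) * nsq V \<phi>"
        using ennreal_double_mult[of "2 * \<eta> / \<delta>"] \<eta> \<delta> by simp
      moreover have "\<dots> \<le> ennreal (2 * \<eta> * (2 / \<delta> + 2 * \<delta>)) * nsq V \<phi>"
        using \<eta> \<delta> by (intro mult_right_mono ennreal_leI mult_left_mono) auto
      moreover have "2 * (ennreal (2 * \<delta> * \<eta>) * nsq V d\<phi>) = ennreal (2 * \<eta> * (2 * \<delta>)) * nsq V d\<phi>"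
        using \<eta> \<delta> by (subst ennreal_double_mult) (auto simp: mult_ac)
      moreover have "\<dots> \<le> ennreal (2 * \<eta> * (2 / \<delta> + 2 * \<delta>)) * nsq V d\<phi>"
        using \<eta> \<delta> by (intro mult_right_mono ennreal_leI mult_left_mono) auto
      moreover have "ennreal (2 * \<omega>\<^sup>2) * (ennreal (2 * \<eta> / \<delta>) * ennreal m) = ennreal (2 * \<eta> * (2 / \<delta>) * (\<omega>\<^sup>2 * m))"
        using \<eta> \<delta> m by (simp flip: ennreal_mult add: mult_ac)
      moreover have "\<dots> \<le> ennreal (2 * \<eta> * (2 / \<delta> + 2 * \<delta>)) * ennreal (\<omega>\<^sup>2 * m)"
      proof -
        have "2 * \<eta> * (2 / \<delta>) * (\<omega>\<^sup>2 * m) \<le> 2 * \<eta> * (2 / \<delta> + 2 * \<delta>) * (\<omega>\<^sup>2 * m)"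
          using \<eta> \<delta> m by (intro mult_right_mono mult_left_mono) auto
        from ennreal_leI[OF this] show ?thesis using \<eta> \<delta> m by (subst ennreal_mult[symmetric]) auto
      qed
      ultimately show ?thesis by (simp add: distrib_left add_mono)
    qed
    finally have "ennreal (vb * \<tau> ^ d) * (\<integral>\<^sup>+x. ennreal ((\<phi> x)\<^sup>2) * indicator (ball p (r/4)) x \<partial>surf S)
        \<le> ennreal (C * (2 * \<tau>) ^ (d - 1) * (2 * \<eta> * (2 / \<delta> + 2 * \<delta>))) * (nsq V \<phi> + nsq V d\<phi> + ennreal (\<omega>\<^sup>2 * m))"
      using pos \<tau> \<eta> \<delta> by (simp add: ennreal_mult mult.assoc mult_left_mono)
    then have "(\<integral>\<^sup>+x. ennreal ((\<phi> x)\<^sup>2) * indicator (ball p (r/4)) x \<partial>surf S)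
        \<le> ennreal (C * (2 * \<tau>) ^ (d - 1) * (2 * \<eta> * (2 / \<delta> + 2 * \<delta>)) / (vb * \<tau> ^ d)) * (nsq V \<phi> + nsq V d\<phi> + ennreal (\<omega>\<^sup>2 * m))"
      using pos \<tau> \<eta> \<delta> vb by (intro ennreal_mult_le_divide) auto
    also have "C * (2 * \<tau>) ^ (d - 1) * (2 * \<eta> * (2 / \<delta> + 2 * \<delta>)) / (vb * \<tau> ^ d) = Q"
    proof -
      have "C * (2 * \<tau>) ^ (d - 1) * (2 * \<eta>) / (vb * \<tau> ^ d) = Q0"
        using d \<tau> vb by (cases d) (auto simp: Q0_def \<eta>_def power_mult_distrib field_simps)
      then show ?thesis unfolding Q_def by (metis mult.assoc times_divide_eq_left)
    qed
    finally show ?thesis using Q m by (simp add: distrib_left mult_ac flip: ennreal_mult)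
  qed
  have "(\<integral>\<^sup>+x. ennreal ((\<phi> x)\<^sup>2) * indicator (ball p (r/4)) x \<partial>surf S) \<le> ennreal Q * (nsq V \<phi> + nsq V d\<phi>)"
    if \<phi>: "C1_grad \<phi> d\<phi>" for \<phi> d\<phi>
  proof (rule ennreal_le_epsilon)
    fix \<epsilon> :: real assume \<epsilon>: "0 < \<epsilon>"
    \<comment> \<open>Makes the remainder \<open>\<omega>\<^sup>2 * (Q * m)\<close> at most
      \<open>\<epsilon>\<close>; the 1 covers the case \<open>Q * m = 0\<close>.\<close>
    define \<omega> where "\<omega> = sqrt (\<epsilon> / (Q * m + 1))"
    have Qm: "0 \<le> Q * m" using Q m by simp
    have \<omega>: "0 < \<omega>" using \<epsilon> Qm by (simp add: \<omega>_def add_nonneg_pos)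
    have "\<omega>\<^sup>2 * (Q * m) = \<epsilon> * (Q * m / (Q * m + 1))" using \<epsilon> Qm by (simp add: \<omega>_def)
    also have "\<dots> \<le> \<epsilon> * 1" using \<epsilon> Qm by (intro mult_left_mono) auto
    finally have "ennreal (\<omega>\<^sup>2 * (Q * m)) \<le> ennreal \<epsilon>" by (intro ennreal_leI) simp
    then show "(\<integral>\<^sup>+x. ennreal ((\<phi> x)\<^sup>2) * indicator (ball p (r/4)) x \<partial>surf S) \<le> ennreal Q * (nsq V \<phi> + nsq V d\<phi>) + ennreal \<epsilon>"
      using main[OF \<phi> \<omega>] by (meson add_left_mono order_trans)
  qed
  then show ?thesis using that Q by blast
qed

text \<open>Only the side \<open>0 < k\<close> of each chart has to lie in \<open>V\<close>, so the
  trace can be estimated from either side of the surface. Compactness makes the constant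
  uniform.\<close>

lemma trace_inequality:
  assumes ch: "\<And>p. p \<in> S \<Longrightarrow> \<exists>r k e K. 0 < r \<and> graph_chart k e K \<and> (\<forall>x\<in>S \<inter> ball p r. k x = 0) \<and> {y \<in> ball p r. 0 < k y} \<subseteq> V"
  obtains Q where "Q \<ge> 0" "\<And>\<phi> d\<phi>. C1_grad \<phi> d\<phi> \<Longrightarrow>
     (\<integral>\<^sup>+x. ennreal ((\<phi> x)\<^sup>2) \<partial>surf S) \<le> ennreal Q * (nsq V \<phi> + nsq V d\<phi>)"
proof -
  define good where "good p r Q \<longleftrightarrow> 0 < r \<and> 0 \<le> Q \<and> (\<forall>\<phi> d\<phi>. C1_grad \<phi> d\<phi> \<longrightarrow>
     (\<integral>\<^sup>+x. ennreal ((\<phi> x)\<^sup>2) * indicator (ball p r) x \<partial>surf S) \<le> ennreal Q * (nsq V \<phi> + nsq V d\<phi>))" for p r Q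
  have "\<exists>r Q. good p r Q" if p: "p \<in> S" for p
  proof -
    obtain r k e K where 1: "0 < r" "graph_chart k e K" "\<forall>x\<in>S \<inter> ball p r. k x = 0" "{y \<in> ball p r. 0 < k y} \<subseteq> V"
      using ch[OF p] by blast
    obtain Q where Q: "Q \<ge> 0" "\<And>\<phi> d\<phi>. C1_grad \<phi> d\<phi> \<Longrightarrow>
     (\<integral>\<^sup>+x. ennreal ((\<phi> x)\<^sup>2) * indicator (ball p (r/4)) x \<partial>surf S)
        \<le> ennreal Q * (nsq {y \<in> ball p r. 0 < k y} \<phi> + nsq {y \<in> ball p r. 0 < k y} d\<phi>)"
      by (rule trace_local[OF 1(2,1) _ refl, of p]) (use 1(3) in auto)
    have "ennreal Q * (nsq {y \<in> ball p r. 0 < k y} \<phi> + nsq {y \<in> ball p r. 0 < k y} d\<phi>) \<le> ennreal Q * (nsq V \<phi> + nsq V d\<phi>)"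
      for \<phi> :: "'a \<Rightarrow> real" and d\<phi> :: "'a \<Rightarrow> 'a"
      by (intro mult_left_mono add_mono nsq_mono 1(4)) auto
    with Q 1(1) have "good p (r/4) Q" unfolding good_def by (meson order_trans divide_pos_pos zero_less_numeral)
    then show ?thesis by blast
  qed
  then obtain r Q where g: "\<forall>p\<in>S. good p (r p) (Q p)" by metis
  obtain F where F: "finite F" "F \<subseteq> S" "S \<subseteq> (\<Union>p\<in>F. ball p (r p))"
    by (rule compact_radius_cover[OF compact, of r]) (use g in \<open>auto simp: good_def\<close>)
  have "(\<integral>\<^sup>+x. ennreal ((\<phi> x)\<^sup>2) \<partial>surf S) \<le> ennreal (sum Q F) * (nsq V \<phi> + nsq V d\<phi>)" if \<phi>: "C1_grad \<phi> d\<phi>" for \<phi> d\<phi>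
  proof -
    note [measurable] = C1_measurable[OF \<phi>]
    have "(\<integral>\<^sup>+x. ennreal ((\<phi> x)\<^sup>2) \<partial>surf S) \<le> (\<integral>\<^sup>+x. (\<Sum>p\<in>F. ennreal ((\<phi> x)\<^sup>2) * indicator (ball p (r p)) x) \<partial>surf S)"
    proof (rule nn_integral_mono_AE, rule eventually_mono[OF AE_surf[OF S_borel]])
      fix x assume "x \<in> S"
      then obtain p where p: "p \<in> F" "x \<in> ball p (r p)" using F by blast
      then have "ennreal ((\<phi> x)\<^sup>2) = ennreal ((\<phi> x)\<^sup>2) * indicator (ball p (r p)) x" by simp
      also have "\<dots> \<le> (\<Sum>p\<in>F. ennreal ((\<phi> x)\<^sup>2) * indicator (ball p (r p)) x)"
        using F p by (intro member_le_sum) auto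
      finally show "ennreal ((\<phi> x)\<^sup>2) \<le> (\<Sum>p\<in>F. ennreal ((\<phi> x)\<^sup>2) * indicator (ball p (r p)) x)" .
    qed
    also have "\<dots> = (\<Sum>p\<in>F. \<integral>\<^sup>+x. ennreal ((\<phi> x)\<^sup>2) * indicator (ball p (r p)) x \<partial>surf S)"
      by (intro nn_integral_sum borel_measurable_times_ennreal borel_measurable_indicator) auto
    also have "\<dots> \<le> (\<Sum>p\<in>F. ennreal (Q p) * (nsq V \<phi> + nsq V d\<phi>))"
      using g F(2) \<phi> by (intro sum_mono) (auto simp: good_def)
    also have "\<dots> = ennreal (sum Q F) * (nsq V \<phi> + nsq V d\<phi>)"
      using g F by (subst sum_ennreal[symmetric]) (auto simp: good_def sum_distrib_right)
    finally show ?thesis .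
  qed
  moreover have "sum Q F \<ge> 0" using g F by (intro sum_nonneg) (auto simp: good_def)
  ultimately show ?thesis using that by blast
qed

end

section \<open>Poincare inequality\<close>

lemma nsq_eq_integral:
  fixes f :: "'a::euclidean_space \<Rightarrow> 'b::euclidean_space"
  assumes f: "continuous_on UNIV f" and A: "A \<in> sets borel" "bounded A"
  shows "nsq A f = ennreal (\<integral>x. indicator A x *\<^sub>R (norm (f x))\<^sup>2 \<partial>lborel)"
proof -
  have "continuous_on UNIV (\<lambda>x. (norm (f x))\<^sup>2)" by (intro continuous_intros f)
  then have "integrable lborel (\<lambda>x. indicator A x *\<^sub>R (norm (f x))\<^sup>2)"
    using A by (intro integrable_indicator_continuous)
  then have "ennreal (\<integral>x. indicator A x *\<^sub>R (norm (f x))\<^sup>2 \<partial>lborel) = (\<integral>\<^sup>+x. ennreal (indicator A x *\<^sub>R (norm (f x))\<^sup>2) \<partial>lborel)"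
    by (intro nn_integral_eq_integral[symmetric]) auto
  also have "\<dots> = nsq A f" unfolding nsq_def by (intro nn_integral_cong) (auto simp: indicator_def)
  finally show ?thesis by simp
qed

text \<open>\<open>green\<close> is applied to \<open>(x \<bullet> i) * (\<phi> x)\<^sup>2\<close>,
  whose derivative along \<open>i\<close> is \<open>(\<phi> x)\<^sup>2\<close> plus a cross term in
  which the coordinate is bounded by \<open>R\<close>.\<close>

lemma (in surface) poincare_inside:
  assumes \<Omega>: "open \<Omega>" "bounded \<Omega>" "frontier \<Omega> = S"
  obtains Q where "Q \<ge> 0" "\<And>\<phi> d\<phi>. C1_grad \<phi> d\<phi> \<Longrightarrow>
     nsq \<Omega> \<phi> \<le> ennreal Q * (nsq \<Omega> d\<phi> + (\<integral>\<^sup>+x. ennreal ((\<phi> x)\<^sup>2) \<partial>surf S))"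
proof -
  obtain i :: 'a where i: "i \<in> Basis" using nonempty_Basis by blast
  obtain R where R: "R > 0" "\<Omega> \<subseteq> ball 0 R" using bounded_subset_ballD[OF \<Omega>(2)] by blast
  have [measurable]: "\<Omega> \<in> sets borel" using \<Omega> by auto
  define q where "q = unit_ball_vol (DIM('a)) * 2 ^ DIM('a) / c"
  have q: "q \<ge> 0" using pos by (simp add: q_def)
  have inR: "\<bar>x \<bullet> i\<bar> \<le> R" if "x \<in> cball 0 R" for x
    using Basis_le_norm[OF i, of x] that by auto
  have SR: "x \<in> cball 0 R" if "x \<in> S" for x
  proof -
    have "x \<in> closure \<Omega>" using that \<Omega>(3) by (auto simp: frontier_def)
    also have "closure \<Omega> \<subseteq> cball 0 R" using R by (intro closure_minimal) auto
    finally show ?thesis .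
  qed
  define Q where "Q = max (2 * q * R) (4 * R\<^sup>2)"
  have Q0: "Q \<ge> 0" by (simp add: Q_def le_max_iff_disj)
  have "nsq \<Omega> \<phi> \<le> ennreal Q * (nsq \<Omega> d\<phi> + (\<integral>\<^sup>+x. ennreal ((\<phi> x)\<^sup>2) \<partial>surf S))" if \<phi>: "C1_grad \<phi> d\<phi>" for \<phi> d\<phi>
  proof (cases "(\<integral>\<^sup>+x. ennreal ((\<phi> x)\<^sup>2) \<partial>surf S) = \<infinity>")
    case True
    have "Q > 0" using R by (simp add: Q_def less_max_iff_disj)
    then show ?thesis using True by (simp add: ennreal_mult_top)
  next
    case False
    note [measurable] = C1_measurable[OF \<phi>] C1_grad_measurable[OF \<phi>]
    have c\<phi>: "continuous_on UNIV \<phi>" "continuous_on UNIV d\<phi>" using C1_continuous[OF \<phi>] C1_continuous_grad[OF \<phi>] by auto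
    from False obtain b where b: "b \<ge> 0" "(\<integral>\<^sup>+x. ennreal ((\<phi> x)\<^sup>2) \<partial>surf S) = ennreal b"
      by (cases "\<integral>\<^sup>+x. ennreal ((\<phi> x)\<^sup>2) \<partial>surf S") auto
    define f where "f x = (x \<bullet> i) * (\<phi> x)\<^sup>2" for x
    define df where "df x = (\<phi> x)\<^sup>2 *\<^sub>R i + (2 * (x \<bullet> i) * \<phi> x) *\<^sub>R d\<phi> x" for x
    have f: "C1_grad f df"
      unfolding C1_grad_def
    proof (intro conjI allI)
      fix x
      show "(f has_derivative (\<lambda>h. df x \<bullet> h)) (at x)"
        unfolding f_def df_def
        by (rule has_derivative_eq_rhs, (rule derivative_intros C1_has_derivative[OF \<phi>])+)
          (auto simp: fun_eq_iff inner_add_left inner_commute algebra_simps)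
      show "continuous_on UNIV df" unfolding df_def by (intro continuous_intros c\<phi>)
    qed
    define a where "a = (\<integral>x. indicator \<Omega> x *\<^sub>R (norm (\<phi> x))\<^sup>2 \<partial>lborel)"
    define g where "g = (\<integral>x. indicator \<Omega> x *\<^sub>R (norm (d\<phi> x))\<^sup>2 \<partial>lborel)"
    have ag1: "nsq \<Omega> \<phi> = ennreal a"
      unfolding a_def by (rule nsq_eq_integral) (use c\<phi> \<Omega> in auto)
    have "nsq \<Omega> d\<phi> = ennreal g"
      unfolding g_def by (rule nsq_eq_integral) (use c\<phi> \<Omega> in auto)
    note ag = ag1 this
    have ag0: "a \<ge> 0" "g \<ge> 0" unfolding a_def g_def by (auto intro!: integral_nonneg_AE)
    have int: "integrable lborel (\<lambda>x. indicator \<Omega> x *\<^sub>R F x)" if "continuous_on UNIV F" for F :: "'a \<Rightarrow> real"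
      using that \<Omega> by (intro integrable_indicator_continuous) auto
    have "ennreal \<bar>\<integral>x. df x \<bullet> i \<partial>lebesgue_on \<Omega>\<bar> \<le> ennreal q * (\<integral>\<^sup>+x. ennreal \<bar>f x\<bar> \<partial>surf S)"
      unfolding q_def using i by (intro green[OF f \<Omega>]) auto
    also have "(\<integral>\<^sup>+x. ennreal \<bar>f x\<bar> \<partial>surf S) \<le> (\<integral>\<^sup>+x. ennreal R * ennreal ((\<phi> x)\<^sup>2) \<partial>surf S)"
    proof (rule nn_integral_mono_AE, rule eventually_mono[OF AE_surf[OF S_borel]])
      fix x assume "x \<in> S"
      then have "\<bar>f x\<bar> \<le> R * (\<phi> x)\<^sup>2" using inR[OF SR] by (auto simp: f_def abs_mult intro!: mult_right_mono)
      from ennreal_leI[OF this] show "ennreal \<bar>f x\<bar> \<le> ennreal R * ennreal ((\<phi> x)\<^sup>2)" using R by (simp add: ennreal_mult)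
    qed
    also have "\<dots> = ennreal (R * b)" using b R by (simp add: nn_integral_cmult ennreal_mult)
    finally have "ennreal \<bar>\<integral>x. df x \<bullet> i \<partial>lebesgue_on \<Omega>\<bar> \<le> ennreal (q * (R * b))"
      using q b R by (simp add: ennreal_mult mult_left_mono)
    then have 1: "\<bar>\<integral>x. df x \<bullet> i \<partial>lebesgue_on \<Omega>\<bar> \<le> q * (R * b)"
      using q b R by (subst (asm) ennreal_le_iff) auto
    have cdf: "continuous_on UNIV (\<lambda>x. df x \<bullet> i)" unfolding df_def by (intro continuous_intros c\<phi>)
    have 2: "(\<integral>x. df x \<bullet> i \<partial>lebesgue_on \<Omega>) = (\<integral>x. indicator \<Omega> x *\<^sub>R (df x \<bullet> i) \<partial>lborel)"
      by (intro integral_lebesgue_on_lborel borel_measurable_continuous_onI cdf) auto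
    \<comment> \<open>By Young's inequality the cross term is at most \<open>(\<phi> x)\<^sup>2 / 2
      + 2 * R\<^sup>2 * (norm (d\<phi> x))\<^sup>2\<close> in absolute value, so half of the first
      integral absorbs it.\<close>
    have "a / 2 - 2 * R\<^sup>2 * g = (\<integral>x. indicator \<Omega> x *\<^sub>R ((norm (\<phi> x))\<^sup>2 / 2 - 2 * R\<^sup>2 * (norm (d\<phi> x))\<^sup>2) \<partial>lborel)"
    proof -
      have e: "indicator \<Omega> x *\<^sub>R ((norm (\<phi> x))\<^sup>2 / 2 - 2 * R\<^sup>2 * (norm (d\<phi> x))\<^sup>2)
         = (1/2) * (indicator \<Omega> x *\<^sub>R (norm (\<phi> x))\<^sup>2) - (2 * R\<^sup>2) * (indicator \<Omega> x *\<^sub>R (norm (d\<phi> x))\<^sup>2)" for x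
        by (simp add: algebra_simps)
      have "(\<integral>x. indicator \<Omega> x *\<^sub>R ((norm (\<phi> x))\<^sup>2 / 2 - 2 * R\<^sup>2 * (norm (d\<phi> x))\<^sup>2) \<partial>lborel)
        = (1/2) * a - (2 * R\<^sup>2) * g"
      proof -
        have i1: "integrable lborel (\<lambda>x. (1/2) * (indicator \<Omega> x *\<^sub>R (norm (\<phi> x))\<^sup>2))"
          and i2: "integrable lborel (\<lambda>x. (2 * R\<^sup>2) * (indicator \<Omega> x *\<^sub>R (norm (d\<phi> x))\<^sup>2))"
          by (intro integrable_mult_right int continuous_intros c\<phi>)+
        show ?thesis
          unfolding e a_def g_def Bochner_Integration.integral_diff[OF i1 i2] by (simp only: integral_mult_right_zero)
      qed
      then show ?thesis by simp
    qed
    also have "\<dots> \<le> (\<integral>x. indicator \<Omega> x *\<^sub>R (df x \<bullet> i) \<partial>lborel)"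
    proof (rule integral_mono[OF int int[OF cdf]])
      show "continuous_on UNIV (\<lambda>x. (norm (\<phi> x))\<^sup>2 / 2 - 2 * R\<^sup>2 * (norm (d\<phi> x))\<^sup>2)"
        by (intro continuous_intros c\<phi>) auto
      fix x
      have "(norm (\<phi> x))\<^sup>2 / 2 - 2 * R\<^sup>2 * (norm (d\<phi> x))\<^sup>2 \<le> df x \<bullet> i" if "x \<in> \<Omega>"
      proof -
        have xR: "\<bar>x \<bullet> i\<bar> \<le> R" using inR R that by force
        have "\<bar>d\<phi> x \<bullet> i\<bar> \<le> norm (d\<phi> x)" using Basis_le_norm[OF i] by simp
        then have "\<bar>(x \<bullet> i) * (d\<phi> x \<bullet> i)\<bar> \<le> R * norm (d\<phi> x)"
          unfolding abs_mult using xR R by (intro mult_mono) auto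
        then have "\<bar>\<phi> x\<bar> * \<bar>(x \<bullet> i) * (d\<phi> x \<bullet> i)\<bar> \<le> \<bar>\<phi> x\<bar> * (R * norm (d\<phi> x))" by (intro mult_left_mono) auto
        then have "\<bar>\<phi> x * ((x \<bullet> i) * (d\<phi> x \<bullet> i))\<bar> \<le> \<bar>\<phi> x\<bar> * (R * norm (d\<phi> x))"
          by (simp only: abs_mult)
        then have "- (2 * (\<phi> x * ((x \<bullet> i) * (d\<phi> x \<bullet> i)))) \<le> 2 * (\<bar>\<phi> x\<bar> * (R * norm (d\<phi> x)))" by linarith
        moreover have "2 * (\<bar>\<phi> x\<bar> * (R * norm (d\<phi> x))) \<le> (\<phi> x)\<^sup>2 / 2 + 2 * R\<^sup>2 * (norm (d\<phi> x))\<^sup>2"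
          using zero_le_power2[of "\<bar>\<phi> x\<bar> - 2 * (R * norm (d\<phi> x))"] by (simp add: power2_diff power_mult_distrib algebra_simps)
        moreover have "df x \<bullet> i = (\<phi> x)\<^sup>2 + 2 * (\<phi> x * ((x \<bullet> i) * (d\<phi> x \<bullet> i)))"
          using i by (simp add: df_def inner_add_left)
        moreover have "(norm (\<phi> x))\<^sup>2 = (\<phi> x)\<^sup>2" by simp
        ultimately show ?thesis by linarith
      qed
      then show "indicator \<Omega> x *\<^sub>R ((norm (\<phi> x))\<^sup>2 / 2 - 2 * R\<^sup>2 * (norm (d\<phi> x))\<^sup>2) \<le> indicator \<Omega> x *\<^sub>R (df x \<bullet> i)"
        by (auto simp: indicator_def)
    qed
    finally have "a \<le> (4 * R\<^sup>2) * g + (2 * q * R) * b" using 1 2 by (simp add: algebra_simps)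
    also have "\<dots> \<le> Q * g + Q * b" using ag0 b by (intro add_mono mult_right_mono) (auto simp: Q_def)
    finally have "ennreal a \<le> ennreal (Q * (g + b))" by (intro ennreal_leI) (simp add: algebra_simps)
    also have "\<dots> = ennreal Q * (ennreal g + ennreal b)" using ag0 b Q0 by (subst ennreal_mult') auto
    finally show ?thesis using ag b by simp
  qed
  then show ?thesis using that Q0 by blast
qed

text \<open>A direct construction in place of a compact embedding. \<open>poincare_inside\<close>
  controls \<open>\<phi>\<close> on the inclusion; translations of small balls carry the control
  through the connected set \<open>\<Omega>\<close> and, inside charts, up to its boundary. A finite
  subcover of the closure yields one constant.\<close>

lemma poincare:
  fixes \<Omega> \<Omega>1 :: "'a::euclidean_space set"
  assumes \<Omega>: "lipschitz_open \<Omega>" "connected \<Omega>" and \<Omega>1: "open \<Omega>1" "\<Omega>1 \<noteq> {}" "\<Omega>1 \<subseteq> \<Omega>"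
    and sf: "surface (frontier \<Omega>1) c C r0"
  obtains Q where "Q \<ge> 0" "\<And>\<phi> d\<phi>. C1_grad \<phi> d\<phi> \<Longrightarrow>
     nsq \<Omega> \<phi> \<le> ennreal Q * (nsq \<Omega> d\<phi> + (\<integral>\<^sup>+x. ennreal ((\<phi> x)\<^sup>2) \<partial>surf (frontier \<Omega>1)))"
proof -
  have op: "open \<Omega>" and bd: "bounded \<Omega>" using \<Omega> by (auto simp: lipschitz_open_def)
  have [measurable]: "\<Omega> \<in> sets borel" using op by auto
  define E where "E \<phi> d\<phi> = nsq \<Omega> d\<phi> + (\<integral>\<^sup>+x. ennreal ((\<phi> x)\<^sup>2) \<partial>surf (frontier \<Omega>1))" for \<phi> :: "'a \<Rightarrow> real" and d\<phi> :: "'a \<Rightarrow> 'a"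
  define good where "good N Q \<longleftrightarrow> Q \<ge> 0 \<and> (\<forall>\<phi> d\<phi>. C1_grad \<phi> d\<phi> \<longrightarrow> nsq (N \<inter> \<Omega>) \<phi> \<le> ennreal Q * E \<phi> d\<phi>)" for N Q
  define P where "P x \<longleftrightarrow> (\<exists>r>0. \<exists>Q. good (ball x r) Q)" for x
  have good_mono: "good N' Q" if "good N Q" "N' \<subseteq> N" for N N' Q
    using that unfolding good_def by (meson Int_mono nsq_mono order_refl order_trans)
  \<comment> \<open>The ball at \<open>x\<close> is compared with its translate at \<open>y\<close>;
    the segments in between must stay in \<open>\<Omega>\<close>, where the gradient is part of
    \<open>E\<close>.\<close>
  have good_move: "good (ball x r) (2 * Q + 2 * (norm (x - y))\<^sup>2)"
    if g: "good (ball y r) Q" and seg: "\<And>z s. z \<in> ball x r \<inter> \<Omega> \<Longrightarrow> 0 \<le> s \<Longrightarrow> s \<le> 1 \<Longrightarrow> z - s *\<^sub>R (x - y) \<in> \<Omega>" for x y r Q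
    unfolding good_def
  proof (intro conjI allI impI)
    show "0 \<le> 2 * Q + 2 * (norm (x - y))\<^sup>2" using g by (simp add: good_def)
    fix \<phi> :: "'a \<Rightarrow> real" and d\<phi> assume \<phi>: "C1_grad \<phi> d\<phi>"
    note [measurable] = C1_measurable[OF \<phi>] C1_grad_measurable[OF \<phi>]
    define v where "v = x - y"
    define A where "A = {z. z + v \<in> ball x r \<inter> \<Omega>}"
    have A[measurable]: "A \<in> sets borel"
      unfolding A_def by (intro borel_open open_vimage[of "ball x r \<inter> \<Omega>" "\<lambda>z. z + v", unfolded vimage_def] continuous_intros) (use op in auto)
    have "nsq (ball x r \<inter> \<Omega>) \<phi> = (\<integral>\<^sup>+z. ennreal ((\<phi> (z + v))\<^sup>2) * indicator A z \<partial>lborel)"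
      unfolding nsq_def A_def
      by (subst nn_integral_translate[of _ v, symmetric]) (auto intro!: nn_integral_cong simp: indicator_def)
    also have "\<dots> \<le> 2 * nsq A \<phi> + ennreal (2 * (norm v)\<^sup>2) * nsq \<Omega> d\<phi>"
    proof (rule nsq_translate_le[OF \<phi> A])
      fix z s :: _ assume z: "z \<in> A" and s: "0 \<le> (s::real)" "s \<le> 1"
      have eq: "(z + v) - (1 - s) *\<^sub>R v = z + s *\<^sub>R v" by (simp add: algebra_simps)
      have "(z + v) - (1 - s) *\<^sub>R v \<in> \<Omega>" using seg[of "z + v" "1 - s"] z s unfolding A_def v_def by auto
      then show "z + s *\<^sub>R v \<in> \<Omega>" by (simp only: eq)
    qed auto
    also have "nsq A \<phi> \<le> nsq (ball y r \<inter> \<Omega>) \<phi>"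
    proof (rule nsq_mono, rule subsetI)
      fix z assume z: "z \<in> A"
      then have "z \<in> \<Omega>" using seg[of "z + v" 1] by (simp add: A_def v_def)
      moreover have "dist y z = dist x (z + v)" by (simp add: v_def dist_norm algebra_simps)
      ultimately show "z \<in> ball y r \<inter> \<Omega>" using z by (simp add: A_def)
    qed
    also have "\<dots> \<le> ennreal Q * E \<phi> d\<phi>" using g \<phi> by (simp add: good_def)
    also have "nsq \<Omega> d\<phi> \<le> E \<phi> d\<phi>" by (simp add: E_def)
    finally have "nsq (ball x r \<inter> \<Omega>) \<phi> \<le> 2 * (ennreal Q * E \<phi> d\<phi>) + ennreal (2 * (norm v)\<^sup>2) * E \<phi> d\<phi>"
      by (simp add: mult_left_mono add_mono)
    also have "\<dots> = ennreal (2 * Q + 2 * (norm v)\<^sup>2) * E \<phi> d\<phi>"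
      using g by (simp add: good_def ennreal_double_mult distrib_right)
    finally show "nsq (ball x r \<inter> \<Omega>) \<phi> \<le> ennreal (2 * Q + 2 * (norm (x - y))\<^sup>2) * E \<phi> d\<phi>" by (simp add: v_def)
  qed
  have P1: "P x" if x: "x \<in> \<Omega>1" for x
  proof -
    have "bounded \<Omega>1" using bd \<Omega>1(3) bounded_subset by blast
    then obtain Q where Q: "Q \<ge> 0" "\<And>\<phi> d\<phi>. C1_grad \<phi> d\<phi> \<Longrightarrow>
     nsq \<Omega>1 \<phi> \<le> ennreal Q * (nsq \<Omega>1 d\<phi> + (\<integral>\<^sup>+x. ennreal ((\<phi> x)\<^sup>2) \<partial>surf (frontier \<Omega>1)))"
      using surface.poincare_inside[OF sf \<Omega>1(1) _ refl] by blast
    have "good \<Omega>1 Q"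
      unfolding good_def
    proof (intro conjI allI impI Q(1))
      fix \<phi> :: "'a \<Rightarrow> real" and d\<phi> assume \<phi>: "C1_grad \<phi> d\<phi>"
      have "nsq (\<Omega>1 \<inter> \<Omega>) \<phi> \<le> nsq \<Omega>1 \<phi>" by (rule nsq_mono) auto
      also note Q(2)[OF \<phi>]
      also have "ennreal Q * (nsq \<Omega>1 d\<phi> + (\<integral>\<^sup>+x. ennreal ((\<phi> x)\<^sup>2) \<partial>surf (frontier \<Omega>1))) \<le> ennreal Q * E \<phi> d\<phi>"
        unfolding E_def using \<Omega>1(3) by (intro mult_left_mono add_mono nsq_mono) auto
      finally show "nsq (\<Omega>1 \<inter> \<Omega>) \<phi> \<le> ennreal Q * E \<phi> d\<phi>" .
    qed
    moreover obtain r where "r > 0" "ball x r \<subseteq> \<Omega>1" using \<Omega>1(1) x open_contains_ball by blast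
    ultimately show ?thesis unfolding P_def using good_mono by blast
  qed
  have P2: "P x" if x: "x \<in> \<Omega>" for x
  proof -
    have ev: "\<forall>\<^sub>F y in at z within \<Omega>. P z = P y" if z: "z \<in> \<Omega>" for z
    proof -
      obtain \<delta> where \<delta>: "\<delta> > 0" "ball z \<delta> \<subseteq> \<Omega>" using op z open_contains_ball by blast
      \<comment> \<open>Both centres are near \<open>z\<close>, so the two balls and all segments
        between them lie in the convex \<open>ball z \<delta>\<close>. Hence \<open>P\<close> is
        locally constant on \<open>\<Omega>\<close>.\<close>
      have move: "P b" if "P a" "dist z a < \<delta> / 2" "dist z b < \<delta> / 2" for a b
      proof -
        obtain r Q where r: "r > 0" "good (ball a r) Q" using \<open>P a\<close> P_def by blast
        define s where "s = min r ((\<delta> - 2 * max (dist z a) (dist z b)) / 2)"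
        have s: "s > 0" "s \<le> r" "s + dist z a < \<delta>" "s + dist z b < \<delta>"
        proof -
          have le: "s \<le> (\<delta> - 2 * max (dist z a) (dist z b)) / 2" unfolding s_def by (rule min.cobounded2)
          show "s > 0" "s \<le> r" using r \<delta> that by (auto simp: s_def)
          show "s + dist z a < \<delta>" "s + dist z b < \<delta>" using le \<delta> by (auto simp: max_def split: if_splits)
        qed
        have "good (ball a s) Q" using r(2) s by (rule_tac good_mono) auto
        then have "good (ball b s) (2 * Q + 2 * (norm (b - a))\<^sup>2)"
        proof (rule good_move)
          fix w t assume w: "w \<in> ball b s \<inter> \<Omega>" and t: "0 \<le> (t::real)" "t \<le> 1"
          have wa: "w - (b - a) \<in> ball z \<delta>"
            using w s(3) dist_triangle[of z "w - (b - a)" a] by (simp add: dist_norm algebra_simps norm_minus_commute)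
          have wb: "w \<in> ball z \<delta>" using w s(4) dist_triangle[of z w b] by simp
          have "w - t *\<^sub>R (b - a) = (1 - t) *\<^sub>R w + t *\<^sub>R (w - (b - a))" by (simp add: algebra_simps)
          also have "\<dots> \<in> ball z \<delta>" using t wa wb by (intro convexD convex_ball) auto
          finally show "w - t *\<^sub>R (b - a) \<in> \<Omega>" using \<delta> by blast
        qed
        then show "P b" using s P_def by blast
      qed
      have Pyz: "P y = P z" if "dist y z < \<delta> / 2" for y
        using move[of z y] move[of y z] that \<delta> by (auto simp: dist_commute)
      have "\<delta> / 2 > 0" using \<delta> by simp
      then show ?thesis unfolding eventually_at using Pyz by blast
    qed
    obtain w where w: "w \<in> \<Omega>1" using \<Omega>1 by blast
    then have "w \<in> \<Omega>" using \<Omega>1 by blast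
    then have "P w = P x" by (rule connected_local_const[OF \<Omega>(2) _ x]) (intro ballI ev)
    with P1[OF w] show ?thesis by simp
  qed
  have P3: "P x" if x: "x \<in> frontier \<Omega>" for x
  proof -
    obtain r k e K where "chart_at \<Omega> x r k e K" by (rule lipschitz_open_chart[OF \<Omega>(1) x])
    then have r: "r > 0" and gc: "graph_chart k e K" and ch: "\<Omega> \<inter> ball x r = {y \<in> ball x r. 0 < k y}"
      by (auto simp: chart_at_def)
    interpret graph_chart k e K by (rule gc)
    have chD: "y \<in> \<Omega> \<longleftrightarrow> 0 < k y" if "dist x y < r" for y using ch that by (metis (no_types, lifting) Int_iff mem_Collect_eq mem_ball)
    have "x \<in> frontier \<Omega> \<inter> ball x r" using x r by simp
    then have kx: "k x = 0" unfolding frontier_chart(1)[OF ch] by blast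
    \<comment> \<open>A vertical move by \<open>\<tau>\<close> leads from the boundary point into
      \<open>\<Omega>\<close> and only raises \<open>k\<close>, so segments that start in
      \<open>\<Omega>\<close> near \<open>x\<close> stay in \<open>\<Omega>\<close>.\<close>
    define \<tau> where "\<tau> = r / 4"
    define y where "y = x - \<tau> *\<^sub>R e"
    have "dist x y = \<tau>" using e r by (simp add: y_def dist_norm \<tau>_def)
    moreover have "k y = \<tau>" using shift[of x "- \<tau>"] kx by (simp add: y_def)
    ultimately have "y \<in> \<Omega>" using chD[of y] r by (simp add: \<tau>_def)
    then obtain s0 Q where s0: "s0 > 0" "good (ball y s0) Q" using P2 P_def by blast
    define s where "s = min s0 (r / 2)"
    have s: "s > 0" "s \<le> r / 2" using s0 r by (auto simp: s_def)
    have "good (ball y s) Q" using s0(2) by (rule good_mono) (auto simp: s_def)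
    then have "good (ball x s) (2 * Q + 2 * (norm (x - y))\<^sup>2)"
    proof (rule good_move)
      fix z t assume z: "z \<in> ball x s \<inter> \<Omega>" and t: "0 \<le> (t::real)" "t \<le> 1"
      have eq: "z - t *\<^sub>R (x - y) = z + (- (t * \<tau>)) *\<^sub>R e" by (simp add: y_def)
      have tt: "0 \<le> t * \<tau>" "t * \<tau> \<le> r / 4" using t r mult_right_mono[of t 1 \<tau>] by (auto simp: \<tau>_def)
      have "0 < k z" using z chD[of z] s r by simp
      then have "0 < k (z + (- (t * \<tau>)) *\<^sub>R e)" using tt shift[of z "- (t * \<tau>)"] by simp
      moreover have "dist z (z + (- (t * \<tau>)) *\<^sub>R e) = t * \<tau>" using e tt by (simp add: dist_norm)
      then have "dist x (z + (- (t * \<tau>)) *\<^sub>R e) < r"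
        using dist_triangle[of x "z + (- (t * \<tau>)) *\<^sub>R e" z] z s tt r e by simp
      ultimately show "z - t *\<^sub>R (x - y) \<in> \<Omega>" unfolding eq using chD by blast
    qed
    then show ?thesis using s P_def by blast
  qed
  have "\<forall>x\<in>closure \<Omega>. \<exists>r Q. 0 < r \<and> good (ball x r) Q"
    using P2 P3 closure_Un_frontier[of \<Omega>] unfolding P_def by blast
  then obtain r Q where rQ: "\<forall>x\<in>closure \<Omega>. 0 < r x \<and> good (ball x (r x)) (Q x)" by metis
  have "compact (closure \<Omega>)" using bd by simp
  then obtain F where F: "finite F" "F \<subseteq> closure \<Omega>" "closure \<Omega> \<subseteq> (\<Union>p\<in>F. ball p (r p))"
    by (rule compact_radius_cover[of _ r]) (use rQ in auto)
  have "nsq \<Omega> \<phi> \<le> ennreal (sum Q F) * E \<phi> d\<phi>" if \<phi>: "C1_grad \<phi> d\<phi>" for \<phi> d\<phi>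
  proof -
    note [measurable] = C1_measurable[OF \<phi>]
    have "nsq \<Omega> \<phi> \<le> (\<integral>\<^sup>+x. (\<Sum>p\<in>F. ennreal ((norm (\<phi> x))\<^sup>2) * indicator (ball p (r p) \<inter> \<Omega>) x) \<partial>lborel)"
      unfolding nsq_def
    proof (rule nn_integral_mono)
      fix x
      show "ennreal ((norm (\<phi> x))\<^sup>2) * indicator \<Omega> x \<le> (\<Sum>p\<in>F. ennreal ((norm (\<phi> x))\<^sup>2) * indicator (ball p (r p) \<inter> \<Omega>) x)"
      proof (cases "x \<in> \<Omega>")
        case True
        then obtain p where p: "p \<in> F" "x \<in> ball p (r p)" using F closure_subset by blast
        then have "ennreal ((norm (\<phi> x))\<^sup>2) * indicator \<Omega> x = ennreal ((norm (\<phi> x))\<^sup>2) * indicator (ball p (r p) \<inter> \<Omega>) x"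
          using True by (simp add: indicator_def)
        also have "\<dots> \<le> (\<Sum>p\<in>F. ennreal ((norm (\<phi> x))\<^sup>2) * indicator (ball p (r p) \<inter> \<Omega>) x)"
          using F p by (intro member_le_sum) auto
        finally show ?thesis .
      qed simp
    qed
    also have "\<dots> = (\<Sum>p\<in>F. nsq (ball p (r p) \<inter> \<Omega>) \<phi>)"
      unfolding nsq_def by (intro nn_integral_sum borel_measurable_times_ennreal borel_measurable_indicator) auto
    also have "\<dots> \<le> (\<Sum>p\<in>F. ennreal (Q p) * E \<phi> d\<phi>)"
      using rQ F(2) \<phi> by (intro sum_mono) (auto simp: good_def)
    also have "\<dots> = ennreal (sum Q F) * E \<phi> d\<phi>"
      using rQ F by (subst sum_ennreal[symmetric]) (auto simp: good_def sum_distrib_right)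
    finally show ?thesis .
  qed
  moreover have "sum Q F \<ge> 0" using rQ F by (intro sum_nonneg) (auto simp: good_def)
  ultimately show ?thesis using that unfolding E_def by blast
qed

section \<open>Square-integrable functions and Riesz sequences\<close>

lemma quadratic_nonneg_discriminant:
  fixes a b c :: real
  assumes q: "\<And>s. 0 \<le> a * s\<^sup>2 + 2 * b * s + c" and a: "0 \<le> a"
  shows "b\<^sup>2 \<le> a * c"
proof (cases "a = 0")
  case True
  have "b = 0"
  proof (rule ccontr)
    assume b: "b \<noteq> 0"
    have "2 * b * (- (c + 1) / (2 * b)) = - (c + 1)" using b by simp
    with q[of "- (c + 1) / (2 * b)"] True show False by simp
  qed
  with True show ?thesis by simp
next
  case False
  with a have a: "a > 0" by simp
  have "0 \<le> a * (a * (- b / a)\<^sup>2 + 2 * b * (- b / a) + c)" using q[of "- b / a"] a by (intro mult_nonneg_nonneg) auto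
  also have "\<dots> = a * c - b\<^sup>2" using a by (simp add: field_simps power2_eq_square)
  finally show ?thesis by simp
qed

text \<open>Counterpart of \<open>L2\<close> for Euclidean values, phrased by integrability so that
  the algebra of the Bochner integral applies; \<open>sqint_iff\<close> returns to the extended-real
  form.\<close>

definition sqint :: "'a measure \<Rightarrow> ('a \<Rightarrow> 'b::euclidean_space) \<Rightarrow> bool" where
  "sqint M f \<longleftrightarrow> f \<in> borel_measurable M \<and> integrable M (\<lambda>x. (norm (f x))\<^sup>2)"

text \<open>A Bochner integral, hence 0 when the integrand is not integrable; its smallness has a
  meaning only together with \<open>sqint\<close>.\<close>

abbreviation sqdist :: "'a measure \<Rightarrow> ('a \<Rightarrow> 'b::euclidean_space) \<Rightarrow> ('a \<Rightarrow> 'b) \<Rightarrow> real" where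
  "sqdist M f g \<equiv> (\<integral>x. (norm (f x - g x))\<^sup>2 \<partial>M)"

lemma sqint_iff: "sqint M f \<longleftrightarrow> f \<in> borel_measurable M \<and> (\<integral>\<^sup>+x. ennreal ((norm (f x))\<^sup>2) \<partial>M) < \<infinity>"
  unfolding sqint_def by (auto simp: integrable_iff_bounded)

lemma L2_iff_sqint: "L2 M f \<longleftrightarrow> sqint M f"
  by (simp add: L2_def sqint_iff)

lemma sqint_measurable: "sqint M f \<Longrightarrow> f \<in> borel_measurable M"
  and sqint_integrable: "sqint M f \<Longrightarrow> integrable M (\<lambda>x. (norm (f x))\<^sup>2)"
  by (auto simp: sqint_def)

lemma sqint_nn: "sqint M f \<Longrightarrow> (\<integral>\<^sup>+x. ennreal ((norm (f x))\<^sup>2) \<partial>M) = ennreal (\<integral>x. (norm (f x))\<^sup>2 \<partial>M)"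
  by (intro nn_integral_eq_integral sqint_integrable) auto

lemma norm_add_sq_le: "(norm (a + b))\<^sup>2 \<le> 2 * (norm a)\<^sup>2 + 2 * (norm (b :: 'b::real_inner))\<^sup>2"
  using zero_le_power2[of "norm (a - b)"] unfolding power2_norm_eq_inner
  by (simp add: inner_add_left inner_add_right inner_diff_left inner_diff_right inner_commute)

lemma sqint_scaleR: "sqint M f \<Longrightarrow> sqint M (\<lambda>x. c *\<^sub>R f x)"
  by (auto simp: sqint_def power_mult_distrib)

lemma sqint_add:
  assumes "sqint M f" "sqint M g"
  shows "sqint M (\<lambda>x. f x + g x)"
proof -
  note [measurable] = assms[THEN sqint_measurable]
  have "integrable M (\<lambda>x. 2 * (norm (f x))\<^sup>2 + 2 * (norm (g x))\<^sup>2)"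
    using assms[THEN sqint_integrable] by auto
  then have "integrable M (\<lambda>x. (norm (f x + g x))\<^sup>2)"
    by (rule Bochner_Integration.integrable_bound) (auto intro!: AE_I2 norm_add_sq_le)
  then show ?thesis by (simp add: sqint_def)
qed

lemma sqint_diff: "sqint M f \<Longrightarrow> sqint M g \<Longrightarrow> sqint M (\<lambda>x. f x - g x)"
  using sqint_add[of M f "\<lambda>x. (-1) *\<^sub>R g x"] sqint_scaleR[of M g "-1"] by simp

lemma sqint_bounded_mult:
  assumes f: "sqint M f" and s: "s \<in> borel_measurable M" "AE x in M. \<bar>s x\<bar> \<le> C"
  shows "sqint M (\<lambda>x. s x *\<^sub>R f x)"
proof -
  note [measurable] = s(1) f[THEN sqint_measurable]
  have "integrable M (\<lambda>x. C\<^sup>2 * (norm (f x))\<^sup>2)" using f[THEN sqint_integrable] by auto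
  then have "integrable M (\<lambda>x. (norm (s x *\<^sub>R f x))\<^sup>2)"
  proof (rule Bochner_Integration.integrable_bound)
    show "AE x in M. norm ((norm (s x *\<^sub>R f x))\<^sup>2) \<le> norm (C\<^sup>2 * (norm (f x))\<^sup>2)"
      using s(2)
    proof eventually_elim
      case (elim x)
      then have "(s x)\<^sup>2 \<le> C\<^sup>2" by (metis abs_ge_zero power2_abs power_mono)
      then show ?case by (simp add: power_mult_distrib mult_right_mono)
    qed
  qed measurable
  then show ?thesis by (simp add: sqint_def)
qed

lemma sqint_inner:
  assumes "sqint M f" "sqint M g"
  shows "integrable M (\<lambda>x. f x \<bullet> g x)"
proof -
  note [measurable] = assms[THEN sqint_measurable]
  have "integrable M (\<lambda>x. (norm (f x))\<^sup>2 + (norm (g x))\<^sup>2)"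
    using assms[THEN sqint_integrable] by auto
  then show ?thesis
  proof (rule Bochner_Integration.integrable_bound)
    show "AE x in M. norm (f x \<bullet> g x) \<le> norm ((norm (f x))\<^sup>2 + (norm (g x))\<^sup>2)"
    proof (rule AE_I2)
      fix x
      have "2 * (norm (f x) * norm (g x)) \<le> (norm (f x))\<^sup>2 + (norm (g x))\<^sup>2"
        using sum_squares_bound[of "norm (f x)" "norm (g x)"] by simp
      moreover have "0 \<le> norm (f x) * norm (g x)" by simp
      ultimately show "norm (f x \<bullet> g x) \<le> norm ((norm (f x))\<^sup>2 + (norm (g x))\<^sup>2)"
        using Cauchy_Schwarz_ineq2[of "f x" "g x"] by simp
    qed
  qed measurable
qed

lemma norm_add_scaleR_sq:
  "(norm (a + s *\<^sub>R b))\<^sup>2 = (norm a)\<^sup>2 + (s\<^sup>2 * (norm b)\<^sup>2 + (2 * s) * (a \<bullet> (b :: 'b::real_inner)))"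
  unfolding power2_norm_eq_inner
  by (simp add: inner_add_left inner_add_right inner_commute power2_eq_square algebra_simps)

lemma sqint_Cauchy_Schwarz:
  assumes f: "sqint M f" and g: "sqint M g"
  shows "(\<integral>x. f x \<bullet> g x \<partial>M)\<^sup>2 \<le> (\<integral>x. (norm (g x))\<^sup>2 \<partial>M) * (\<integral>x. (norm (f x))\<^sup>2 \<partial>M)"
proof (rule quadratic_nonneg_discriminant)
  fix s :: real
  note int = sqint_integrable[OF f] sqint_integrable[OF g] sqint_inner[OF f g]
  have "0 \<le> (\<integral>x. (norm (f x + s *\<^sub>R g x))\<^sup>2 \<partial>M)" by (intro integral_nonneg_AE) auto
  also have "\<dots> = (\<integral>x. (norm (f x))\<^sup>2 + (s\<^sup>2 * (norm (g x))\<^sup>2 + (2 * s) * (f x \<bullet> g x)) \<partial>M)"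
    by (simp only: norm_add_scaleR_sq)
  also have "\<dots> = (\<integral>x. (norm (f x))\<^sup>2 \<partial>M) + (s\<^sup>2 * (\<integral>x. (norm (g x))\<^sup>2 \<partial>M) + (2 * s) * (\<integral>x. f x \<bullet> g x \<partial>M))"
    using int by simp
  finally show "0 \<le> (\<integral>x. (norm (g x))\<^sup>2 \<partial>M) * s\<^sup>2 + 2 * (\<integral>x. f x \<bullet> g x \<partial>M) * s + (\<integral>x. (norm (f x))\<^sup>2 \<partial>M)"
    by (simp add: algebra_simps)
qed (auto intro!: integral_nonneg_AE)

lemma sqdist_inner_tendsto:
  assumes f: "\<And>n. sqint M (f n)" "sqint M h" and g: "sqint M g" and lim: "(\<lambda>n. sqdist M (f n) h) \<longlonglongrightarrow> 0"
  shows "(\<lambda>n. \<integral>x. f n x \<bullet> g x \<partial>M) \<longlonglongrightarrow> (\<integral>x. h x \<bullet> g x \<partial>M)"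
proof -
  have "(\<lambda>n. ((\<integral>x. f n x \<bullet> g x \<partial>M) - (\<integral>x. h x \<bullet> g x \<partial>M))\<^sup>2) \<longlonglongrightarrow> 0"
  proof (rule tendsto_sandwich[OF _ _ tendsto_const])
    show "(\<lambda>n. (\<integral>x. (norm (g x))\<^sup>2 \<partial>M) * sqdist M (f n) h) \<longlonglongrightarrow> 0"
      using tendsto_mult[OF tendsto_const lim] by simp
    show "\<forall>\<^sub>F n in sequentially. ((\<integral>x. f n x \<bullet> g x \<partial>M) - (\<integral>x. h x \<bullet> g x \<partial>M))\<^sup>2 \<le> (\<integral>x. (norm (g x))\<^sup>2 \<partial>M) * sqdist M (f n) h"
    proof (intro always_eventually allI)
      fix n
      have "(\<integral>x. f n x \<bullet> g x \<partial>M) - (\<integral>x. h x \<bullet> g x \<partial>M) = (\<integral>x. (f n x - h x) \<bullet> g x \<partial>M)"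
        unfolding inner_diff_left by (intro Bochner_Integration.integral_diff[symmetric] sqint_inner f g)
      then show "((\<integral>x. f n x \<bullet> g x \<partial>M) - (\<integral>x. h x \<bullet> g x \<partial>M))\<^sup>2 \<le> (\<integral>x. (norm (g x))\<^sup>2 \<partial>M) * sqdist M (f n) h"
        using sqint_Cauchy_Schwarz[OF sqint_diff[OF f(1)[of n] f(2)] g] by simp
    qed
  qed auto
  from tendsto_real_sqrt[OF this] have "(\<lambda>n. (\<integral>x. f n x \<bullet> g x \<partial>M) - (\<integral>x. h x \<bullet> g x \<partial>M)) \<longlonglongrightarrow> 0"
    by (simp add: tendsto_rabs_zero_iff)
  then show ?thesis by (rule LIM_zero_cancel)
qed

lemma sqdist_triangle:
  assumes "sqint M f" "sqint M g" "sqint M h"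
  shows "sqdist M f h \<le> 2 * sqdist M f g + 2 * sqdist M g h"
proof -
  have i: "integrable M (\<lambda>x. (norm (f x - h x))\<^sup>2)" "integrable M (\<lambda>x. 2 * (norm (f x - g x))\<^sup>2)" "integrable M (\<lambda>x. 2 * (norm (g x - h x))\<^sup>2)"
    using sqint_integrable[OF sqint_diff] assms by auto
  have "sqdist M f h \<le> (\<integral>x. 2 * (norm (f x - g x))\<^sup>2 + 2 * (norm (g x - h x))\<^sup>2 \<partial>M)"
  proof (intro integral_mono Bochner_Integration.integrable_add i)
    show "(norm (f x - h x))\<^sup>2 \<le> 2 * (norm (f x - g x))\<^sup>2 + 2 * (norm (g x - h x))\<^sup>2" for x
      using norm_add_sq_le[of "f x - g x" "g x - h x"] by simp
  qed
  also have "\<dots> = 2 * sqdist M f g + 2 * sqdist M g h" using i by simp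
  finally show ?thesis .
qed

text \<open>The Riesz-Fischer theorem: a rapidly convergent subsequence converges almost everywhere,
  and Fatou's lemma turns this into convergence of the whole sequence in mean square.\<close>

lemma L2_complete:
  fixes f :: "nat \<Rightarrow> 'a \<Rightarrow> 'b::euclidean_space"
  assumes f: "\<And>n. sqint M (f n)"
    and Cauchy: "\<And>\<epsilon>. \<epsilon> > 0 \<Longrightarrow> \<exists>N. \<forall>m\<ge>N. \<forall>n\<ge>N. sqdist M (f m) (f n) < \<epsilon>"
  obtains g where "sqint M g" "(\<lambda>n. sqdist M (f n) g) \<longlonglongrightarrow> 0"
proof -
  note [measurable] = f[THEN sqint_measurable]
  have "\<forall>j. \<exists>N. \<forall>m\<ge>N. \<forall>n\<ge>N. sqdist M (f m) (f n) < (1/4)^j" for j :: nat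
    using Cauchy by simp
  then obtain N where N: "\<And>j m n. m \<ge> N j \<Longrightarrow> n \<ge> N j \<Longrightarrow> sqdist M (f m) (f n) < (1/4)^j" by metis
  \<comment> \<open>The maximum puts \<open>k j\<close> beyond all thresholds up to index
    \<open>j\<close>, so both \<open>k j\<close> and \<open>k (Suc j)\<close> are beyond
    \<open>N j\<close> and consecutive members differ by less than \<open>(1/4)^j\<close>.\<close>
  define k where "k j = j + Max (N ` {..j})" for j
  have kN: "k j \<ge> N i" if "i \<le> j" for i j using that by (auto simp: k_def intro!: trans_le_add2 Max_ge)
  have kj: "k j \<ge> j" for j by (simp add: k_def)
  define D where "D j x = f (k (Suc j)) x - f (k j) x" for j x
  have D[measurable]: "D j \<in> borel_measurable M" for j unfolding D_def by measurable
  have sqD: "sqint M (D j)" for j unfolding D_def by (intro sqint_diff f)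
  have D4: "(\<integral>x. (norm (D j x))\<^sup>2 \<partial>M) \<le> (1/4)^j" for j
    unfolding D_def using N[OF kN kN, of j "Suc j" j] by (simp add: less_imp_le)
  \<comment> \<open>The weight \<open>2^j\<close> still leaves a summable series, and finiteness of
    the weighted sum forces geometric decay of \<open>norm (D j x)\<close> at almost every
    point.\<close>
  have "(\<integral>\<^sup>+x. (\<Sum>j. ennreal (2^j * (norm (D j x))\<^sup>2)) \<partial>M) = (\<Sum>j. \<integral>\<^sup>+x. ennreal (2^j * (norm (D j x))\<^sup>2) \<partial>M)"
    by (intro nn_integral_suminf) measurable
  also have "\<dots> \<le> (\<Sum>j. ennreal ((1/2)^j))"
  proof (intro suminf_le)
    fix j
    have "(\<integral>\<^sup>+x. ennreal (2^j * (norm (D j x))\<^sup>2) \<partial>M) = ennreal (2^j) * (\<integral>\<^sup>+x. ennreal ((norm (D j x))\<^sup>2) \<partial>M)"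
      by (subst nn_integral_cmult[symmetric]) (auto simp: ennreal_mult)
    also have "\<dots> = ennreal (2^j * (\<integral>x. (norm (D j x))\<^sup>2 \<partial>M))" by (simp add: sqint_nn[OF sqD] ennreal_mult)
    also have "\<dots> \<le> ennreal (2^j * (1/4)^j)" using D4[of j] by (intro ennreal_leI mult_left_mono) auto
    also have "(2::real)^j * (1/4)^j = (1/2)^j" by (simp flip: power_mult_distrib)
    finally show "(\<integral>\<^sup>+x. ennreal (2^j * (norm (D j x))\<^sup>2) \<partial>M) \<le> ennreal ((1/2)^j)" .
  qed auto
  also have "\<dots> < \<infinity>" by (subst suminf_ennreal2) (auto intro!: summable_geometric)
  finally have "AE x in M. (\<Sum>j. ennreal (2^j * (norm (D j x))\<^sup>2)) \<noteq> \<infinity>"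
    by (intro nn_integral_PInf_AE) auto
  then have conv: "AE x in M. convergent (\<lambda>j. f (k j) x)"
  proof eventually_elim
    case (elim x)
    then have "summable (\<lambda>j. 2^j * (norm (D j x))\<^sup>2)" by (intro summable_suminf_not_top) auto
    then have "Bseq (\<lambda>j. 2^j * (norm (D j x))\<^sup>2)" by (intro convergent_imp_Bseq summable_LIMSEQ_zero[THEN convergentI])
    then obtain B where B: "B > 0" "\<And>j. norm (2^j * (norm (D j x))\<^sup>2) \<le> B" by (auto elim: BseqE)
    have nb: "norm (D j x) \<le> sqrt B * (sqrt (1/2))^j" for j
    proof (rule power2_le_imp_le)
      have "(norm (D j x))\<^sup>2 = (1/2)^j * (2^j * (norm (D j x))\<^sup>2)" by (simp flip: power_mult_distrib mult.assoc)
      also have "\<dots> \<le> (1/2)^j * B" using B(2)[of j] by (intro mult_left_mono) auto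
      also have "\<dots> = (sqrt B * (sqrt (1/2))^j)\<^sup>2"
      proof -
        have "((sqrt (1/2))^j)\<^sup>2 = ((sqrt (1/2))\<^sup>2)^j" by (simp only: power_mult[symmetric] mult.commute)
        then have "((sqrt (1/2))^j)\<^sup>2 = (1/2)^j" by simp
        then show ?thesis using B(1) by (simp add: power_mult_distrib)
      qed
      finally show "(norm (D j x))\<^sup>2 \<le> (sqrt B * (sqrt (1/2))^j)\<^sup>2" .
    qed (use B in simp)
    have "sqrt (1/2) < 1" by simp
    then have sm: "summable (\<lambda>j. sqrt B * (sqrt (1/2))^j)" by (intro summable_mult summable_geometric) simp
    have "summable (\<lambda>j. D j x)" by (rule summable_comparison_test'[OF sm, of 0]) (rule nb)
    then have "convergent (\<lambda>n. \<Sum>j<n. D j x)" by (simp add: summable_iff_convergent)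
    moreover have "(\<Sum>j<n. D j x) = f (k n) x - f (k 0) x" for n
      unfolding D_def by (rule sum_lessThan_telescope)
    ultimately have "convergent (\<lambda>n. (f (k n) x - f (k 0) x) + f (k 0) x)"
      by (intro convergent_add) (auto simp: convergent_const)
    then show ?case by simp
  qed
  \<comment> \<open>On the null set of divergence \<open>lim\<close> has an unspecified value;
    \<open>g\<close> is measurable all the same.\<close>
  define g where "g x = lim (\<lambda>j. f (k j) x)" for x
  have g[measurable]: "g \<in> borel_measurable M" unfolding g_def by measurable
  have lim: "AE x in M. (\<lambda>j. f (k j) x) \<longlonglongrightarrow> g x"
    using conv by eventually_elim (simp add: g_def convergent_LIMSEQ_iff)
  have fatou: "(\<integral>\<^sup>+x. ennreal ((norm (f m x - g x))\<^sup>2) \<partial>M) \<le> ennreal \<epsilon>"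
    if \<epsilon>: "\<epsilon> > 0" and n: "\<And>i. i \<ge> n \<Longrightarrow> sqdist M (f m) (f i) < \<epsilon>" for m n \<epsilon>
  proof -
    have "(\<integral>\<^sup>+x. ennreal ((norm (f m x - g x))\<^sup>2) \<partial>M) = (\<integral>\<^sup>+x. liminf (\<lambda>j. ennreal ((norm (f m x - f (k j) x))\<^sup>2)) \<partial>M)"
    proof (rule nn_integral_cong_AE)
      show "AE x in M. ennreal ((norm (f m x - g x))\<^sup>2) = liminf (\<lambda>j. ennreal ((norm (f m x - f (k j) x))\<^sup>2))"
        using lim
      proof eventually_elim
        case (elim x)
        then have "(\<lambda>j. ennreal ((norm (f m x - f (k j) x))\<^sup>2)) \<longlonglongrightarrow> ennreal ((norm (f m x - g x))\<^sup>2)"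
          by (intro tendsto_intros)
        then show ?case by (rule lim_imp_Liminf[OF sequentially_bot, symmetric])
      qed
    qed
    also have "\<dots> \<le> liminf (\<lambda>j. \<integral>\<^sup>+x. ennreal ((norm (f m x - f (k j) x))\<^sup>2) \<partial>M)"
      by (intro nn_integral_liminf) measurable
    also have "\<dots> \<le> ennreal \<epsilon>"
    proof (rule Liminf_le)
      show "\<forall>\<^sub>F j in sequentially. (\<integral>\<^sup>+x. ennreal ((norm (f m x - f (k j) x))\<^sup>2) \<partial>M) \<le> ennreal \<epsilon>"
        using eventually_ge_at_top[of n]
      proof eventually_elim
        case (elim j)
        then have "sqdist M (f m) (f (k j)) < \<epsilon>" using n[of "k j"] kj[of j] by simp
        then show ?case by (simp add: sqint_nn[OF sqint_diff[OF f f]] ennreal_leI)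
      qed
    qed simp
    finally show ?thesis .
  qed
  obtain n1 where n1: "\<And>m n. m \<ge> n1 \<Longrightarrow> n \<ge> n1 \<Longrightarrow> sqdist M (f m) (f n) < 1" using Cauchy[of 1] by auto
  have "(\<integral>\<^sup>+x. ennreal ((norm (f n1 x - g x))\<^sup>2) \<partial>M) \<le> ennreal 1" by (rule fatou[of 1 n1]) (use n1 in auto)
  also have "\<dots> < \<infinity>" by simp
  finally have "sqint M (\<lambda>x. f n1 x - g x)" by (simp add: sqint_iff)
  from sqint_diff[OF f[of n1] this] have sg: "sqint M g" by simp
  moreover have "(\<lambda>n. sqdist M (f n) g) \<longlonglongrightarrow> 0"
  proof (rule LIMSEQ_I)
    fix r :: real assume r: "0 < r"
    then obtain n0 where n0: "\<And>m n. m \<ge> n0 \<Longrightarrow> n \<ge> n0 \<Longrightarrow> sqdist M (f m) (f n) < r/2" using Cauchy[of "r/2"] by auto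
    show "\<exists>no. \<forall>n\<ge>no. norm (sqdist M (f n) g - 0) < r"
    proof (intro exI allI impI)
      fix n assume n: "n \<ge> n0"
      have "(\<integral>\<^sup>+x. ennreal ((norm (f n x - g x))\<^sup>2) \<partial>M) \<le> ennreal (r/2)" by (rule fatou[of "r/2" n0]) (use n0 n r in auto)
      then have "sqdist M (f n) g \<le> r/2" using r by (simp add: sqint_nn[OF sqint_diff[OF f sg]])
      moreover have "0 \<le> sqdist M (f n) g" by (intro integral_nonneg_AE) auto
      ultimately show "norm (sqdist M (f n) g - 0) < r" using r by simp
    qed
  qed
  ultimately show ?thesis using that by blast
qed

text \<open>The form may be degenerate, so functions are used directly, without classes modulo null
  sets. The two instances are \<open>C1\<close> with the energy and the traces of solutions with the
  \<open>L^2\<close> product on the interface.\<close>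

locale semi_inner =
  fixes U :: "('a \<Rightarrow> real) set" and B :: "('a \<Rightarrow> real) \<Rightarrow> ('a \<Rightarrow> real) \<Rightarrow> real"
  assumes nonempty: "U \<noteq> {}"
    and lin_closed: "\<And>f g c. f \<in> U \<Longrightarrow> g \<in> U \<Longrightarrow> (\<lambda>x. f x + c * g x) \<in> U"
    and B_lin: "\<And>f g h c. f \<in> U \<Longrightarrow> g \<in> U \<Longrightarrow> h \<in> U \<Longrightarrow> B (\<lambda>x. f x + c * g x) h = B f h + c * B g h"
    and B_sym: "\<And>f g. f \<in> U \<Longrightarrow> g \<in> U \<Longrightarrow> B f g = B g f"
    and B_nonneg: "\<And>f. f \<in> U \<Longrightarrow> 0 \<le> B f f"
begin

text \<open>The Riesz representation theorem without completeness: the representing vector is replaced by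
  a minimizing sequence of the quadratic functional \<open>B f f - 2 * l f\<close>.\<close>

lemma riesz_sequence:
  assumes l: "\<And>f g c. f \<in> U \<Longrightarrow> g \<in> U \<Longrightarrow> l (\<lambda>x. f x + c * g x) = l f + c * l g"
    and bound: "\<And>f. f \<in> U \<Longrightarrow> (l f)\<^sup>2 \<le> C * B f f"
  obtains u \<delta> where "\<And>n. u n \<in> U" "\<delta> \<longlonglongrightarrow> (0::real)"
    "\<And>n f. f \<in> U \<Longrightarrow> (B (u n) f - l f)\<^sup>2 \<le> \<delta> n * B f f"
proof -
  define J where "J f = B f f - 2 * l f" for f
  have bdd: "bdd_below (J ` U)"
  proof (rule bdd_belowI2)
    fix f assume f: "f \<in> U"
    define b where "b = B f f"
    have b: "0 \<le> b" "(l f)\<^sup>2 \<le> C * b" using B_nonneg[OF f] bound[OF f] by (auto simp: b_def)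
    \<comment> \<open>By \<open>bound\<close>, the size of \<open>l f\<close> is at most the
      geometric mean of \<open>b\<close> and \<open>\<bar>C\<bar>\<close>, so
      \<open>2 * l f \<le> b + \<bar>C\<bar>\<close>.\<close>
    show "- \<bar>C\<bar> \<le> J f"
    proof (rule ccontr)
      assume "\<not> ?thesis"
      then have "b + \<bar>C\<bar> < 2 * l f" by (simp add: J_def b_def)
      moreover have "0 \<le> b + \<bar>C\<bar>" using b by simp
      ultimately have "(b + \<bar>C\<bar>)\<^sup>2 < (2 * l f)\<^sup>2" by (intro power_strict_mono) auto
      also have "\<dots> \<le> 4 * (C * b)" using b by (simp add: power_mult_distrib)
      also have "\<dots> \<le> 4 * (\<bar>C\<bar> * b)" using b by (simp add: mult_right_mono)
      also have "\<dots> \<le> (b + \<bar>C\<bar>)\<^sup>2" using zero_le_power2[of "b - \<bar>C\<bar>"] by (simp add: power2_eq_square algebra_simps)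
      finally show False by simp
    qed
  qed
  define I where "I = Inf (J ` U)"
  have I: "I \<le> J f" if "f \<in> U" for f unfolding I_def using bdd that by (intro cInf_lower) auto
  define \<delta> where "\<delta> n = inverse (real (Suc n))" for n
  have "\<exists>f\<in>U. J f < I + \<delta> n" for n
  proof -
    have "I < I + \<delta> n" by (simp add: \<delta>_def)
    then show ?thesis using nonempty cInf_lessD[of "J ` U" "I + \<delta> n"] unfolding I_def by auto
  qed
  then obtain u where u: "\<And>n. u n \<in> U" "\<And>n. J (u n) < I + \<delta> n" by metis
  have "(B (u n) f - l f)\<^sup>2 \<le> B f f * \<delta> n" if f: "f \<in> U" for n f
  \<comment> \<open>Near-minimality of \<open>u n\<close> makes the quadratic polynomial
    \<open>J ?v - J (u n) + \<delta> n\<close> in \<open>s\<close> nonnegative; its discriminant is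
    the claimed estimate.\<close>
  proof (rule quadratic_nonneg_discriminant)
    fix s
    let ?v = "\<lambda>x. u n x + s * f x"
    have v: "?v \<in> U" by (intro lin_closed u f)
    have "B ?v ?v = B (u n) ?v + s * B f ?v" by (intro B_lin u f v)
    also have "B (u n) ?v = B (u n) (u n) + s * B f (u n)" using B_sym[OF u(1) v] B_lin[OF u(1) f u(1)] by simp
    also have "B f ?v = B (u n) f + s * B f f" using B_sym[OF f v] B_lin[OF u(1) f f] by simp
    finally have "J ?v = J (u n) + 2 * s * (B (u n) f - l f) + s\<^sup>2 * B f f"
      using B_sym[OF f u(1)] l[OF u(1) f] by (simp add: J_def power2_eq_square algebra_simps)
    with I[OF v] u(2)[of n] show "0 \<le> B f f * s\<^sup>2 + 2 * (B (u n) f - l f) * s + \<delta> n" by (simp add: algebra_simps)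
  qed (rule B_nonneg[OF f])
  moreover have "\<delta> \<longlonglongrightarrow> 0" unfolding \<delta>_def by (rule LIMSEQ_inverse_real_of_nat)
  ultimately show ?thesis using u(1) that[of u \<delta>] by (simp add: mult.commute)
qed

text \<open>The residual estimate is tested with the difference \<open>w\<close> of two members:
  \<open>B w w\<close> is itself a difference of two residuals at \<open>w\<close>, so its square is
  at most a multiple of \<open>(\<delta> m + \<delta> n) * B w w\<close>.\<close>

lemma riesz_sequence_Cauchy:
  assumes u: "\<And>n. u n \<in> U" and \<delta>: "\<delta> \<longlonglongrightarrow> (0::real)"
    and r: "\<And>n f. f \<in> U \<Longrightarrow> (B (u n) f - l f)\<^sup>2 \<le> \<delta> n * B f f" and \<epsilon>: "0 < \<epsilon>"
  shows "\<exists>N. \<forall>m\<ge>N. \<forall>n\<ge>N. B (\<lambda>x. u m x - u n x) (\<lambda>x. u m x - u n x) < \<epsilon>"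
proof -
  have "\<forall>\<^sub>F n in sequentially. \<delta> n < \<epsilon> / 4" using \<delta> \<epsilon> by (intro order_tendstoD(2)) auto
  then obtain N where N: "\<And>n. n \<ge> N \<Longrightarrow> \<delta> n < \<epsilon> / 4" by (auto simp: eventually_sequentially)
  have "B (\<lambda>x. u m x - u n x) (\<lambda>x. u m x - u n x) < \<epsilon>" if mn: "m \<ge> N" "n \<ge> N" for m n
  proof -
    define w where "w = (\<lambda>x. u m x - u n x)"
    have w: "w \<in> U" using lin_closed[OF u[of m] u[of n], of "-1"] by (simp add: w_def)
    define q where "q = B w w"
    have q0: "0 \<le> q" using B_nonneg[OF w] by (simp add: q_def)
    have "q = B (u m) w - B (u n) w" using B_lin[OF u[of m] u[of n] w, of "-1"] by (simp add: q_def w_def)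
    then have "q = (B (u m) w - l w) - (B (u n) w - l w)" by simp
    moreover have "(a - b)\<^sup>2 \<le> 2 * a\<^sup>2 + 2 * b\<^sup>2" for a b :: real
      using zero_le_power2[of "a + b"] by (simp add: power2_eq_square algebra_simps)
    ultimately have "q\<^sup>2 \<le> 2 * (B (u m) w - l w)\<^sup>2 + 2 * (B (u n) w - l w)\<^sup>2"
      by metis
    also have "\<dots> \<le> 2 * (\<delta> m * q) + 2 * (\<delta> n * q)" unfolding q_def using r[OF w] by (intro add_mono mult_left_mono) auto
    finally have "q * q \<le> (2 * (\<delta> m + \<delta> n)) * q" by (simp add: power2_eq_square algebra_simps)
    then have "q \<le> 2 * (\<delta> m + \<delta> n) \<or> q = 0" using q0 by (metis mult_le_cancel_right order_le_less)
    then show ?thesis using N[OF mn(1)] N[OF mn(2)] \<epsilon> unfolding q_def w_def by auto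
  qed
  then show ?thesis by blast
qed

end

section \<open>Test functions\<close>

lemma C1_add:
  assumes \<phi>: "C1_grad \<phi> d\<phi>" and \<psi>: "C1_grad \<psi> d\<psi>"
  shows "C1_grad (\<lambda>x. \<phi> x + \<psi> x) (\<lambda>x. d\<phi> x + d\<psi> x)"
  unfolding C1_grad_def
proof (intro conjI allI)
  fix x
  show "((\<lambda>x. \<phi> x + \<psi> x) has_derivative (\<lambda>h. (d\<phi> x + d\<psi> x) \<bullet> h)) (at x)"
    by (rule has_derivative_eq_rhs[OF has_derivative_add[OF C1_has_derivative[OF \<phi>] C1_has_derivative[OF \<psi>]]])
      (simp add: fun_eq_iff inner_add_left)
qed (intro continuous_intros C1_continuous_grad[OF \<phi>] C1_continuous_grad[OF \<psi>])

lemma C1_mult: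
  assumes \<phi>: "C1_grad \<phi> d\<phi>" and \<psi>: "C1_grad \<psi> d\<psi>"
  shows "C1_grad (\<lambda>x. \<phi> x * \<psi> x) (\<lambda>x. \<phi> x *\<^sub>R d\<psi> x + \<psi> x *\<^sub>R d\<phi> x)"
  unfolding C1_grad_def
proof (intro conjI allI)
  fix x
  show "((\<lambda>x. \<phi> x * \<psi> x) has_derivative (\<lambda>h. (\<phi> x *\<^sub>R d\<psi> x + \<psi> x *\<^sub>R d\<phi> x) \<bullet> h)) (at x)"
    by (rule has_derivative_eq_rhs[OF has_derivative_mult[OF C1_has_derivative[OF \<phi>] C1_has_derivative[OF \<psi>]]])
      (simp add: fun_eq_iff inner_add_left)
qed (intro continuous_intros C1_continuous[OF \<phi>] C1_continuous[OF \<psi>] C1_continuous_grad[OF \<phi>] C1_continuous_grad[OF \<psi>])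

lemma C1_compose:
  assumes \<phi>: "C1_grad \<phi> d\<phi>" and F: "\<And>x. (F has_real_derivative F' (\<phi> x)) (at (\<phi> x))"
    and F': "continuous_on UNIV (\<lambda>x. F' (\<phi> x))"
  shows "C1_grad (\<lambda>x. F (\<phi> x)) (\<lambda>x. F' (\<phi> x) *\<^sub>R d\<phi> x)"
  unfolding C1_grad_def
proof (intro conjI allI)
  fix x
  show "((\<lambda>x. F (\<phi> x)) has_derivative (\<lambda>h. (F' (\<phi> x) *\<^sub>R d\<phi> x) \<bullet> h)) (at x)"
    using has_derivative_compose[OF C1_has_derivative[OF \<phi>] F[unfolded has_field_derivative_def]]
    by simp
qed (intro continuous_intros F' C1_continuous_grad[OF \<phi>])

lemma C1_sum:
  assumes "\<And>j. j \<in> J \<Longrightarrow> C1_grad (\<phi> j) (d\<phi> j)"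
  shows "C1_grad (\<lambda>x. \<Sum>j\<in>J. \<phi> j x) (\<lambda>x. \<Sum>j\<in>J. d\<phi> j x)"
  using assms by (induction J rule: infinite_finite_induct) (auto intro: C1_const C1_add)

lemma C1_inner: "C1_grad (\<lambda>x. x \<bullet> v) (\<lambda>_. v)"
  unfolding C1_grad_def by (auto intro!: derivative_eq_intros simp: inner_commute)

lemma C1_norm_sq: "C1_grad (\<lambda>x. (norm (x - c))\<^sup>2) (\<lambda>x. 2 *\<^sub>R (x - c))"
  unfolding C1_grad_def power2_norm_eq_inner
  by (auto intro!: derivative_eq_intros continuous_intros simp: inner_commute)

text \<open>Building block of all cutoffs: \<open>C1_grad\<close> asks for one continuous derivative
  only, so squared positive parts do the work of the usual smooth bumps.\<close>

lemma max0_sq_derivative: "((\<lambda>t. (max 0 t)\<^sup>2) has_real_derivative 2 * max 0 t) (at t)"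
proof -
  consider "t > 0" | "t < 0" | "t = 0" by linarith
  then show ?thesis
  proof cases
    case 1
    have d: "((\<lambda>t. t\<^sup>2) has_real_derivative 2 * max 0 t) (at t)" using 1 by (auto intro!: derivative_eq_intros)
    have ev: "\<forall>\<^sub>F s in nhds t. s\<^sup>2 = (max 0 s)\<^sup>2"
      using eventually_nhds_in_open[of "{0<..}" t] 1 by (auto elim!: eventually_mono)
    show ?thesis by (rule iffD1[OF DERIV_cong_ev[OF refl ev refl] d])
  next
    case 2
    have d: "((\<lambda>t. 0) has_real_derivative 2 * max 0 t) (at t)" using 2 by (auto intro!: derivative_eq_intros)
    have ev: "\<forall>\<^sub>F s in nhds t. 0 = (max 0 s)\<^sup>2"
      using eventually_nhds_in_open[of "{..<0}" t] 2 by (auto elim!: eventually_mono)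
    show ?thesis by (rule iffD1[OF DERIV_cong_ev[OF refl ev refl] d])
  next
    case 3
    have "((\<lambda>h::real. (max 0 h)\<^sup>2 / h) \<longlongrightarrow> 0) (at 0)"
    proof (rule Lim_null_comparison)
      show "\<forall>\<^sub>F h in at 0. norm ((max 0 h)\<^sup>2 / h) \<le> \<bar>h\<bar>"
        by (auto simp: max_def power2_eq_square eventually_at_filter)
      show "((\<lambda>h::real. \<bar>h\<bar>) \<longlongrightarrow> 0) (at 0)" by (rule tendsto_rabs_zero) simp
    qed
    then show ?thesis using 3 by (simp add: DERIV_def)
  qed
qed

section \<open>Bump functions, approximation of open sets and the fundamental lemma\<close>

definition bump :: "'a::euclidean_space \<Rightarrow> real \<Rightarrow> 'a \<Rightarrow> real" where
  "bump c r x = (max 0 (r\<^sup>2 - (norm (x - c))\<^sup>2))\<^sup>2"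

lemma C1_bump:
  obtains db where "C1_grad (bump c r) db"
proof -
  have 1: "C1_grad (\<lambda>x. r\<^sup>2 + (- 1) * (norm (x - c))\<^sup>2) (\<lambda>x. 0 + ((- 1) *\<^sub>R (2 *\<^sub>R (x - c)) + (norm (x - c))\<^sup>2 *\<^sub>R 0))"
    by (intro C1_add C1_mult C1_const C1_norm_sq)
  have "C1_grad (\<lambda>x. (max 0 (r\<^sup>2 + (- 1) * (norm (x - c))\<^sup>2))\<^sup>2)
      (\<lambda>x. (2 * max 0 (r\<^sup>2 + (- 1) * (norm (x - c))\<^sup>2)) *\<^sub>R (0 + ((- 1) *\<^sub>R (2 *\<^sub>R (x - c)) + (norm (x - c))\<^sup>2 *\<^sub>R 0)))"
    by (rule C1_compose[OF 1 max0_sq_derivative]) (intro continuous_intros)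
  then show ?thesis using that by (simp add: bump_def[abs_def])
qed

lemma bump_nonneg: "0 \<le> bump c r x"
  by (simp add: bump_def)

lemma bump_pos_iff: "0 \<le> r \<Longrightarrow> bump c r x \<noteq> 0 \<longleftrightarrow> x \<in> ball c r"
  using abs_square_less_1 power2_less_imp_less[of "norm (x - c)" r] power_strict_mono[of "norm (x - c)" r 2]
  by (auto simp: bump_def max_def dist_norm norm_minus_commute)

text \<open>By Lindelof \<open>W\<close> is a countable union of balls whose closures lie in
  \<open>W\<close>. The finite sums \<open>q k\<close> of their bumps have compact support in
  \<open>W\<close>, and \<open>real k * q k x / (1 + real k * q k x)\<close> pushes every positive
  value to 1.\<close>

lemma open_indicator_test_funs:
  fixes W :: "'a::euclidean_space set"
  assumes W: "open W"
  obtains \<phi> d\<phi> where "\<And>k::nat. test_fun W (\<phi> k) (d\<phi> k)" "\<And>k x. 0 \<le> \<phi> k x \<and> \<phi> k x \<le> 1"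
    "\<And>x. (\<lambda>k. \<phi> k x) \<longlonglongrightarrow> indicator W x"
proof (cases "W = {}")
  case True
  have "test_fun W (\<lambda>_. 0) (\<lambda>_. 0)" using C1_const[of 0] by (simp add: test_fun_def)
  then show ?thesis using that[of "\<lambda>_ _. 0" "\<lambda>_ _. 0"] True by simp
next
  case False
  define \<F> where "\<F> = (\<lambda>(c, r). ball c r) ` {(c, r). 0 < r \<and> cball c r \<subseteq> W}"
  have "\<Union>\<F> = W"
  proof
    show "\<Union>\<F> \<subseteq> W" using ball_subset_cball by (fastforce simp: \<F>_def)
    show "W \<subseteq> \<Union>\<F>"
    proof
      fix x assume "x \<in> W"
      then obtain r where "r > 0" "cball x r \<subseteq> W" using W open_contains_cball by blast
      then have "ball x r \<in> \<F>" unfolding \<F>_def by (intro image_eqI[of _ _ "(x, r)"]) auto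
      then show "x \<in> \<Union>\<F>" using \<open>r > 0\<close> by (intro UnionI[of "ball x r"]) auto
    qed
  qed
  moreover obtain \<F>' where \<F>': "\<F>' \<subseteq> \<F>" "countable \<F>'" "\<Union>\<F>' = \<Union>\<F>"
    by (rule Lindelof[of \<F>]) (auto simp: \<F>_def)
  ultimately have un: "\<Union>\<F>' = W" by simp
  then have ne: "\<F>' \<noteq> {}" using False by auto
  have "\<forall>j. \<exists>p. 0 < snd p \<and> cball (fst p) (snd p) \<subseteq> W \<and> from_nat_into \<F>' j = ball (fst p) (snd p)"
  proof
    fix j
    have "from_nat_into \<F>' j \<in> \<F>" using from_nat_into[OF ne] \<F>'(1) by blast
    then obtain a where "a \<in> {(c, r). 0 < r \<and> cball c r \<subseteq> W}" "from_nat_into \<F>' j = (\<lambda>(c, r). ball c r) a"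
      unfolding \<F>_def by (rule imageE)
    then show "\<exists>p. 0 < snd p \<and> cball (fst p) (snd p) \<subseteq> W \<and> from_nat_into \<F>' j = ball (fst p) (snd p)"
      by (intro exI[of _ a]) (simp add: case_prod_beta)
  qed
  then obtain p where p: "\<And>j. 0 < snd (p j)" "\<And>j. cball (fst (p j)) (snd (p j)) \<subseteq> W"
    "\<And>j. from_nat_into \<F>' j = ball (fst (p j)) (snd (p j))" by metis
  define b where "b j = bump (fst (p j)) (snd (p j))" for j
  have "\<exists>db. C1_grad (b j) db" for j unfolding b_def using C1_bump by metis
  then obtain db where db: "\<And>j. C1_grad (b j) (db j)" by metis
  have b0: "0 \<le> b j x" for j x by (simp add: b_def bump_nonneg)
  have bpos: "b j x \<noteq> 0 \<longleftrightarrow> x \<in> ball (fst (p j)) (snd (p j))" for j x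
    unfolding b_def using p(1)[of j] by (intro bump_pos_iff) auto
  define q where "q k x = (\<Sum>j<k. b j x)" for k x
  have q0: "0 \<le> q k x" for k x unfolding q_def by (intro sum_nonneg b0)
  have Cq: "C1_grad (q k) (\<lambda>x. \<Sum>j<k. db j x)" for k unfolding q_def[abs_def] by (intro C1_sum db)
  define \<phi> where "\<phi> k x = real k * q k x / (1 + real k * q k x)" for k x
  have den: "1 + real k * q k x > 0" for k x using q0[of k x] by (simp add: add_pos_nonneg)
  have "\<exists>d. test_fun W (\<phi> k) d" for k
  proof -
    have C: "C1_grad (\<phi> k) (\<lambda>x. (real k / (1 + real k * q k x)\<^sup>2) *\<^sub>R (\<Sum>j<k. db j x))"
      unfolding \<phi>_def[abs_def]
    proof (rule C1_compose[OF Cq, of "\<lambda>t. real k * t / (1 + real k * t)" "\<lambda>t. real k / (1 + real k * t)\<^sup>2"])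
      show "((\<lambda>t. real k * t / (1 + real k * t)) has_real_derivative real k / (1 + real k * q k x)\<^sup>2) (at (q k x))" for x
        using den[of k x] by (auto intro!: derivative_eq_intros simp: field_simps power2_eq_square)
      have "1 + real k * q k x \<noteq> 0" for x using den[of k x] by simp
      then show "continuous_on UNIV (\<lambda>x. real k / (1 + real k * q k x)\<^sup>2)"
        by (intro continuous_intros C1_continuous[OF Cq]) auto
    qed
    have sub: "{x. \<phi> k x \<noteq> 0} \<subseteq> (\<Union>j<k. cball (fst (p j)) (snd (p j)))"
    proof
      fix x assume "x \<in> {x. \<phi> k x \<noteq> 0}"
      then have "q k x \<noteq> 0" by (auto simp: \<phi>_def)
      then obtain j where "j < k" "b j x \<noteq> 0" unfolding q_def by (metis sum.neutral lessThan_iff)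
      then show "x \<in> (\<Union>j<k. cball (fst (p j)) (snd (p j)))" using bpos ball_subset_cball by blast
    qed
    have co: "compact (\<Union>j<k. cball (fst (p j)) (snd (p j)))" by (intro compact_UN) auto
    then have cl: "closure {x. \<phi> k x \<noteq> 0} \<subseteq> (\<Union>j<k. cball (fst (p j)) (snd (p j)))"
      using sub by (intro closure_minimal compact_imp_closed)
    have "compact (closure {x. \<phi> k x \<noteq> 0})"
      using compact_Int_closed[OF co closed_closure[of "{x. \<phi> k x \<noteq> 0}"]] cl by (simp add: inf.absorb2)
    then show ?thesis unfolding test_fun_def using C cl p(2) by blast
  qed
  then obtain d where "\<And>k. test_fun W (\<phi> k) (d k)" by metis
  moreover have "0 \<le> \<phi> k x \<and> \<phi> k x \<le> 1" for k x
    using den[of k x] q0[of k x] by (auto simp: \<phi>_def)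
  moreover have "(\<lambda>k. \<phi> k x) \<longlonglongrightarrow> indicator W x" for x
  proof (cases "x \<in> W")
    case False
    then have "x \<notin> ball (fst (p j)) (snd (p j))" for j using p(2)[of j] ball_subset_cball by blast
    then have "b j x = 0" for j using bpos by blast
    then show ?thesis using False by (simp add: \<phi>_def q_def)
  next
    case True
    then obtain A where A: "A \<in> \<F>'" "x \<in> A" using un by auto
    then obtain j where "from_nat_into \<F>' j = A" using from_nat_into_surj[OF \<F>'(2)] by blast
    then have "x \<in> ball (fst (p j)) (snd (p j))" using A(2) unfolding p(3) by blast
    then have "b j x \<noteq> 0" using bpos by blast
    then have bj: "b j x > 0" using b0[of j x] by simp
    have "(\<lambda>k. 1 - \<phi> k x) \<longlonglongrightarrow> 0"
    proof (rule tendsto_sandwich[OF _ _ tendsto_const])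
      show "(\<lambda>k. 1 / (1 + real k * b j x)) \<longlonglongrightarrow> 0" using bj by real_asymp
      show "\<forall>\<^sub>F k in sequentially. 0 \<le> 1 - \<phi> k x" using den q0 by (auto simp: \<phi>_def)
      show "\<forall>\<^sub>F k in sequentially. 1 - \<phi> k x \<le> 1 / (1 + real k * b j x)"
        using eventually_gt_at_top[of j]
      proof eventually_elim
        case (elim k)
        have "b j x \<le> q k x" unfolding q_def using elim b0 by (intro member_le_sum) auto
        then have "1 / (1 + real k * q k x) \<le> 1 / (1 + real k * b j x)"
          using bj by (intro divide_left_mono add_left_mono mult_left_mono mult_pos_pos den) (auto intro: add_pos_nonneg)
        moreover have "1 - \<phi> k x = 1 / (1 + real k * q k x)" using den[of k x] by (simp add: \<phi>_def field_simps)
        ultimately show ?case by simp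
      qed
    qed
    then have "(\<lambda>k. 1 - (1 - \<phi> k x)) \<longlonglongrightarrow> 1 - 0" by (intro tendsto_intros)
    then show ?thesis using True by simp
  qed
  ultimately show ?thesis using that by blast
qed

text \<open>Stated for surface measures and for Lebesgue measure on an open set alike; the last assumption
  allows the completion in the latter.\<close>

lemma fundamental_lemma:
  fixes h :: "'a::euclidean_space \<Rightarrow> real"
  assumes id: "(\<lambda>x. x) \<in> measurable M borel" and h: "integrable M h"
    and W: "open W" "\<And>x. x \<in> space M \<Longrightarrow> x \<in> W"
    and test: "\<And>\<phi> d\<phi>. test_fun W \<phi> d\<phi> \<Longrightarrow> (\<integral>x. h x * \<phi> x \<partial>M) = 0"
    and approx: "\<And>A. A \<in> sets M \<Longrightarrow> \<exists>B\<in>sets borel. AE x in M. x \<in> A \<longleftrightarrow> x \<in> B"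
  shows "AE x in M. h x = 0"
proof -
  have [measurable]: "h \<in> borel_measurable M" using h by auto
  have ind[measurable]: "(\<lambda>x. indicator B x :: real) \<in> borel_measurable M" if "B \<in> sets borel" for B
    by (rule measurable_compose[OF id borel_measurable_indicator[OF that]])
  have int: "integrable M (\<lambda>x. h x * indicator B x)" if "B \<in> sets borel" for B
    using ind[OF that] by (intro Bochner_Integration.integrable_bound[OF h]) (auto simp: indicator_def)
  have op: "(\<integral>x. h x * indicator B x \<partial>M) = 0" if B: "open B" for B
  proof -
    have "open (B \<inter> W)" using B W by auto
    then obtain \<phi> d\<phi> where \<phi>: "\<And>k::nat. test_fun (B \<inter> W) (\<phi> k) (d\<phi> k)" "\<And>k x. 0 \<le> \<phi> k x \<and> \<phi> k x \<le> 1"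
      "\<And>x. (\<lambda>k. \<phi> k x) \<longlonglongrightarrow> indicator (B \<inter> W) x" by (rule open_indicator_test_funs) (rule that)
    have meas: "\<phi> k \<in> borel_measurable M" for k
      using measurable_compose[OF id C1_measurable, of "\<phi> k" "d\<phi> k"] \<phi>(1)[of k] by (simp add: test_fun_def)
    have "(\<lambda>k. \<integral>x. h x * \<phi> k x \<partial>M) \<longlonglongrightarrow> (\<integral>x. h x * indicator (B \<inter> W) x \<partial>M)"
    proof (rule integral_dominated_convergence[where w = "\<lambda>x. \<bar>h x\<bar>"])
      show "(\<lambda>x. h x * indicator (B \<inter> W) x) \<in> borel_measurable M"
        using ind[of "B \<inter> W"] B W by auto
      show "(\<lambda>x. h x * \<phi> k x) \<in> borel_measurable M" for k using meas by auto
      show "AE x in M. (\<lambda>k. h x * \<phi> k x) \<longlonglongrightarrow> h x * indicator (B \<inter> W) x"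
        by (intro AE_I2 tendsto_intros \<phi>(3))
      show "AE x in M. norm (h x * \<phi> k x) \<le> \<bar>h x\<bar>" for k
        using \<phi>(2)[of k] by (intro AE_I2) (auto simp: abs_mult intro!: mult_left_le)
    qed (use h in auto)
    moreover have "(\<integral>x. h x * \<phi> k x \<partial>M) = 0" for k
      using \<phi>(1)[of k] by (intro test[of _ "d\<phi> k"]) (auto simp: test_fun_def)
    ultimately have "(\<integral>x. h x * indicator (B \<inter> W) x \<partial>M) = 0" by (simp add: LIMSEQ_const_iff)
    also have "(\<integral>x. h x * indicator (B \<inter> W) x \<partial>M) = (\<integral>x. h x * indicator B x \<partial>M)"
      using W(2) by (intro Bochner_Integration.integral_cong) (auto simp: indicator_def)
    finally show ?thesis .
  qed
  have bor: "(\<integral>x. h x * indicator B x \<partial>M) = 0" if B: "B \<in> sets borel" for B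
  proof -
    \<comment> \<open>Open sets form an intersection-stable generator of the Borel sets, so
      vanishing of the integrals passes to all Borel sets by Dynkin's theorem.\<close>
    have "Int_stable {S :: 'a set. open S}" "{S :: 'a set. open S} \<subseteq> Pow UNIV" "B \<in> sigma_sets UNIV {S. open S}"
      using B by (auto simp: borel_def Int_stable_def)
    then show ?thesis
    proof (induction rule: sigma_sets_induct_disjoint)
      case (basic A) then show ?case using op by simp
    next
      case empty then show ?case by simp
    next
      case (compl A)
      then have "A \<in> sets borel" by (simp add: borel_def)
      then have "(\<integral>x. h x - h x * indicator A x \<partial>M) = (\<integral>x. h x \<partial>M) - (\<integral>x. h x * indicator A x \<partial>M)"
        by (intro Bochner_Integration.integral_diff h int)
      also have "\<dots> = 0" using compl op[of UNIV] by simp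
      also have "(\<integral>x. h x - h x * indicator A x \<partial>M) = (\<integral>x. h x * indicator (UNIV - A) x \<partial>M)"
        by (intro Bochner_Integration.integral_cong) (auto simp: indicator_def)
      finally show ?case .
    next
      case (union A)
      then have A: "A i \<in> sets borel" for i using union(2)[THEN subsetD, of "A i"] by (auto simp: borel_def)
      have "(\<lambda>n. \<Sum>i<n. \<integral>x. h x * indicator (A i) x \<partial>M) \<longlonglongrightarrow> (\<integral>x. h x * indicator (\<Union>i. A i) x \<partial>M)"
      proof -
        have "(\<lambda>n. \<integral>x. h x * indicator (\<Union>i<n. A i) x \<partial>M) \<longlonglongrightarrow> (\<integral>x. h x * indicator (\<Union>i. A i) x \<partial>M)"
        proof (rule integral_dominated_convergence[where w = "\<lambda>x. \<bar>h x\<bar>"])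
          show "AE x in M. (\<lambda>n. h x * indicator (\<Union>i<n. A i) x) \<longlonglongrightarrow> h x * indicator (\<Union>i. A i) x"
            by (intro AE_I2 tendsto_intros LIMSEQ_indicator_UN)
          show "(\<lambda>x. h x * indicator (\<Union>i. A i) x) \<in> borel_measurable M"
            using ind[of "\<Union>i. A i"] A by auto
          show "(\<lambda>x. h x * indicator (\<Union>i<n. A i) x) \<in> borel_measurable M" for n
            using ind[of "\<Union>i<n. A i"] A by auto
        qed (use h in \<open>auto simp: indicator_def\<close>)
        moreover have "(\<integral>x. h x * indicator (\<Union>i<n. A i) x \<partial>M) = (\<Sum>i<n. \<integral>x. h x * indicator (A i) x \<partial>M)" for n
        proof -
          have ind_eq: "indicator (\<Union>i<n. A i) x = (\<Sum>i<n. indicator (A i) x :: real)" for x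
            using union(1) by (intro indicator_UN_disjoint) (auto simp: disjoint_family_on_def)
          show ?thesis unfolding ind_eq sum_distrib_left
            by (rule Bochner_Integration.integral_sum) (rule int[OF A])
        qed
        ultimately show ?thesis by simp
      qed
      then show ?case using union(3) by (simp add: LIMSEQ_const_iff)
    qed
  qed
  have half: "AE x in M. g x \<le> 0"
    if g: "integrable M g" and gb: "\<And>B. B \<in> sets borel \<Longrightarrow> (\<integral>x. g x * indicator B x \<partial>M) = 0" for g :: "'a \<Rightarrow> real"
  proof -
    have [measurable]: "g \<in> borel_measurable M" using g by auto
    have "{x \<in> space M. 0 < g x} \<in> sets M" by measurable
    \<comment> \<open>The set where \<open>g\<close> is positive is the one to be tested; over a
      completion it may fail to be Borel, and \<open>approx\<close> supplies a Borel set that agrees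
      with it almost everywhere.\<close>
    then obtain B where B: "B \<in> sets borel" "AE x in M. x \<in> {x \<in> space M. 0 < g x} \<longleftrightarrow> x \<in> B" using approx by blast
    have eq: "AE x in M. g x * indicator B x = max 0 (g x)"
      using B(2) AE_space by eventually_elim (auto simp: indicator_def max_def)
    have "(\<integral>x. max 0 (g x) \<partial>M) = (\<integral>x. g x * indicator B x \<partial>M)"
      using eq ind[OF B(1)] by (intro integral_cong_AE) auto
    also have "\<dots> = 0" using gb[OF B(1)] .
    finally have "AE x in M. max 0 (g x) = 0"
      using g by (subst (asm) integral_nonneg_eq_0_iff_AE) auto
    then show ?thesis by eventually_elim auto
  qed
  have "AE x in M. h x \<le> 0" using half[OF h] bor by blast
  moreover have "AE x in M. - h x \<le> 0"
    using half[of "\<lambda>x. - h x"] h bor by simp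
  ultimately show ?thesis by eventually_elim simp
qed

section \<open>Potentials of sources in an annulus\<close>

text \<open>Differentiation under the integral sign. Convexity of \<open>S\<close> lets the mean
  value inequality bound the difference quotients by \<open>w\<close>, as dominated convergence
  requires.\<close>

lemma integral_holomorphic:
  fixes k k' :: "complex \<Rightarrow> 'a \<Rightarrow> complex"
  assumes S: "open S" "convex S"
    and int: "\<And>t. t \<in> S \<Longrightarrow> integrable M (k t)" and meas: "\<And>t. t \<in> S \<Longrightarrow> k' t \<in> borel_measurable M"
    and der: "\<And>t y. t \<in> S \<Longrightarrow> ((\<lambda>t. k t y) has_field_derivative k' t y) (at t)"
    and w: "integrable M w" and bound: "\<And>t y. t \<in> S \<Longrightarrow> norm (k' t y) \<le> w y"
  shows "(\<lambda>t. \<integral>y. k t y \<partial>M) holomorphic_on S"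
proof (rule holomorphic_onI)
  fix t assume t: "t \<in> S"
  have "((\<lambda>t. \<integral>y. k t y \<partial>M) has_field_derivative (\<integral>y. k' t y \<partial>M)) (at t)"
    unfolding has_field_derivative_iff
  proof (subst tendsto_at_iff_sequentially, intro allI impI)
    fix X :: "nat \<Rightarrow> complex" assume X: "\<forall>i. X i \<in> UNIV - {t}" "X \<longlonglongrightarrow> t"
    have "\<forall>\<^sub>F n in sequentially. X n \<in> S" using X(2) S(1) t by (rule topological_tendstoD)
    then obtain N where N: "\<And>n. n \<ge> N \<Longrightarrow> X n \<in> S" by (auto simp: eventually_sequentially)
    \<comment> \<open>Only the tail of the sequence is known to lie in \<open>S\<close>, where the
      kernel is under control.\<close>
    define Y where "Y n = X (n + N)" for n
    have Y: "Y n \<in> S" "Y n \<noteq> t" for n using N X(1) by (auto simp: Y_def)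
    have Yt: "Y \<longlonglongrightarrow> t" unfolding Y_def using X(2) by (rule LIMSEQ_ignore_initial_segment)
    have lip: "norm (k (Y n) y - k t y) \<le> w y * norm (Y n - t)" for n y
      by (rule field_differentiable_bound[OF S(2), where f' = "\<lambda>t. k' t y"])
        (use der bound Y t in \<open>auto intro: has_field_derivative_at_within\<close>)
    have "(\<lambda>n. \<integral>y. (k (Y n) y - k t y) / (Y n - t) \<partial>M) \<longlonglongrightarrow> (\<integral>y. k' t y \<partial>M)"
    proof (rule integral_dominated_convergence[where w = w])
      show "k' t \<in> borel_measurable M" by (rule meas[OF t])
      show "(\<lambda>y. (k (Y n) y - k t y) / (Y n - t)) \<in> borel_measurable M" for n
        using int[OF Y(1)] int[OF t] by auto
      show "AE y in M. (\<lambda>n. (k (Y n) y - k t y) / (Y n - t)) \<longlonglongrightarrow> k' t y"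
      proof (rule AE_I2)
        fix y
        have "((\<lambda>z. (k z y - k t y) / (z - t)) \<longlongrightarrow> k' t y) (at t)"
          using der[OF t] by (simp add: has_field_derivative_iff)
        moreover have "filterlim Y (at t) sequentially" using Yt Y by (simp add: filterlim_at)
        ultimately show "(\<lambda>n. (k (Y n) y - k t y) / (Y n - t)) \<longlonglongrightarrow> k' t y" by (rule filterlim_compose)
      qed
      show "AE y in M. norm ((k (Y n) y - k t y) / (Y n - t)) \<le> w y" for n
        using lip[of n] Y(2)[of n] by (intro AE_I2) (simp add: norm_divide divide_le_eq)
    qed (rule w)
    also have "(\<lambda>n. \<integral>y. (k (Y n) y - k t y) / (Y n - t) \<partial>M) = (\<lambda>n. ((\<integral>y. k (Y n) y \<partial>M) - (\<integral>y. k t y \<partial>M)) / (Y n - t))"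
      using int[OF Y(1)] int[OF t] by (simp add: fun_eq_iff)
    finally have "(\<lambda>n. ((\<lambda>z. ((\<integral>y. k z y \<partial>M) - (\<integral>y. k t y \<partial>M)) / (z - t)) \<circ> X) (n + N)) \<longlonglongrightarrow> (\<integral>y. k' t y \<partial>M)"
      by (simp add: Y_def)
    then show "((\<lambda>z. ((\<integral>y. k z y \<partial>M) - (\<integral>y. k t y \<partial>M)) / (z - t)) \<circ> X) \<longlonglongrightarrow> (\<integral>y. k' t y \<partial>M)"
      by (rule LIMSEQ_offset)
  qed
  then show "(\<lambda>t. \<integral>y. k t y \<partial>M) field_differentiable (at t within S)"
    using field_differentiable_at_within field_differentiable_def by blast
qed

text \<open>In terms of the squared distance \<open>s\<close> from \<open>x0\<close> the cutoff is
  \<open>f s / (f s + g s)\<close>, where \<open>f\<close> and \<open>g\<close> are the squared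
  positive parts of \<open>b - s\<close> and \<open>s - a\<close>; \<open>a < b\<close> keeps the
  denominator positive.\<close>

lemma C1_cutoff:
  fixes x0 :: "'a::euclidean_space"
  assumes R: "R > 0"
  obtains \<kappa> d\<kappa> where "C1_grad \<kappa> d\<kappa>" "\<And>y. 0 \<le> \<kappa> y \<and> \<kappa> y \<le> 1"
    "\<And>y. dist x0 y \<le> R / 2 \<Longrightarrow> \<kappa> y = 1 \<and> d\<kappa> y = 0" "\<And>y. dist x0 y \<ge> 3 * R / 4 \<Longrightarrow> \<kappa> y = 0 \<and> d\<kappa> y = 0"
proof -
  define a b where "a = (R / 2)\<^sup>2" and "b = (3 * R / 4)\<^sup>2"
  have ab: "a < b" using R by (simp add: a_def b_def power2_eq_square)
  define f where "f s = (max 0 (b - s))\<^sup>2" for s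
  define g where "g s = (max 0 (s - a))\<^sup>2" for s
  define f' where "f' s = - 2 * max 0 (b - s)" for s
  define g' where "g' s = 2 * max 0 (s - a)" for s
  have f: "(f has_real_derivative f' s) (at s)" for s
  proof -
    have "((\<lambda>s. b - s) has_real_derivative -1) (at s)" by (auto intro!: derivative_eq_intros)
    from DERIV_chain2[OF max0_sq_derivative this] show ?thesis unfolding f_def[abs_def] f'_def by simp
  qed
  have g: "(g has_real_derivative g' s) (at s)" for s
  proof -
    have "((\<lambda>s. s - a) has_real_derivative 1) (at s)" by (auto intro!: derivative_eq_intros)
    from DERIV_chain2[OF max0_sq_derivative this] show ?thesis unfolding g_def[abs_def] g'_def by simp
  qed
  have fg: "f s + g s > 0" for s
  proof (cases "s < b")
    case True then show ?thesis by (simp add: f_def g_def add_pos_nonneg)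
  next
    case False then show ?thesis using ab by (simp add: f_def g_def add_nonneg_pos)
  qed
  have fg0: "f s + g s \<noteq> 0" for s using fg[of s] by simp
  define \<theta> where "\<theta> s = f s / (f s + g s)" for s
  define \<theta>' where "\<theta>' s = (f' s * g s - f s * g' s) / (f s + g s)\<^sup>2" for s
  have \<theta>: "(\<theta> has_real_derivative \<theta>' s) (at s)" for s
    unfolding \<theta>_def \<theta>'_def
    using DERIV_divide[OF f DERIV_add[OF f g] fg0, of s] by (simp add: power2_eq_square algebra_simps)
  have cont: "continuous_on UNIV \<theta>'"
    unfolding \<theta>'_def f'_def g'_def
    by (intro continuous_intros DERIV_continuous_on[OF f] DERIV_continuous_on[OF g] has_field_derivative_at_within f g)
      (use fg0 in \<open>auto intro: has_field_derivative_at_within f g\<close>)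
  define \<kappa> where "\<kappa> y = \<theta> ((norm (y - x0))\<^sup>2)" for y :: 'a
  define d\<kappa> where "d\<kappa> y = \<theta>' ((norm (y - x0))\<^sup>2) *\<^sub>R (2 *\<^sub>R (y - x0))" for y :: 'a
  have "C1_grad \<kappa> d\<kappa>"
    unfolding \<kappa>_def[abs_def] d\<kappa>_def[abs_def]
    by (rule C1_compose[OF C1_norm_sq \<theta>]) (intro continuous_on_compose2[OF cont] continuous_intros, auto)
  moreover have "0 \<le> \<kappa> y \<and> \<kappa> y \<le> 1" for y
    using fg by (auto simp: \<kappa>_def \<theta>_def f_def g_def divide_le_eq)
  moreover have "\<kappa> y = 1 \<and> d\<kappa> y = 0" if "dist x0 y \<le> R / 2" for y
  proof -
    have "(norm (y - x0))\<^sup>2 \<le> a" unfolding a_def using that by (intro power_mono) (auto simp: dist_norm norm_minus_commute)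
    then have "g ((norm (y - x0))\<^sup>2) = 0" "g' ((norm (y - x0))\<^sup>2) = 0" by (auto simp: g_def g'_def)
    then show ?thesis using fg[of "(norm (y - x0))\<^sup>2"] by (simp add: \<kappa>_def d\<kappa>_def \<theta>_def \<theta>'_def)
  qed
  moreover have "\<kappa> y = 0 \<and> d\<kappa> y = 0" if "dist x0 y \<ge> 3 * R / 4" for y
  proof -
    have "b \<le> (norm (y - x0))\<^sup>2" unfolding b_def using that R by (intro power_mono) (auto simp: dist_norm norm_minus_commute)
    then have "f ((norm (y - x0))\<^sup>2) = 0" "f' ((norm (y - x0))\<^sup>2) = 0" by (auto simp: f_def f'_def)
    then show ?thesis by (simp add: \<kappa>_def d\<kappa>_def \<theta>_def \<theta>'_def)
  qed
  ultimately show ?thesis using that by blast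
qed

text \<open>\<open>fund n\<close> is a primitive of \<open>t powr (- n / 2)\<close>, so that \<open>fund n (|y|^2)\<close> is a multiple of the
  fundamental solution of the Laplacian in dimension \<open>n\<close>, including the case \<open>n = 2\<close>.\<close>

definition fund :: "nat \<Rightarrow> real \<Rightarrow> real" where
  "fund n t = (if n = 2 then ln t else t powr (1 - real n / 2) / (1 - real n / 2))"

text \<open>Holomorphic extension of \<open>fund\<close> by principal branches; it is evaluated in
  the right half-plane.\<close>

definition cfund :: "nat \<Rightarrow> complex \<Rightarrow> complex" where
  "cfund n z = (if n = 2 then Ln z else z powr of_real (1 - real n / 2) / of_real (1 - real n / 2))"

lemma fund_derivative: "t > 0 \<Longrightarrow> (fund n has_real_derivative t powr (- real n / 2)) (at t within A)"
proof (cases "n = 2")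
  case True
  moreover assume t: "t > 0"
  ultimately have "fund n = ln" "t powr (- real n / 2) = inverse t" by (auto simp: fund_def fun_eq_iff powr_minus)
  then show ?thesis using DERIV_ln[OF t] has_field_derivative_at_within by metis
next
  case False
  assume t: "t > 0"
  define c where "c = 1 - real n / 2"
  have c: "c \<noteq> 0" unfolding c_def using False by auto
  have "((\<lambda>t. t powr c / c) has_real_derivative (c * t powr (c - 1)) / c) (at t within A)"
    by (intro DERIV_cdivide has_field_derivative_at_within[OF has_real_derivative_powr] t)
  moreover have "c - 1 = - real n / 2" by (simp add: c_def)
  ultimately show ?thesis using False c unfolding fund_def[abs_def] c_def[symmetric] by simp
qed

lemma cpowr_of_real: "t > 0 \<Longrightarrow> (of_real t :: complex) powr of_real a = of_real (t powr a)"
  by (simp add: powr_of_real)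

lemma cfund_of_real: "t > 0 \<Longrightarrow> cfund n (of_real t) = of_real (fund n t)"
  unfolding cfund_def fund_def by (simp only: cpowr_of_real Ln_of_real of_real_divide split: if_split) simp

lemma cfund_derivative:
  assumes "Re z > 0"
  shows "(cfund n has_field_derivative z powr of_real (- real n / 2)) (at z)"
proof -
  have z: "z \<notin> \<real>\<^sub>\<le>\<^sub>0" using assms complex_nonpos_Reals_iff by force
  show ?thesis
  proof (cases "n = 2")
    case True
    then have "cfund n = Ln" by (simp add: cfund_def fun_eq_iff)
    moreover have "z powr of_real (- real n / 2) = inverse z" using True assms by (simp add: powr_minus powr_to_1)
    ultimately show ?thesis using has_field_derivative_Ln[OF z] by simp
  next
    case False
    define c :: complex where "c = of_real (1 - real n / 2)"
    have "1 - real n / 2 \<noteq> 0" using False by auto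
    then have c: "c \<noteq> 0" unfolding c_def by (simp only: of_real_eq_0_iff not_False_eq_True)
    have "((\<lambda>z. z powr c / c) has_field_derivative (c * z powr (c - 1)) / c) (at z)"
      by (intro DERIV_cdivide has_field_derivative_powr z)
    moreover have "c - 1 = of_real (- real n / 2)" by (simp add: c_def)
    ultimately show ?thesis using False c unfolding cfund_def[abs_def] c_def[symmetric] by simp
  qed
qed


text \<open>The kernel \<open>f\<close> is under control only on \<open>D\<close>, where the density
  \<open>\<alpha>\<close> lives; elsewhere it may be singular or cross a branch cut. The indicator
  of \<open>D\<close> restores measurability.\<close>

lemma integrable_scaleR_bounded:
  fixes f :: "'a::euclidean_space \<Rightarrow> 'b::{banach, second_countable_topology}"
  assumes \<alpha>: "integrable lborel \<alpha>" "\<And>y. y \<notin> D \<Longrightarrow> \<alpha> y = 0" and D: "D \<in> sets borel"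
    and f: "continuous_on D f" "\<And>y. y \<in> D \<Longrightarrow> norm (f y) \<le> M"
  shows "integrable lborel (\<lambda>y. \<alpha> y *\<^sub>R f y)"
proof -
  have [measurable]: "(\<lambda>y. indicator D y *\<^sub>R f y) \<in> borel_measurable borel" using D f by (intro borel_measurable_continuous_on_indicator)
  have [measurable]: "\<alpha> \<in> borel_measurable borel" using \<alpha> by auto
  have "integrable lborel (\<lambda>y. \<alpha> y *\<^sub>R (indicator D y *\<^sub>R f y))"
  proof (rule Bochner_Integration.integrable_bound)
    show "integrable lborel (\<lambda>y. M * \<alpha> y)" using \<alpha> by auto
    show "AE y in lborel. norm (\<alpha> y *\<^sub>R (indicator D y *\<^sub>R f y)) \<le> norm (M * \<alpha> y)"
    proof (rule AE_I2)
      fix y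
      have "\<bar>\<alpha> y\<bar> * norm (f y) \<le> \<bar>\<alpha> y\<bar> * \<bar>M\<bar>" if "y \<in> D"
        using f(2)[OF that] by (intro mult_left_mono) auto
      then show "norm (\<alpha> y *\<^sub>R (indicator D y *\<^sub>R f y)) \<le> norm (M * \<alpha> y)"
        by (cases "y \<in> D") (auto simp: abs_mult mult.commute)
    qed
  qed measurable
  moreover have "(\<lambda>y. \<alpha> y *\<^sub>R (indicator D y *\<^sub>R f y)) = (\<lambda>y. \<alpha> y *\<^sub>R f y)"
    using \<alpha>(2) by (auto simp: fun_eq_iff indicator_def)
  ultimately show ?thesis by simp
qed

text \<open>The sources lie at distance at least \<open>R / 2\<close> from \<open>x0\<close>, so
  within \<open>R / 4\<close> of \<open>x0\<close> the kernels of \<open>pot\<close> are nonsingular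
  even for \<open>\<epsilon> = 0\<close>. The density
  \<open>x \<bullet> \<beta> y + \<gamma> y\<close> is affine in \<open>x\<close> because the factor
  \<open>d\<kappa> y \<bullet> (y - x)\<close> in \<open>representation\<close> is.\<close>

locale annulus_potential =
  fixes x0 :: "'a::euclidean_space" and R :: real and n :: nat and \<alpha> \<gamma> :: "'a \<Rightarrow> real" and \<beta> :: "'a \<Rightarrow> 'a"
  assumes R: "R > 0"
    and int: "integrable lborel \<alpha>" "integrable lborel \<beta>" "integrable lborel \<gamma>"
    and vanish: "\<And>y. \<not> (R / 2 \<le> dist x0 y \<and> dist x0 y \<le> R) \<Longrightarrow> \<alpha> y = 0 \<and> \<beta> y = 0 \<and> \<gamma> y = 0"
begin

definition D where "D = {y. R / 2 \<le> dist x0 y \<and> dist x0 y \<le> R}"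

definition pot :: "real \<Rightarrow> 'a \<Rightarrow> real" where
  "pot \<epsilon> x = (\<integral>y. \<alpha> y *\<^sub>R fund n ((norm (x - y))\<^sup>2 + \<epsilon>\<^sup>2)
     + (x \<bullet> \<beta> y + \<gamma> y) *\<^sub>R ((norm (x - y))\<^sup>2 + \<epsilon>\<^sup>2) powr (- real n / 2) \<partial>lborel)"

lemma compact_D: "compact D"
proof -
  have "D = cball x0 R \<inter> {y. R / 2 \<le> dist x0 y}" by (auto simp: D_def)
  then show ?thesis by (auto intro!: compact_Int_closed closed_Collect_le continuous_intros)
qed

lemma D_borel [measurable]: "D \<in> sets borel"
  using compact_D by (intro borel_closed compact_imp_closed)

lemma vanish_D: "y \<notin> D \<Longrightarrow> \<alpha> y = 0 \<and> \<beta> y = 0 \<and> \<gamma> y = 0"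
  using vanish by (auto simp: D_def)

lemma fund_continuous: "continuous_on {0<..} (fund n)"
  using fund_derivative by (intro DERIV_continuous_on) auto

lemma pot_limits:
  shows pot_bounded: "\<exists>M. \<forall>x\<in>ball x0 (R/4). \<forall>\<epsilon>\<in>{0..1}. \<bar>pot \<epsilon> x\<bar> \<le> M"
    and pot_tendsto: "x \<in> ball x0 (R/4) \<Longrightarrow> (\<lambda>k. pot (inverse (real (Suc k))) x) \<longlonglongrightarrow> pot 0 x"
proof -
  \<comment> \<open>For \<open>x\<close> in the quarter ball and \<open>y\<close> in the annulus the
    distance lies between \<open>R / 4\<close> and \<open>5 * R / 4\<close>, and
    \<open>\<epsilon>\<^sup>2 \<le> 1\<close>: the kernel argument stays in a fixed compact interval
    of positive numbers.\<close>
  define c0 c1 where "c0 = R\<^sup>2 / 16" and "c1 = (5 * R / 4)\<^sup>2 + 1"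
  have c0: "c0 > 0" using R by (simp add: c0_def)
  define q where "q \<epsilon> x y = (norm (x - y))\<^sup>2 + \<epsilon>\<^sup>2" for \<epsilon> :: real and x y :: 'a
  have q: "q \<epsilon> x y \<in> {c0..c1}" if "x \<in> ball x0 (R/4)" "y \<in> D" "\<epsilon> \<in> {0..1}" for \<epsilon> x y
  proof -
    have "R / 4 \<le> norm (x - y)" "norm (x - y) \<le> 5 * R / 4"
      using that dist_triangle[of x0 y x] dist_triangle[of x y x0] by (auto simp: D_def dist_norm norm_minus_commute)
    then have "(R / 4)\<^sup>2 \<le> (norm (x - y))\<^sup>2" "(norm (x - y))\<^sup>2 \<le> (5 * R / 4)\<^sup>2"
      using R by (auto intro!: power_mono)
    moreover have "0 \<le> \<epsilon>\<^sup>2" "\<epsilon>\<^sup>2 \<le> 1" using that by (auto intro!: power_le_one)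
    moreover have "(R / 4)\<^sup>2 = R\<^sup>2 / 16" by (simp add: power_divide)
    ultimately show ?thesis unfolding q_def c0_def c1_def atLeastAtMost_iff by linarith
  qed
  have cP: "continuous_on {0<..} (\<lambda>t::real. t powr (- real n / 2))" by (intro continuous_intros) auto
  have "compact (fund n ` {c0..c1})" "compact ((\<lambda>t::real. t powr (- real n / 2)) ` {c0..c1})"
    by (rule compact_continuous_image[OF continuous_on_subset[OF fund_continuous] compact_Icc], use c0 in force,
        rule compact_continuous_image[OF continuous_on_subset[OF cP] compact_Icc], use c0 in force)
  then obtain M0 M1 where M0: "M0 > 0" "\<And>t. t \<in> {c0..c1} \<Longrightarrow> \<bar>fund n t\<bar> \<le> M0"
    and M1: "M1 > 0" "\<And>t. t \<in> {c0..c1} \<Longrightarrow> \<bar>t powr (- real n / 2)\<bar> \<le> M1"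
    by (auto dest!: compact_imp_bounded simp: bounded_pos)
  define f where "f \<epsilon> x y = \<alpha> y *\<^sub>R fund n (q \<epsilon> x y) + (x \<bullet> \<beta> y + \<gamma> y) *\<^sub>R q \<epsilon> x y powr (- real n / 2)" for \<epsilon> x y
  define w where "w y = M0 * \<bar>\<alpha> y\<bar> + M1 * ((norm x0 + R) * norm (\<beta> y) + \<bar>\<gamma> y\<bar>)" for y
  have w: "integrable lborel w" unfolding w_def using int by auto
  have fw: "norm (f \<epsilon> x y) \<le> w y" if x: "x \<in> ball x0 (R/4)" "\<epsilon> \<in> {0..1}" for \<epsilon> x y
  proof (cases "y \<in> D")
    case True
    have "norm x \<le> norm x0 + norm (x - x0)" using norm_triangle_ineq[of x0 "x - x0"] by simp
    also have "norm (x - x0) < R" using x R by (auto simp: dist_norm norm_minus_commute)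
    finally have nx: "norm x \<le> norm x0 + R" by simp
    have "\<bar>x \<bullet> \<beta> y\<bar> \<le> (norm x0 + R) * norm (\<beta> y)"
      using Cauchy_Schwarz_ineq2[of x "\<beta> y"] mult_right_mono[OF nx, of "norm (\<beta> y)"] by simp
    then have 1: "\<bar>x \<bullet> \<beta> y + \<gamma> y\<bar> \<le> (norm x0 + R) * norm (\<beta> y) + \<bar>\<gamma> y\<bar>" by linarith
    have "norm (f \<epsilon> x y) \<le> \<bar>\<alpha> y\<bar> * \<bar>fund n (q \<epsilon> x y)\<bar> + \<bar>x \<bullet> \<beta> y + \<gamma> y\<bar> * \<bar>q \<epsilon> x y powr (- real n / 2)\<bar>"
      unfolding f_def by (rule order_trans[OF norm_triangle_ineq]) (simp add: abs_mult)
    also have "\<dots> \<le> \<bar>\<alpha> y\<bar> * M0 + ((norm x0 + R) * norm (\<beta> y) + \<bar>\<gamma> y\<bar>) * M1"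
      using M0(2)[OF q[OF x(1) True x(2)]] M1(2)[OF q[OF x(1) True x(2)]] 1 M1(1)
      by (intro add_mono mult_mono) auto
    finally show ?thesis by (simp add: w_def mult.commute)
  next
    case False
    then show ?thesis using vanish_D[OF False] by (simp add: f_def w_def)
  qed
  have cq: "continuous_on A (q \<epsilon> x)" for A \<epsilon> x unfolding q_def by (intro continuous_intros)
  have meas: "f \<epsilon> x \<in> borel_measurable lborel" if x: "x \<in> ball x0 (R/4)" "\<epsilon> \<in> {0..1}" for \<epsilon> x
  proof -
    have sub: "q \<epsilon> x ` D \<subseteq> {0<..}" using q[OF x(1) _ x(2)] c0 by fastforce
    have "integrable lborel (\<lambda>y. \<alpha> y *\<^sub>R fund n (q \<epsilon> x y))"
      using q[OF x(1) _ x(2)] M0(2) vanish_D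
      by (intro integrable_scaleR_bounded[OF int(1) _ D_borel continuous_on_compose2[OF fund_continuous cq sub], of M0]) auto
    moreover have "integrable lborel (\<lambda>y. (x \<bullet> \<beta> y + \<gamma> y) *\<^sub>R q \<epsilon> x y powr (- real n / 2))"
      using q[OF x(1) _ x(2)] M1(2) vanish_D int
      by (intro integrable_scaleR_bounded[OF _ _ D_borel continuous_on_compose2[OF cP cq sub], of _ M1]) auto
    ultimately show ?thesis unfolding f_def by (intro borel_measurable_integrable Bochner_Integration.integrable_add)
  qed
  have pot_eq: "pot \<epsilon> x = (\<integral>y. f \<epsilon> x y \<partial>lborel)" for \<epsilon> x by (simp add: pot_def f_def q_def)
  show "\<exists>M. \<forall>x\<in>ball x0 (R/4). \<forall>\<epsilon>\<in>{0..1}. \<bar>pot \<epsilon> x\<bar> \<le> M"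
  proof (intro exI[of _ "\<integral>y. w y \<partial>lborel"] ballI)
    fix x \<epsilon> assume x: "x \<in> ball x0 (R/4)" "\<epsilon> \<in> {0..1::real}"
    have "integrable lborel (f \<epsilon> x)"
      by (rule Bochner_Integration.integrable_bound[OF w meas[OF x]])
        (use fw[OF x] in \<open>auto intro!: AE_I2 order_trans[OF _ abs_ge_self]\<close>)
    then have "norm (\<integral>y. f \<epsilon> x y \<partial>lborel) \<le> (\<integral>y. w y \<partial>lborel)"
      by (intro Bochner_Integration.integral_norm_bound_integral w fw[OF x])
    then show "\<bar>pot \<epsilon> x\<bar> \<le> (\<integral>y. w y \<partial>lborel)" by (simp add: pot_eq)
  qed
  assume x: "x \<in> ball x0 (R/4)"
  define e where "e k = inverse (real (Suc k))" for k
  have e: "e k \<in> {0..1}" for k by (auto simp: e_def field_simps)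
  have e0: "e \<longlonglongrightarrow> 0" unfolding e_def by (rule LIMSEQ_inverse_real_of_nat)
  have 0: "0 \<in> {0..1::real}" by simp
  have "(\<lambda>k. pot (e k) x) \<longlonglongrightarrow> pot 0 x"
    unfolding pot_eq
  proof (rule integral_dominated_convergence[where w = w])
    show "AE y in lborel. (\<lambda>k. f (e k) x y) \<longlonglongrightarrow> f 0 x y"
    proof (rule AE_I2)
      fix y
      show "(\<lambda>k. f (e k) x y) \<longlonglongrightarrow> f 0 x y"
      proof (cases "y \<in> D")
        case True
        have ql: "(\<lambda>k. q (e k) x y) \<longlonglongrightarrow> q 0 x y" unfolding q_def by (intro tendsto_intros e0)
        have q0: "q 0 x y > 0" using q[OF x True 0] c0 by auto
        have "isCont (fund n) (q 0 x y)" using fund_derivative[OF q0, of n UNIV] by (auto intro: DERIV_isCont)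
        then have "(\<lambda>k. fund n (q (e k) x y)) \<longlonglongrightarrow> fund n (q 0 x y)" using ql by (rule isCont_tendsto_compose)
        then show ?thesis unfolding f_def using q0 by (intro tendsto_intros ql) auto
      next
        case False then show ?thesis using vanish_D[OF False] by (simp add: f_def)
      qed
    qed
  qed (use meas[OF x 0] meas[OF x e] w fw[OF x e] in auto)
  then show "(\<lambda>k. pot (inverse (real (Suc k))) x) \<longlonglongrightarrow> pot 0 x" by (simp add: e_def)
qed

text \<open>Along a line the kernel extends holomorphically to a complex neighbourhood of the segment.\<close>

lemma pot_unique_continuation:
  assumes p: "p \<in> ball x0 (R/4)" and \<rho>: "\<rho> > 0" and zero: "\<And>x. x \<in> ball p \<rho> \<Longrightarrow> x \<in> ball x0 (R/4) \<Longrightarrow> pot 0 x = 0"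
    and x: "x \<in> ball x0 (R/4)"
  shows "pot 0 x = 0"
proof -
  define b where "b = x - p"
  \<comment> \<open>The complex neighbourhood extends by \<open>\<eta>\<close> beyond the segment.
    Since \<open>\<eta> * norm b \<le> R / 16\<close>, the real points stay at least
    \<open>3 * R / 16\<close> away from the annulus, which beats the imaginary contribution of at
    most \<open>R / 16\<close>.\<close>
  define \<eta> where "\<eta> = R / (16 * (norm b + 1))"
  have nb: "norm b + 1 > 0" by (simp add: add_nonneg_pos)
  have \<eta>: "\<eta> > 0" using R nb by (simp add: \<eta>_def)
  have \<eta>b: "\<eta> * norm b \<le> R / 16"
  proof -
    have "\<eta> * norm b \<le> \<eta> * (norm b + 1)" using \<eta> by simp
    also have "R / (16 * c) * c = R / 16" if "c > 0" for c :: real using that by simp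
    from this[OF nb] have "\<eta> * (norm b + 1) = R / 16" unfolding \<eta>_def .
    finally show ?thesis .
  qed
  define S T where "S = box (Complex (- \<eta>) (- \<eta>)) (Complex (1 + \<eta>) \<eta>)"
    and "T = cbox (Complex (- \<eta>) (- \<eta>)) (Complex (1 + \<eta>) \<eta>)"
  have ST: "S \<subseteq> T" "open S" "convex S" "compact T"
    unfolding S_def T_def by (rule box_subset_cbox, rule open_box, rule convex_box, rule compact_cbox)
  \<comment> \<open>The polynomial in \<open>t\<close> that continues the squared distance from
    \<open>y\<close> to the point with parameter \<open>t\<close> on the line (see
    \<open>Q_real\<close>).\<close>
  define Q where "Q t y = of_real ((norm (p - y))\<^sup>2) + 2 * of_real ((p - y) \<bullet> b) * t + of_real ((norm b)\<^sup>2) * t\<^sup>2" for t :: complex and y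
  define Q' where "Q' t y = 2 * of_real ((p - y) \<bullet> b) + 2 * of_real ((norm b)\<^sup>2) * t" for t :: complex and y
  have Q_real: "Q (of_real s) y = of_real ((norm (p + s *\<^sub>R b - y))\<^sup>2)" for s y
  proof -
    have "(norm ((p - y) + s *\<^sub>R b))\<^sup>2 = (norm (p - y))\<^sup>2 + (s\<^sup>2 * (norm b)\<^sup>2 + (2 * s) * ((p - y) \<bullet> b))" by (rule norm_add_scaleR_sq)
    moreover have "(p - y) + s *\<^sub>R b = p + s *\<^sub>R b - y" by simp
    moreover have "Q (of_real s) y = of_real ((norm (p - y))\<^sup>2 + (s\<^sup>2 * (norm b)\<^sup>2 + (2 * s) * ((p - y) \<bullet> b)))"
      unfolding Q_def by simp
    ultimately show ?thesis by (simp only:)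
  qed
  have Q_pos: "Re (Q t y) > 0" if t: "t \<in> T" and y: "y \<in> D" for t y
  proof -
    define s where "s = Re t"
    have s: "- \<eta> \<le> s" "s \<le> 1 + \<eta>" and im: "\<bar>Im t\<bar> \<le> \<eta>" using t by (auto simp: T_def s_def in_cbox_complex_iff)
    have "Re (Q t y) = Re (Q (of_real s) y) - (Im t)\<^sup>2 * (norm b)\<^sup>2"
      by (simp add: Q_def s_def power2_eq_square algebra_simps)
    then have re: "Re (Q t y) = (norm (p + s *\<^sub>R b - y))\<^sup>2 - (Im t)\<^sup>2 * (norm b)\<^sup>2" unfolding Q_real by simp
    define s' where "s' = max 0 (min 1 s)"
    have s': "0 \<le> s'" "s' \<le> 1" "\<bar>s - s'\<bar> \<le> \<eta>" using s \<eta> by (auto simp: s'_def)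
    have "p + s' *\<^sub>R b = (1 - s') *\<^sub>R p + s' *\<^sub>R x" by (simp add: b_def algebra_simps)
    also have "\<dots> \<in> ball x0 (R/4)" using s' p x by (intro convexD convex_ball) auto
    finally have "dist x0 (p + s' *\<^sub>R b) < R / 4" by simp
    moreover have "dist (p + s' *\<^sub>R b) (p + s *\<^sub>R b) \<le> R / 16"
    proof -
      have "(p + s' *\<^sub>R b) - (p + s *\<^sub>R b) = (s' - s) *\<^sub>R b" by (simp add: algebra_simps)
      then have "dist (p + s' *\<^sub>R b) (p + s *\<^sub>R b) = \<bar>s - s'\<bar> * norm b" unfolding dist_norm by (simp add: abs_minus_commute)
      also have "\<dots> \<le> \<eta> * norm b" using s' by (intro mult_right_mono) auto
      finally show ?thesis using \<eta>b by simp
    qed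
    moreover have "R / 2 \<le> dist x0 y" using y by (simp add: D_def)
    ultimately have "3 * R / 16 \<le> dist (p + s *\<^sub>R b) y"
      using dist_triangle[of x0 y "p + s *\<^sub>R b"] dist_triangle[of x0 "p + s *\<^sub>R b" "p + s' *\<^sub>R b"] by linarith
    then have "(3 * R / 16)\<^sup>2 \<le> (norm (p + s *\<^sub>R b - y))\<^sup>2" using R by (intro power_mono) (auto simp: dist_norm)
    moreover have "\<bar>Im t\<bar> * norm b \<le> R / 16" using mult_right_mono[OF im, of "norm b"] \<eta>b by simp
    then have "(Im t)\<^sup>2 * (norm b)\<^sup>2 \<le> (R / 16)\<^sup>2"
      using power_mono[of "\<bar>Im t\<bar> * norm b" "R / 16" 2] by (simp add: power_mult_distrib)
    moreover have "(R / 16)\<^sup>2 < (3 * R / 16)\<^sup>2" using R by (intro power_strict_mono) auto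
    ultimately show ?thesis unfolding re by linarith
  qed
  define P where "P z = z powr of_real (- real n / 2)" for z :: complex
  define P' where "P' z = of_real (- real n / 2) * z powr (of_real (- real n / 2) - 1)" for z :: complex
  have npR: "z \<notin> \<real>\<^sub>\<le>\<^sub>0" if "Re z > 0" for z using that complex_nonpos_Reals_iff by force
  have dP: "(P has_field_derivative P' z) (at z)" if "Re z > 0" for z
    unfolding P_def[abs_def] P'_def by (rule has_field_derivative_powr[OF npR[OF that]])
  have dF: "(cfund n has_field_derivative P z) (at z)" if "Re z > 0" for z
    unfolding P_def by (rule cfund_derivative[OF that])
  have cP: "continuous_on {z. Re z > 0} P"
    by (rule DERIV_continuous_on, rule has_field_derivative_at_within) (use dP in auto)
  have cF: "continuous_on {z. Re z > 0} (cfund n)"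
    by (rule DERIV_continuous_on, rule has_field_derivative_at_within) (use dF in auto)
  have cP': "continuous_on {z. Re z > 0} P'"
    unfolding P'_def[abs_def] using npR by (intro continuous_intros) auto
  have cQ2: "continuous_on A (\<lambda>z. Q (fst z) (snd z))" "continuous_on A (\<lambda>z. Q' (fst z) (snd z))" for A
    unfolding Q_def Q'_def by (intro continuous_intros)+
  have cQ: "continuous_on A (Q t)" "continuous_on A (Q' t)" for A t
    unfolding Q_def[abs_def] Q'_def[abs_def] by (intro continuous_intros)+
  have dQ: "((\<lambda>t. Q t y) has_field_derivative Q' t y) (at t)" for t y
    unfolding Q_def Q'_def by (auto intro!: derivative_eq_intros)
  \<comment> \<open>On the line the affine density splits into
    \<open>p \<bullet> \<beta> y + \<gamma> y\<close> and \<open>t\<close> times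
    \<open>b \<bullet> \<beta> y\<close>, so the integrand is holomorphic in
    \<open>t\<close>.\<close>
  define k where "k t y = \<alpha> y *\<^sub>R cfund n (Q t y) + (p \<bullet> \<beta> y + \<gamma> y) *\<^sub>R P (Q t y) + (b \<bullet> \<beta> y) *\<^sub>R (t * P (Q t y))" for t y
  define h1 where "h1 t y = P (Q t y) * Q' t y" for t y
  define h2 where "h2 t y = P' (Q t y) * Q' t y" for t y
  define h3 where "h3 t y = t * (P' (Q t y) * Q' t y) + P (Q t y)" for t y
  define k' where "k' t y = \<alpha> y *\<^sub>R h1 t y + (p \<bullet> \<beta> y + \<gamma> y) *\<^sub>R h2 t y + (b \<bullet> \<beta> y) *\<^sub>R h3 t y" for t y
  have vD: "\<alpha> y = 0" "p \<bullet> \<beta> y + \<gamma> y = 0" "b \<bullet> \<beta> y = 0" if "y \<notin> D" for y using vanish_D[OF that] by auto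
  have i3: "integrable lborel (\<lambda>y. p \<bullet> \<beta> y + \<gamma> y)" "integrable lborel (\<lambda>y. b \<bullet> \<beta> y)" using int by auto
  have bounded_ex: "\<exists>M. \<forall>t\<in>T. \<forall>y\<in>D. norm (h t y) \<le> M"
    if "continuous_on (T \<times> D) (\<lambda>z. h (fst z) (snd z))" for h :: "complex \<Rightarrow> 'a \<Rightarrow> complex"
  proof -
    have "compact ((\<lambda>z. h (fst z) (snd z)) ` (T \<times> D))" using that ST compact_D by (intro compact_continuous_image compact_Times)
    then obtain M where "\<forall>z\<in>T \<times> D. norm (h (fst z) (snd z)) \<le> M" by (auto dest!: compact_imp_bounded simp: bounded_iff)
    then show ?thesis by auto
  qed
  have comp2: "continuous_on (T \<times> D) (\<lambda>z. h (Q (fst z) (snd z)))" if "continuous_on {z. Re z > 0} h" for h :: "complex \<Rightarrow> complex"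
    by (rule continuous_on_compose2[OF that cQ2(1)]) (use Q_pos in auto)
  have comp1: "continuous_on D (\<lambda>y. h (Q t y))" if "continuous_on {z. Re z > 0} h" "t \<in> T" for h :: "complex \<Rightarrow> complex" and t
    by (rule continuous_on_compose2[OF that(1) cQ(1)]) (use Q_pos that in auto)
  obtain F0 where F0: "\<forall>t\<in>T. \<forall>y\<in>D. norm (cfund n (Q t y)) \<le> F0" using bounded_ex[OF comp2[OF cF]] by blast
  obtain P0 where P0: "\<forall>t\<in>T. \<forall>y\<in>D. norm (P (Q t y)) \<le> P0" using bounded_ex[OF comp2[OF cP]] by blast
  have "continuous_on (T \<times> D) (\<lambda>z. fst z * P (Q (fst z) (snd z)))" by (intro continuous_intros comp2 cP)
  from bounded_ex[of "\<lambda>t y. t * P (Q t y)", OF this] obtain P1 where P1: "\<forall>t\<in>T. \<forall>y\<in>D. norm (t * P (Q t y)) \<le> P1" by blast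
  have ch: "continuous_on (T \<times> D) (\<lambda>z. h1 (fst z) (snd z))" "continuous_on (T \<times> D) (\<lambda>z. h2 (fst z) (snd z))"
    "continuous_on (T \<times> D) (\<lambda>z. h3 (fst z) (snd z))"
    unfolding h1_def h2_def h3_def by (intro continuous_intros comp2 cP cP' cQ2)+
  obtain H1 where H1: "\<forall>t\<in>T. \<forall>y\<in>D. norm (h1 t y) \<le> H1" using bounded_ex[of h1, OF ch(1)] by blast
  obtain H2 where H2: "\<forall>t\<in>T. \<forall>y\<in>D. norm (h2 t y) \<le> H2" using bounded_ex[of h2, OF ch(2)] by blast
  obtain H3 where H3: "\<forall>t\<in>T. \<forall>y\<in>D. norm (h3 t y) \<le> H3" using bounded_ex[of h3, OF ch(3)] by blast
  have int_k: "integrable lborel (k t)" if "t \<in> S" for t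
  proof -
    have t: "t \<in> T" using that ST by blast
    have "integrable lborel (\<lambda>y. \<alpha> y *\<^sub>R cfund n (Q t y))"
      by (rule integrable_scaleR_bounded[OF int(1) vD(1) D_borel comp1[OF cF t], of F0]) (use F0 t in auto)
    moreover have "integrable lborel (\<lambda>y. (p \<bullet> \<beta> y + \<gamma> y) *\<^sub>R P (Q t y))"
      by (rule integrable_scaleR_bounded[OF i3(1) vD(2) D_borel comp1[OF cP t], of P0]) (use P0 t in auto)
    moreover have "integrable lborel (\<lambda>y. (b \<bullet> \<beta> y) *\<^sub>R (t * P (Q t y)))"
      by (rule integrable_scaleR_bounded[OF i3(2) vD(3) D_borel, of _ P1]) (use P1 t in \<open>auto intro!: continuous_intros comp1 cP\<close>)
    ultimately show ?thesis unfolding k_def by (intro Bochner_Integration.integrable_add)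
  qed
  have int_k': "integrable lborel (k' t)" if "t \<in> S" for t
  proof -
    have t: "t \<in> T" using that ST by blast
    have c: "continuous_on D (h1 t)" "continuous_on D (h2 t)" "continuous_on D (h3 t)"
      unfolding h1_def[abs_def] h2_def[abs_def] h3_def[abs_def] by (intro continuous_intros comp1 cP cP' cQ t)+
    have "integrable lborel (\<lambda>y. \<alpha> y *\<^sub>R h1 t y)"
      by (rule integrable_scaleR_bounded[OF int(1) vD(1) D_borel c(1), of H1]) (use H1 t in auto)
    moreover have "integrable lborel (\<lambda>y. (p \<bullet> \<beta> y + \<gamma> y) *\<^sub>R h2 t y)"
      by (rule integrable_scaleR_bounded[OF i3(1) vD(2) D_borel c(2), of H2]) (use H2 t in auto)
    moreover have "integrable lborel (\<lambda>y. (b \<bullet> \<beta> y) *\<^sub>R h3 t y)"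
      by (rule integrable_scaleR_bounded[OF i3(2) vD(3) D_borel c(3), of H3]) (use H3 t in auto)
    ultimately show ?thesis unfolding k'_def by (intro Bochner_Integration.integrable_add)
  qed
  define w where "w y = \<bar>\<alpha> y\<bar> * H1 + \<bar>p \<bullet> \<beta> y + \<gamma> y\<bar> * H2 + \<bar>b \<bullet> \<beta> y\<bar> * H3" for y
  have w: "integrable lborel w" unfolding w_def using int i3 by auto
  define g where "g t = (\<integral>y. k t y \<partial>lborel)" for t
  have hol: "g holomorphic_on S"
    unfolding g_def
  proof (rule integral_holomorphic[OF ST(2,3) int_k _ _ w])
    show "k' t \<in> borel_measurable lborel" if "t \<in> S" for t using int_k'[OF that] by auto
    show "((\<lambda>t. k t y) has_field_derivative k' t y) (at t)" if "t \<in> S" for t y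
    proof (cases "y \<in> D")
      case True
      have re: "Re (Q t y) > 0" using Q_pos True that ST by blast
      have 1: "((\<lambda>t. cfund n (Q t y)) has_field_derivative h1 t y) (at t)"
        unfolding h1_def by (rule DERIV_chain2[OF dF[OF re] dQ])
      have 2: "((\<lambda>t. P (Q t y)) has_field_derivative h2 t y) (at t)"
        unfolding h2_def by (rule DERIV_chain2[OF dP[OF re] dQ])
      have 3: "((\<lambda>t. t * P (Q t y)) has_field_derivative h3 t y) (at t)"
        using DERIV_mult[OF DERIV_ident 2] by (simp add: h3_def h2_def algebra_simps)
      show ?thesis unfolding k_def k'_def scaleR_conv_of_real by (intro DERIV_add DERIV_cmult 1 2 3)
    next
      case False
      then show ?thesis using vD[OF False] by (simp add: k_def k'_def)
    qed
    show "norm (k' t y) \<le> w y" if "t \<in> S" for t y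
    proof (cases "y \<in> D")
      case True
      have t: "t \<in> T" using that ST by blast
      have "norm (k' t y) \<le> norm (\<alpha> y *\<^sub>R h1 t y) + norm ((p \<bullet> \<beta> y + \<gamma> y) *\<^sub>R h2 t y) + norm ((b \<bullet> \<beta> y) *\<^sub>R h3 t y)"
        unfolding k'_def by (intro norm_triangle_le add_mono norm_triangle_ineq order_refl)
      also have "\<dots> \<le> w y"
        unfolding w_def norm_scaleR using H1 H2 H3 t True by (intro add_mono mult_left_mono) auto
      finally show ?thesis .
    next
      case False
      then show ?thesis using vD[OF False] by (simp add: k'_def w_def)
    qed
  qed
  have g_real: "g (of_real s) = of_real (pot 0 (p + s *\<^sub>R b))" if s: "0 \<le> s" "s \<le> 1" for s
  proof -
    have keq: "k (of_real s) y = of_real (\<alpha> y *\<^sub>R fund n ((norm (p + s *\<^sub>R b - y))\<^sup>2 + 0\<^sup>2)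
     + ((p + s *\<^sub>R b) \<bullet> \<beta> y + \<gamma> y) *\<^sub>R ((norm (p + s *\<^sub>R b - y))\<^sup>2 + 0\<^sup>2) powr (- real n / 2))" for y
    proof (cases "y \<in> D")
      case True
      have "of_real s \<in> T" using s \<eta> by (auto simp: T_def in_cbox_complex_iff)
      from Q_pos[OF this True] have pos: "(norm (p + s *\<^sub>R b - y))\<^sup>2 > 0" unfolding Q_real by simp
      have "P (of_real ((norm (p + s *\<^sub>R b - y))\<^sup>2)) = of_real (((norm (p + s *\<^sub>R b - y))\<^sup>2) powr (- real n / 2))"
        unfolding P_def by (rule cpowr_of_real[OF pos])
      moreover have "cfund n (of_real ((norm (p + s *\<^sub>R b - y))\<^sup>2)) = of_real (fund n ((norm (p + s *\<^sub>R b - y))\<^sup>2))"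
        by (rule cfund_of_real[OF pos])
      ultimately show ?thesis unfolding k_def Q_real
        by (simp only: zero_power2 add_0_right scaleR_conv_of_real of_real_add of_real_mult inner_add_left inner_scaleR_left real_scaleR_def)
          (simp add: algebra_simps)
    next
      case False
      then show ?thesis using vD[OF False] vanish_D[OF False] by (simp add: k_def)
    qed
    show ?thesis unfolding g_def pot_def by (simp only: integral_complex_of_real[symmetric] keq[symmetric])
  qed
  \<comment> \<open>For parameters below \<open>\<rho>'\<close> the line is still in
    \<open>ball p \<rho>\<close>, so the zeros of \<open>g\<close> accumulate at 0 and the identity
    theorem applies.\<close>
  define \<rho>' where "\<rho>' = min 1 (\<rho> / (norm b + 1))"
  have \<rho>': "0 < \<rho>'" "\<rho>' \<le> 1" "\<rho>' * norm b \<le> \<rho>"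
  proof -
    show "0 < \<rho>'" "\<rho>' \<le> 1" using \<rho> nb by (auto simp: \<rho>'_def)
    have "\<rho>' * norm b \<le> \<rho> / (norm b + 1) * (norm b + 1)" using \<rho> nb by (intro mult_mono) (auto simp: \<rho>'_def)
    then show "\<rho>' * norm b \<le> \<rho>" using nb by simp
  qed
  have inS: "of_real s \<in> S" if "0 \<le> s" "s \<le> 1" for s using that \<eta> by (auto simp: S_def in_box_complex_iff)
  define U where "U = (of_real :: real \<Rightarrow> complex) ` {0<..<\<rho>'}"
  have "g (of_real 1) = 0"
  proof (rule analytic_continuation[OF hol ST(2) convex_connected[OF ST(3)], of U "of_real 0"])
    show "U \<subseteq> S" using inS \<rho>' by (auto simp: U_def)
    show "of_real 0 \<in> S" "of_real 1 \<in> S" using inS[of 0] inS[of 1] by auto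
    show "(of_real 0 :: complex) islimpt U"
      unfolding islimpt_sequential
    proof (intro exI[of _ "\<lambda>k. of_real (\<rho>' * (1/2)^Suc k)"] conjI allI)
      fix k
      have "(1/2::real)^Suc k < 1" by (rule power_Suc_less_one) auto
      then have "\<rho>' * (1/2)^Suc k \<in> {0<..<\<rho>'}" using \<rho>' by simp
      then have "of_real (\<rho>' * (1/2)^Suc k) \<in> U" unfolding U_def by (rule imageI)
      moreover have "(of_real (\<rho>' * (1/2)^Suc k) :: complex) \<noteq> of_real 0" using \<rho>' by (simp only: of_real_eq_iff) simp
      ultimately show "of_real (\<rho>' * (1/2)^Suc k) \<in> U - {of_real 0 :: complex}" by blast
    next
      have "(\<lambda>k. \<rho>' * (1/2)^Suc k) \<longlonglongrightarrow> \<rho>' * 0"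
        by (intro tendsto_intros LIMSEQ_Suc LIMSEQ_power_zero) simp
      then show "(\<lambda>k. complex_of_real (\<rho>' * (1/2)^Suc k)) \<longlonglongrightarrow> of_real 0"
        by (intro tendsto_of_real) simp
    qed
    fix z assume "z \<in> U"
    then obtain s where s: "z = of_real s" "0 < s" "s < \<rho>'" by (auto simp: U_def)
    \<comment> \<open>If \<open>b = 0\<close> then \<open>x = p\<close> and the line degenerates to
      one point.\<close>
    have "dist p (p + s *\<^sub>R b) < \<rho> \<or> b = 0"
    proof (cases "b = 0")
      case False
      have "dist p (p + s *\<^sub>R b) = s * norm b" using s by (simp add: dist_norm)
      also have "\<dots> < \<rho>' * norm b" using s False by (intro mult_strict_right_mono) auto
      finally show ?thesis using \<rho>' by simp
    qed simp
    then have "p + s *\<^sub>R b \<in> ball p \<rho>" using \<rho> by auto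
    moreover have "p + s *\<^sub>R b = (1 - s) *\<^sub>R p + s *\<^sub>R x" by (simp add: b_def algebra_simps)
    then have "p + s *\<^sub>R b \<in> ball x0 (R/4)" using s \<rho>' p x by (simp only:) (intro convexD convex_ball, auto)
    ultimately show "g z = 0" using g_real[of s] s \<rho>' zero by simp
  qed
  then show ?thesis using g_real[of 1] by (simp add: b_def)
qed

end

section \<open>Local unique continuation\<close>

lemma integrable_scaleR_compact:
  fixes f :: "'a::euclidean_space \<Rightarrow> 'b::{banach, second_countable_topology}"
  assumes "integrable lborel \<alpha>" "bounded B" "\<And>y. y \<notin> B \<Longrightarrow> \<alpha> y = 0" and f: "continuous_on UNIV f"
  shows "integrable lborel (\<lambda>y. \<alpha> y *\<^sub>R f y)"
proof -
  have "compact (closure B)" using assms(2) by simp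
  then have "compact (f ` closure B)" using f by (intro compact_continuous_image) (auto intro: continuous_on_subset)
  then have "\<exists>M. \<forall>y\<in>closure B. norm (f y) \<le> M" by (auto dest!: compact_imp_bounded simp: bounded_iff)
  then obtain M where M: "\<And>y. y \<in> closure B \<Longrightarrow> norm (f y) \<le> M" by blast
  show ?thesis
    by (rule integrable_scaleR_bounded[OF assms(1) _ _ continuous_on_subset[OF f] M])
      (use assms(3) closure_subset[of B] in auto)
qed

lemma C1_eq: "C1_grad \<phi> d\<phi> \<Longrightarrow> (\<And>x. \<phi> x = \<psi> x) \<Longrightarrow> (\<And>x. d\<phi> x = d\<psi> x) \<Longrightarrow> C1_grad \<psi> d\<psi>"
  by (metis ext)

lemma lborel_integral_translate:
  fixes f :: "'a::euclidean_space \<Rightarrow> real"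
  assumes "f \<in> borel_measurable borel"
  shows "(\<integral>x. f (x + c) \<partial>lborel) = (\<integral>x. f x \<partial>lborel)"
proof -
  have "(\<integral>x. f x \<partial>lborel) = (\<integral>x. f x \<partial>distr lborel borel ((+) c))" by (simp add: lborel_distr_plus)
  also have "\<dots> = (\<integral>x. f (x + c) \<partial>lborel)"
    using assms by (subst integral_distr) (auto simp: add.commute)
  finally show ?thesis by simp
qed

text \<open>Meant for functions extended by zero to the whole space. \<open>weak_gradient\<close>
  admits test functions without compact support, which expresses that no jump occurs at the edge of
  the original domain; \<open>harmonic\<close> is tested only with functions that vanish outside one
  ball.\<close>

locale harmonic_region =
  fixes v :: "'a::euclidean_space \<Rightarrow> real" and G :: "'a \<Rightarrow> 'a" and x0 :: 'a and R :: real and B :: "'a set"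
  assumes R: "R > 0" and iv: "integrable lborel v" and iG: "integrable lborel G"
    and B: "bounded B" "\<And>y. y \<notin> B \<Longrightarrow> v y = 0" "\<And>y. y \<notin> B \<Longrightarrow> G y = 0"
    and weak_gradient: "\<And>f df i. C1_grad f df \<Longrightarrow> i \<in> Basis \<Longrightarrow> (\<integral>y. v y * (df y \<bullet> i) + f y * (G y \<bullet> i) \<partial>lborel) = 0"
    and harmonic: "\<And>f df. C1_grad f df \<Longrightarrow> (\<And>y. y \<notin> ball x0 R \<Longrightarrow> f y = 0) \<Longrightarrow> (\<integral>y. G y \<bullet> df y \<partial>lborel) = 0"
begin

text \<open>The Laplacian of \<open>fund DIM('a) ((norm z)\<^sup>2 + \<epsilon>\<^sup>2)\<close> in
  \<open>z\<close>. It scales like an approximate identity: its total mass is independent of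
  \<open>\<epsilon>\<close> and gathers at 0.\<close>

definition ps :: "real \<Rightarrow> 'a \<Rightarrow> real" where
  "ps \<epsilon> z = 2 * real DIM('a) * \<epsilon>\<^sup>2 * ((norm z)\<^sup>2 + \<epsilon>\<^sup>2) powr (- real DIM('a) / 2 - 1)"

lemma integrable_v_mult: "continuous_on UNIV g \<Longrightarrow> integrable lborel (\<lambda>y. v y * g y)"
  using integrable_scaleR_compact[OF iv B(1,2), of g] by simp

lemma integrable_G_inner:
  assumes g: "continuous_on UNIV g"
  shows "integrable lborel (\<lambda>y. G y \<bullet> g y)"
proof -
  have "integrable lborel (\<lambda>y. \<Sum>i\<in>Basis. (G y \<bullet> i) *\<^sub>R (g y \<bullet> i))"
    using iG B by (intro Bochner_Integration.integrable_sum integrable_scaleR_compact[OF _ B(1)] continuous_intros g integrable_inner_left) auto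
  moreover have "(\<lambda>y. \<Sum>i\<in>Basis. (G y \<bullet> i) *\<^sub>R (g y \<bullet> i)) = (\<lambda>y. G y \<bullet> g y)"
    by (rule ext, subst euclidean_inner) simp
  ultimately show ?thesis by simp
qed

lemma ps_continuous: "\<epsilon> > 0 \<Longrightarrow> continuous_on A (ps \<epsilon>)"
  unfolding ps_def by (intro continuous_intros) (auto simp: sum_power2_eq_zero_iff)

lemma ps_nonneg: "0 \<le> ps \<epsilon> z"
  by (simp add: ps_def)

lemma ps_le:
  assumes "\<delta> > 0" "\<delta> \<le> norm z"
  shows "ps \<epsilon> z \<le> 2 * real DIM('a) * \<epsilon>\<^sup>2 * (\<delta>\<^sup>2) powr (- real DIM('a) / 2 - 1)"
proof -
  have "\<delta>\<^sup>2 \<le> (norm z)\<^sup>2 + \<epsilon>\<^sup>2" using power_mono[OF assms(2), of 2] assms(1) by (simp add: add_increasing2)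
  then have "((norm z)\<^sup>2 + \<epsilon>\<^sup>2) powr (- real DIM('a) / 2 - 1) \<le> (\<delta>\<^sup>2) powr (- real DIM('a) / 2 - 1)"
    using assms by (intro powr_mono2') auto
  then show ?thesis unfolding ps_def by (intro mult_left_mono) auto
qed

context
  fixes \<kappa> :: "'a \<Rightarrow> real" and d\<kappa> :: "'a \<Rightarrow> 'a"
  assumes \<kappa>: "C1_grad \<kappa> d\<kappa>" and \<kappa>1: "\<And>y. 0 \<le> \<kappa> y \<and> \<kappa> y \<le> 1"
    and \<kappa>_in: "\<And>y. dist x0 y \<le> R / 2 \<Longrightarrow> \<kappa> y = 1 \<and> d\<kappa> y = 0"
    and \<kappa>_out: "\<And>y. dist x0 y \<ge> 3 * R / 4 \<Longrightarrow> \<kappa> y = 0 \<and> d\<kappa> y = 0"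
begin

interpretation annulus_potential x0 R "DIM('a)" "\<lambda>y. G y \<bullet> d\<kappa> y" "\<lambda>y. (- 2 * v y) * (d\<kappa> y \<bullet> y)" "\<lambda>y. (2 * v y) *\<^sub>R d\<kappa> y"
proof
  note c = C1_continuous_grad[OF \<kappa>, of UNIV]
  show "integrable lborel (\<lambda>y. G y \<bullet> d\<kappa> y)" by (rule integrable_G_inner[OF c])
  show "integrable lborel (\<lambda>y. (2 * v y) *\<^sub>R d\<kappa> y)"
    using integrable_scaleR_compact[OF iv B(1,2) c] by (simp flip: scaleR_scaleR)
  have "integrable lborel (\<lambda>y. (-2) * (v y * (d\<kappa> y \<bullet> y)))"
    by (intro integrable_mult_right integrable_v_mult continuous_intros c)
  then show "integrable lborel (\<lambda>y. (- 2 * v y) * (d\<kappa> y \<bullet> y))" by (simp only: mult.assoc)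
  fix y assume "\<not> (R / 2 \<le> dist x0 y \<and> dist x0 y \<le> R)"
  then have "dist x0 y \<le> R / 2 \<or> dist x0 y \<ge> 3 * R / 4" using R by auto
  then have "d\<kappa> y = 0" using \<kappa>_in \<kappa>_out by blast
  then show "G y \<bullet> d\<kappa> y = 0 \<and> (2 * v y) *\<^sub>R d\<kappa> y = 0 \<and> (- 2 * v y) * (d\<kappa> y \<bullet> y) = 0" by simp
qed (rule R)

text \<open>The representation formula: cut off with \<open>\<kappa>\<close> and test with the regularized fundamental
  solution centred at \<open>x\<close>, whose Laplacian is the approximate identity \<open>ps\<close>.\<close>

lemma representation:
  assumes \<epsilon>: "\<epsilon> > 0"
  shows "(\<integral>y. v y * \<kappa> y * ps \<epsilon> (x - y) \<partial>lborel) = pot \<epsilon> x"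
proof -
  define q where "q y = (norm (y - x))\<^sup>2 + \<epsilon>\<^sup>2" for y
  have q0: "q y > 0" for y using \<epsilon> by (simp add: q_def add_nonneg_pos)
  have Cq: "C1_grad q (\<lambda>y. 2 *\<^sub>R (y - x))"
    by (rule C1_eq[OF C1_add[OF C1_norm_sq[of x] C1_const[of "\<epsilon>\<^sup>2"]]]) (auto simp: q_def)
  have cq: "continuous_on A q" for A using C1_continuous[OF Cq] .
  define m where "m y = q y powr (- real DIM('a) / 2)" for y
  define m' where "m' y = - real DIM('a) / 2 * q y powr (- real DIM('a) / 2 - 1)" for y
  define N where "N y = fund DIM('a) (q y)" for y
  have cm: "continuous_on A m" "continuous_on A m'" for A
    unfolding m_def m'_def by (intro continuous_intros cq; use q0 in \<open>auto simp: less_imp_neq[symmetric]\<close>)+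
  have Cm: "C1_grad m (\<lambda>y. m' y *\<^sub>R (2 *\<^sub>R (y - x)))"
    unfolding m_def[abs_def] m'_def
  proof (rule C1_compose[OF Cq, where F' = "\<lambda>t. - real DIM('a) / 2 * t powr (- real DIM('a) / 2 - 1)"])
    show "((\<lambda>t. t powr (- real DIM('a) / 2)) has_real_derivative - real DIM('a) / 2 * q y powr (- real DIM('a) / 2 - 1)) (at (q y))" for y
      by (rule has_real_derivative_powr[OF q0])
    show "continuous_on UNIV (\<lambda>y. - real DIM('a) / 2 * q y powr (- real DIM('a) / 2 - 1))" using cm(2) unfolding m'_def[abs_def] .
  qed
  have CN: "C1_grad N (\<lambda>y. m y *\<^sub>R (2 *\<^sub>R (y - x)))"
    unfolding N_def[abs_def] m_def
  proof (rule C1_compose[OF Cq, where F' = "\<lambda>t. t powr (- real DIM('a) / 2)"])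
    show "(fund DIM('a) has_real_derivative q y powr (- real DIM('a) / 2)) (at (q y))" for y
      by (rule fund_derivative[OF q0])
    show "continuous_on UNIV (\<lambda>y. q y powr (- real DIM('a) / 2))" using cm(1) unfolding m_def[abs_def] .
  qed
  define l where "l i y = y \<bullet> (2 *\<^sub>R i) + (- (x \<bullet> (2 *\<^sub>R i)))" for i y :: 'a
  have l: "l i y = 2 * ((y - x) \<bullet> i)" for i y by (simp add: l_def inner_diff_left)
  have Cl: "C1_grad (l i) (\<lambda>_. 2 *\<^sub>R i)" for i
    by (rule C1_eq[OF C1_add[OF C1_inner[of "2 *\<^sub>R i"] C1_const[of "- (x \<bullet> (2 *\<^sub>R i))"]]]) (auto simp: l_def)
  \<comment> \<open>Components of the vector field \<open>\<kappa>\<close> times the gradient of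
    \<open>N\<close>; \<open>l i y\<close> is twice the coordinate of \<open>y - x\<close> along
    \<open>i\<close>. The weak gradient is tested with each component and the results are
    added.\<close>
  define f where "f i y = \<kappa> y * (m y * l i y)" for i y
  define df where "df i y = \<kappa> y *\<^sub>R (m y *\<^sub>R (2 *\<^sub>R i) + l i y *\<^sub>R (m' y *\<^sub>R (2 *\<^sub>R (y - x)))) + (m y * l i y) *\<^sub>R d\<kappa> y" for i y
  have Cf: "C1_grad (f i) (df i)" for i
    unfolding f_def[abs_def] df_def[abs_def] by (intro C1_mult \<kappa> Cm Cl)
  note conts = C1_continuous[OF \<kappa>, of UNIV] C1_continuous_grad[OF \<kappa>, of UNIV] cm C1_continuous[OF CN]
  have int_i: "integrable lborel (\<lambda>y. v y * (df i y \<bullet> i) + f i y * (G y \<bullet> i))" for i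
  proof -
    have "integrable lborel (\<lambda>y. v y * (df i y \<bullet> i))"
      by (intro integrable_v_mult continuous_intros C1_continuous_grad[OF Cf])
    moreover have "integrable lborel (\<lambda>y. G y \<bullet> (f i y *\<^sub>R i))"
      by (intro integrable_G_inner continuous_intros C1_continuous[OF Cf])
    ultimately show ?thesis by simp
  qed
  have "(\<integral>y. (\<Sum>i\<in>Basis. v y * (df i y \<bullet> i) + f i y * (G y \<bullet> i)) \<partial>lborel) = (\<Sum>i\<in>Basis. (\<integral>y. v y * (df i y \<bullet> i) + f i y * (G y \<bullet> i) \<partial>lborel))"
    by (rule Bochner_Integration.integral_sum) (rule int_i)
  also have "\<dots> = 0" using weak_gradient[OF Cf] by simp
  finally have 1: "(\<integral>y. (\<Sum>i\<in>Basis. v y * (df i y \<bullet> i) + f i y * (G y \<bullet> i)) \<partial>lborel) = 0" .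
  have sum_eq: "(\<Sum>i\<in>Basis. v y * (df i y \<bullet> i) + f i y * (G y \<bullet> i))
      = v y * \<kappa> y * ps \<epsilon> (x - y) + 2 * v y * m y * (d\<kappa> y \<bullet> (y - x)) + 2 * \<kappa> y * m y * (G y \<bullet> (y - x))" for y
  proof -
    have bb: "(\<Sum>i\<in>Basis. ((y - x) \<bullet> i) * ((y - x) \<bullet> i)) = (norm (y - x))\<^sup>2"
      unfolding power2_norm_eq_inner by (subst euclidean_inner[of "y - x" "y - x"]) simp
    have bk: "(\<Sum>i\<in>Basis. ((y - x) \<bullet> i) * (d\<kappa> y \<bullet> i)) = d\<kappa> y \<bullet> (y - x)"
      by (subst euclidean_inner[of "d\<kappa> y" "y - x"]) (simp add: mult.commute)
    have bG: "(\<Sum>i\<in>Basis. ((y - x) \<bullet> i) * (G y \<bullet> i)) = G y \<bullet> (y - x)"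
      by (subst euclidean_inner[of "G y" "y - x"]) (simp add: mult.commute)
    have "(\<Sum>i\<in>Basis. v y * (df i y \<bullet> i) + f i y * (G y \<bullet> i))
      = (\<Sum>i\<in>Basis. 2 * v y * \<kappa> y * m y + (4 * v y * \<kappa> y * m' y) * (((y - x) \<bullet> i) * ((y - x) \<bullet> i))
          + (2 * v y * m y) * (((y - x) \<bullet> i) * (d\<kappa> y \<bullet> i)) + (2 * \<kappa> y * m y) * (((y - x) \<bullet> i) * (G y \<bullet> i)))"
    proof (rule sum.cong[OF refl])
      fix i :: 'a assume i: "i \<in> Basis"
      then have ii: "i \<bullet> i = 1" by simp
      have "df i y \<bullet> i = \<kappa> y * (2 * m y + 4 * (((y - x) \<bullet> i) * ((y - x) \<bullet> i)) * m' y) + 2 * m y * (((y - x) \<bullet> i) * (d\<kappa> y \<bullet> i))"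
        unfolding df_def l inner_add_left inner_scaleR_left ii by (simp only: algebra_simps)
      then show "v y * (df i y \<bullet> i) + f i y * (G y \<bullet> i) = 2 * v y * \<kappa> y * m y + (4 * v y * \<kappa> y * m' y) * (((y - x) \<bullet> i) * ((y - x) \<bullet> i))
          + (2 * v y * m y) * (((y - x) \<bullet> i) * (d\<kappa> y \<bullet> i)) + (2 * \<kappa> y * m y) * (((y - x) \<bullet> i) * (G y \<bullet> i))"
        unfolding f_def l by algebra
    qed
    also have "\<dots> = real DIM('a) * (2 * v y * \<kappa> y * m y) + (4 * v y * \<kappa> y * m' y) * (norm (y - x))\<^sup>2
          + (2 * v y * m y) * (d\<kappa> y \<bullet> (y - x)) + (2 * \<kappa> y * m y) * (G y \<bullet> (y - x))"
      by (simp only: sum.distrib sum_distrib_left[symmetric] bb bk bG sum_constant mult.left_commute[of _ "real DIM('a)"])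
    also have "real DIM('a) * (2 * v y * \<kappa> y * m y) + (4 * v y * \<kappa> y * m' y) * (norm (y - x))\<^sup>2 = v y * \<kappa> y * ps \<epsilon> (x - y)"
    proof -
      define c where "c = q y powr (- real DIM('a) / 2 - 1)"
      have mc: "m y = q y * c" unfolding m_def c_def using q0[of y] by (simp add: powr_mult_base)
      have m'c: "m' y = - real DIM('a) / 2 * c" by (simp add: m'_def c_def)
      have pc: "ps \<epsilon> (x - y) = 2 * real DIM('a) * \<epsilon>\<^sup>2 * c" by (simp add: ps_def c_def q_def norm_minus_commute)
      show ?thesis unfolding mc m'c pc q_def by (simp add: algebra_simps)
    qed
    finally show ?thesis by (simp only: mult.assoc)
  qed
  have i1: "integrable lborel (\<lambda>y. v y * \<kappa> y * ps \<epsilon> (x - y))"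
    using integrable_v_mult[of "\<lambda>y. \<kappa> y * ps \<epsilon> (x - y)"] \<epsilon>
    by (simp add: mult.assoc continuous_intros conts continuous_on_compose2[OF ps_continuous[of \<epsilon> UNIV]])
  have i2: "integrable lborel (\<lambda>y. 2 * v y * m y * (d\<kappa> y \<bullet> (y - x)))"
  proof -
    have "integrable lborel (\<lambda>y. v y * (2 * m y * (d\<kappa> y \<bullet> (y - x))))" by (intro integrable_v_mult continuous_intros conts)
    then show ?thesis by (simp add: mult_ac)
  qed
  have i3: "integrable lborel (\<lambda>y. 2 * \<kappa> y * m y * (G y \<bullet> (y - x)))"
    using integrable_G_inner[of "\<lambda>y. (2 * \<kappa> y * m y) *\<^sub>R (y - x)"] by (simp add: continuous_intros conts)
  have i4: "integrable lborel (\<lambda>y. N y * (G y \<bullet> d\<kappa> y))"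
    using integrable_G_inner[of "\<lambda>y. N y *\<^sub>R d\<kappa> y"] by (simp add: continuous_intros conts)
  from 1 have A: "(\<integral>y. v y * \<kappa> y * ps \<epsilon> (x - y) \<partial>lborel) + (\<integral>y. 2 * v y * m y * (d\<kappa> y \<bullet> (y - x)) \<partial>lborel)
      + (\<integral>y. 2 * \<kappa> y * m y * (G y \<bullet> (y - x)) \<partial>lborel) = 0"
    unfolding sum_eq using i1 i2 i3 by simp
  \<comment> \<open>Testing harmonicity with the product of \<open>\<kappa>\<close> and
    \<open>N\<close> trades the remaining term, \<open>G\<close> paired with \<open>\<kappa>\<close>
    times the gradient of \<open>N\<close>, for one with \<open>d\<kappa>\<close>; only sources in
    the annulus are left.\<close>
  have "(\<integral>y. G y \<bullet> (\<kappa> y *\<^sub>R (m y *\<^sub>R (2 *\<^sub>R (y - x))) + N y *\<^sub>R d\<kappa> y) \<partial>lborel) = 0"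
  proof (rule harmonic[OF C1_mult[OF \<kappa> CN]])
    fix y assume "y \<notin> ball x0 R"
    then show "\<kappa> y * N y = 0" using \<kappa>_out[of y] R by simp
  qed
  also have "(\<lambda>y. G y \<bullet> (\<kappa> y *\<^sub>R (m y *\<^sub>R (2 *\<^sub>R (y - x))) + N y *\<^sub>R d\<kappa> y))
      = (\<lambda>y. 2 * \<kappa> y * m y * (G y \<bullet> (y - x)) + N y * (G y \<bullet> d\<kappa> y))"
    by (simp add: fun_eq_iff inner_add_right)
  finally have "(\<integral>y. 2 * \<kappa> y * m y * (G y \<bullet> (y - x)) \<partial>lborel) + (\<integral>y. N y * (G y \<bullet> d\<kappa> y) \<partial>lborel) = 0"
    using i3 i4 by simp
  with A have "(\<integral>y. v y * \<kappa> y * ps \<epsilon> (x - y) \<partial>lborel)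
     = (\<integral>y. N y * (G y \<bullet> d\<kappa> y) \<partial>lborel) - (\<integral>y. 2 * v y * m y * (d\<kappa> y \<bullet> (y - x)) \<partial>lborel)" by simp
  also have "\<dots> = (\<integral>y. N y * (G y \<bullet> d\<kappa> y) - 2 * v y * m y * (d\<kappa> y \<bullet> (y - x)) \<partial>lborel)"
    using i4 i2 by simp
  also have "\<dots> = pot \<epsilon> x"
    unfolding pot_def
    by (intro Bochner_Integration.integral_cong)
      (simp_all add: N_def m_def q_def norm_minus_commute[of x] inner_diff_right inner_commute algebra_simps)
  finally show ?thesis .
qed

text \<open>Almost every point at which \<open>v\<close> is nonzero is at distance at least
  \<open>\<delta>\<close> from \<open>x\<close>, and there \<open>ps\<close> is of order
  \<open>\<epsilon>\<^sup>2\<close>; hence the left side of \<open>representation\<close> tends to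
  0.\<close>

lemma pot_zero_near:
  assumes zero: "AE y in lborel. y \<in> ball p \<rho> \<longrightarrow> v y = 0" and x: "x \<in> ball p \<rho>" "x \<in> ball x0 (R/4)"
  shows "pot 0 x = 0"
proof -
  define \<delta> where "\<delta> = \<rho> - dist p x"
  have \<delta>: "\<delta> > 0" using x by (simp add: \<delta>_def)
  define K where "K = 2 * real DIM('a) * (\<delta>\<^sup>2) powr (- real DIM('a) / 2 - 1)"
  have [measurable]: "v \<in> borel_measurable borel" "\<kappa> \<in> borel_measurable borel" using iv C1_measurable[OF \<kappa>] by auto
  have bnd: "\<bar>pot \<epsilon> x\<bar> \<le> \<epsilon>\<^sup>2 * (K * (\<integral>y. \<bar>v y\<bar> \<partial>lborel))" if \<epsilon>: "\<epsilon> > 0" for \<epsilon>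
  proof -
    have "continuous_on UNIV (\<lambda>y. \<kappa> y * ps \<epsilon> (x - y))"
      by (intro continuous_intros C1_continuous[OF \<kappa>] continuous_on_compose2[OF ps_continuous[OF \<epsilon>, of UNIV]]) auto
    from integrable_v_mult[OF this] have int: "integrable lborel (\<lambda>y. v y * \<kappa> y * ps \<epsilon> (x - y))" by (simp add: mult.assoc)
    have "\<bar>pot \<epsilon> x\<bar> \<le> (\<integral>y. \<bar>v y * \<kappa> y * ps \<epsilon> (x - y)\<bar> \<partial>lborel)"
      unfolding representation[OF \<epsilon>, symmetric] using integral_norm_bound[of lborel "\<lambda>y. v y * \<kappa> y * ps \<epsilon> (x - y)"] by simp
    also have "\<dots> \<le> (\<integral>y. \<bar>v y\<bar> * (\<epsilon>\<^sup>2 * K) \<partial>lborel)"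
    proof (rule integral_mono_AE)
      show "AE y in lborel. \<bar>v y * \<kappa> y * ps \<epsilon> (x - y)\<bar> \<le> \<bar>v y\<bar> * (\<epsilon>\<^sup>2 * K)"
        using zero
      proof eventually_elim
        case (elim y)
        show ?case
        proof (cases "y \<in> ball p \<rho>")
          case False
          then have "\<delta> \<le> norm (x - y)" using dist_triangle[of p y x] by (simp add: \<delta>_def dist_norm)
          from ps_le[OF \<delta> this, of \<epsilon>] have "ps \<epsilon> (x - y) \<le> \<epsilon>\<^sup>2 * K" by (simp add: K_def mult_ac)
          then have "\<kappa> y * ps \<epsilon> (x - y) \<le> 1 * (\<epsilon>\<^sup>2 * K)" using \<kappa>1[of y] ps_nonneg by (intro mult_mono) auto
          moreover have "0 \<le> \<kappa> y * ps \<epsilon> (x - y)" using \<kappa>1[of y] ps_nonneg by (intro mult_nonneg_nonneg) auto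
          ultimately have "\<bar>\<kappa> y * ps \<epsilon> (x - y)\<bar> \<le> \<epsilon>\<^sup>2 * K" by simp
          then have "\<bar>v y\<bar> * \<bar>\<kappa> y * ps \<epsilon> (x - y)\<bar> \<le> \<bar>v y\<bar> * (\<epsilon>\<^sup>2 * K)" by (intro mult_left_mono) auto
          then show ?thesis by (simp only: abs_mult mult.assoc)
        qed (use elim in simp)
      qed
    qed (use int iv in auto)
    also have "\<dots> = \<epsilon>\<^sup>2 * (K * (\<integral>y. \<bar>v y\<bar> \<partial>lborel))" by (simp add: mult_ac)
    finally show ?thesis .
  qed
  have "(\<lambda>k. pot (inverse (real (Suc k))) x) \<longlonglongrightarrow> 0"
  proof (rule Lim_null_comparison)
    show "\<forall>\<^sub>F k in sequentially. norm (pot (inverse (real (Suc k))) x) \<le> (inverse (real (Suc k)))\<^sup>2 * (K * (\<integral>y. \<bar>v y\<bar> \<partial>lborel))"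
      using bnd by simp
    have "(\<lambda>k. (inverse (real (Suc k)))\<^sup>2 * (K * (\<integral>y. \<bar>v y\<bar> \<partial>lborel))) \<longlonglongrightarrow> 0\<^sup>2 * (K * (\<integral>y. \<bar>v y\<bar> \<partial>lborel))"
      by (intro tendsto_intros LIMSEQ_inverse_real_of_nat)
    then show "(\<lambda>k. (inverse (real (Suc k)))\<^sup>2 * (K * (\<integral>y. \<bar>v y\<bar> \<partial>lborel))) \<longlonglongrightarrow> 0" by simp
  qed
  with pot_tendsto[OF x(2)] show ?thesis using LIMSEQ_unique by blast
qed

text \<open>On \<open>ball 0 \<epsilon>\<close> the function \<open>ps\<close> is at least a
  constant over the volume of that ball, up to dimension factors. A lower bound independent of
  \<open>\<epsilon>\<close> is enough, since the mass is only divided by.\<close>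

lemma ps_mass_ge:
  assumes \<epsilon>: "0 < \<epsilon>" "\<epsilon> \<le> r"
  shows "2 * real DIM('a) * 2 powr (- real DIM('a) / 2 - 1) * unit_ball_vol DIM('a)
     \<le> (\<integral>z. indicator (ball 0 r) z *\<^sub>R ps \<epsilon> z \<partial>lborel)" (is "?c \<le> _")
proof -
  define a where "a = 2 * real DIM('a) * \<epsilon>\<^sup>2 * (2 * \<epsilon>\<^sup>2) powr (- real DIM('a) / 2 - 1)"
  have "(\<epsilon>\<^sup>2) powr (- real DIM('a) / 2 - 1) = \<epsilon> powr (- real DIM('a) - 2)"
  proof -
    have "\<epsilon>\<^sup>2 = \<epsilon> powr 2" using \<epsilon> by (simp add: powr_numeral)
    then show ?thesis by (simp add: powr_powr algebra_simps)
  qed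
  moreover have "\<epsilon>\<^sup>2 * \<epsilon> powr (- real DIM('a) - 2) * \<epsilon> ^ DIM('a) = 1"
  proof -
    have "\<epsilon>\<^sup>2 = \<epsilon> powr 2" "\<epsilon> ^ DIM('a) = \<epsilon> powr real DIM('a)" using \<epsilon> by (simp_all add: powr_numeral powr_realpow)
    then have "\<epsilon>\<^sup>2 * \<epsilon> powr (- real DIM('a) - 2) * \<epsilon> ^ DIM('a) = \<epsilon> powr (2 + (- real DIM('a) - 2) + real DIM('a))"
      by (simp only: powr_add)
    then show ?thesis using \<epsilon> by simp
  qed
  ultimately have "?c = a * (unit_ball_vol DIM('a) * \<epsilon> ^ DIM('a))"
    using \<epsilon> unfolding a_def by (simp add: powr_mult)
  also have "\<dots> = (\<integral>z. a * indicator (ball (0::'a) \<epsilon>) z \<partial>lborel)" using \<epsilon> by (simp add: content_ball)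
  also have "\<dots> \<le> (\<integral>z. indicator (ball 0 r) z *\<^sub>R ps \<epsilon> z \<partial>lborel)"
  proof (rule integral_mono)
    have "emeasure lborel (ball (0::'a) \<epsilon>) < \<infinity>" by (rule emeasure_bounded_finite) simp
    then show "integrable lborel (\<lambda>z. a * indicator (ball (0::'a) \<epsilon>) z)" by simp
    show "integrable lborel (\<lambda>z. indicator (ball 0 r) z *\<^sub>R ps \<epsilon> z)"
      by (intro integrable_indicator_continuous ps_continuous \<epsilon>) auto
    fix z :: 'a
    show "a * indicator (ball 0 \<epsilon>) z \<le> indicator (ball 0 r) z *\<^sub>R ps \<epsilon> z"
    proof (cases "z \<in> ball 0 \<epsilon>")
      case True
      then have "(norm z)\<^sup>2 \<le> \<epsilon>\<^sup>2" by (intro power_mono) auto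
      then have "(2 * \<epsilon>\<^sup>2) powr (- real DIM('a) / 2 - 1) \<le> ((norm z)\<^sup>2 + \<epsilon>\<^sup>2) powr (- real DIM('a) / 2 - 1)"
        using \<epsilon> by (intro powr_mono2') (auto simp: add_nonneg_pos)
      then have "a \<le> ps \<epsilon> z" unfolding a_def ps_def by (intro mult_left_mono) auto
      moreover have "z \<in> ball 0 r" using True \<epsilon> by auto
      ultimately show ?thesis using True by simp
    next
      case False then show ?thesis using ps_nonneg by (simp add: indicator_def)
    qed
  qed
  finally show ?thesis .
qed

text \<open>\<open>I\<close> is evaluated in two ways. The potentials tend to 0 on the support of
  \<open>\<eta>\<close>, so \<open>I\<close> tends to 0. By Fubini the approximate identity falls on
  \<open>\<eta>\<close>, and on \<open>ball x0 R\<close> the function \<open>T k\<close> is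
  uniformly close to \<open>cc k * \<eta>\<close>; division by \<open>cc k\<close> gives the claim.
  Smoothing \<open>\<eta>\<close> instead of \<open>v\<close> avoids Lebesgue points of the merely
  integrable \<open>v\<close>.\<close>

lemma v_test_zero:
  assumes p: "p \<in> ball x0 (R/4)" and \<rho>: "\<rho> > 0" and zero: "AE y in lborel. y \<in> ball p \<rho> \<longrightarrow> v y = 0"
    and test: "test_fun (ball x0 (R/4)) \<eta> d\<eta>"
  shows "(\<integral>y. v y * \<eta> y \<partial>lborel) = 0"
proof -
  define W where "W = ball x0 (R/4)"
  have pot0: "pot 0 x = 0" if "x \<in> W" for x
    using that unfolding W_def
    by (intro pot_unique_continuation[OF p \<rho> pot_zero_near[OF zero]])
  have C\<eta>: "C1_grad \<eta> d\<eta>" and co: "compact (closure {x. \<eta> x \<noteq> 0})" and sub: "closure {x. \<eta> x \<noteq> 0} \<subseteq> W"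
    using test by (auto simp: test_fun_def W_def)
  have \<eta>W: "x \<in> W" if "\<eta> x \<noteq> 0" for x using sub closure_subset[of "{x. \<eta> x \<noteq> 0}"] that by blast
  have c\<eta>: "continuous_on A \<eta>" for A by (rule C1_continuous[OF C\<eta>])
  have [measurable]: "v \<in> borel_measurable borel" "\<kappa> \<in> borel_measurable borel" "\<eta> \<in> borel_measurable borel"
    using iv C1_measurable[OF \<kappa>] C1_measurable[OF C\<eta>] by auto
  have [measurable]: "W \<in> sets borel" by (simp add: W_def)
  have "compact (\<eta> ` cball x0 (4 * R))" by (intro compact_continuous_image c\<eta> compact_cball)
  then have "\<exists>M>0. \<forall>x\<in>cball x0 (4 * R). \<bar>\<eta> x\<bar> \<le> M" by (auto dest!: compact_imp_bounded simp: bounded_pos)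
  then obtain M where M: "M > 0" "\<And>x. x \<in> cball x0 (4 * R) \<Longrightarrow> \<bar>\<eta> x\<bar> \<le> M" by blast
  have M': "\<bar>\<eta> x\<bar> \<le> M" for x using M \<eta>W[of x] R by (cases "\<eta> x = 0") (auto simp: W_def)
  define e where "e k = inverse (real (Suc k))" for k
  have e: "0 < e k" "e k \<le> 1" for k by (auto simp: e_def field_simps)
  have e0: "e \<longlonglongrightarrow> 0" unfolding e_def by (rule LIMSEQ_inverse_real_of_nat)
  have [measurable]: "ps \<epsilon> \<in> borel_measurable borel" for \<epsilon> unfolding ps_def by measurable
  define I where "I k = (\<integral>x. \<eta> x * pot (e k) x \<partial>lborel)" for k
  have pot_meas: "(\<lambda>x. pot (e k) x) \<in> borel_measurable borel" for k
    unfolding representation[OF e(1), symmetric] by measurable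
  have I0: "I \<longlonglongrightarrow> 0"
  proof -
    obtain Mp where Mp: "\<forall>x\<in>W. \<forall>\<epsilon>\<in>{0..1}. \<bar>pot \<epsilon> x\<bar> \<le> Mp" using pot_bounded unfolding W_def by blast
    have "I \<longlonglongrightarrow> (\<integral>x. 0 \<partial>(lborel :: 'a measure))"
      unfolding I_def
    proof (rule integral_dominated_convergence[where w = "\<lambda>x. (M * Mp) * indicator W x"])
      have "emeasure lborel W < \<infinity>" unfolding W_def by (rule emeasure_bounded_finite) simp
      then show "integrable lborel (\<lambda>x. (M * Mp) * indicator W x)" by simp
      show "AE x in lborel. (\<lambda>k. \<eta> x * pot (e k) x) \<longlonglongrightarrow> 0"
      proof (rule AE_I2)
        fix x
        show "(\<lambda>k. \<eta> x * pot (e k) x) \<longlonglongrightarrow> 0"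
        proof (cases "x \<in> W")
          case True
          then have "(\<lambda>k. \<eta> x * pot (e k) x) \<longlonglongrightarrow> \<eta> x * pot 0 x" unfolding e_def W_def by (intro tendsto_intros pot_tendsto)
          then show ?thesis using pot0[OF True] by simp
        next
          case False then have "\<eta> x = 0" using \<eta>W by blast
          then show ?thesis by simp
        qed
      qed
      show "AE x in lborel. norm (\<eta> x * pot (e k) x) \<le> (M * Mp) * indicator W x" for k
      proof (rule AE_I2)
        fix x
        show "norm (\<eta> x * pot (e k) x) \<le> (M * Mp) * indicator W x"
        proof (cases "x \<in> W")
          case True
          have "\<bar>\<eta> x\<bar> * \<bar>pot (e k) x\<bar> \<le> M * Mp" using Mp True e[of k] M(1) by (intro mult_mono M') auto
          then show ?thesis using True by (simp add: abs_mult)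
        next
          case False then have "\<eta> x = 0" using \<eta>W by blast
          then show ?thesis using False by simp
        qed
      qed
    qed (use pot_meas in auto)
    then show ?thesis by simp
  qed
  define V where "V = (\<integral>y. \<bar>v y\<bar> \<partial>lborel)"
  have V0: "V \<ge> 0" unfolding V_def by (intro integral_nonneg_AE) auto
  define T where "T k y = (\<integral>x. \<eta> x * ps (e k) (x - y) \<partial>lborel)" for k y
  \<comment> \<open>\<open>\<eta>\<close> is continuous with bounded support,
    \<open>ps (e k)\<close> is bounded by its value at 0, and \<open>v\<close> is
    integrable.\<close>
  have int_pair: "integrable (lborel \<Otimes>\<^sub>M lborel) (\<lambda>(x, y). \<eta> x * (v y * \<kappa> y * ps (e k) (x - y)))" for k
  proof (rule lborel_pair.Fubini_integrable)
    show "(\<lambda>(x, y). \<eta> x * (v y * \<kappa> y * ps (e k) (x - y))) \<in> borel_measurable (lborel \<Otimes>\<^sub>M lborel)" by measurable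
    have i: "integrable lborel (\<lambda>y. v y * \<kappa> y * ps (e k) (x - y))" for x
    proof -
      have "continuous_on UNIV (\<lambda>y. \<kappa> y * ps (e k) (x - y))"
        by (intro continuous_intros C1_continuous[OF \<kappa>] continuous_on_compose2[OF ps_continuous[OF e(1), of UNIV]]) auto
      from integrable_v_mult[OF this] show ?thesis by (simp add: mult.assoc)
    qed
    then show "AE x in lborel. integrable lborel (\<lambda>y. case (x, y) of (x, y) \<Rightarrow> \<eta> x * (v y * \<kappa> y * ps (e k) (x - y)))" by simp
    define Kk where "Kk = ps (e k) 0"
    have ps_le0: "ps (e k) z \<le> Kk" for z
      unfolding Kk_def ps_def using e(1)[of k] by (intro mult_left_mono powr_mono2') auto
    have "integrable lborel (\<lambda>x. indicator W x *\<^sub>R (\<bar>\<eta> x\<bar> * (Kk * V)))"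
      by (intro integrable_indicator_continuous continuous_intros c\<eta>) (auto simp: W_def)
    then show "integrable lborel (\<lambda>x. \<integral>y. norm (case (x, y) of (x, y) \<Rightarrow> \<eta> x * (v y * \<kappa> y * ps (e k) (x - y))) \<partial>lborel)"
    proof (rule Bochner_Integration.integrable_bound)
      show "AE x in lborel. norm (\<integral>y. norm (case (x, y) of (x, y) \<Rightarrow> \<eta> x * (v y * \<kappa> y * ps (e k) (x - y))) \<partial>lborel)
         \<le> norm (indicator W x *\<^sub>R (\<bar>\<eta> x\<bar> * (Kk * V)))"
      proof (rule AE_I2)
        fix x
        have "(\<integral>y. norm (\<eta> x * (v y * \<kappa> y * ps (e k) (x - y))) \<partial>lborel) \<le> (\<integral>y. \<bar>\<eta> x\<bar> * (Kk * \<bar>v y\<bar>) \<partial>lborel)"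
        proof (rule integral_mono)
          show "integrable lborel (\<lambda>y. norm (\<eta> x * (v y * \<kappa> y * ps (e k) (x - y))))" using i[of x] by (intro integrable_norm integrable_mult_right)
          show "integrable lborel (\<lambda>y. \<bar>\<eta> x\<bar> * (Kk * \<bar>v y\<bar>))" using iv by auto
          fix y
          have "\<bar>v y\<bar> * (\<kappa> y * ps (e k) (x - y)) \<le> \<bar>v y\<bar> * (1 * Kk)"
            using \<kappa>1[of y] ps_le0 ps_nonneg by (intro mult_left_mono mult_mono) auto
          then have "\<bar>\<eta> x\<bar> * (\<bar>v y\<bar> * (\<kappa> y * ps (e k) (x - y))) \<le> \<bar>\<eta> x\<bar> * (\<bar>v y\<bar> * (1 * Kk))" by (rule mult_left_mono) auto
          moreover have "norm (\<eta> x * (v y * \<kappa> y * ps (e k) (x - y))) = \<bar>\<eta> x\<bar> * (\<bar>v y\<bar> * (\<kappa> y * ps (e k) (x - y)))"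
            using \<kappa>1[of y] ps_nonneg[of "e k" "x - y"] by (simp add: abs_mult)
          ultimately show "norm (\<eta> x * (v y * \<kappa> y * ps (e k) (x - y))) \<le> \<bar>\<eta> x\<bar> * (Kk * \<bar>v y\<bar>)"
            by (simp only: mult_1 mult.commute)
        qed
        also have "\<dots> = \<bar>\<eta> x\<bar> * (Kk * V)" by (simp add: V_def)
        finally have le: "(\<integral>y. norm (\<eta> x * (v y * \<kappa> y * ps (e k) (x - y))) \<partial>lborel) \<le> \<bar>\<eta> x\<bar> * (Kk * V)" .
        have ge: "0 \<le> (\<integral>y. norm (\<eta> x * (v y * \<kappa> y * ps (e k) (x - y))) \<partial>lborel)" by (intro integral_nonneg_AE) auto
        show "norm (\<integral>y. norm (case (x, y) of (x, y) \<Rightarrow> \<eta> x * (v y * \<kappa> y * ps (e k) (x - y))) \<partial>lborel)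
         \<le> norm (indicator W x *\<^sub>R (\<bar>\<eta> x\<bar> * (Kk * V)))"
        proof (cases "x \<in> W")
          case True
          have "norm (\<integral>y. norm (\<eta> x * (v y * \<kappa> y * ps (e k) (x - y))) \<partial>lborel) \<le> \<bar>\<eta> x\<bar> * (Kk * V)" using le ge by simp
          also have "\<dots> \<le> norm (indicator W x *\<^sub>R (\<bar>\<eta> x\<bar> * (Kk * V)))" using True by simp
          finally show ?thesis by simp
        next
          case False then have "\<eta> x = 0" using \<eta>W by blast
          then show ?thesis by simp
        qed
      qed
    qed measurable
  qed
  have I_eq: "I k = (\<integral>y. v y * \<kappa> y * T k y \<partial>lborel)" for k
  proof -
    have "I k = (\<integral>x. (\<integral>y. \<eta> x * (v y * \<kappa> y * ps (e k) (x - y)) \<partial>lborel) \<partial>lborel)"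
      unfolding I_def by (simp only: representation[OF e(1), symmetric] integral_mult_right_zero)
    also have "\<dots> = (\<integral>y. (\<integral>x. \<eta> x * (v y * \<kappa> y * ps (e k) (x - y)) \<partial>lborel) \<partial>lborel)"
      by (rule lborel_pair.Fubini_integral[OF int_pair, symmetric])
    also have "\<dots> = (\<integral>y. v y * \<kappa> y * T k y \<partial>lborel)"
    proof (intro Bochner_Integration.integral_cong refl)
      fix y
      have "(\<lambda>x. \<eta> x * (v y * \<kappa> y * ps (e k) (x - y))) = (\<lambda>x. (v y * \<kappa> y) * (\<eta> x * ps (e k) (x - y)))" by (simp add: fun_eq_iff)
      then show "(\<integral>x. \<eta> x * (v y * \<kappa> y * ps (e k) (x - y)) \<partial>lborel) = v y * \<kappa> y * T k y"
        unfolding T_def by (simp only: integral_mult_right_zero)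
    qed
    finally show ?thesis .
  qed
  \<comment> \<open>For \<open>y\<close> in \<open>ball x0 R\<close> and \<open>z + y\<close> in the
    support of \<open>\<eta>\<close>, \<open>norm z\<close> is below \<open>5 * R / 4\<close>, so
    the integral over \<open>z\<close> may be cut to this ball.\<close>
  define Bz where "Bz = ball (0::'a) (2 * R)"
  define L where "L = measure lborel Bz"
  have finB: "emeasure lborel Bz < \<infinity>" unfolding Bz_def by (rule emeasure_bounded_finite) simp
  define cc where "cc k = (\<integral>z. indicator Bz z *\<^sub>R ps (e k) z \<partial>lborel)" for k
  have int_ps: "integrable lborel (\<lambda>z. indicator Bz z *\<^sub>R ps (e k) z)" for k
    unfolding Bz_def by (intro integrable_indicator_continuous ps_continuous e) auto
  have cc0: "cc k \<ge> 0" for k unfolding cc_def by (intro integral_nonneg_AE) (auto simp: ps_nonneg)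
  \<comment> \<open>Near 0 the oscillation \<open>\<omega>\<close> of \<open>\<eta>\<close> counts,
    weighted by the mass \<open>cc k\<close>; beyond radius \<open>\<delta>\<close> it is the size
    of \<open>ps\<close>, of order \<open>(e k)\<^sup>2\<close>.\<close>
  have Tc: "\<bar>T k y - cc k * \<eta> y\<bar> \<le> \<omega> * cc k + 2 * M * (2 * real DIM('a) * (e k)\<^sup>2 * (\<delta>\<^sup>2) powr (- real DIM('a) / 2 - 1)) * L"
    if \<omega>: "\<omega> > 0" and \<delta>: "\<delta> > 0" "\<And>y z. norm z < \<delta> \<Longrightarrow> \<bar>\<eta> (z + y) - \<eta> y\<bar> \<le> \<omega>" and y: "y \<in> ball x0 R" for \<omega> \<delta> k y
  proof -
    define Kk where "Kk = 2 * real DIM('a) * (e k)\<^sup>2 * (\<delta>\<^sup>2) powr (- real DIM('a) / 2 - 1)"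
    have "T k y = (\<integral>z. \<eta> (z + y) * ps (e k) z \<partial>lborel)"
      unfolding T_def using lborel_integral_translate[of "\<lambda>x. \<eta> x * ps (e k) (x - y)" y] by simp
    also have "\<dots> = (\<integral>z. indicator Bz z *\<^sub>R (\<eta> (z + y) * ps (e k) z) \<partial>lborel)"
    proof (intro Bochner_Integration.integral_cong refl)
      fix z
      have "\<eta> (z + y) = 0" if "z \<notin> Bz"
      proof (rule ccontr)
        assume "\<eta> (z + y) \<noteq> 0"
        from \<eta>W[OF this] have "dist x0 (z + y) < R / 4" by (simp add: W_def)
        moreover have "norm z \<le> dist x0 (z + y) + dist x0 y"
          using dist_triangle3[of "z + y" y x0] by (simp add: dist_norm)
        ultimately show False using that y R by (simp add: Bz_def)
      qed
      then show "\<eta> (z + y) * ps (e k) z = indicator Bz z *\<^sub>R (\<eta> (z + y) * ps (e k) z)" by (auto simp: indicator_def)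
    qed
    finally have T1: "T k y = (\<integral>z. indicator Bz z *\<^sub>R (\<eta> (z + y) * ps (e k) z) \<partial>lborel)" .
    have i1: "integrable lborel (\<lambda>z. indicator Bz z *\<^sub>R (\<eta> (z + y) * ps (e k) z))"
      unfolding Bz_def by (intro integrable_indicator_continuous continuous_intros ps_continuous e continuous_on_compose2[OF c\<eta>[of UNIV]]) auto
    have i2: "integrable lborel (\<lambda>z. \<eta> y * (indicator Bz z *\<^sub>R ps (e k) z))" using int_ps by (rule integrable_mult_right)
    have "T k y - cc k * \<eta> y = (\<integral>z. indicator Bz z *\<^sub>R (\<eta> (z + y) * ps (e k) z) - \<eta> y * (indicator Bz z *\<^sub>R ps (e k) z) \<partial>lborel)"
      unfolding T1 cc_def using i1 i2 by (simp add: mult.commute[of _ "\<eta> y"])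
    also have "\<bar>\<dots>\<bar> \<le> (\<integral>z. \<omega> * (indicator Bz z *\<^sub>R ps (e k) z) + (2 * M * Kk) * indicator Bz z \<partial>lborel)"
      unfolding real_norm_def[symmetric]
    proof (intro Bochner_Integration.integral_norm_bound_integral Bochner_Integration.integrable_diff i1 i2)
      show "integrable lborel (\<lambda>z. \<omega> * (indicator Bz z *\<^sub>R ps (e k) z) + (2 * M * Kk) * indicator Bz z)"
        using int_ps finB by (intro Bochner_Integration.integrable_add integrable_mult_right) (auto simp: Bz_def)
      fix z
      have K0: "0 \<le> Kk" by (simp add: Kk_def)
      have "\<bar>\<eta> (z + y) - \<eta> y\<bar> * ps (e k) z \<le> \<omega> * ps (e k) z + 2 * M * Kk"
      proof (cases "norm z < \<delta>")
        case True
        then have "\<bar>\<eta> (z + y) - \<eta> y\<bar> * ps (e k) z \<le> \<omega> * ps (e k) z" using \<delta>(2) ps_nonneg by (intro mult_right_mono) auto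
        moreover have "0 \<le> 2 * M * Kk" using M K0 by simp
        ultimately show ?thesis by linarith
      next
        case False
        have "\<bar>\<eta> (z + y) - \<eta> y\<bar> \<le> 2 * M" using M'[of "z + y"] M'[of y] by linarith
        moreover have "ps (e k) z \<le> Kk" unfolding Kk_def using False by (intro ps_le \<delta>(1)) auto
        ultimately have "\<bar>\<eta> (z + y) - \<eta> y\<bar> * ps (e k) z \<le> 2 * M * Kk" using M ps_nonneg by (intro mult_mono) auto
        moreover have "0 \<le> \<omega> * ps (e k) z" using \<omega> ps_nonneg by simp
        ultimately show ?thesis by linarith
      qed
      then show "norm (indicator Bz z *\<^sub>R (\<eta> (z + y) * ps (e k) z) - \<eta> y * (indicator Bz z *\<^sub>R ps (e k) z))
          \<le> \<omega> * (indicator Bz z *\<^sub>R ps (e k) z) + (2 * M * Kk) * indicator Bz z"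
        using ps_nonneg[of "e k" z] by (auto simp: indicator_def abs_mult simp flip: left_diff_distrib)
    qed
    also have "\<dots> = \<omega> * cc k + 2 * M * Kk * L"
      unfolding cc_def L_def using int_ps finB by (subst Bochner_Integration.integral_add) (auto simp: Bz_def)
    finally show ?thesis by (simp add: Kk_def)
  qed
  define c where "c = 2 * real DIM('a) * 2 powr (- real DIM('a) / 2 - 1) * unit_ball_vol DIM('a)"
  have c: "c > 0" by (simp add: c_def)
  have "\<forall>\<^sub>F k in sequentially. e k < 2 * R" using e0 R by (intro order_tendstoD(2)) auto
  then have ev_c: "\<forall>\<^sub>F k in sequentially. c \<le> cc k"
    by eventually_elim (use ps_mass_ge e(1) in \<open>auto simp: c_def cc_def Bz_def\<close>)
  have v\<eta>: "v y * \<kappa> y * \<eta> y = v y * \<eta> y" for y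
    using \<eta>W[of y] \<kappa>_in[of y] R by (cases "\<eta> y = 0") (auto simp: W_def)
  have "\<bar>\<integral>y. v y * \<eta> y \<partial>lborel\<bar> \<le> \<omega> * V" if \<omega>: "\<omega> > 0" for \<omega>
  proof -
    have "uniformly_continuous_on (cball x0 (4 * R)) \<eta>" by (rule compact_uniformly_continuous[OF c\<eta> compact_cball])
    then obtain \<delta>0 where \<delta>0: "\<delta>0 > 0" "\<And>x z. x \<in> cball x0 (4 * R) \<Longrightarrow> z \<in> cball x0 (4 * R) \<Longrightarrow> dist z x < \<delta>0 \<Longrightarrow> dist (\<eta> z) (\<eta> x) < \<omega>"
      using \<omega> unfolding uniformly_continuous_on_def by metis
    define \<delta> where "\<delta> = min \<delta>0 R"
    have \<delta>: "\<delta> > 0" using \<delta>0 R by (simp add: \<delta>_def)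
    have unif: "\<bar>\<eta> (z + y) - \<eta> y\<bar> \<le> \<omega>" if z: "norm z < \<delta>" for y z
    proof (cases "dist x0 y < 2 * R")
      case True
      have "dist x0 (z + y) \<le> dist x0 y + norm z" using dist_triangle[of x0 "z + y" y] by (simp add: dist_norm)
      then have "dist (\<eta> (z + y)) (\<eta> y) < \<omega>" using True z R by (intro \<delta>0(2)) (auto simp: \<delta>_def dist_norm)
      then show ?thesis by (simp add: dist_real_def)
    next
      case False
      have "dist x0 y \<le> dist x0 (z + y) + norm z" using dist_triangle[of x0 y "z + y"] by (simp add: dist_norm)
      then have "z + y \<notin> W" "y \<notin> W" using False z R by (auto simp: W_def \<delta>_def)
      then have "\<eta> (z + y) = 0" "\<eta> y = 0" using \<eta>W by blast+
      then show ?thesis using \<omega> by simp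
    qed
    define KK where "KK = 2 * M * (2 * real DIM('a) * (\<delta>\<^sup>2) powr (- real DIM('a) / 2 - 1)) * L"
    have KK0: "KK \<ge> 0" using M by (simp add: KK_def L_def)
    have step: "cc k * \<bar>\<integral>y. v y * \<eta> y \<partial>lborel\<bar> \<le> \<bar>I k\<bar> + (\<omega> * cc k + KK * (e k)\<^sup>2) * V" for k
    proof -
      have iI: "integrable lborel (\<lambda>y. v y * \<kappa> y * T k y)"
      proof -
        have "integrable lborel (\<lambda>y. \<integral>x. \<eta> x * (v y * \<kappa> y * ps (e k) (x - y)) \<partial>lborel)"
          using lborel_pair.integrable_snd[OF int_pair[of k]] by simp
        moreover have "(\<lambda>x. \<eta> x * (v y * \<kappa> y * ps (e k) (x - y))) = (\<lambda>x. (v y * \<kappa> y) * (\<eta> x * ps (e k) (x - y)))" for y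
          by (simp add: fun_eq_iff)
        ultimately show ?thesis unfolding T_def by (simp only: integral_mult_right_zero)
      qed
      have iE: "integrable lborel (\<lambda>y. cc k * (v y * \<kappa> y * \<eta> y))"
        using integrable_v_mult[OF c\<eta>] unfolding v\<eta> by simp
      have "cc k * (\<integral>y. v y * \<eta> y \<partial>lborel) = (\<integral>y. cc k * (v y * \<kappa> y * \<eta> y) \<partial>lborel)" by (simp add: v\<eta>)
      also have "\<dots> = I k - (\<integral>y. v y * \<kappa> y * T k y - cc k * (v y * \<kappa> y * \<eta> y) \<partial>lborel)"
        unfolding I_eq using iI iE by simp
      finally have "cc k * \<bar>\<integral>y. v y * \<eta> y \<partial>lborel\<bar> \<le> \<bar>I k\<bar> + \<bar>\<integral>y. v y * \<kappa> y * T k y - cc k * (v y * \<kappa> y * \<eta> y) \<partial>lborel\<bar>"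
        using abs_mult[of "cc k" "\<integral>y. v y * \<eta> y \<partial>lborel"] cc0[of k] by linarith
      also have "\<bar>\<integral>y. v y * \<kappa> y * T k y - cc k * (v y * \<kappa> y * \<eta> y) \<partial>lborel\<bar> \<le> (\<integral>y. (\<omega> * cc k + KK * (e k)\<^sup>2) * \<bar>v y\<bar> \<partial>lborel)"
        unfolding real_norm_def[symmetric]
      proof (intro Bochner_Integration.integral_norm_bound_integral Bochner_Integration.integrable_diff iI iE)
        show "integrable lborel (\<lambda>y. (\<omega> * cc k + KK * (e k)\<^sup>2) * norm (v y))" using iv by auto
        fix y
        have eq: "v y * \<kappa> y * T k y - cc k * (v y * \<kappa> y * \<eta> y) = v y * (\<kappa> y * (T k y - cc k * \<eta> y))" by (simp add: algebra_simps)
        have "\<kappa> y * \<bar>T k y - cc k * \<eta> y\<bar> \<le> \<omega> * cc k + KK * (e k)\<^sup>2"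
        proof (cases "y \<in> ball x0 R")
          case True
          have "\<kappa> y * \<bar>T k y - cc k * \<eta> y\<bar> \<le> 1 * \<bar>T k y - cc k * \<eta> y\<bar>" using \<kappa>1[of y] by (intro mult_right_mono) auto
          also have "\<dots> \<le> \<omega> * cc k + KK * (e k)\<^sup>2" using Tc[OF \<omega> \<delta> unif True, of k] by (simp add: KK_def mult_ac)
          finally show ?thesis .
        next
          case False
          then have "\<kappa> y = 0" using \<kappa>_out[of y] R by auto
          then show ?thesis using \<omega> cc0[of k] KK0 by simp
        qed
        then have "\<bar>v y\<bar> * (\<kappa> y * \<bar>T k y - cc k * \<eta> y\<bar>) \<le> \<bar>v y\<bar> * (\<omega> * cc k + KK * (e k)\<^sup>2)" by (intro mult_left_mono) auto
        then show "norm (v y * \<kappa> y * T k y - cc k * (v y * \<kappa> y * \<eta> y)) \<le> (\<omega> * cc k + KK * (e k)\<^sup>2) * norm (v y)"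
          unfolding eq using \<kappa>1[of y] by (simp add: abs_mult mult.commute)
      qed
      finally show ?thesis by (simp add: V_def)
    qed
    have "\<forall>\<^sub>F k in sequentially. \<bar>\<integral>y. v y * \<eta> y \<partial>lborel\<bar> \<le> \<bar>I k\<bar> / c + \<omega> * V + KK * (e k)\<^sup>2 * V / c"
      using ev_c
    proof eventually_elim
      case (elim k)
      then have ck: "cc k > 0" using c by simp
      have "\<bar>\<integral>y. v y * \<eta> y \<partial>lborel\<bar> \<le> (\<bar>I k\<bar> + (\<omega> * cc k + KK * (e k)\<^sup>2) * V) / cc k"
        using step[of k] ck by (simp add: pos_le_divide_eq mult.commute)
      also have "\<dots> = \<bar>I k\<bar> / cc k + \<omega> * V + KK * (e k)\<^sup>2 * V / cc k" using ck by (simp add: field_simps)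
      also have "\<dots> \<le> \<bar>I k\<bar> / c + \<omega> * V + KK * (e k)\<^sup>2 * V / c"
        using elim c KK0 V0 by (intro add_mono divide_left_mono mult_pos_pos ck) auto
      finally show ?case .
    qed
    moreover have "(\<lambda>k. \<bar>I k\<bar> / c + \<omega> * V + KK * (e k)\<^sup>2 * V / c) \<longlonglongrightarrow> \<bar>0\<bar> / c + \<omega> * V + KK * 0\<^sup>2 * V / c"
      using c by (intro tendsto_intros I0 e0) auto
    ultimately have "\<bar>\<integral>y. v y * \<eta> y \<partial>lborel\<bar> \<le> \<bar>0\<bar> / c + \<omega> * V + KK * 0\<^sup>2 * V / c"
      by (intro tendsto_lowerbound[OF _ _ sequentially_bot])
    then show ?thesis by simp
  qed
  note bound = this
  have "\<bar>\<integral>y. v y * \<eta> y \<partial>lborel\<bar> \<le> 0"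
  proof (rule field_le_epsilon)
    fix r :: real assume r: "0 < r"
    have "\<bar>\<integral>y. v y * \<eta> y \<partial>lborel\<bar> \<le> r / (V + 1) * V" using r V0 by (intro bound) auto
    also have "\<dots> \<le> r" using r V0 by (simp add: field_simps)
    finally show "\<bar>\<integral>y. v y * \<eta> y \<partial>lborel\<bar> \<le> 0 + r" by simp
  qed
  then show ?thesis by simp
qed

end

text \<open>The cutoff is only an auxiliary object and is chosen here; the fundamental lemma then
  turns vanishing against test functions into vanishing almost everywhere.\<close>

lemma local_unique_continuation:
  assumes p: "p \<in> ball x0 (R/4)" and \<rho>: "\<rho> > 0" and zero: "AE y in lborel. y \<in> ball p \<rho> \<longrightarrow> v y = 0"
  shows "AE y in lborel. y \<in> ball x0 (R/4) \<longrightarrow> v y = 0"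
proof -
  obtain \<kappa> d\<kappa> where \<kappa>: "C1_grad \<kappa> d\<kappa>" "\<And>y. 0 \<le> \<kappa> y \<and> \<kappa> y \<le> 1"
    "\<And>y. dist x0 y \<le> R / 2 \<Longrightarrow> \<kappa> y = 1 \<and> d\<kappa> y = 0" "\<And>y. dist x0 y \<ge> 3 * R / 4 \<Longrightarrow> \<kappa> y = 0 \<and> d\<kappa> y = 0"
    using C1_cutoff[OF R] by metis
  let ?W = "ball x0 (R/4)"
  let ?M = "restrict_space lborel ?W"
  have "AE y in ?M. v y = 0"
  proof (rule fundamental_lemma[where W = ?W])
    show "(\<lambda>x. x) \<in> measurable ?M borel" by (rule measurable_restrict_space1) auto
    show "integrable ?M v"
      using integrable_mult_indicator[of ?W lborel v] iv by (subst integrable_restrict_space) (auto simp: set_integrable_def)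
    show "(\<integral>x. v x * \<phi> x \<partial>?M) = 0" if t: "test_fun ?W \<phi> d\<phi>" for \<phi> d\<phi>
    proof -
      have z: "\<phi> x = 0" if "x \<notin> ?W" for x
        using t closure_subset[of "{x. \<phi> x \<noteq> 0}"] that unfolding test_fun_def by blast
      have "(\<integral>x. v x * \<phi> x \<partial>?M) = (\<integral>x. indicator ?W x *\<^sub>R (v x * \<phi> x) \<partial>lborel)"
        by (subst integral_restrict_space) (auto simp: set_lebesgue_integral_def)
      also have "\<dots> = (\<integral>x. v x * \<phi> x \<partial>lborel)"
        using z by (intro Bochner_Integration.integral_cong) (auto simp: indicator_def simp del: mem_ball)
      also have "\<dots> = 0" by (rule v_test_zero[OF \<kappa> p \<rho> zero t])
      finally show ?thesis .
    qed
    show "\<exists>B\<in>sets borel. AE x in ?M. x \<in> A \<longleftrightarrow> x \<in> B" if "A \<in> sets ?M" for A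
      using that by (intro bexI[of _ A]) (auto simp: sets_restrict_space)
  qed (auto simp: space_restrict_space)
  then show ?thesis by (subst (asm) AE_restrict_space_iff) auto
qed

end

section \<open>The transmission problem\<close>

lemma nn_integral_lebesgue_on:
  assumes "A \<in> sets borel" "f \<in> borel_measurable borel"
  shows "(\<integral>\<^sup>+x. f x \<partial>lebesgue_on A) = (\<integral>\<^sup>+x. f x * indicator A x \<partial>lborel)"
  using assms by (subst nn_integral_restrict_space) (auto intro!: nn_integral_completion)

text \<open>\<open>lebesgue_on\<close> belongs to the completed measure. For representatives
  measurable over \<open>restrict_space lborel A\<close> both measures give the same integrals, and
  their extensions by zero are Borel, as the potential theory above requires.\<close>

lemma restrict_lborel_lebesgue_on:
  fixes A :: "'a::euclidean_space set" and f :: "'a \<Rightarrow> 'b::euclidean_space"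
  assumes A: "A \<in> sets borel" and f: "f \<in> borel_measurable (restrict_space lborel A)"
  shows borel_measurable_lebesgue_on_restrict: "f \<in> borel_measurable (lebesgue_on A)"
    and integral_restrict_lborel: "(\<integral>x. f x \<partial>restrict_space lborel A) = (\<integral>x. f x \<partial>lebesgue_on A)"
    and integrable_restrict_lborel: "integrable (restrict_space lborel A) f \<longleftrightarrow> integrable (lebesgue_on A) f"
proof -
  have m: "(\<lambda>x. indicator A x *\<^sub>R f x) \<in> borel_measurable lborel"
    using f A by (subst (asm) borel_measurable_restrict_space_iff) auto
  then have "(\<lambda>x. indicator A x *\<^sub>R f x) \<in> borel_measurable lebesgue" by (rule measurable_completion)
  then show "f \<in> borel_measurable (lebesgue_on A)" using A by (subst borel_measurable_restrict_space_iff) auto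
  show "(\<integral>x. f x \<partial>restrict_space lborel A) = (\<integral>x. f x \<partial>lebesgue_on A)"
    using A m by (simp add: integral_restrict_space integral_completion set_lebesgue_integral_def)
  show "integrable (restrict_space lborel A) f \<longleftrightarrow> integrable (lebesgue_on A) f"
    using A m by (simp add: integrable_restrict_space integrable_completion set_integrable_def)
qed

lemma sqint_restrict_lborel:
  assumes A: "A \<in> sets borel" and f: "sqint (restrict_space lborel A) f"
  shows "sqint (lebesgue_on A) f"
proof -
  have m: "f \<in> borel_measurable (restrict_space lborel A)" using f by (rule sqint_measurable)
  then have "(\<lambda>x. (norm (f x))\<^sup>2) \<in> borel_measurable (restrict_space lborel A)" by measurable
  then show ?thesis using f restrict_lborel_lebesgue_on[OF A m] integrable_restrict_lborel[OF A]
    by (auto simp: sqint_def)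
qed

lemma sqint_nsq:
  fixes f :: "'a::euclidean_space \<Rightarrow> 'b::euclidean_space"
  assumes f: "continuous_on UNIV f" and A: "A \<in> sets borel" "bounded A"
  shows sqint_lebesgue_on: "sqint (lebesgue_on A) f"
    and nsq_eq_lebesgue_on: "nsq A f = ennreal (\<integral>x. (norm (f x))\<^sup>2 \<partial>lebesgue_on A)"
proof -
  have m[measurable]: "f \<in> borel_measurable borel" using f by (rule borel_measurable_continuous_onI)
  have eq: "(\<integral>\<^sup>+x. ennreal ((norm (f x))\<^sup>2) \<partial>lebesgue_on A) = nsq A f"
    unfolding nsq_def using A by (intro nn_integral_lebesgue_on) auto
  have "f \<in> borel_measurable lebesgue" by (rule measurable_completion) (use m in simp)
  then have "f \<in> borel_measurable (lebesgue_on A)" by (rule measurable_restrict_space1)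
  then show s: "sqint (lebesgue_on A) f"
    unfolding sqint_iff eq nsq_eq_integral[OF f A] by simp
  show "nsq A f = ennreal (\<integral>x. (norm (f x))\<^sup>2 \<partial>lebesgue_on A)"
    using sqint_nn[OF s] eq by simp
qed

lemma sqint_const_finite: "finite_measure M \<Longrightarrow> sqint M (\<lambda>_. c)"
  by (simp add: sqint_def finite_measure.integrable_const)

lemma sqint_integrable_finite:
  fixes f :: "'a \<Rightarrow> real"
  shows "finite_measure M \<Longrightarrow> sqint M f \<Longrightarrow> integrable M f"
  using sqint_inner[of M f "\<lambda>_. 1"] sqint_const_finite[of M "1::real"] by simp

section \<open>C^1 functions with their gradients, and the estimates for the two-domain
  geometry\<close>

definition C1 :: "('a::euclidean_space \<Rightarrow> real) set" where
  "C1 = {\<phi>. \<exists>d\<phi>. C1_grad \<phi> d\<phi>}"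

text \<open>The choice makes the gradient depend on the function alone; \<open>gr_unique\<close>
  identifies it and thus gives linearity.\<close>

definition gr :: "('a::euclidean_space \<Rightarrow> real) \<Rightarrow> 'a \<Rightarrow> 'a" where
  "gr \<phi> = (SOME d\<phi>. C1_grad \<phi> d\<phi>)"

lemma C1_gr: "\<phi> \<in> C1 \<Longrightarrow> C1_grad \<phi> (gr \<phi>)"
  by (simp add: C1_def gr_def someI_ex)

lemma C1_gradI: "C1_grad \<phi> d\<phi> \<Longrightarrow> \<phi> \<in> C1"
  unfolding C1_def by blast

lemma gr_unique:
  assumes "C1_grad \<phi> d\<phi>"
  shows "gr \<phi> = d\<phi>"
proof
  fix x
  have "(\<lambda>h. gr \<phi> x \<bullet> h) = (\<lambda>h. d\<phi> x \<bullet> h)"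
    using C1_has_derivative[OF C1_gr[OF C1_gradI[OF assms]], of x UNIV] C1_has_derivative[OF assms, of x UNIV]
    by (rule has_derivative_unique)
  then have "gr \<phi> x \<bullet> h = d\<phi> x \<bullet> h" for h by (rule fun_cong)
  then show "gr \<phi> x = d\<phi> x" using inner_eq_zero_iff[of "gr \<phi> x - d\<phi> x"] by (simp add: inner_diff_left)
qed

lemma C1_lin:
  assumes "\<phi> \<in> C1" "\<psi> \<in> C1"
  shows "(\<lambda>x. \<phi> x + c * \<psi> x) \<in> C1" and "gr (\<lambda>x. \<phi> x + c * \<psi> x) = (\<lambda>x. gr \<phi> x + c *\<^sub>R gr \<psi> x)"
proof -
  have "C1_grad (\<lambda>x. \<phi> x + c * \<psi> x) (\<lambda>x. gr \<phi> x + c *\<^sub>R gr \<psi> x)"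
    by (rule C1_eq[OF C1_add[OF C1_gr[OF assms(1)] C1_mult[OF C1_const[of c] C1_gr[OF assms(2)]]]]) auto
  then show "(\<lambda>x. \<phi> x + c * \<psi> x) \<in> C1" "gr (\<lambda>x. \<phi> x + c * \<psi> x) = (\<lambda>x. gr \<phi> x + c *\<^sub>R gr \<psi> x)"
    by (auto intro: C1_gradI gr_unique)
qed

lemma C1_diff:
  assumes "\<phi> \<in> C1" "\<psi> \<in> C1"
  shows "(\<lambda>x. \<phi> x - \<psi> x) \<in> C1" and "gr (\<lambda>x. \<phi> x - \<psi> x) = (\<lambda>x. gr \<phi> x - gr \<psi> x)"
  using C1_lin[OF assms, of "-1"] by simp_all

lemma C1_zero: "(\<lambda>_. 0) \<in> C1" "gr (\<lambda>_. 0) = (\<lambda>_. 0)"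
  using C1_const[of 0] by (auto intro: C1_gradI gr_unique)

lemma surface_measure_measurable:
  assumes "S \<in> sets borel" "f \<in> borel_measurable borel"
  shows "f \<in> borel_measurable (surface_measure S)"
  unfolding surface_measure_eq using assms by (intro measurable_restrict_space1) (simp cong: measurable_cong_sets)

lemma finite_surface_measure:
  assumes "surface S c C r0"
  shows "finite_measure (surface_measure S)"
proof (rule finite_measureI)
  interpret surface S c C r0 by (rule assms)
  have "emeasure (surface_measure S) (space (surface_measure S)) = (\<integral>\<^sup>+x. 1 \<partial>surface_measure S)" by simp
  also have "\<dots> = emeasure (surf S) UNIV" by (subst nn_integral_surface) auto
  finally show "emeasure (surface_measure S) (space (surface_measure S)) \<noteq> \<infinity>" using finite_surf by simp
qed

text \<open>\<open>ok\<close> and the nonempty inclusion exclude the cases of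
  \<open>trivial_solution\<close>; nonemptiness is where the Poincare inequality starts.\<close>

locale transmission =
  fixes \<Omega> \<Omega>1 :: "'a::euclidean_space set" and \<sigma>1 \<sigma>2 :: real and \<gamma> :: "'a \<Rightarrow> real"
  assumes dim: "DIM('a) \<ge> 2"
    and \<Omega>: "lipschitz_open \<Omega>" "connected \<Omega>"
    and \<Omega>1: "closure \<Omega>1 \<subseteq> \<Omega>" "lipschitz_open \<Omega>1" "\<Omega>1 \<noteq> {}"
    and \<Omega>2: "connected (\<Omega> - closure \<Omega>1)"
    and \<sigma>: "\<sigma>1 > 0" "\<sigma>2 > 0"
    and \<gamma>: "Linf_pos (surface_measure (frontier \<Omega>1)) \<gamma>"
    and ok: "hausdorff_ok TYPE('a)"
begin

abbreviation M\<Omega> :: "'a measure" where "M\<Omega> \<equiv> lebesgue_on \<Omega>"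
abbreviation M\<Gamma> :: "'a measure" where "M\<Gamma> \<equiv> surface_measure (frontier \<Omega>1)"
abbreviation MO :: "'a measure" where "MO \<equiv> surface_measure (frontier \<Omega>)"
abbreviation s :: "'a \<Rightarrow> real" where "s x \<equiv> (if x \<in> \<Omega>1 then \<sigma>1 else \<sigma>2)"

lemma opens: "open \<Omega>" "bounded \<Omega>" "open \<Omega>1" "bounded \<Omega>1"
  using \<Omega> \<Omega>1 by (auto simp: lipschitz_open_def)

lemma borels [measurable]: "\<Omega> \<in> sets borel" "\<Omega>1 \<in> sets borel" "frontier \<Omega> \<in> sets borel" "frontier \<Omega>1 \<in> sets borel"
  using opens by (auto intro: borel_closed frontier_closed)

lemma surface_\<Gamma>: "\<exists>c C r0. surface (frontier \<Omega>1) c C r0"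
  by (rule surface_frontier[OF dim ok \<Omega>1(2)]) blast

lemma surface_O: "\<exists>c C r0. surface (frontier \<Omega>) c C r0"
  by (rule surface_frontier[OF dim ok \<Omega>(1)]) blast

lemma finite_measures: "finite_measure M\<Omega>" "finite_measure M\<Gamma>" "finite_measure MO"
proof -
  have "emeasure M\<Omega> (space M\<Omega>) = emeasure lborel \<Omega>"
    by (simp add: space_restrict_space emeasure_restrict_space)
  also have "\<dots> < \<infinity>" using opens by (intro emeasure_bounded_finite)
  finally show "finite_measure M\<Omega>" by (intro finite_measureI) auto
  show "finite_measure M\<Gamma>" "finite_measure MO" using surface_\<Gamma> surface_O finite_surface_measure by blast+
qed

lemma sqint_C1_M\<Omega>:
  assumes "\<phi> \<in> C1"
  shows "sqint M\<Omega> \<phi>" and "sqint M\<Omega> (gr \<phi>)"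
proof -
  show "sqint M\<Omega> \<phi>" by (rule sqint_lebesgue_on[OF C1_continuous[OF C1_gr[OF assms]] borels(1) opens(2)])
  show "sqint M\<Omega> (gr \<phi>)" by (rule sqint_lebesgue_on[OF C1_continuous_grad[OF C1_gr[OF assms]] borels(1) opens(2)])
qed

lemma trace_estimate:
  assumes sf: "surface S c C r0" and V: "open V" "bounded V"
    and ch: "\<And>p. p \<in> S \<Longrightarrow> \<exists>r k e K. 0 < r \<and> graph_chart k e K \<and> (\<forall>x\<in>S \<inter> ball p r. k x = 0) \<and> {y \<in> ball p r. 0 < k y} \<subseteq> V"
  shows "\<exists>Q\<ge>0. \<forall>\<phi>\<in>C1. sqint (surface_measure S) \<phi> \<and>
     (\<integral>x. (\<phi> x)\<^sup>2 \<partial>surface_measure S) \<le> Q * ((\<integral>x. (\<phi> x)\<^sup>2 \<partial>lebesgue_on V) + (\<integral>x. (norm (gr \<phi> x))\<^sup>2 \<partial>lebesgue_on V))"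
proof -
  interpret surface S c C r0 by (rule sf)
  obtain Q where Q: "Q \<ge> 0" "\<And>\<phi> d\<phi>. C1_grad \<phi> d\<phi> \<Longrightarrow> (\<integral>\<^sup>+x. ennreal ((\<phi> x)\<^sup>2) \<partial>surf S) \<le> ennreal Q * (nsq V \<phi> + nsq V d\<phi>)"
    by (rule trace_inequality[OF ch]) (assumption, rule that)
  have "sqint (surface_measure S) \<phi> \<and>
     (\<integral>x. (\<phi> x)\<^sup>2 \<partial>surface_measure S) \<le> Q * ((\<integral>x. (\<phi> x)\<^sup>2 \<partial>lebesgue_on V) + (\<integral>x. (norm (gr \<phi> x))\<^sup>2 \<partial>lebesgue_on V))"
    if \<phi>: "\<phi> \<in> C1" for \<phi>
  proof
    note C = C1_gr[OF \<phi>]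
    have [measurable]: "\<phi> \<in> borel_measurable borel" by (rule C1_measurable[OF C])
    define a b where "a = (\<integral>x. (\<phi> x)\<^sup>2 \<partial>lebesgue_on V)" and "b = (\<integral>x. (norm (gr \<phi> x))\<^sup>2 \<partial>lebesgue_on V)"
    have ab: "a \<ge> 0" "b \<ge> 0" unfolding a_def b_def by (auto intro!: integral_nonneg_AE)
    have n: "nsq V \<phi> = ennreal a" "nsq V (gr \<phi>) = ennreal b"
      using nsq_eq_lebesgue_on[OF C1_continuous[OF C], of V] nsq_eq_lebesgue_on[OF C1_continuous_grad[OF C], of V] V
      by (auto simp: a_def b_def)
    have "(\<integral>\<^sup>+x. ennreal ((norm (\<phi> x))\<^sup>2) \<partial>surface_measure S) = (\<integral>\<^sup>+x. ennreal ((\<phi> x)\<^sup>2) \<partial>surf S)"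
      by (subst nn_integral_surface) auto
    also have "\<dots> \<le> ennreal (Q * (a + b))" using Q(2)[OF C] Q(1) ab by (simp add: n ennreal_mult)
    finally have le: "(\<integral>\<^sup>+x. ennreal ((norm (\<phi> x))\<^sup>2) \<partial>surface_measure S) \<le> ennreal (Q * (a + b))" .
    also have "\<dots> < \<infinity>" by simp
    finally show sq: "sqint (surface_measure S) \<phi>"
      by (simp add: sqint_iff surface_measure_measurable)
    show "(\<integral>x. (\<phi> x)\<^sup>2 \<partial>surface_measure S) \<le> Q * (a + b)"
      using le Q ab unfolding sqint_nn[OF sq] by simp
  qed
  then show ?thesis using Q(1) by blast
qed

lemma trace_O: "\<exists>Q\<ge>0. \<forall>\<phi>\<in>C1. sqint MO \<phi> \<and>
     (\<integral>x. (\<phi> x)\<^sup>2 \<partial>MO) \<le> Q * ((\<integral>x. (\<phi> x)\<^sup>2 \<partial>M\<Omega>) + (\<integral>x. (norm (gr \<phi> x))\<^sup>2 \<partial>M\<Omega>))"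
proof -
  obtain c C r0 where sf: "surface (frontier \<Omega>) c C r0" using surface_O by blast
  show ?thesis
  proof (rule trace_estimate[OF sf opens(1,2)])
    fix p assume p: "p \<in> frontier \<Omega>"
    obtain r k e K where "chart_at \<Omega> p r k e K" by (rule lipschitz_open_chart[OF \<Omega>(1) p])
    then have r: "0 < r" and gc: "graph_chart k e K" and ch: "\<Omega> \<inter> ball p r = {y \<in> ball p r. 0 < k y}" by (auto simp: chart_at_def)
    have "\<forall>x\<in>frontier \<Omega> \<inter> ball p r. k x = 0" using graph_chart.frontier_chart(1)[OF gc ch] by blast
    moreover have "{y \<in> ball p r. 0 < k y} \<subseteq> \<Omega>" using ch by blast
    ultimately show "\<exists>r k e K. 0 < r \<and> graph_chart k e K \<and> (\<forall>x\<in>frontier \<Omega> \<inter> ball p r. k x = 0) \<and> {y \<in> ball p r. 0 < k y} \<subseteq> \<Omega>"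
      using r gc by blast
  qed
qed

lemma open_\<Omega>2: "open (\<Omega> - closure \<Omega>1)" "bounded (\<Omega> - closure \<Omega>1)"
  using opens by (auto intro: bounded_subset)

text \<open>The interface trace is taken from the outer side on purpose: unique continuation will
  make the limit vanish there, and this estimate carries the zero over to the interface.\<close>

lemma trace_\<Gamma>: "\<exists>Q\<ge>0. \<forall>\<phi>\<in>C1. sqint M\<Gamma> \<phi> \<and>
     (\<integral>x. (\<phi> x)\<^sup>2 \<partial>M\<Gamma>) \<le> Q * ((\<integral>x. (\<phi> x)\<^sup>2 \<partial>lebesgue_on (\<Omega> - closure \<Omega>1)) + (\<integral>x. (norm (gr \<phi> x))\<^sup>2 \<partial>lebesgue_on (\<Omega> - closure \<Omega>1)))"
proof -
  obtain c C r0 where sf: "surface (frontier \<Omega>1) c C r0" using surface_\<Gamma> by blast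
  show ?thesis
  proof (rule trace_estimate[OF sf open_\<Omega>2])
    fix p assume p: "p \<in> frontier \<Omega>1"
    obtain r k e K where "chart_at \<Omega>1 p r k e K" by (rule lipschitz_open_chart[OF \<Omega>1(2) p])
    then have r: "0 < r" and gc: "graph_chart k e K" and ch: "\<Omega>1 \<inter> ball p r = {y \<in> ball p r. 0 < k y}" by (auto simp: chart_at_def)
    have "p \<in> \<Omega>" using p \<Omega>1(1) by (auto simp: frontier_def)
    then obtain r' where r': "r' > 0" "ball p r' \<subseteq> \<Omega>" using opens(1) open_contains_ball by blast
    define \<rho> where "\<rho> = min r r'"
    have \<rho>: "\<rho> > 0" "ball p \<rho> \<subseteq> ball p r" "ball p \<rho> \<subseteq> \<Omega>" using r r' by (auto simp: \<rho>_def)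
    have gc': "graph_chart (\<lambda>y. - k y) (- e) K" by (rule graph_chart.reflect[OF gc])
    have "\<forall>x\<in>frontier \<Omega>1 \<inter> ball p \<rho>. - k x = 0"
      using graph_chart.frontier_chart(1)[OF gc ch] \<rho>(2) by fastforce
    moreover have "{y \<in> ball p \<rho>. 0 < - k y} \<subseteq> \<Omega> - closure \<Omega>1"
      using graph_chart.frontier_chart(2)[OF gc ch] \<rho>(2,3) by fastforce
    ultimately show "\<exists>r k e K. 0 < r \<and> graph_chart k e K \<and> (\<forall>x\<in>frontier \<Omega>1 \<inter> ball p r. k x = 0) \<and> {y \<in> ball p r. 0 < k y} \<subseteq> \<Omega> - closure \<Omega>1"
      using \<rho>(1) gc' by blast
  qed
qed

lemma sqint_C1_traces:
  assumes "\<phi> \<in> C1"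
  shows sqint_C1_MO: "sqint MO \<phi>" and sqint_C1_M\<Gamma>: "sqint M\<Gamma> \<phi>"
  using trace_O trace_\<Gamma> assms by blast+

lemma poincare_real: "\<exists>Q\<ge>0. \<forall>\<phi>\<in>C1. (\<integral>x. (\<phi> x)\<^sup>2 \<partial>M\<Omega>) \<le> Q * ((\<integral>x. (norm (gr \<phi> x))\<^sup>2 \<partial>M\<Omega>) + (\<integral>x. (\<phi> x)\<^sup>2 \<partial>M\<Gamma>))"
proof -
  obtain c C r0 where sf: "surface (frontier \<Omega>1) c C r0" using surface_\<Gamma> by blast
  have "\<Omega>1 \<subseteq> \<Omega>" using \<Omega>1(1) closure_subset by blast
  then obtain Q where Q: "Q \<ge> 0" "\<And>\<phi> d\<phi>. C1_grad \<phi> d\<phi> \<Longrightarrow>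
     nsq \<Omega> \<phi> \<le> ennreal Q * (nsq \<Omega> d\<phi> + (\<integral>\<^sup>+x. ennreal ((\<phi> x)\<^sup>2) \<partial>surf (frontier \<Omega>1)))"
    by (rule poincare[OF \<Omega> opens(3) \<Omega>1(3) _ sf]) (rule that)
  have "(\<integral>x. (\<phi> x)\<^sup>2 \<partial>M\<Omega>) \<le> Q * ((\<integral>x. (norm (gr \<phi> x))\<^sup>2 \<partial>M\<Omega>) + (\<integral>x. (\<phi> x)\<^sup>2 \<partial>M\<Gamma>))" if \<phi>: "\<phi> \<in> C1" for \<phi>
  proof -
    note C = C1_gr[OF \<phi>]
    have [measurable]: "\<phi> \<in> borel_measurable borel" by (rule C1_measurable[OF C])
    define a b t where "a = (\<integral>x. (\<phi> x)\<^sup>2 \<partial>M\<Omega>)" and "b = (\<integral>x. (norm (gr \<phi> x))\<^sup>2 \<partial>M\<Omega>)" and "t = (\<integral>x. (\<phi> x)\<^sup>2 \<partial>M\<Gamma>)"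
    have abt: "a \<ge> 0" "b \<ge> 0" "t \<ge> 0" unfolding a_def b_def t_def by (auto intro!: integral_nonneg_AE)
    have n: "nsq \<Omega> \<phi> = ennreal a" "nsq \<Omega> (gr \<phi>) = ennreal b"
      using nsq_eq_lebesgue_on[OF C1_continuous[OF C], of \<Omega>] nsq_eq_lebesgue_on[OF C1_continuous_grad[OF C], of \<Omega>] opens
      by (auto simp: a_def b_def)
    have "(\<integral>\<^sup>+x. ennreal ((\<phi> x)\<^sup>2) \<partial>surf (frontier \<Omega>1)) = (\<integral>\<^sup>+x. ennreal ((norm (\<phi> x))\<^sup>2) \<partial>M\<Gamma>)"
      by (subst nn_integral_surface) auto
    also have "\<dots> = ennreal t" unfolding sqint_nn[OF sqint_C1_M\<Gamma>[OF \<phi>]] by (simp add: t_def)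
    finally have "ennreal a \<le> ennreal (Q * (b + t))" using Q(2)[OF C] Q(1) abt by (simp add: n ennreal_mult)
    then show ?thesis using Q abt unfolding a_def b_def t_def by (subst (asm) ennreal_le_iff) auto
  qed
  then show ?thesis using Q(1) by blast
qed

text \<open>Only the product on the outer boundary enters the bound. It is 0 for test functions
  (\<open>weak_grad_limit\<close>) and tends to 0 when the traces do
  (\<open>zero_extension\<close>).\<close>

lemma green_product:
  obtains Q where "Q \<ge> 0" "\<And>\<phi> f df i. \<phi> \<in> C1 \<Longrightarrow> C1_grad f df \<Longrightarrow> i \<in> Basis \<Longrightarrow>
     \<bar>\<integral>x. \<phi> x * (df x \<bullet> i) + f x * (gr \<phi> x \<bullet> i) \<partial>M\<Omega>\<bar> \<le> Q * (\<integral>x. \<bar>\<phi> x * f x\<bar> \<partial>MO)"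
proof -
  obtain c C r0 where sf: "surface (frontier \<Omega>) c C r0" using surface_O by blast
  interpret surface "frontier \<Omega>" c C r0 by (rule sf)
  define Q where "Q = unit_ball_vol (DIM('a)) * 2 ^ DIM('a) / c"
  have Q: "Q \<ge> 0" using pos by (simp add: Q_def)
  have "\<bar>\<integral>x. \<phi> x * (df x \<bullet> i) + f x * (gr \<phi> x \<bullet> i) \<partial>M\<Omega>\<bar> \<le> Q * (\<integral>x. \<bar>\<phi> x * f x\<bar> \<partial>MO)"
    if \<phi>: "\<phi> \<in> C1" and f: "C1_grad f df" and i: "i \<in> Basis" for \<phi> f df i
  proof -
    note C = C1_mult[OF C1_gr[OF \<phi>] f]
    have [measurable]: "\<phi> \<in> borel_measurable borel" "f \<in> borel_measurable borel"
      using C1_measurable[OF C1_gr[OF \<phi>]] C1_measurable[OF f] by auto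
    have int: "integrable MO (\<lambda>x. \<bar>\<phi> x * f x\<bar>)"
      using sqint_inner[OF sqint_C1_MO[OF \<phi>] sqint_C1_MO[OF C1_gradI[OF f]]] by simp
    have "ennreal \<bar>\<integral>x. (\<phi> x *\<^sub>R df x + f x *\<^sub>R gr \<phi> x) \<bullet> i \<partial>M\<Omega>\<bar> \<le> ennreal Q * (\<integral>\<^sup>+x. ennreal \<bar>\<phi> x * f x\<bar> \<partial>surf (frontier \<Omega>))"
      unfolding Q_def using i by (intro green[OF C opens(1,2) refl]) auto
    also have "(\<integral>\<^sup>+x. ennreal \<bar>\<phi> x * f x\<bar> \<partial>surf (frontier \<Omega>)) = (\<integral>\<^sup>+x. ennreal \<bar>\<phi> x * f x\<bar> \<partial>MO)"
      by (subst nn_integral_surface) auto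
    also have "\<dots> = ennreal (\<integral>x. \<bar>\<phi> x * f x\<bar> \<partial>MO)" by (intro nn_integral_eq_integral int) auto
    also have "ennreal Q * \<dots> = ennreal (Q * (\<integral>x. \<bar>\<phi> x * f x\<bar> \<partial>MO))" using Q by (simp add: ennreal_mult')
    finally have "\<bar>\<integral>x. (\<phi> x *\<^sub>R df x + f x *\<^sub>R gr \<phi> x) \<bullet> i \<partial>M\<Omega>\<bar> \<le> Q * (\<integral>x. \<bar>\<phi> x * f x\<bar> \<partial>MO)"
      using Q by (subst (asm) ennreal_le_iff) (auto intro!: mult_nonneg_nonneg integral_nonneg_AE)
    then show ?thesis by (simp add: inner_add_left)
  qed
  with Q show ?thesis using that by blast
qed

end

section \<open>Weak solutions\<close>

context transmission
begin

lemma \<gamma>_bounds: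
  obtains c C where "0 < c" "AE x in M\<Gamma>. c \<le> \<gamma> x" "AE x in M\<Gamma>. \<bar>\<gamma> x\<bar> \<le> C"
proof -
  obtain c C where c: "0 < c" "AE x in M\<Gamma>. c \<le> \<gamma> x \<and> \<gamma> x \<le> C" using \<gamma> by (auto simp: Linf_pos_def)
  have "AE x in M\<Gamma>. c \<le> \<gamma> x" using c(2) by eventually_elim simp
  moreover have "AE x in M\<Gamma>. \<bar>\<gamma> x\<bar> \<le> C" using c(2) by eventually_elim (use c(1) in auto)
  ultimately show ?thesis using that c(1) by blast
qed

lemma \<gamma>_measurable [measurable]: "\<gamma> \<in> borel_measurable M\<Gamma>"
  using \<gamma> by (simp add: Linf_pos_def)

lemma s_measurable [measurable]: "s \<in> borel_measurable M\<Omega>"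
  by (rule measurable_restrict_space1) (auto intro: measurable_completion)

lemma sqint_s: "sqint M\<Omega> G \<Longrightarrow> sqint M\<Omega> (\<lambda>x. s x *\<^sub>R G x)"
  by (rule sqint_bounded_mult[of _ _ _ "max \<sigma>1 \<sigma>2"]) (use \<sigma> in auto)

lemma sqint_\<gamma>:
  assumes "sqint M\<Gamma> t"
  shows "sqint M\<Gamma> (\<lambda>x. \<gamma> x * t x)"
proof -
  obtain C where "AE x in M\<Gamma>. \<bar>\<gamma> x\<bar> \<le> C" by (rule \<gamma>_bounds)
  from sqint_bounded_mult[OF assms \<gamma>_measurable this] show ?thesis by simp
qed

lemma integrable_flux: "sqint M\<Omega> G \<Longrightarrow> sqint M\<Omega> H \<Longrightarrow> integrable M\<Omega> (\<lambda>x. s x * (G x \<bullet> H x))"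
  using sqint_inner[OF sqint_s, of G H] by simp

lemma integrable_\<gamma>: "sqint M\<Gamma> t \<Longrightarrow> sqint M\<Gamma> w \<Longrightarrow> integrable M\<Gamma> (\<lambda>x. \<gamma> x * t x * w x)"
  using sqint_inner[OF sqint_\<gamma>, of t w] by simp

text \<open>Gradient and trace are separate arguments because the limit of a sequence is no C^1
  function and has no \<open>gr\<close>.\<close>

definition bil :: "('a \<Rightarrow> 'a) \<Rightarrow> ('a \<Rightarrow> real) \<Rightarrow> ('a \<Rightarrow> 'a) \<Rightarrow> ('a \<Rightarrow> real) \<Rightarrow> real" where
  "bil G t H w = (\<integral>x. s x * (G x \<bullet> H x) \<partial>M\<Omega>) + (\<integral>x. \<gamma> x * t x * w x \<partial>M\<Gamma>)"

definition en :: "('a \<Rightarrow> real) \<Rightarrow> ('a \<Rightarrow> real) \<Rightarrow> real" where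
  "en \<phi> \<psi> = bil (gr \<phi>) \<phi> (gr \<psi>) \<psi>"

lemma bil_sym: "bil G t H w = bil H w G t"
  by (simp add: bil_def inner_commute mult_ac)

lemma bil_lin:
  assumes "sqint M\<Omega> G" "sqint M\<Omega> G'" "sqint M\<Omega> H" "sqint M\<Gamma> t" "sqint M\<Gamma> t'" "sqint M\<Gamma> w"
  shows "bil (\<lambda>x. G x + c *\<^sub>R G' x) (\<lambda>x. t x + c * t' x) H w = bil G t H w + c * bil G' t' H w"
proof -
  have 1: "(\<lambda>x. s x * ((G x + c *\<^sub>R G' x) \<bullet> H x)) = (\<lambda>x. s x * (G x \<bullet> H x) + c * (s x * (G' x \<bullet> H x)))"
    by (auto simp: fun_eq_iff inner_add_left algebra_simps)
  have 2: "(\<lambda>x. \<gamma> x * (t x + c * t' x) * w x) = (\<lambda>x. \<gamma> x * t x * w x + c * (\<gamma> x * t' x * w x))"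
    by (auto simp: fun_eq_iff algebra_simps)
  have "(\<integral>x. s x * (G x \<bullet> H x) + c * (s x * (G' x \<bullet> H x)) \<partial>M\<Omega>) = (\<integral>x. s x * (G x \<bullet> H x) \<partial>M\<Omega>) + c * (\<integral>x. s x * (G' x \<bullet> H x) \<partial>M\<Omega>)"
    using assms by (subst Bochner_Integration.integral_add)
      (auto intro!: integrable_flux integrable_mult_right simp only: integral_mult_right_zero)
  moreover have "(\<integral>x. \<gamma> x * t x * w x + c * (\<gamma> x * t' x * w x) \<partial>M\<Gamma>) = (\<integral>x. \<gamma> x * t x * w x \<partial>M\<Gamma>) + c * (\<integral>x. \<gamma> x * t' x * w x \<partial>M\<Gamma>)"
    using assms by (subst Bochner_Integration.integral_add)
      (auto intro!: integrable_\<gamma> integrable_mult_right simp only: integral_mult_right_zero)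
  ultimately show ?thesis unfolding bil_def 1 2 by (simp only: distrib_left)
qed

lemma bil_lower:
  obtains m where "m > 0" "\<And>G t. sqint M\<Omega> G \<Longrightarrow> sqint M\<Gamma> t \<Longrightarrow>
     m * ((\<integral>x. (norm (G x))\<^sup>2 \<partial>M\<Omega>) + (\<integral>x. (t x)\<^sup>2 \<partial>M\<Gamma>)) \<le> bil G t G t"
proof -
  obtain c C where c: "0 < c" "AE x in M\<Gamma>. c \<le> \<gamma> x" by (rule \<gamma>_bounds)
  define m where "m = min (min \<sigma>1 \<sigma>2) c"
  have m: "m > 0" "m \<le> c" "m \<le> s x" for x using \<sigma> c by (auto simp: m_def)
  have "m * ((\<integral>x. (norm (G x))\<^sup>2 \<partial>M\<Omega>) + (\<integral>x. (t x)\<^sup>2 \<partial>M\<Gamma>)) \<le> bil G t G t"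
    if G: "sqint M\<Omega> G" and t: "sqint M\<Gamma> t" for G t
  proof -
    have "(\<integral>x. m * (norm (G x))\<^sup>2 \<partial>M\<Omega>) \<le> (\<integral>x. s x * (G x \<bullet> G x) \<partial>M\<Omega>)"
    proof (intro integral_mono integrable_flux G integrable_mult_right sqint_integrable)
      fix x
      show "m * (norm (G x))\<^sup>2 \<le> s x * (G x \<bullet> G x)"
        unfolding power2_norm_eq_inner using m(3)[of x] by (intro mult_right_mono) auto
    qed
    moreover have "(\<integral>x. m * (t x)\<^sup>2 \<partial>M\<Gamma>) \<le> (\<integral>x. \<gamma> x * t x * t x \<partial>M\<Gamma>)"
    proof (rule integral_mono_AE[OF _ integrable_\<gamma>[OF t t]])
      show "integrable M\<Gamma> (\<lambda>x. m * (t x)\<^sup>2)" using sqint_integrable[OF t] by simp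
      show "AE x in M\<Gamma>. m * (t x)\<^sup>2 \<le> \<gamma> x * t x * t x"
        using c(2)
      proof eventually_elim
        case (elim x)
        then have "m * (t x)\<^sup>2 \<le> \<gamma> x * (t x)\<^sup>2" using m(2) by (intro mult_right_mono) auto
        then show ?case by (simp add: power2_eq_square mult.assoc)
      qed
    qed
    ultimately show ?thesis unfolding bil_def by (simp add: distrib_left)
  qed
  with m(1) show ?thesis using that by blast
qed

text \<open>Gradient and interface terms control the function itself through the Poincare
  inequality, so a sequence that is Cauchy in energy converges in \<open>H^1\<close> together with
  its interface trace.\<close>

lemma en_coercive:
  obtains Q where "Q \<ge> 0" "\<And>\<phi>. \<phi> \<in> C1 \<Longrightarrow> (\<integral>x. (\<phi> x)\<^sup>2 \<partial>M\<Omega>) + (\<integral>x. (norm (gr \<phi> x))\<^sup>2 \<partial>M\<Omega>) + (\<integral>x. (\<phi> x)\<^sup>2 \<partial>M\<Gamma>) \<le> Q * en \<phi> \<phi>"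
proof -
  obtain m where m: "m > 0" "\<And>G t. sqint M\<Omega> G \<Longrightarrow> sqint M\<Gamma> t \<Longrightarrow>
     m * ((\<integral>x. (norm (G x))\<^sup>2 \<partial>M\<Omega>) + (\<integral>x. (t x)\<^sup>2 \<partial>M\<Gamma>)) \<le> bil G t G t" by (rule bil_lower) (rule that)
  obtain P where P: "P \<ge> 0" "\<And>\<phi>. \<phi> \<in> C1 \<Longrightarrow> (\<integral>x. (\<phi> x)\<^sup>2 \<partial>M\<Omega>) \<le> P * ((\<integral>x. (norm (gr \<phi> x))\<^sup>2 \<partial>M\<Omega>) + (\<integral>x. (\<phi> x)\<^sup>2 \<partial>M\<Gamma>))"
    using poincare_real by blast
  have "(\<integral>x. (\<phi> x)\<^sup>2 \<partial>M\<Omega>) + (\<integral>x. (norm (gr \<phi> x))\<^sup>2 \<partial>M\<Omega>) + (\<integral>x. (\<phi> x)\<^sup>2 \<partial>M\<Gamma>) \<le> ((P + 1) / m) * en \<phi> \<phi>" if \<phi>: "\<phi> \<in> C1" for \<phi>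
  proof -
    define b where "b = (\<integral>x. (norm (gr \<phi> x))\<^sup>2 \<partial>M\<Omega>) + (\<integral>x. (\<phi> x)\<^sup>2 \<partial>M\<Gamma>)"
    have "(\<integral>x. (\<phi> x)\<^sup>2 \<partial>M\<Omega>) + (\<integral>x. (norm (gr \<phi> x))\<^sup>2 \<partial>M\<Omega>) + (\<integral>x. (\<phi> x)\<^sup>2 \<partial>M\<Gamma>) \<le> (P + 1) * b"
      using P(2)[OF \<phi>] by (simp add: b_def algebra_simps)
    also have "\<dots> = ((P + 1) / m) * (m * b)" using m(1) by simp
    also have "\<dots> \<le> ((P + 1) / m) * en \<phi> \<phi>"
      using m(2)[OF sqint_C1_M\<Omega>(2)[OF \<phi>] sqint_C1_M\<Gamma>[OF \<phi>]] m(1) P(1)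
      by (intro mult_left_mono) (auto simp: en_def b_def)
    finally show ?thesis .
  qed
  then show ?thesis using that[of "(P + 1) / m"] m(1) P(1) by simp
qed

lemma en_nonneg: "\<phi> \<in> C1 \<Longrightarrow> 0 \<le> en \<phi> \<phi>"
proof -
  assume \<phi>: "\<phi> \<in> C1"
  obtain m where m: "m > 0" "\<And>G t. sqint M\<Omega> G \<Longrightarrow> sqint M\<Gamma> t \<Longrightarrow>
     m * ((\<integral>x. (norm (G x))\<^sup>2 \<partial>M\<Omega>) + (\<integral>x. (t x)\<^sup>2 \<partial>M\<Gamma>)) \<le> bil G t G t" by (rule bil_lower) (rule that)
  have "0 \<le> m * ((\<integral>x. (norm (gr \<phi> x))\<^sup>2 \<partial>M\<Omega>) + (\<integral>x. (\<phi> x)\<^sup>2 \<partial>M\<Gamma>))"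
    using m(1) by (intro mult_nonneg_nonneg add_nonneg_nonneg integral_nonneg_AE) auto
  also have "\<dots> \<le> en \<phi> \<phi>" unfolding en_def using \<phi> by (intro m(2) sqint_C1_M\<Omega> sqint_C1_M\<Gamma>)
  finally show ?thesis .
qed

sublocale energy: semi_inner C1 en
proof
  show "C1 \<noteq> ({} :: ('a \<Rightarrow> real) set)" using C1_zero(1) by blast
  show "(\<lambda>x. f x + c * g x) \<in> C1" if "f \<in> C1" "g \<in> C1" for f g :: "'a \<Rightarrow> real" and c using C1_lin(1)[OF that] .
  show "en (\<lambda>x. f x + c * g x) h = en f h + c * en g h" if "f \<in> C1" "g \<in> C1" "h \<in> C1" for f g h c
    unfolding en_def C1_lin(2)[OF that(1,2)] using that by (intro bil_lin sqint_C1_M\<Omega> sqint_C1_M\<Gamma>)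
  show "en f g = en g f" for f g unfolding en_def by (rule bil_sym)
  show "0 \<le> en f f" if "f \<in> C1" for f using en_nonneg[OF that] .
qed

text \<open>Stands for an element of \<open>H^1\<close> with its gradient \<open>G\<close> and
  interface trace \<open>t\<close>. One sequence realizes all three limits, so identities for C^1
  functions pass to the limit simultaneously.\<close>

definition H1lim :: "(nat \<Rightarrow> 'a \<Rightarrow> real) \<Rightarrow> ('a \<Rightarrow> real) \<Rightarrow> ('a \<Rightarrow> 'a) \<Rightarrow> ('a \<Rightarrow> real) \<Rightarrow> bool" where
  "H1lim un u G t \<longleftrightarrow> (\<forall>n. un n \<in> C1) \<and> sqint M\<Omega> u \<and> sqint M\<Omega> G \<and> sqint M\<Gamma> t \<and>
     (\<lambda>n. sqdist M\<Omega> (un n) u) \<longlonglongrightarrow> 0 \<and> (\<lambda>n. sqdist M\<Omega> (gr (un n)) G) \<longlonglongrightarrow> 0 \<and> (\<lambda>n. sqdist M\<Gamma> (un n) t) \<longlonglongrightarrow> 0"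

lemma energy_Cauchy_limit:
  assumes un: "\<And>n. un n \<in> C1" and Cauchy: "\<And>\<epsilon>. \<epsilon> > 0 \<Longrightarrow> \<exists>N. \<forall>m\<ge>N. \<forall>n\<ge>N. en (\<lambda>x. un m x - un n x) (\<lambda>x. un m x - un n x) < \<epsilon>"
  obtains u G t where "H1lim un u G t" "u \<in> borel_measurable (restrict_space lborel \<Omega>)" "G \<in> borel_measurable (restrict_space lborel \<Omega>)"
proof -
  \<comment> \<open>Completeness is used over \<open>?M0\<close> and not over
    \<open>M\<Omega>\<close>, so that the limits are Borel on \<open>\<Omega>\<close>; the distances
    agree by \<open>dist0\<close>.\<close>
  let ?M0 = "restrict_space lborel \<Omega>"
  obtain Q where Q: "Q \<ge> 0" "\<And>\<phi>. \<phi> \<in> C1 \<Longrightarrow> (\<integral>x. (\<phi> x)\<^sup>2 \<partial>M\<Omega>) + (\<integral>x. (norm (gr \<phi> x))\<^sup>2 \<partial>M\<Omega>) + (\<integral>x. (\<phi> x)\<^sup>2 \<partial>M\<Gamma>) \<le> Q * en \<phi> \<phi>"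
    by (rule en_coercive) (rule that)
  have small: "\<exists>N. \<forall>m\<ge>N. \<forall>n\<ge>N. sqdist M\<Omega> (un m) (un n) < \<epsilon> \<and> sqdist M\<Omega> (gr (un m)) (gr (un n)) < \<epsilon> \<and> sqdist M\<Gamma> (un m) (un n) < \<epsilon>"
    if \<epsilon>: "\<epsilon> > 0" for \<epsilon>
  proof -
    obtain N where N: "\<And>m n. m \<ge> N \<Longrightarrow> n \<ge> N \<Longrightarrow> en (\<lambda>x. un m x - un n x) (\<lambda>x. un m x - un n x) < \<epsilon> / (Q + 1)"
      using Cauchy[of "\<epsilon> / (Q + 1)"] \<epsilon> Q by auto
    have "sqdist M\<Omega> (un m) (un n) < \<epsilon> \<and> sqdist M\<Omega> (gr (un m)) (gr (un n)) < \<epsilon> \<and> sqdist M\<Gamma> (un m) (un n) < \<epsilon>"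
      if mn: "m \<ge> N" "n \<ge> N" for m n
    proof -
      note d = C1_diff[OF un[of m] un[of n]]
      have "Q * en (\<lambda>x. un m x - un n x) (\<lambda>x. un m x - un n x) \<le> Q * (\<epsilon> / (Q + 1))"
        using N[OF mn] Q(1) by (intro mult_left_mono) auto
      also have "\<dots> < \<epsilon>" using Q(1) \<epsilon> by (simp add: field_simps)
      finally have "sqdist M\<Omega> (un m) (un n) + sqdist M\<Omega> (gr (un m)) (gr (un n)) + sqdist M\<Gamma> (un m) (un n) < \<epsilon>"
        using Q(2)[OF d(1)] unfolding d(2) by simp
      moreover have "0 \<le> sqdist M\<Omega> (un m) (un n)" "0 \<le> sqdist M\<Omega> (gr (un m)) (gr (un n))" "0 \<le> sqdist M\<Gamma> (un m) (un n)"
        by (auto intro!: integral_nonneg_AE)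
      ultimately show ?thesis by linarith
    qed
    then show ?thesis by blast
  qed
  have m0: "un n \<in> borel_measurable ?M0" "gr (un n) \<in> borel_measurable ?M0" for n
    using C1_measurable[OF C1_gr[OF un]] C1_grad_measurable[OF C1_gr[OF un]] by (auto intro!: measurable_restrict_space1)
  have sq0: "sqint ?M0 f" if "f \<in> borel_measurable ?M0" "sqint M\<Omega> f" for f :: "'a \<Rightarrow> 'b::euclidean_space"
    using that integrable_restrict_lborel[OF borels(1), of "\<lambda>x. (norm (f x))\<^sup>2"] by (auto simp: sqint_def)
  have dist0: "sqdist ?M0 f g = sqdist M\<Omega> f g" if [measurable]: "f \<in> borel_measurable ?M0" "g \<in> borel_measurable ?M0" for f g :: "'a \<Rightarrow> 'b::euclidean_space"
    by (rule integral_restrict_lborel[OF borels(1)]) measurable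
  obtain u where u: "sqint ?M0 u" "(\<lambda>n. sqdist ?M0 (un n) u) \<longlonglongrightarrow> 0"
  proof (rule L2_complete[of ?M0 un])
    show "sqint ?M0 (un n)" for n by (intro sq0 m0 sqint_C1_M\<Omega> un)
    show "\<exists>N. \<forall>m\<ge>N. \<forall>n\<ge>N. sqdist ?M0 (un m) (un n) < \<epsilon>" if "\<epsilon> > 0" for \<epsilon>
      unfolding dist0[OF m0(1) m0(1)] using small[OF that] by blast
  qed
  obtain G where G: "sqint ?M0 G" "(\<lambda>n. sqdist ?M0 (gr (un n)) G) \<longlonglongrightarrow> 0"
  proof (rule L2_complete[of ?M0 "\<lambda>n. gr (un n)"])
    show "sqint ?M0 (gr (un n))" for n by (intro sq0 m0 sqint_C1_M\<Omega> un)
    show "\<exists>N. \<forall>m\<ge>N. \<forall>n\<ge>N. sqdist ?M0 (gr (un m)) (gr (un n)) < \<epsilon>" if "\<epsilon> > 0" for \<epsilon>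
      unfolding dist0[OF m0(2) m0(2)] using small[OF that] by blast
  qed
  obtain t where t: "sqint M\<Gamma> t" "(\<lambda>n. sqdist M\<Gamma> (un n) t) \<longlonglongrightarrow> 0"
  proof (rule L2_complete[of M\<Gamma> un])
    show "sqint M\<Gamma> (un n)" for n by (intro sqint_C1_M\<Gamma> un)
    show "\<exists>N. \<forall>m\<ge>N. \<forall>n\<ge>N. sqdist M\<Gamma> (un m) (un n) < \<epsilon>" if "\<epsilon> > 0" for \<epsilon>
      using small[OF that] by blast
  qed
  have "H1lim un u G t"
    unfolding H1lim_def
    using un t sqint_restrict_lborel[OF borels(1) u(1)] sqint_restrict_lborel[OF borels(1) G(1)]
      u(2)[unfolded dist0[OF m0(1) sqint_measurable[OF u(1)]]] G(2)[unfolded dist0[OF m0(2) sqint_measurable[OF G(1)]]]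
    by blast
  then show ?thesis by (rule that[OF _ sqint_measurable[OF u(1)] sqint_measurable[OF G(1)]])
qed

lemma bil_tendsto_left:
  assumes lim: "H1lim un u G t" and H: "sqint M\<Omega> H" "sqint M\<Gamma> w"
  shows "(\<lambda>n. bil (gr (un n)) (un n) H w) \<longlonglongrightarrow> bil G t H w"
proof -
  have un: "\<And>n. un n \<in> C1" and sq: "sqint M\<Omega> G" "sqint M\<Gamma> t"
    and tend: "(\<lambda>n. sqdist M\<Omega> (gr (un n)) G) \<longlonglongrightarrow> 0" "(\<lambda>n. sqdist M\<Gamma> (un n) t) \<longlonglongrightarrow> 0"
    using lim by (auto simp: H1lim_def)
  have 1: "(\<lambda>n. \<integral>x. gr (un n) x \<bullet> (s x *\<^sub>R H x) \<partial>M\<Omega>) \<longlonglongrightarrow> (\<integral>x. G x \<bullet> (s x *\<^sub>R H x) \<partial>M\<Omega>)"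
    by (rule sqdist_inner_tendsto[OF sqint_C1_M\<Omega>(2)[OF un] sq(1) sqint_s[OF H(1)] tend(1)])
  have 2: "(\<lambda>n. \<integral>x. un n x \<bullet> (\<gamma> x * w x) \<partial>M\<Gamma>) \<longlonglongrightarrow> (\<integral>x. t x \<bullet> (\<gamma> x * w x) \<partial>M\<Gamma>)"
    by (rule sqdist_inner_tendsto[OF sqint_C1_M\<Gamma>[OF un] sq(2) sqint_\<gamma>[OF H(2)] tend(2)])
  have e1: "A x \<bullet> (s x *\<^sub>R H x) = s x * (A x \<bullet> H x)" for A :: "'a \<Rightarrow> 'a" and x by simp
  have e2: "b x \<bullet> (\<gamma> x * w x) = \<gamma> x * b x * w x" for b :: "'a \<Rightarrow> real" and x by simp
  from tendsto_add[OF 1 2] show ?thesis unfolding bil_def e1 e2 .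
qed

lemma bil_tendsto_right:
  "H1lim un u G t \<Longrightarrow> sqint M\<Omega> H \<Longrightarrow> sqint M\<Gamma> w \<Longrightarrow> (\<lambda>n. bil H w (gr (un n)) (un n)) \<longlonglongrightarrow> bil H w G t"
  using bil_tendsto_left by (simp add: bil_sym[of H w])

text \<open>The functional \<open>l\<close> is kept general because it serves two kinds of source:
  on the outer boundary in \<open>solves_exists\<close> and on the interface in
  \<open>orthogonal_zero\<close>.\<close>

lemma solution_exists:
  assumes l: "\<And>f g c. f \<in> C1 \<Longrightarrow> g \<in> C1 \<Longrightarrow> l (\<lambda>x. f x + c * g x) = l f + c * l g"
    and bound: "\<And>f. f \<in> C1 \<Longrightarrow> (l f)\<^sup>2 \<le> K * en f f"
  obtains un u G t where "H1lim un u G t" "u \<in> borel_measurable (restrict_space lborel \<Omega>)" "G \<in> borel_measurable (restrict_space lborel \<Omega>)"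
    "\<And>\<phi>. \<phi> \<in> C1 \<Longrightarrow> bil G t (gr \<phi>) \<phi> = l \<phi>"
proof -
  obtain un \<delta> where un: "\<And>n. un n \<in> C1" and \<delta>: "\<delta> \<longlonglongrightarrow> 0"
    and r: "\<And>n f. f \<in> C1 \<Longrightarrow> (en (un n) f - l f)\<^sup>2 \<le> \<delta> n * en f f"
    by (rule energy.riesz_sequence[OF l bound]) (assumption, assumption, assumption, rule that)
  have Cauchy: "\<exists>N. \<forall>m\<ge>N. \<forall>n\<ge>N. en (\<lambda>x. un m x - un n x) (\<lambda>x. un m x - un n x) < \<epsilon>" if "\<epsilon> > 0" for \<epsilon>
    by (rule energy.riesz_sequence_Cauchy[OF un \<delta> r that])
  obtain u G t where lim: "H1lim un u G t" and m: "u \<in> borel_measurable (restrict_space lborel \<Omega>)" "G \<in> borel_measurable (restrict_space lborel \<Omega>)"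
    by (rule energy_Cauchy_limit[OF un Cauchy]) (assumption, rule that)
  have "bil G t (gr \<phi>) \<phi> = l \<phi>" if \<phi>: "\<phi> \<in> C1" for \<phi>
  proof -
    have "(\<lambda>n. (en (un n) \<phi> - l \<phi>)\<^sup>2) \<longlonglongrightarrow> 0"
    proof (rule tendsto_sandwich[OF _ _ tendsto_const])
      show "(\<lambda>n. \<delta> n * en \<phi> \<phi>) \<longlonglongrightarrow> 0" using tendsto_mult[OF \<delta> tendsto_const, of "en \<phi> \<phi>"] by simp
    qed (use r[OF \<phi>] in auto)
    from tendsto_real_sqrt[OF this] have "(\<lambda>n. en (un n) \<phi> - l \<phi>) \<longlonglongrightarrow> 0" by (simp add: tendsto_rabs_zero_iff)
    then have "(\<lambda>n. en (un n) \<phi>) \<longlonglongrightarrow> l \<phi>" by (rule LIM_zero_cancel)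
    moreover have "(\<lambda>n. en (un n) \<phi>) \<longlonglongrightarrow> bil G t (gr \<phi>) \<phi>"
      unfolding en_def by (intro bil_tendsto_left[OF lim] sqint_C1_M\<Omega> sqint_C1_M\<Gamma> \<phi>)
    ultimately show ?thesis using LIMSEQ_unique by blast
  qed
  then show ?thesis using that lim m by blast
qed

text \<open>For each C^1 member integration by parts is exact, because the bound of
  \<open>green_product\<close> is 0 when the test function vanishes on the frontier; both sides then
  pass to the limit.\<close>

lemma weak_grad_limit:
  assumes lim: "H1lim un u G t"
  shows "weak_grad \<Omega> u G"
proof -
  have un: "\<And>n. un n \<in> C1" and sq: "sqint M\<Omega> u" "sqint M\<Omega> G" using lim by (auto simp: H1lim_def)
  obtain Q where Q: "\<And>\<phi> f df i. \<phi> \<in> C1 \<Longrightarrow> C1_grad f df \<Longrightarrow> i \<in> Basis \<Longrightarrow>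
     \<bar>\<integral>x. \<phi> x * (df x \<bullet> i) + f x * (gr \<phi> x \<bullet> i) \<partial>M\<Omega>\<bar> \<le> Q * (\<integral>x. \<bar>\<phi> x * f x\<bar> \<partial>MO)"
    by (rule green_product) (rule that)
  have "(\<integral>x. u x * (d\<psi> x \<bullet> i) \<partial>M\<Omega>) = - (\<integral>x. (G x \<bullet> i) * \<psi> x \<partial>M\<Omega>)" if t: "test_fun \<Omega> \<psi> d\<psi>" and i: "i \<in> Basis" for \<psi> d\<psi> i
  proof -
    have C: "C1_grad \<psi> d\<psi>" using t by (simp add: test_fun_def)
    have z: "\<psi> x = 0" if "x \<in> frontier \<Omega>" for x
      using t closure_subset[of "{x. \<psi> x \<noteq> 0}"] that opens(1) unfolding test_fun_def frontier_def by (auto simp: interior_open)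
    have s1: "sqint M\<Omega> (\<lambda>x. d\<psi> x \<bullet> i)" and s2: "sqint M\<Omega> (\<lambda>x. \<psi> x *\<^sub>R i)"
      using opens by (auto intro!: sqint_lebesgue_on continuous_intros C1_continuous[OF C] C1_continuous_grad[OF C])
    have "(\<integral>x. un n x \<bullet> (d\<psi> x \<bullet> i) \<partial>M\<Omega>) + (\<integral>x. gr (un n) x \<bullet> (\<psi> x *\<^sub>R i) \<partial>M\<Omega>) = 0" for n
    proof -
      have "(\<integral>x. \<bar>un n x * \<psi> x\<bar> \<partial>MO) = (\<integral>x. 0 \<partial>MO)"
        using z by (intro Bochner_Integration.integral_cong) (auto simp: surface_measure_eq space_restrict_space)
      then have "(\<integral>x. un n x * (d\<psi> x \<bullet> i) + \<psi> x * (gr (un n) x \<bullet> i) \<partial>M\<Omega>) = 0"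
        using Q[OF un C i, of n] by simp
      moreover have "(\<integral>x. un n x \<bullet> (d\<psi> x \<bullet> i) + gr (un n) x \<bullet> (\<psi> x *\<^sub>R i) \<partial>M\<Omega>)
          = (\<integral>x. un n x \<bullet> (d\<psi> x \<bullet> i) \<partial>M\<Omega>) + (\<integral>x. gr (un n) x \<bullet> (\<psi> x *\<^sub>R i) \<partial>M\<Omega>)"
        by (intro Bochner_Integration.integral_add sqint_inner s1 s2 sqint_C1_M\<Omega> un)
      ultimately show ?thesis by simp
    qed
    moreover have "(\<lambda>n. (\<integral>x. un n x \<bullet> (d\<psi> x \<bullet> i) \<partial>M\<Omega>) + (\<integral>x. gr (un n) x \<bullet> (\<psi> x *\<^sub>R i) \<partial>M\<Omega>))
        \<longlonglongrightarrow> (\<integral>x. u x \<bullet> (d\<psi> x \<bullet> i) \<partial>M\<Omega>) + (\<integral>x. G x \<bullet> (\<psi> x *\<^sub>R i) \<partial>M\<Omega>)"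
      using lim by (intro tendsto_add sqdist_inner_tendsto s1 s2 sqint_C1_M\<Omega> un sq) (auto simp: H1lim_def)
    ultimately have "(\<integral>x. u x \<bullet> (d\<psi> x \<bullet> i) \<partial>M\<Omega>) + (\<integral>x. G x \<bullet> (\<psi> x *\<^sub>R i) \<partial>M\<Omega>) = 0"
      by (simp add: LIMSEQ_const_iff)
    then show ?thesis by (simp add: mult.commute)
  qed
  then show ?thesis unfolding weak_grad_def L2_iff_sqint using sq sq(2)[unfolded sqint_iff] by blast
qed

text \<open>\<open>trace_on\<close> brings its own gradient with it, so the gradients belonging to
  two traces of one function, and the one named in \<open>weak_solution\<close>, have to be
  identified almost everywhere.\<close>

lemma weak_grad_unique:
  assumes "weak_grad \<Omega> u G1" "weak_grad \<Omega> u G2"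
  shows "AE x in M\<Omega>. G1 x = G2 x"
proof -
  have sq: "sqint M\<Omega> G1" "sqint M\<Omega> G2" using assms by (auto simp: weak_grad_def sqint_iff)
  have "AE x in M\<Omega>. (G1 x - G2 x) \<bullet> i = 0" if i: "i \<in> Basis" for i
  proof (rule fundamental_lemma[where W = \<Omega>])
    show "(\<lambda>x. x) \<in> measurable M\<Omega> borel" by (rule measurable_restrict_space1) (auto intro: measurable_completion)
    have si: "sqint M\<Omega> (\<lambda>_. i)" by (rule sqint_const_finite) (rule finite_measures)
    show "integrable M\<Omega> (\<lambda>x. (G1 x - G2 x) \<bullet> i)" by (rule sqint_inner[OF sqint_diff[OF sq] si])
    show "(\<integral>x. ((G1 x - G2 x) \<bullet> i) * \<phi> x \<partial>M\<Omega>) = 0" if t: "test_fun \<Omega> \<phi> d\<phi>" for \<phi> d\<phi>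
    proof -
      have C: "C1_grad \<phi> d\<phi>" using t by (simp add: test_fun_def)
      have s2: "sqint M\<Omega> (\<lambda>x. \<phi> x *\<^sub>R i)"
        using opens by (auto intro!: sqint_lebesgue_on continuous_intros C1_continuous[OF C])
      have "(\<integral>x. ((G1 x - G2 x) \<bullet> i) * \<phi> x \<partial>M\<Omega>) = (\<integral>x. G1 x \<bullet> (\<phi> x *\<^sub>R i) - G2 x \<bullet> (\<phi> x *\<^sub>R i) \<partial>M\<Omega>)"
        by (intro Bochner_Integration.integral_cong) (auto simp: inner_diff_left algebra_simps)
      also have "\<dots> = (\<integral>x. G1 x \<bullet> (\<phi> x *\<^sub>R i) \<partial>M\<Omega>) - (\<integral>x. G2 x \<bullet> (\<phi> x *\<^sub>R i) \<partial>M\<Omega>)"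
        by (intro Bochner_Integration.integral_diff sqint_inner sq s2)
      also have "\<dots> = (\<integral>x. (G1 x \<bullet> i) * \<phi> x \<partial>M\<Omega>) - (\<integral>x. (G2 x \<bullet> i) * \<phi> x \<partial>M\<Omega>)" by (simp add: mult.commute)
      also have "\<dots> = 0"
      proof -
        have "(\<integral>x. u x * (d\<phi> x \<bullet> i) \<partial>M\<Omega>) = - (\<integral>x. (G x \<bullet> i) * \<phi> x \<partial>M\<Omega>)" if "weak_grad \<Omega> u G" for G
          using that[unfolded weak_grad_def] t i by (elim conjE allE[of _ \<phi>] allE[of _ d\<phi>]) simp
        from this[OF assms(1)] this[OF assms(2)] show ?thesis by linarith
      qed
      finally show ?thesis .
    qed
    show "\<exists>B\<in>sets borel. AE x in M\<Omega>. x \<in> A \<longleftrightarrow> x \<in> B" if A: "A \<in> sets M\<Omega>" for A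
    proof -
      have "A \<in> sets (completion lborel)" using A by (simp add: sets_restrict_space_iff)
      then obtain S N N' where SN: "A = S \<union> N" "N \<subseteq> N'" "N' \<in> null_sets lborel" "S \<in> sets lborel"
        by (rule sets_completionE)
      have "AE x in lborel. x \<notin> N'" using SN(3) by (rule AE_not_in)
      then have "AE x in lebesgue. x \<notin> N'" by (rule AE_completion)
      then have "AE x in M\<Omega>. x \<notin> N'" by (subst AE_restrict_space_iff) (auto elim: eventually_mono)
      then have "AE x in M\<Omega>. x \<in> A \<longleftrightarrow> x \<in> S" by eventually_elim (use SN in auto)
      then show ?thesis using SN(4) by auto
    qed
    show "open \<Omega>" by (rule opens(1))
    show "x \<in> \<Omega>" if "x \<in> space M\<Omega>" for x using that by (simp add: space_restrict_space)
  qed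
  then have "AE x in M\<Omega>. \<forall>i\<in>Basis. (G1 x - G2 x) \<bullet> i = 0" by (subst AE_ball_countable) (auto intro: countable_finite)
  then show ?thesis
  proof eventually_elim
    case (elim x)
    show ?case by (rule euclidean_eqI) (use elim in \<open>simp add: inner_diff_left\<close>)
  qed
qed

lemma trace_limit:
  assumes lim: "H1lim un u G t"
  shows "trace_on \<Omega> (frontier \<Omega>1) u t"
  unfolding trace_on_def
proof (intro exI conjI allI)
  have un: "\<And>n. un n \<in> C1" and sq: "sqint M\<Omega> u" "sqint M\<Omega> G" "sqint M\<Gamma> t"
    and tend: "(\<lambda>n. sqdist M\<Omega> (un n) u) \<longlonglongrightarrow> 0" "(\<lambda>n. sqdist M\<Omega> (gr (un n)) G) \<longlonglongrightarrow> 0" "(\<lambda>n. sqdist M\<Gamma> (un n) t) \<longlonglongrightarrow> 0"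
    using lim by (auto simp: H1lim_def)
  show "weak_grad \<Omega> u G" by (rule weak_grad_limit[OF lim])
  show "L2 M\<Gamma> t" using sq by (simp add: L2_iff_sqint)
  show "C1_grad (un n) (gr (un n))" for n by (rule C1_gr[OF un])
  note d1 = sqint_diff[OF sqint_C1_M\<Omega>(1)[OF un] sq(1)] and d2 = sqint_diff[OF sqint_C1_M\<Omega>(2)[OF un] sq(2)]
    and d3 = sqint_diff[OF sqint_C1_M\<Gamma>[OF un] sq(3)]
  have eq: "(\<integral>\<^sup>+x. ennreal ((un n x - u x)\<^sup>2 + (norm (gr (un n) x - G x))\<^sup>2) \<partial>M\<Omega>)
      = ennreal (sqdist M\<Omega> (un n) u + sqdist M\<Omega> (gr (un n)) G)" for n
  proof -
    have "(\<integral>x. (norm (un n x - u x))\<^sup>2 + (norm (gr (un n) x - G x))\<^sup>2 \<partial>M\<Omega>) = sqdist M\<Omega> (un n) u + sqdist M\<Omega> (gr (un n)) G"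
      by (intro Bochner_Integration.integral_add sqint_integrable d1 d2)
    moreover have "integrable M\<Omega> (\<lambda>x. (norm (un n x - u x))\<^sup>2 + (norm (gr (un n) x - G x))\<^sup>2)"
      by (intro Bochner_Integration.integrable_add sqint_integrable d1 d2)
    ultimately show ?thesis using nn_integral_eq_integral[of M\<Omega> "\<lambda>x. (norm (un n x - u x))\<^sup>2 + (norm (gr (un n) x - G x))\<^sup>2"] by simp
  qed
  show "(\<lambda>n. \<integral>\<^sup>+x. ennreal ((un n x - u x)\<^sup>2 + (norm (gr (un n) x - G x))\<^sup>2) \<partial>M\<Omega>) \<longlonglongrightarrow> 0"
    unfolding eq using tendsto_ennrealI[OF tendsto_add[OF tend(1,2)]] by simp
  have eq3: "(\<integral>\<^sup>+x. ennreal ((un n x - t x)\<^sup>2) \<partial>M\<Gamma>) = ennreal (sqdist M\<Gamma> (un n) t)" for n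
    using sqint_nn[OF d3, of n] by simp
  show "(\<lambda>n. \<integral>\<^sup>+x. ennreal ((un n x - t x)\<^sup>2) \<partial>M\<Gamma>) \<longlonglongrightarrow> 0"
    unfolding eq3 using tendsto_ennrealI[OF tend(3)] by simp
qed

lemma trace_onD:
  assumes "trace_on \<Omega> S w t" and S: "\<And>\<phi>. \<phi> \<in> C1 \<Longrightarrow> sqint (surface_measure S) \<phi>"
  obtains G \<phi> where "weak_grad \<Omega> w G" "sqint M\<Omega> w" "sqint M\<Omega> G" "sqint (surface_measure S) t" "\<And>n. \<phi> n \<in> C1"
    "(\<lambda>n. sqdist M\<Omega> (\<phi> n) w) \<longlonglongrightarrow> 0" "(\<lambda>n. sqdist M\<Omega> (gr (\<phi> n)) G) \<longlonglongrightarrow> 0" "(\<lambda>n. sqdist (surface_measure S) (\<phi> n) t) \<longlonglongrightarrow> 0"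
proof -
  obtain G \<phi> d\<phi> where G: "weak_grad \<Omega> w G" and t: "L2 (surface_measure S) t" and C: "\<And>n. C1_grad (\<phi> n) (d\<phi> n)"
    and l1: "(\<lambda>n. \<integral>\<^sup>+ x. ennreal ((\<phi> n x - w x)\<^sup>2 + (norm (d\<phi> n x - G x))\<^sup>2) \<partial>M\<Omega>) \<longlonglongrightarrow> 0"
    and l2: "(\<lambda>n. \<integral>\<^sup>+ x. ennreal ((\<phi> n x - t x)\<^sup>2) \<partial>surface_measure S) \<longlonglongrightarrow> 0"
    using assms(1) unfolding trace_on_def by blast
  have gr: "gr (\<phi> n) = d\<phi> n" and \<phi>: "\<phi> n \<in> C1" for n using gr_unique[OF C] C1_gradI[OF C] by auto
  have sq: "sqint M\<Omega> w" "sqint M\<Omega> G" "sqint (surface_measure S) t"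
    using G t by (auto simp: weak_grad_def L2_iff_sqint sqint_iff)
  note d1 = sqint_diff[OF sqint_C1_M\<Omega>(1)[OF \<phi>] sq(1)] and d2 = sqint_diff[OF sqint_C1_M\<Omega>(2)[OF \<phi>] sq(2)]
    and d3 = sqint_diff[OF S[OF \<phi>] sq(3)]
  have nn: "0 \<le> sqdist M f g" for M f and g :: "'a \<Rightarrow> 'b::euclidean_space" by (intro integral_nonneg_AE) auto
  have le: "ennreal (sqdist M\<Omega> (\<phi> n) w) \<le> (\<integral>\<^sup>+ x. ennreal ((\<phi> n x - w x)\<^sup>2 + (norm (d\<phi> n x - G x))\<^sup>2) \<partial>M\<Omega>)"
    "ennreal (sqdist M\<Omega> (gr (\<phi> n)) G) \<le> (\<integral>\<^sup>+ x. ennreal ((\<phi> n x - w x)\<^sup>2 + (norm (d\<phi> n x - G x))\<^sup>2) \<partial>M\<Omega>)" for n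
    unfolding sqint_nn[OF d1, symmetric] sqint_nn[OF d2, symmetric]
    by (auto intro!: nn_integral_mono ennreal_leI simp: gr simp del: ennreal_plus)
  have "(\<lambda>n. ennreal (sqdist M\<Omega> (\<phi> n) w)) \<longlonglongrightarrow> 0" "(\<lambda>n. ennreal (sqdist M\<Omega> (gr (\<phi> n)) G)) \<longlonglongrightarrow> 0"
    by (rule tendsto_sandwich[OF _ _ tendsto_const l1]; use le in auto)+
  then have "(\<lambda>n. sqdist M\<Omega> (\<phi> n) w) \<longlonglongrightarrow> 0" "(\<lambda>n. sqdist M\<Omega> (gr (\<phi> n)) G) \<longlonglongrightarrow> 0"
    by (auto simp: ennreal_tendsto_0_iff nn)
  moreover have "(\<lambda>n. ennreal (sqdist (surface_measure S) (\<phi> n) t)) \<longlonglongrightarrow> 0"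
    unfolding sqint_nn[OF d3, symmetric] using l2 by simp
  then have "(\<lambda>n. sqdist (surface_measure S) (\<phi> n) t) \<longlonglongrightarrow> 0" by (auto simp: ennreal_tendsto_0_iff nn)
  ultimately show ?thesis by (rule that[of G \<phi>, OF G sq \<phi>])
qed

text \<open>The obstacle is that the test function \<open>w\<close> comes with two unrelated
  approximating sequences, one for each trace. The first is shown to converge on the outer boundary
  too, and the equation passes to the limit along it alone.\<close>

lemma weak_solutionI:
  assumes lim: "H1lim un u G t" and g: "sqint MO g"
    and eq: "\<And>\<phi>. \<phi> \<in> C1 \<Longrightarrow> bil G t (gr \<phi>) \<phi> = (\<integral>x. g x * \<phi> x \<partial>MO)"
  shows "weak_solution \<Omega> \<Omega>1 \<sigma>1 \<sigma>2 \<gamma> g u"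
  unfolding weak_solution_def
proof (rule exI[of _ G], rule exI[of _ t], intro conjI allI impI)
  show "weak_grad \<Omega> u G" "trace_on \<Omega> (frontier \<Omega>1) u t" by (rule weak_grad_limit[OF lim], rule trace_limit[OF lim])
  have sq: "sqint M\<Omega> G" "sqint M\<Gamma> t" using lim by (auto simp: H1lim_def)
  fix w Gw w\<Gamma> w\<Omega>
  assume w: "weak_grad \<Omega> w Gw \<and> trace_on \<Omega> (frontier \<Omega>1) w w\<Gamma> \<and> trace_on \<Omega> (frontier \<Omega>) w w\<Omega>"
  obtain G1 \<phi> where 1: "weak_grad \<Omega> w G1" "sqint M\<Omega> w" "sqint M\<Omega> G1" "sqint M\<Gamma> w\<Gamma>" "\<And>n. \<phi> n \<in> C1"
    "(\<lambda>n. sqdist M\<Omega> (\<phi> n) w) \<longlonglongrightarrow> 0" "(\<lambda>n. sqdist M\<Omega> (gr (\<phi> n)) G1) \<longlonglongrightarrow> 0" "(\<lambda>n. sqdist M\<Gamma> (\<phi> n) w\<Gamma>) \<longlonglongrightarrow> 0"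
    by (rule trace_onD[of "frontier \<Omega>1" w w\<Gamma>]) (use w sqint_C1_M\<Gamma> in blast, use sqint_C1_M\<Gamma> in blast, rule that)
  obtain G2 \<psi> where 2: "weak_grad \<Omega> w G2" "sqint M\<Omega> w" "sqint M\<Omega> G2" "sqint MO w\<Omega>" "\<And>n. \<psi> n \<in> C1"
    "(\<lambda>n. sqdist M\<Omega> (\<psi> n) w) \<longlonglongrightarrow> 0" "(\<lambda>n. sqdist M\<Omega> (gr (\<psi> n)) G2) \<longlonglongrightarrow> 0" "(\<lambda>n. sqdist MO (\<psi> n) w\<Omega>) \<longlonglongrightarrow> 0"
    by (rule trace_onD[of "frontier \<Omega>" w w\<Omega>]) (use w in blast, use sqint_C1_MO in blast, rule that)
  have Gw: "sqint M\<Omega> Gw" using w by (auto simp: weak_grad_def sqint_iff)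
  have AE1: "AE x in M\<Omega>. G1 x = Gw x" using weak_grad_unique 1(1) w by blast
  have AE2: "AE x in M\<Omega>. G2 x = G1 x" using weak_grad_unique 2(1) 1(1) by blast
  have dG: "sqdist M\<Omega> (gr (\<psi> n)) G2 = sqdist M\<Omega> (gr (\<psi> n)) G1" for n
  proof (rule integral_cong_AE)
    note [measurable] = sqint_measurable[OF sqint_C1_M\<Omega>(2)[OF 2(5)]] sqint_measurable[OF 2(3)] sqint_measurable[OF 1(3)]
    show "(\<lambda>x. (norm (gr (\<psi> n) x - G2 x))\<^sup>2) \<in> borel_measurable M\<Omega>" "(\<lambda>x. (norm (gr (\<psi> n) x - G1 x))\<^sup>2) \<in> borel_measurable M\<Omega>"
      by measurable
    show "AE x in M\<Omega>. (norm (gr (\<psi> n) x - G2 x))\<^sup>2 = (norm (gr (\<psi> n) x - G1 x))\<^sup>2"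
      using AE2 by eventually_elim simp
  qed
  have nn: "0 \<le> sqdist M f g" for M :: "'a measure" and f and g :: "'a \<Rightarrow> 'b::euclidean_space" by (intro integral_nonneg_AE) auto
  obtain Q where Q: "Q \<ge> 0" "\<And>\<phi>. \<phi> \<in> C1 \<Longrightarrow> (\<integral>x. (\<phi> x)\<^sup>2 \<partial>MO) \<le> Q * ((\<integral>x. (\<phi> x)\<^sup>2 \<partial>M\<Omega>) + (\<integral>x. (norm (gr \<phi> x))\<^sup>2 \<partial>M\<Omega>))"
    using trace_O by blast
  \<comment> \<open>\<open>\<phi>\<close> and \<open>\<psi>\<close> approach the same function with
    almost everywhere the same gradient, so the trace inequality makes their difference small on the
    outer boundary.\<close>
  have "(\<lambda>n. sqdist MO (\<phi> n) w\<Omega>) \<longlonglongrightarrow> 0"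
  proof (rule tendsto_sandwich[OF _ _ tendsto_const])
    let ?b = "\<lambda>n. 2 * (Q * ((2 * sqdist M\<Omega> (\<phi> n) w + 2 * sqdist M\<Omega> (\<psi> n) w) + (2 * sqdist M\<Omega> (gr (\<phi> n)) G1 + 2 * sqdist M\<Omega> (gr (\<psi> n)) G2)))
         + 2 * sqdist MO (\<psi> n) w\<Omega>"
    have "?b \<longlonglongrightarrow> 2 * (Q * ((2 * 0 + 2 * 0) + (2 * 0 + 2 * 0))) + 2 * 0"
      by (intro tendsto_intros 1 2)
    then show "?b \<longlonglongrightarrow> 0" by simp
    show "\<forall>\<^sub>F n in sequentially. sqdist MO (\<phi> n) w\<Omega> \<le> ?b n"
    proof (intro always_eventually allI)
      fix n
      note d = C1_diff[OF 1(5)[of n] 2(5)[of n]]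
      have comm: "sqdist M f g = sqdist M g f" for M :: "'a measure" and f and g :: "'a \<Rightarrow> 'b::euclidean_space" by (simp add: norm_minus_commute)
      have "sqdist MO (\<phi> n) w\<Omega> \<le> 2 * sqdist MO (\<phi> n) (\<psi> n) + 2 * sqdist MO (\<psi> n) w\<Omega>"
        by (intro sqdist_triangle sqint_C1_MO 1 2)
      moreover have "sqdist MO (\<phi> n) (\<psi> n) \<le> Q * (sqdist M\<Omega> (\<phi> n) (\<psi> n) + sqdist M\<Omega> (gr (\<phi> n)) (gr (\<psi> n)))"
        using Q(2)[OF d(1)] unfolding d(2) by simp
      moreover have "sqdist M\<Omega> (\<phi> n) (\<psi> n) \<le> 2 * sqdist M\<Omega> (\<phi> n) w + 2 * sqdist M\<Omega> (\<psi> n) w"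
        unfolding comm[of M\<Omega> "\<psi> n" w] by (intro sqdist_triangle sqint_C1_M\<Omega> 1 2)
      moreover have "sqdist M\<Omega> (gr (\<phi> n)) (gr (\<psi> n)) \<le> 2 * sqdist M\<Omega> (gr (\<phi> n)) G1 + 2 * sqdist M\<Omega> (gr (\<psi> n)) G2"
        unfolding dG comm[of M\<Omega> "gr (\<psi> n)" G1] by (intro sqdist_triangle sqint_C1_M\<Omega> 1 2)
      ultimately have "sqdist MO (\<phi> n) w\<Omega> \<le> 2 * (Q * (sqdist M\<Omega> (\<phi> n) (\<psi> n) + sqdist M\<Omega> (gr (\<phi> n)) (gr (\<psi> n)))) + 2 * sqdist MO (\<psi> n) w\<Omega>"
        and "Q * (sqdist M\<Omega> (\<phi> n) (\<psi> n) + sqdist M\<Omega> (gr (\<phi> n)) (gr (\<psi> n)))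
          \<le> Q * ((2 * sqdist M\<Omega> (\<phi> n) w + 2 * sqdist M\<Omega> (\<psi> n) w) + (2 * sqdist M\<Omega> (gr (\<phi> n)) G1 + 2 * sqdist M\<Omega> (gr (\<psi> n)) G2))"
        using Q(1) by (simp_all add: mult_left_mono add_mono)
      then show "sqdist MO (\<phi> n) w\<Omega> \<le> ?b n" by linarith
    qed
  qed (use nn in auto)
  then have lim1: "(\<lambda>n. \<integral>x. \<phi> n x \<bullet> g x \<partial>MO) \<longlonglongrightarrow> (\<integral>x. w\<Omega> x \<bullet> g x \<partial>MO)"
    by (intro sqdist_inner_tendsto sqint_C1_MO 1 2 g)
  have "H1lim \<phi> w G1 w\<Gamma>" unfolding H1lim_def using 1 by blast
  then have lim2: "(\<lambda>n. bil G t (gr (\<phi> n)) (\<phi> n)) \<longlonglongrightarrow> bil G t G1 w\<Gamma>" using sq by (rule bil_tendsto_right)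
  have "bil G t (gr (\<phi> n)) (\<phi> n) = (\<integral>x. \<phi> n x \<bullet> g x \<partial>MO)" for n using eq[OF 1(5)] by (simp add: mult.commute)
  then have "bil G t G1 w\<Gamma> = (\<integral>x. w\<Omega> x \<bullet> g x \<partial>MO)" using LIMSEQ_unique[OF lim2] lim1 by simp
  moreover have "(\<integral>x. s x * (G x \<bullet> G1 x) \<partial>M\<Omega>) = (\<integral>x. s x * (G x \<bullet> Gw x) \<partial>M\<Omega>)"
    using AE1 integrable_flux[OF sq(1) 1(3)] integrable_flux[OF sq(1) Gw]
    by (intro integral_cong_AE borel_measurable_integrable) (auto elim: eventually_mono)
  ultimately show "(\<integral>x. s x * (G x \<bullet> Gw x) \<partial>M\<Omega>) + (\<integral>x. \<gamma> x * t x * w\<Gamma> x \<partial>M\<Gamma>) = (\<integral>x. g x * w\<Omega> x \<partial>MO)"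
    by (simp add: bil_def mult.commute)
qed

end

section \<open>Density of the traces\<close>

lemma C1_grad_zero_on_open:
  assumes f: "C1_grad f df" and W: "open W" "\<And>y. y \<in> W \<Longrightarrow> f y = 0" and x: "x \<in> W"
  shows "df x = 0"
proof -
  have "((\<lambda>_. 0) has_derivative (\<lambda>h. df x \<bullet> h)) (at x)"
    by (rule has_derivative_transform_within_open[OF C1_has_derivative[OF f] W(1) x]) (use W(2) in auto)
  then have "(\<lambda>h. df x \<bullet> h) = (\<lambda>h. 0)" by (rule has_derivative_unique) (rule has_derivative_const)
  then have "df x \<bullet> df x = 0" by (rule fun_cong)
  then show ?thesis by simp
qed

lemma integral_lebesgue_on_restrict:
  fixes f :: "'a::euclidean_space \<Rightarrow> 'b::euclidean_space"
  assumes A: "A \<in> sets borel" and f: "f \<in> borel_measurable (restrict_space lborel A)"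
  shows "(\<integral>x. f x \<partial>lebesgue_on A) = (\<integral>x. indicator A x *\<^sub>R f x \<partial>lborel)"
  using integral_restrict_lborel[OF A f] A by (simp add: integral_restrict_space set_lebesgue_integral_def)

lemma sqdist_lin_tendsto:
  assumes sq: "\<And>n. sqint M (f n)" "\<And>n. sqint M (g n)" "sqint M f0" "sqint M g0"
    and lim: "(\<lambda>n. sqdist M (f n) f0) \<longlonglongrightarrow> 0" "(\<lambda>n. sqdist M (g n) g0) \<longlonglongrightarrow> 0"
  shows "(\<lambda>n. sqdist M (\<lambda>x. f n x + c *\<^sub>R g n x) (\<lambda>x. f0 x + c *\<^sub>R g0 x)) \<longlonglongrightarrow> 0"
proof (rule tendsto_sandwich[OF _ _ tendsto_const])
  have "(\<lambda>n. 2 * sqdist M (f n) f0 + 2 * c\<^sup>2 * sqdist M (g n) g0) \<longlonglongrightarrow> 2 * 0 + 2 * c\<^sup>2 * 0"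
    by (intro tendsto_intros lim)
  then show "(\<lambda>n. 2 * sqdist M (f n) f0 + 2 * c\<^sup>2 * sqdist M (g n) g0) \<longlonglongrightarrow> 0" by simp
  show "\<forall>\<^sub>F n in sequentially. sqdist M (\<lambda>x. f n x + c *\<^sub>R g n x) (\<lambda>x. f0 x + c *\<^sub>R g0 x) \<le> 2 * sqdist M (f n) f0 + 2 * c\<^sup>2 * sqdist M (g n) g0"
  proof (intro always_eventually allI)
    fix n
    note d1 = sqint_integrable[OF sqint_diff[OF sq(1)[of n] sq(3)]] and d2 = sqint_integrable[OF sqint_diff[OF sq(2)[of n] sq(4)]]
    have "sqdist M (\<lambda>x. f n x + c *\<^sub>R g n x) (\<lambda>x. f0 x + c *\<^sub>R g0 x)
        \<le> (\<integral>x. 2 * (norm (f n x - f0 x))\<^sup>2 + 2 * c\<^sup>2 * (norm (g n x - g0 x))\<^sup>2 \<partial>M)"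
    proof (rule integral_mono)
      show "integrable M (\<lambda>x. (norm (f n x + c *\<^sub>R g n x - (f0 x + c *\<^sub>R g0 x)))\<^sup>2)"
        by (intro sqint_integrable sqint_diff sqint_add sqint_scaleR sq)
      show "integrable M (\<lambda>x. 2 * (norm (f n x - f0 x))\<^sup>2 + 2 * c\<^sup>2 * (norm (g n x - g0 x))\<^sup>2)"
        using d1 d2 by auto
      fix x
      have e: "f n x + c *\<^sub>R g n x - (f0 x + c *\<^sub>R g0 x) = (f n x - f0 x) + c *\<^sub>R (g n x - g0 x)" by (simp add: algebra_simps)
      show "(norm (f n x + c *\<^sub>R g n x - (f0 x + c *\<^sub>R g0 x)))\<^sup>2 \<le> 2 * (norm (f n x - f0 x))\<^sup>2 + 2 * c\<^sup>2 * (norm (g n x - g0 x))\<^sup>2"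
        unfolding e using norm_add_sq_le[of "f n x - f0 x" "c *\<^sub>R (g n x - g0 x)"] by (simp add: power_mult_distrib)
    qed
    also have "\<dots> = 2 * sqdist M (f n) f0 + 2 * c\<^sup>2 * sqdist M (g n) g0" using d1 d2 by simp
    finally show "sqdist M (\<lambda>x. f n x + c *\<^sub>R g n x) (\<lambda>x. f0 x + c *\<^sub>R g0 x) \<le> 2 * sqdist M (f n) f0 + 2 * c\<^sup>2 * sqdist M (g n) g0" .
  qed
qed (auto intro!: always_eventually integral_nonneg_AE)

context transmission
begin

text \<open>\<open>f\<close> is free on the outer boundary: the boundary term of
  \<open>green_product\<close> is small by Cauchy-Schwarz, because the traces of the approximants
  are. So the extensions of \<open>v\<close> and \<open>G\<close> by zero are again a function and
  its weak gradient.\<close>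

lemma zero_extension:
  assumes lim: "H1lim vn v G \<tau>" and zero: "(\<lambda>n. \<integral>x. (vn n x)\<^sup>2 \<partial>MO) \<longlonglongrightarrow> 0"
    and f: "C1_grad f df" and i: "i \<in> Basis"
  shows "(\<integral>x. v x * (df x \<bullet> i) + f x * (G x \<bullet> i) \<partial>M\<Omega>) = 0"
proof -
  have vn: "\<And>n. vn n \<in> C1" and sq: "sqint M\<Omega> v" "sqint M\<Omega> G"
    and tend: "(\<lambda>n. sqdist M\<Omega> (vn n) v) \<longlonglongrightarrow> 0" "(\<lambda>n. sqdist M\<Omega> (gr (vn n)) G) \<longlonglongrightarrow> 0"
    using lim by (auto simp: H1lim_def)
  obtain Q where Q: "Q \<ge> 0" "\<And>\<phi> f df i. \<phi> \<in> C1 \<Longrightarrow> C1_grad f df \<Longrightarrow> i \<in> Basis \<Longrightarrow>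
     \<bar>\<integral>x. \<phi> x * (df x \<bullet> i) + f x * (gr \<phi> x \<bullet> i) \<partial>M\<Omega>\<bar> \<le> Q * (\<integral>x. \<bar>\<phi> x * f x\<bar> \<partial>MO)"
    by (rule green_product) (rule that)
  have s1: "sqint M\<Omega> (\<lambda>x. df x \<bullet> i)" and s2: "sqint M\<Omega> (\<lambda>x. f x *\<^sub>R i)"
    using opens by (auto intro!: sqint_lebesgue_on continuous_intros C1_continuous[OF f] C1_continuous_grad[OF f])
  have fO: "sqint MO f" by (rule sqint_C1_MO[OF C1_gradI[OF f]])
  define F where "F = (\<integral>x. (f x)\<^sup>2 \<partial>MO)"
  have abs_sq: "sqint MO (\<lambda>x. \<bar>g x\<bar>)" if "sqint MO g" for g :: "'a \<Rightarrow> real"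
    using that by (auto simp: sqint_def)
  have "(\<lambda>n. (\<integral>x. \<bar>vn n x * f x\<bar> \<partial>MO)\<^sup>2) \<longlonglongrightarrow> 0"
  proof (rule tendsto_sandwich[OF _ _ tendsto_const])
    show "(\<lambda>n. F * (\<integral>x. (vn n x)\<^sup>2 \<partial>MO)) \<longlonglongrightarrow> 0" using tendsto_mult[OF tendsto_const zero, of F] by simp
    show "\<forall>\<^sub>F n in sequentially. (\<integral>x. \<bar>vn n x * f x\<bar> \<partial>MO)\<^sup>2 \<le> F * (\<integral>x. (vn n x)\<^sup>2 \<partial>MO)"
      using sqint_Cauchy_Schwarz[OF abs_sq[OF sqint_C1_MO[OF vn]] abs_sq[OF fO]] by (simp add: F_def abs_mult)
  qed auto
  from tendsto_real_sqrt[OF this] have "(\<lambda>n. \<integral>x. \<bar>vn n x * f x\<bar> \<partial>MO) \<longlonglongrightarrow> 0" by (simp add: tendsto_rabs_zero_iff)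
  then have b: "(\<lambda>n. Q * (\<integral>x. \<bar>vn n x * f x\<bar> \<partial>MO)) \<longlonglongrightarrow> 0" using tendsto_mult[OF tendsto_const, of _ 0 _ Q] by fastforce
  have split: "(\<integral>x. w x * (df x \<bullet> i) + f x * (H x \<bullet> i) \<partial>M\<Omega>) = (\<integral>x. w x \<bullet> (df x \<bullet> i) \<partial>M\<Omega>) + (\<integral>x. H x \<bullet> (f x *\<^sub>R i) \<partial>M\<Omega>)"
    if "sqint M\<Omega> w" "sqint M\<Omega> H" for w H
  proof -
    have "(\<integral>x. w x \<bullet> (df x \<bullet> i) + H x \<bullet> (f x *\<^sub>R i) \<partial>M\<Omega>) = (\<integral>x. w x \<bullet> (df x \<bullet> i) \<partial>M\<Omega>) + (\<integral>x. H x \<bullet> (f x *\<^sub>R i) \<partial>M\<Omega>)"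
      by (intro Bochner_Integration.integral_add sqint_inner s1 s2 that)
    then show ?thesis by simp
  qed
  have "(\<lambda>n. \<integral>x. vn n x * (df x \<bullet> i) + f x * (gr (vn n) x \<bullet> i) \<partial>M\<Omega>) \<longlonglongrightarrow> 0"
    by (rule Lim_null_comparison[OF _ b]) (use Q(2)[OF vn f i] in auto)
  moreover have "(\<lambda>n. \<integral>x. vn n x * (df x \<bullet> i) + f x * (gr (vn n) x \<bullet> i) \<partial>M\<Omega>) \<longlonglongrightarrow> (\<integral>x. v x * (df x \<bullet> i) + f x * (G x \<bullet> i) \<partial>M\<Omega>)"
    unfolding split[OF sqint_C1_M\<Omega>(1)[OF vn] sqint_C1_M\<Omega>(2)[OF vn]] split[OF sq]
    by (intro tendsto_add sqdist_inner_tendsto s1 s2 sqint_C1_M\<Omega> vn sq tend)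
  ultimately show ?thesis using LIMSEQ_unique by blast
qed

lemma unique_continuation:
  assumes lim: "H1lim vn v G \<tau>" and zero: "(\<lambda>n. \<integral>x. (vn n x)\<^sup>2 \<partial>MO) \<longlonglongrightarrow> 0"
    and vm: "v \<in> borel_measurable (restrict_space lborel \<Omega>)" and Gm: "G \<in> borel_measurable (restrict_space lborel \<Omega>)"
    and harmonic: "\<And>f. f \<in> C1 \<Longrightarrow> (\<And>x. x \<in> closure \<Omega>1 \<Longrightarrow> f x = 0) \<Longrightarrow> (\<integral>x. s x * (G x \<bullet> gr f x) \<partial>M\<Omega>) = 0"
  shows "AE x in lborel. x \<in> \<Omega> - closure \<Omega>1 \<longrightarrow> v x = 0 \<and> G x = 0"
proof -
  define v' where "v' x = indicator \<Omega> x *\<^sub>R v x" for x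
  define G' where "G' x = indicator \<Omega> x *\<^sub>R G x" for x
  have sq: "sqint M\<Omega> v" "sqint M\<Omega> G" using lim by (auto simp: H1lim_def)
  have intM: "integrable M\<Omega> v" "integrable M\<Omega> G"
  proof -
    show "integrable M\<Omega> v" by (rule sqint_integrable_finite[OF finite_measures(1) sq(1)])
    have "integrable M\<Omega> (\<lambda>x. G x \<bullet> i)" for i
      by (rule sqint_inner[OF sq(2) sqint_const_finite[OF finite_measures(1)]])
    then have "integrable M\<Omega> (\<lambda>x. \<Sum>i\<in>Basis. (G x \<bullet> i) *\<^sub>R i)" by (intro Bochner_Integration.integrable_sum integrable_scaleR_left)
    then show "integrable M\<Omega> G" by (simp add: euclidean_representation)
  qed
  have iv: "integrable lborel v'" and iG: "integrable lborel G'"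
    using intM integrable_restrict_lborel[OF borels(1) vm] integrable_restrict_lborel[OF borels(1) Gm]
    unfolding v'_def G'_def by (simp_all add: integrable_restrict_space set_integrable_def)
  note bm = measurable_restrict_space1[of _ lborel borel \<Omega>]
  have grad0: "(\<integral>y. v' y * (df y \<bullet> i) + f y * (G' y \<bullet> i) \<partial>lborel) = 0" if f: "C1_grad f df" and i: "i \<in> Basis" for f df i
  proof -
    have [measurable]: "f \<in> borel_measurable (restrict_space lborel \<Omega>)" "df \<in> borel_measurable (restrict_space lborel \<Omega>)"
      using C1_measurable[OF f] C1_grad_measurable[OF f] by (auto intro!: bm)
    note [measurable] = vm Gm
    have "0 = (\<integral>x. indicator \<Omega> x *\<^sub>R (v x * (df x \<bullet> i) + f x * (G x \<bullet> i)) \<partial>lborel)"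
      unfolding zero_extension[OF lim zero f i, symmetric] by (rule integral_lebesgue_on_restrict[OF borels(1)]) measurable
    also have "(\<lambda>x. indicator \<Omega> x *\<^sub>R (v x * (df x \<bullet> i) + f x * (G x \<bullet> i))) = (\<lambda>y. v' y * (df y \<bullet> i) + f y * (G' y \<bullet> i))"
      by (auto simp: fun_eq_iff v'_def G'_def indicator_def)
    finally show ?thesis by simp
  qed
  \<comment> \<open>The ball avoids the closed inclusion but may cross the outer boundary.\<close>
  have region: "harmonic_region v' G' x0 R \<Omega>" if R: "R > 0" and disj: "ball x0 R \<inter> closure \<Omega>1 = {}" for x0 R
  proof
    fix f df assume f: "C1_grad f df" and off: "\<And>y. y \<notin> ball x0 R \<Longrightarrow> f y = 0"
    have [measurable]: "df \<in> borel_measurable (restrict_space lborel \<Omega>)" using C1_grad_measurable[OF f] by (auto intro!: bm)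
    note [measurable] = vm Gm
    have f0: "f x = 0" if "x \<in> closure \<Omega>1" for x using off that disj by blast
    have d0: "df x = 0" if "x \<in> \<Omega>1" for x
      by (rule C1_grad_zero_on_open[OF f opens(3) _ that]) (use f0 closure_subset in blast)
    have "0 = (\<integral>x. s x * (G x \<bullet> df x) \<partial>M\<Omega>)" using harmonic[OF C1_gradI[OF f] f0] gr_unique[OF f] by simp
    also have "\<dots> = (\<integral>x. \<sigma>2 * (G x \<bullet> df x) \<partial>M\<Omega>)" using d0 by (intro Bochner_Integration.integral_cong) auto
    also have "\<dots> = \<sigma>2 * (\<integral>x. G x \<bullet> df x \<partial>M\<Omega>)" by (rule integral_mult_right_zero)
    finally have "(\<integral>x. G x \<bullet> df x \<partial>M\<Omega>) = 0" using \<sigma> by simp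
    then have "(\<integral>x. indicator \<Omega> x *\<^sub>R (G x \<bullet> df x) \<partial>lborel) = 0"
      using integral_lebesgue_on_restrict[OF borels(1), of "\<lambda>x. G x \<bullet> df x"] by simp
    then show "(\<integral>y. G' y \<bullet> df y \<partial>lborel) = 0" by (simp add: G'_def)
  qed (use R iv iG opens grad0 in \<open>auto simp: v'_def G'_def\<close>)
  define P where "P x \<longleftrightarrow> (\<exists>r>0. AE y in lborel. y \<in> ball x r \<longrightarrow> v' y = 0)" for x
  have PI: "P y" if "AE y in lborel. y \<in> ball x r \<longrightarrow> v' y = 0" "y \<in> ball x r" for x r y
  proof -
    have "r - dist x y > 0" using that(2) by simp
    moreover have sub: "ball y (r - dist x y) \<subseteq> ball x r"
    proof
      fix z assume "z \<in> ball y (r - dist x y)"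
      then show "z \<in> ball x r" using dist_triangle[of x z y] by simp
    qed
    have "AE z in lborel. z \<in> ball y (r - dist x y) \<longrightarrow> v' z = 0" using that(1) by eventually_elim (use sub in blast)
    ultimately show ?thesis unfolding P_def by blast
  qed
  have spread: "AE y in lborel. y \<in> ball x0 (R/4) \<longrightarrow> v' y = 0"
    if R: "R > 0" "ball x0 R \<inter> closure \<Omega>1 = {}" and p: "p \<in> ball x0 (R/4)" "P p" for x0 R p
  proof -
    obtain r where "r > 0" "AE y in lborel. y \<in> ball p r \<longrightarrow> v' y = 0" using p(2) by (auto simp: P_def)
    then show ?thesis by (rule harmonic_region.local_unique_continuation[OF region[OF R] p(1)])
  qed
  have P_all: "P x" if x: "x \<in> \<Omega> - closure \<Omega>1" for x
  proof -
    have ev: "\<forall>\<^sub>F y in at z within \<Omega> - closure \<Omega>1. P z = P y" if z: "z \<in> \<Omega> - closure \<Omega>1" for z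
    proof -
      obtain R where R: "R > 0" "ball z R \<subseteq> \<Omega> - closure \<Omega>1" using open_\<Omega>2(1) z open_contains_ball by blast
      have disj: "ball z R \<inter> closure \<Omega>1 = {}" using R by blast
      have eq: "P z = P y" if y: "y \<in> ball z (R/4)" for y
      proof
        assume "P z"
        have "z \<in> ball z (R/4)" using R by simp
        from PI[OF spread[OF R(1) disj this \<open>P z\<close>] y] show "P y" .
      next
        assume "P y"
        have "z \<in> ball z (R/4)" using R by simp
        from PI[OF spread[OF R(1) disj y \<open>P y\<close>] this] show "P z" .
      qed
      show ?thesis
        unfolding eventually_at
      proof (intro exI[of _ "R/4"] conjI ballI impI)
        fix y assume "y \<noteq> z \<and> dist y z < R/4"
        then show "P z = P y" by (intro eq) (simp add: dist_commute)
      qed (use R in simp)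
    qed
    \<comment> \<open>The starting point. Near a boundary point \<open>x0\<close> a point
      \<open>p\<close> just outside has a neighbourhood where the extension is 0 by definition; one
      local continuation around \<open>x0\<close> then reaches \<open>w\<close> just inside.\<close>
    obtain w where w: "w \<in> \<Omega> - closure \<Omega>1" "P w"
    proof -
      have "\<Omega> \<noteq> {}" using \<Omega>1 closure_subset by blast
      moreover have "\<Omega> \<noteq> UNIV" using opens(2) not_bounded_UNIV by blast
      ultimately obtain x0 where x0: "x0 \<in> frontier \<Omega>" using frontier_eq_empty[of \<Omega>] by blast
      then have "x0 \<notin> closure \<Omega>1" using \<Omega>1(1) opens(1) by (auto simp: frontier_def interior_open)
      then obtain r1 where r1: "r1 > 0" "ball x0 r1 \<subseteq> - closure \<Omega>1"
        using open_contains_ball[of "- closure \<Omega>1"] by (auto simp: open_Compl)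
      obtain r k e K where "chart_at \<Omega> x0 r k e K" by (rule lipschitz_open_chart[OF \<Omega>(1) x0])
      then have r: "0 < r" and gc: "graph_chart k e K" and ch: "\<Omega> \<inter> ball x0 r = {y \<in> ball x0 r. 0 < k y}" by (auto simp: chart_at_def)
      interpret graph_chart k e K by (rule gc)
      have "x0 \<in> frontier \<Omega> \<inter> ball x0 r" using x0 r by simp
      then have k0: "k x0 = 0" unfolding frontier_chart(1)[OF ch] by blast
      have chD: "y \<in> \<Omega> \<longleftrightarrow> 0 < k y" if "dist x0 y < r" for y
        using ch that by (metis (no_types, lifting) Int_iff mem_Collect_eq mem_ball)
      define R where "R = r1"
      have disj: "ball x0 R \<inter> closure \<Omega>1 = {}" and R: "R > 0" using r1 by (auto simp: R_def)
      \<comment> \<open>Small enough for both \<open>p\<close> and \<open>w\<close> to lie in the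
        chart and in the quarter ball of the local continuation.\<close>
      define t where "t = min r (R / 4) / 2"
      have t: "t > 0" "t < r" "t < R / 4" using r R by (auto simp: t_def)
      define p w where "p = x0 + t *\<^sub>R e" and "w = x0 + (- t) *\<^sub>R e"
      have d: "dist x0 p = t" "dist x0 w = t" using e t by (auto simp: p_def w_def dist_norm)
      have kp: "k p = - t" "k w = t" unfolding p_def w_def shift k0 by auto
      have "P p"
        unfolding P_def
      proof (intro exI conjI)
        \<comment> \<open>On this ball \<open>k\<close> stays negative, since
          \<open>k p = - t\<close> and \<open>k\<close> is \<open>K\<close>-Lipschitz.\<close>
        define \<rho> where "\<rho> = min (r - t) (t / K)"
        have K: "K > 0" using K_ge_1 by simp
        show "\<rho> > 0" using t K by (simp add: \<rho>_def)
        show "AE y in lborel. y \<in> ball p \<rho> \<longrightarrow> v' y = 0"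
        proof (rule AE_I2, rule impI)
          fix y assume y: "y \<in> ball p \<rho>"
          have "dist x0 y < r" using dist_triangle[of x0 y p] y d by (simp add: \<rho>_def)
          moreover have "K * dist y p < t" using y K by (simp add: \<rho>_def dist_commute field_simps)
          then have "k y < 0" using lipD[of y p] kp by linarith
          ultimately have "y \<notin> \<Omega>" using chD by simp
          then show "v' y = 0" by (simp add: v'_def)
        qed
      qed
      then have "AE y in lborel. y \<in> ball x0 (R/4) \<longrightarrow> v' y = 0"
        by (intro spread[OF R disj, of p]) (use d t in auto)
      then have "P w" by (rule PI) (use d t in auto)
      moreover have "w \<in> \<Omega>" using chD[of w] d t kp by simp
      moreover have "w \<in> ball x0 R" using d t R by simp
      then have "w \<notin> closure \<Omega>1" using disj by blast
      ultimately show ?thesis using that by blast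
    qed
    have "P w = P x" by (rule connected_local_const[OF \<Omega>2 w(1) x]) (intro ballI ev)
    with w(2) show ?thesis by simp
  qed
  have v0: "AE x in lborel. x \<in> \<Omega> - closure \<Omega>1 \<longrightarrow> v' x = 0"
  proof -
    \<comment> \<open>Each point has its own exceptional null set; Lindelof reduces the balls to
      countably many.\<close>
    define \<F> where "\<F> = {ball x r |x r. AE y in lborel. y \<in> ball x r \<longrightarrow> v' y = 0}"
    obtain \<F>' where F: "\<F>' \<subseteq> \<F>" "countable \<F>'" "\<Union>\<F>' = \<Union>\<F>" by (rule Lindelof[of \<F>]) (auto simp: \<F>_def)
    have "\<forall>B\<in>\<F>'. AE y in lborel. y \<in> B \<longrightarrow> v' y = 0" using F(1) by (auto simp: \<F>_def)
    then have "AE y in lborel. \<forall>B\<in>\<F>'. y \<in> B \<longrightarrow> v' y = 0" using F(2) by (subst AE_ball_countable) auto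
    then show ?thesis
    proof eventually_elim
      case (elim y)
      show ?case
      proof
        assume "y \<in> \<Omega> - closure \<Omega>1"
        then obtain r where "r > 0" "AE z in lborel. z \<in> ball y r \<longrightarrow> v' z = 0" using P_all P_def by blast
        then have "y \<in> ball y r" "ball y r \<in> \<F>" by (auto simp: \<F>_def)
        then have "y \<in> \<Union>\<F>'" using F(3) by blast
        then show "v' y = 0" using elim by blast
      qed
    qed
  qed
  let ?W = "\<Omega> - closure \<Omega>1"
  let ?M = "restrict_space lborel ?W"
  have [measurable]: "?W \<in> sets borel" using open_\<Omega>2(1) by auto
  have "AE x in ?M. G' x \<bullet> i = 0" if i: "i \<in> Basis" for i
  proof (rule fundamental_lemma[where W = ?W])
    show "(\<lambda>x. x) \<in> measurable ?M borel" by (rule measurable_restrict_space1) auto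
    have "integrable lborel (\<lambda>x. G' x \<bullet> i)" using iG by (rule integrable_inner_left)
    from integrable_mult_indicator[of ?W lborel, OF _ this] show "integrable ?M (\<lambda>x. G' x \<bullet> i)"
      by (subst integrable_restrict_space) (auto simp: set_integrable_def)
    show "(\<integral>x. (G' x \<bullet> i) * \<phi> x \<partial>?M) = 0" if t: "test_fun ?W \<phi> d\<phi>" for \<phi> d\<phi>
    proof -
      have C: "C1_grad \<phi> d\<phi>" using t by (simp add: test_fun_def)
      define N where "N = closure {x. \<phi> x \<noteq> 0}"
      have N: "N \<subseteq> ?W" "open (- N)" using t by (auto simp: test_fun_def N_def)
      have z: "\<phi> x = 0" if "x \<in> - N" for x using that closure_subset[of "{x. \<phi> x \<noteq> 0}"] unfolding N_def by blast
      have dz: "d\<phi> x = 0" if "x \<in> - N" for x by (rule C1_grad_zero_on_open[OF C N(2) z that])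
      \<comment> \<open>The gradient vanishes along with the function: the term with
        \<open>v'\<close> drops out on the support of \<open>\<phi>\<close> by \<open>v0\<close> and
        off it by \<open>dz\<close>.\<close>
      have "AE y in lborel. v' y * (d\<phi> y \<bullet> i) + \<phi> y * (G' y \<bullet> i) = \<phi> y * (G' y \<bullet> i)"
        using v0
      proof eventually_elim
        case (elim y)
        then show ?case using dz[of y] N(1) by (cases "y \<in> N") auto
      qed
      moreover have [measurable]: "v' \<in> borel_measurable lborel" "G' \<in> borel_measurable lborel" "\<phi> \<in> borel_measurable lborel" "d\<phi> \<in> borel_measurable lborel"
        using iv iG C1_measurable[OF C] C1_grad_measurable[OF C] by auto
      ultimately have "(\<integral>y. v' y * (d\<phi> y \<bullet> i) + \<phi> y * (G' y \<bullet> i) \<partial>lborel) = (\<integral>y. \<phi> y * (G' y \<bullet> i) \<partial>lborel)"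
        by (intro integral_cong_AE) auto
      then have "(\<integral>y. \<phi> y * (G' y \<bullet> i) \<partial>lborel) = 0" using grad0[OF C i] by simp
      moreover have "(\<integral>x. (G' x \<bullet> i) * \<phi> x \<partial>?M) = (\<integral>x. indicator ?W x *\<^sub>R ((G' x \<bullet> i) * \<phi> x) \<partial>lborel)"
        by (subst integral_restrict_space) (auto simp: set_lebesgue_integral_def)
      moreover have "(\<lambda>x. indicator ?W x *\<^sub>R ((G' x \<bullet> i) * \<phi> x)) = (\<lambda>y. \<phi> y * (G' y \<bullet> i))"
      proof
        fix x show "indicator ?W x *\<^sub>R ((G' x \<bullet> i) * \<phi> x) = \<phi> x * (G' x \<bullet> i)"
          using z[of x] N(1) by (cases "x \<in> ?W") auto
      qed
      ultimately show ?thesis by simp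
    qed
    show "\<exists>B\<in>sets borel. AE x in ?M. x \<in> A \<longleftrightarrow> x \<in> B" if "A \<in> sets ?M" for A
      using that by (intro bexI[of _ A]) (auto simp: sets_restrict_space)
    show "open ?W" by (rule open_\<Omega>2(1))
    show "x \<in> ?W" if "x \<in> space ?M" for x using that by (simp add: space_restrict_space)
  qed
  then have "\<forall>i\<in>Basis. AE x in lborel. x \<in> ?W \<longrightarrow> G' x \<bullet> i = 0"
    by (subst (asm) AE_restrict_space_iff) auto
  then have "AE x in lborel. \<forall>i\<in>Basis. x \<in> ?W \<longrightarrow> G' x \<bullet> i = 0" by (subst AE_ball_countable) (auto intro: countable_finite)
  with v0 show ?thesis
  proof eventually_elim
    case (elim x)
    show ?case
    proof
      assume x: "x \<in> ?W"
      then have "\<forall>i\<in>Basis. G' x \<bullet> i = 0" using elim(2) by blast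
      then have "G' x = 0" by (simp only: euclidean_all_zero_iff)
      then show "v x = 0 \<and> G x = 0" using elim(1) x by (simp add: v'_def G'_def)
    qed
  qed
qed

section \<open>Linear structure of the solutions, orthogonality and density\<close>

lemma H1lim_lin:
  assumes 1: "H1lim un u G t" and 2: "H1lim un' u' G' t'"
  shows "H1lim (\<lambda>n x. un n x + c * un' n x) (\<lambda>x. u x + c * u' x) (\<lambda>x. G x + c *\<^sub>R G' x) (\<lambda>x. t x + c * t' x)"
proof -
  note a = 1[unfolded H1lim_def] 2[unfolded H1lim_def]
  have un: "\<And>n. un n \<in> C1" "\<And>n. un' n \<in> C1" and sq: "sqint M\<Omega> u" "sqint M\<Omega> u'" "sqint M\<Omega> G" "sqint M\<Omega> G'" "sqint M\<Gamma> t" "sqint M\<Gamma> t'"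
    using a by auto
  have s: "sqint M\<Omega> (\<lambda>x. u x + c * u' x)" "sqint M\<Gamma> (\<lambda>x. t x + c * t' x)"
    using sqint_add[OF sq(1) sqint_scaleR[OF sq(2), of c]] sqint_add[OF sq(5) sqint_scaleR[OF sq(6), of c]] by simp_all
  have l1: "(\<lambda>n. sqdist M\<Omega> (\<lambda>x. un n x + c *\<^sub>R un' n x) (\<lambda>x. u x + c *\<^sub>R u' x)) \<longlonglongrightarrow> 0"
    using a by (intro sqdist_lin_tendsto sqint_C1_M\<Omega> un sq) auto
  have l2: "(\<lambda>n. sqdist M\<Omega> (\<lambda>x. gr (un n) x + c *\<^sub>R gr (un' n) x) (\<lambda>x. G x + c *\<^sub>R G' x)) \<longlonglongrightarrow> 0"
    using a by (intro sqdist_lin_tendsto sqint_C1_M\<Omega> un sq) auto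
  have l3: "(\<lambda>n. sqdist M\<Gamma> (\<lambda>x. un n x + c *\<^sub>R un' n x) (\<lambda>x. t x + c *\<^sub>R t' x)) \<longlonglongrightarrow> 0"
    using a by (intro sqdist_lin_tendsto sqint_C1_M\<Gamma> un sq) auto
  show ?thesis
    unfolding H1lim_def C1_lin(2)[OF un]
    using C1_lin(1)[OF un] s sqint_add[OF sq(3) sqint_scaleR[OF sq(4)]] l1 l2 l3 by simp
qed

text \<open>The approximating sequence is part of the relation, which makes linear combinations and
  the testing of one solution with another immediate; \<open>weak_solutionI\<close> leads back to
  \<open>weak_solution\<close>.\<close>

definition solves :: "('a \<Rightarrow> real) \<Rightarrow> (nat \<Rightarrow> 'a \<Rightarrow> real) \<Rightarrow> ('a \<Rightarrow> real) \<Rightarrow> ('a \<Rightarrow> 'a) \<Rightarrow> ('a \<Rightarrow> real) \<Rightarrow> bool" where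
  "solves g un u G t \<longleftrightarrow> sqint MO g \<and> H1lim un u G t \<and> (\<forall>\<phi>\<in>C1. bil G t (gr \<phi>) \<phi> = (\<integral>x. g x * \<phi> x \<partial>MO))"

lemma functional_lin:
  assumes "sqint M g" and C: "\<And>\<phi>. \<phi> \<in> C1 \<Longrightarrow> sqint M \<phi>" and "\<phi> \<in> C1" "\<psi> \<in> C1"
  shows "(\<integral>x. g x * (\<phi> x + c * \<psi> x) \<partial>M) = (\<integral>x. g x * \<phi> x \<partial>M) + c * (\<integral>x. g x * \<psi> x \<partial>(M :: 'a measure))"
proof -
  have i: "integrable M (\<lambda>x. g x * \<phi> x)" "integrable M (\<lambda>x. g x * \<psi> x)"
    using sqint_inner[OF assms(1) C[OF assms(3)]] sqint_inner[OF assms(1) C[OF assms(4)]] by simp_all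
  have "(\<integral>x. g x * \<phi> x + c * (g x * \<psi> x) \<partial>M) = (\<integral>x. g x * \<phi> x \<partial>M) + c * (\<integral>x. g x * \<psi> x \<partial>M)"
    using i by simp
  then show ?thesis by (simp add: algebra_simps)
qed

lemma functional_bound:
  assumes g: "sqint M g" and C: "\<And>\<phi>. \<phi> \<in> C1 \<Longrightarrow> sqint M \<phi>" and \<phi>: "\<phi> \<in> C1" and Q: "(\<integral>x. (\<phi> x)\<^sup>2 \<partial>M) \<le> Q * en \<phi> \<phi>"
  shows "(\<integral>x. g x * \<phi> x \<partial>M)\<^sup>2 \<le> ((\<integral>x. (g x)\<^sup>2 \<partial>M) * Q) * en \<phi> \<phi>"
proof -
  have "(\<integral>x. g x * \<phi> x \<partial>M)\<^sup>2 \<le> (\<integral>x. (\<phi> x)\<^sup>2 \<partial>M) * (\<integral>x. (g x)\<^sup>2 \<partial>M)"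
    using sqint_Cauchy_Schwarz[OF g C[OF \<phi>]] by simp
  also have "\<dots> \<le> (Q * en \<phi> \<phi>) * (\<integral>x. (g x)\<^sup>2 \<partial>M)" using Q by (intro mult_right_mono integral_nonneg_AE) auto
  finally show ?thesis by (simp add: mult_ac)
qed

lemma trace_energy_bounds:
  obtains Q where "\<And>\<phi>. \<phi> \<in> C1 \<Longrightarrow> (\<integral>x. (\<phi> x)\<^sup>2 \<partial>MO) \<le> Q * en \<phi> \<phi>" "\<And>\<phi>. \<phi> \<in> C1 \<Longrightarrow> (\<integral>x. (\<phi> x)\<^sup>2 \<partial>M\<Gamma>) \<le> Q * en \<phi> \<phi>"
proof -
  obtain Q1 where Q1: "Q1 \<ge> 0" "\<And>\<phi>. \<phi> \<in> C1 \<Longrightarrow> (\<integral>x. (\<phi> x)\<^sup>2 \<partial>M\<Omega>) + (\<integral>x. (norm (gr \<phi> x))\<^sup>2 \<partial>M\<Omega>) + (\<integral>x. (\<phi> x)\<^sup>2 \<partial>M\<Gamma>) \<le> Q1 * en \<phi> \<phi>"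
    by (rule en_coercive) (rule that)
  obtain Q2 where Q2: "Q2 \<ge> 0" "\<And>\<phi>. \<phi> \<in> C1 \<Longrightarrow> (\<integral>x. (\<phi> x)\<^sup>2 \<partial>MO) \<le> Q2 * ((\<integral>x. (\<phi> x)\<^sup>2 \<partial>M\<Omega>) + (\<integral>x. (norm (gr \<phi> x))\<^sup>2 \<partial>M\<Omega>))"
    using trace_O by blast
  have "(\<integral>x. (\<phi> x)\<^sup>2 \<partial>MO) \<le> (Q2 * Q1 + Q1) * en \<phi> \<phi> \<and> (\<integral>x. (\<phi> x)\<^sup>2 \<partial>M\<Gamma>) \<le> (Q2 * Q1 + Q1) * en \<phi> \<phi>" if \<phi>: "\<phi> \<in> C1" for \<phi>
  proof -
    define a b t where "a = (\<integral>x. (\<phi> x)\<^sup>2 \<partial>M\<Omega>)" and "b = (\<integral>x. (norm (gr \<phi> x))\<^sup>2 \<partial>M\<Omega>)" and "t = (\<integral>x. (\<phi> x)\<^sup>2 \<partial>M\<Gamma>)"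
    have nn: "a \<ge> 0" "b \<ge> 0" "t \<ge> 0" unfolding a_def b_def t_def by (auto intro!: integral_nonneg_AE)
    have e: "a + b + t \<le> Q1 * en \<phi> \<phi>" using Q1(2)[OF \<phi>] by (simp add: a_def b_def t_def)
    have "(\<integral>x. (\<phi> x)\<^sup>2 \<partial>MO) \<le> Q2 * (a + b)" using Q2(2)[OF \<phi>] by (simp add: a_def b_def)
    also have "\<dots> \<le> Q2 * (Q1 * en \<phi> \<phi>)" using e nn Q2(1) by (intro mult_left_mono) auto
    finally have "(\<integral>x. (\<phi> x)\<^sup>2 \<partial>MO) \<le> Q2 * Q1 * en \<phi> \<phi>" by simp
    moreover have "0 \<le> Q1 * en \<phi> \<phi>" "0 \<le> Q2 * Q1 * en \<phi> \<phi>" using Q1(1) Q2(1) en_nonneg[OF \<phi>] by auto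
    moreover have "t \<le> Q1 * en \<phi> \<phi>" using e nn by simp
    ultimately show ?thesis unfolding t_def by (simp add: distrib_right)
  qed
  then show ?thesis using that by blast
qed

lemma solves_exists:
  assumes g: "sqint MO g"
  obtains un u G t where "solves g un u G t"
proof -
  obtain Q where Q: "\<And>\<phi>. \<phi> \<in> C1 \<Longrightarrow> (\<integral>x. (\<phi> x)\<^sup>2 \<partial>MO) \<le> Q * en \<phi> \<phi>"
    by (rule trace_energy_bounds) (rule that)
  obtain un u G t where "H1lim un u G t" "\<And>\<phi>. \<phi> \<in> C1 \<Longrightarrow> bil G t (gr \<phi>) \<phi> = (\<integral>x. g x * \<phi> x \<partial>MO)"
    by (rule solution_exists[OF functional_lin[OF g sqint_C1_MO] functional_bound[OF g sqint_C1_MO _ Q]])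
      (assumption, assumption, assumption, assumption, assumption, assumption, rule that)
  then have "solves g un u G t" using g by (simp add: solves_def)
  then show ?thesis by (rule that)
qed

lemma solves_lin:
  assumes 1: "solves g un u G t" and 2: "solves g' un' u' G' t'"
  shows "solves (\<lambda>x. g x + c * g' x) (\<lambda>n x. un n x + c * un' n x) (\<lambda>x. u x + c * u' x) (\<lambda>x. G x + c *\<^sub>R G' x) (\<lambda>x. t x + c * t' x)"
proof -
  have g: "sqint MO g" "sqint MO g'" and h: "H1lim un u G t" "H1lim un' u' G' t'" using 1 2 by (auto simp: solves_def)
  have sq: "sqint M\<Omega> G" "sqint M\<Omega> G'" "sqint M\<Gamma> t" "sqint M\<Gamma> t'" using h by (auto simp: H1lim_def)
  have "sqint MO (\<lambda>x. g x + c * g' x)" using sqint_add[OF g(1) sqint_scaleR[OF g(2), of c]] by simp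
  moreover have "bil (\<lambda>x. G x + c *\<^sub>R G' x) (\<lambda>x. t x + c * t' x) (gr \<phi>) \<phi> = (\<integral>x. (g x + c * g' x) * \<phi> x \<partial>MO)" if \<phi>: "\<phi> \<in> C1" for \<phi>
  proof -
    have i: "integrable MO (\<lambda>x. g x * \<phi> x)" "integrable MO (\<lambda>x. g' x * \<phi> x)"
      using sqint_inner[OF g(1) sqint_C1_MO[OF \<phi>]] sqint_inner[OF g(2) sqint_C1_MO[OF \<phi>]] by simp_all
    have "bil (\<lambda>x. G x + c *\<^sub>R G' x) (\<lambda>x. t x + c * t' x) (gr \<phi>) \<phi> = bil G t (gr \<phi>) \<phi> + c * bil G' t' (gr \<phi>) \<phi>"
      by (intro bil_lin sq sqint_C1_M\<Omega> sqint_C1_M\<Gamma> \<phi>)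
    also have "\<dots> = (\<integral>x. g x * \<phi> x \<partial>MO) + c * (\<integral>x. g' x * \<phi> x \<partial>MO)" using 1 2 \<phi> by (simp add: solves_def)
    also have "\<dots> = (\<integral>x. g x * \<phi> x + c * (g' x * \<phi> x) \<partial>MO)" using i by simp
    finally show ?thesis by (simp add: algebra_simps)
  qed
  ultimately show ?thesis unfolding solves_def using H1lim_lin[OF h] by blast
qed

text \<open>On the outer region \<open>h\<close> is 0 almost everywhere, so the size of
  \<open>w\<close> there is already part of its distance to \<open>h\<close>.\<close>

lemma restriction_le_distance:
  fixes w h :: "'a \<Rightarrow> 'b::euclidean_space"
  assumes w: "continuous_on UNIV w" and h: "h \<in> borel_measurable (restrict_space lborel \<Omega>)" "sqint M\<Omega> h"
    and zero: "AE x in lborel. x \<in> \<Omega> - closure \<Omega>1 \<longrightarrow> h x = 0"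
  shows "(\<integral>x. (norm (w x))\<^sup>2 \<partial>lebesgue_on (\<Omega> - closure \<Omega>1)) \<le> sqdist M\<Omega> w h"
proof -
  let ?W = "\<Omega> - closure \<Omega>1"
  have W[measurable]: "?W \<in> sets borel" "bounded ?W" using open_\<Omega>2 by auto
  have [measurable]: "w \<in> borel_measurable borel" using w by (rule borel_measurable_continuous_onI)
  have wr: "w \<in> borel_measurable (restrict_space lborel A)" for A by (rule measurable_restrict_space1) simp
  have dm: "(\<lambda>x. (norm (w x - h x))\<^sup>2) \<in> borel_measurable (restrict_space lborel \<Omega>)" using wr[of \<Omega>] h(1) by measurable
  have wm2: "(\<lambda>x. (norm (w x))\<^sup>2) \<in> borel_measurable (restrict_space lborel ?W)" using wr[of ?W] by measurable
  have "integrable M\<Omega> (\<lambda>x. (norm (w x - h x))\<^sup>2)"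
    by (intro sqint_integrable sqint_diff h sqint_lebesgue_on w borels opens)
  then have int1: "integrable lborel (\<lambda>x. indicator \<Omega> x *\<^sub>R (norm (w x - h x))\<^sup>2)"
    using integrable_restrict_lborel[OF borels(1) dm] by (simp add: integrable_restrict_space set_integrable_def)
  have int2: "integrable lborel (\<lambda>x. indicator ?W x *\<^sub>R (norm (w x))\<^sup>2)"
    using W by (intro integrable_indicator_continuous continuous_intros w)
  have "(\<integral>x. indicator ?W x *\<^sub>R (norm (w x))\<^sup>2 \<partial>lborel) \<le> (\<integral>x. indicator \<Omega> x *\<^sub>R (norm (w x - h x))\<^sup>2 \<partial>lborel)"
  proof (rule integral_mono_AE[OF int2 int1])
    show "AE x in lborel. indicator ?W x *\<^sub>R (norm (w x))\<^sup>2 \<le> indicator \<Omega> x *\<^sub>R (norm (w x - h x))\<^sup>2"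
      using zero by eventually_elim (auto simp: indicator_def)
  qed
  then show ?thesis
    unfolding integral_lebesgue_on_restrict[OF borels(1) dm] integral_lebesgue_on_restrict[OF W(1) wm2] .
qed

lemma surface_test_zero:
  assumes f: "sqint M\<Gamma> f" and zero: "\<And>\<phi>. \<phi> \<in> C1 \<Longrightarrow> (\<integral>x. f x * \<phi> x \<partial>M\<Gamma>) = 0"
  shows "AE x in M\<Gamma>. f x = 0"
proof (rule fundamental_lemma[where W = UNIV])
  show "(\<lambda>x. x) \<in> measurable M\<Gamma> borel" by (rule surface_measure_measurable) auto
  show "integrable M\<Gamma> f" by (rule sqint_integrable_finite[OF finite_measures(2) f])
  show "(\<integral>x. f x * \<phi> x \<partial>M\<Gamma>) = 0" if "test_fun UNIV \<phi> d\<phi>" for \<phi> d\<phi>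
    using that by (intro zero) (auto simp: test_fun_def intro: C1_gradI)
  show "\<exists>B\<in>sets borel. AE x in M\<Gamma>. x \<in> A \<longleftrightarrow> x \<in> B" if A: "A \<in> sets M\<Gamma>" for A
  proof -
    obtain B where B: "B \<in> sets borel" "A = frontier \<Omega>1 \<inter> B"
      using A by (auto simp: surface_measure_eq sets_restrict_space)
    have "AE x in M\<Gamma>. x \<in> A \<longleftrightarrow> x \<in> B"
      by (rule AE_I2) (auto simp: B surface_measure_eq space_restrict_space)
    then show ?thesis using B(1) by blast
  qed
qed auto

lemma orthogonal_zero:
  assumes f: "sqint M\<Gamma> f" and orth: "\<And>g un u G t. solves g un u G t \<Longrightarrow> (\<integral>x. f x * t x \<partial>M\<Gamma>) = 0"
  shows "AE x in M\<Gamma>. f x = 0"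
proof -
  obtain Q where Q: "\<And>\<phi>. \<phi> \<in> C1 \<Longrightarrow> (\<integral>x. (\<phi> x)\<^sup>2 \<partial>M\<Gamma>) \<le> Q * en \<phi> \<phi>"
    by (rule trace_energy_bounds) (rule that)
  obtain vn v G \<tau> where lim: "H1lim vn v G \<tau>" and vm: "v \<in> borel_measurable (restrict_space lborel \<Omega>)" "G \<in> borel_measurable (restrict_space lborel \<Omega>)"
    and eq: "\<And>\<phi>. \<phi> \<in> C1 \<Longrightarrow> bil G \<tau> (gr \<phi>) \<phi> = (\<integral>x. f x * \<phi> x \<partial>M\<Gamma>)"
    by (rule solution_exists[OF functional_lin[OF f sqint_C1_M\<Gamma>] functional_bound[OF f sqint_C1_M\<Gamma> _ Q]])
      (assumption, assumption, assumption, assumption, assumption, assumption, rule that)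
  have vn: "\<And>n. vn n \<in> C1" and sq: "sqint M\<Omega> v" "sqint M\<Omega> G" "sqint M\<Gamma> \<tau>"
    and tend: "(\<lambda>n. sqdist M\<Omega> (vn n) v) \<longlonglongrightarrow> 0" "(\<lambda>n. sqdist M\<Omega> (gr (vn n)) G) \<longlonglongrightarrow> 0" "(\<lambda>n. sqdist M\<Gamma> (vn n) \<tau>) \<longlonglongrightarrow> 0"
    using lim by (auto simp: H1lim_def)
  have comm: "sqdist M f g = sqdist M g f" for M :: "'a measure" and f and g :: "'a \<Rightarrow> 'b::euclidean_space" by (simp add: norm_minus_commute)
  \<comment> \<open>The outer traces of \<open>vn\<close> converge to some \<open>g\<close>, which
    is then used as flux datum. The symmetric form at \<open>v\<close> and the resulting solution
    has two values: the pairing of \<open>f\<close> with the trace of a solution, which is 0, and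
    the squared norm of \<open>g\<close>.\<close>
  have zeroO: "(\<lambda>n. \<integral>x. (vn n x)\<^sup>2 \<partial>MO) \<longlonglongrightarrow> 0"
  proof -
    obtain Q2 where Q2: "Q2 \<ge> 0" "\<And>\<phi>. \<phi> \<in> C1 \<Longrightarrow> (\<integral>x. (\<phi> x)\<^sup>2 \<partial>MO) \<le> Q2 * ((\<integral>x. (\<phi> x)\<^sup>2 \<partial>M\<Omega>) + (\<integral>x. (norm (gr \<phi> x))\<^sup>2 \<partial>M\<Omega>))"
      using trace_O by blast
    define a where "a n = sqdist M\<Omega> (vn n) v + sqdist M\<Omega> (gr (vn n)) G" for n
    have a0: "a \<longlonglongrightarrow> 0" unfolding a_def using tendsto_add[OF tend(1,2)] by simp
    have le: "sqdist MO (vn m) (vn n) \<le> Q2 * (2 * a m + 2 * a n)" for m n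
    proof -
      note d = C1_diff[OF vn[of m] vn[of n]]
      have "sqdist MO (vn m) (vn n) \<le> Q2 * (sqdist M\<Omega> (vn m) (vn n) + sqdist M\<Omega> (gr (vn m)) (gr (vn n)))"
        using Q2(2)[OF d(1)] unfolding d(2) by simp
      moreover have "sqdist M\<Omega> (vn m) (vn n) \<le> 2 * sqdist M\<Omega> (vn m) v + 2 * sqdist M\<Omega> (vn n) v"
        unfolding comm[of M\<Omega> "vn n" v] by (intro sqdist_triangle sqint_C1_M\<Omega> vn sq)
      moreover have "sqdist M\<Omega> (gr (vn m)) (gr (vn n)) \<le> 2 * sqdist M\<Omega> (gr (vn m)) G + 2 * sqdist M\<Omega> (gr (vn n)) G"
        unfolding comm[of M\<Omega> "gr (vn n)" G] by (intro sqdist_triangle sqint_C1_M\<Omega> vn sq)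
      ultimately have "sqdist M\<Omega> (vn m) (vn n) + sqdist M\<Omega> (gr (vn m)) (gr (vn n)) \<le> 2 * a m + 2 * a n"
        by (simp add: a_def)
      then have "Q2 * (sqdist M\<Omega> (vn m) (vn n) + sqdist M\<Omega> (gr (vn m)) (gr (vn n))) \<le> Q2 * (2 * a m + 2 * a n)"
        using Q2(1) by (rule mult_left_mono)
      with \<open>sqdist MO (vn m) (vn n) \<le> _\<close> show ?thesis by linarith
    qed
    obtain g where g: "sqint MO g" "(\<lambda>n. sqdist MO (vn n) g) \<longlonglongrightarrow> 0"
    proof (rule L2_complete[of MO vn])
      show "sqint MO (vn n)" for n by (rule sqint_C1_MO[OF vn])
      fix \<epsilon> :: real assume \<epsilon>: "\<epsilon> > 0"
      have "(\<lambda>n. Q2 * (4 * a n)) \<longlonglongrightarrow> Q2 * (4 * 0)" by (intro tendsto_intros a0)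
      then have "\<forall>\<^sub>F n in sequentially. Q2 * (4 * a n) < \<epsilon>" using \<epsilon> by (intro order_tendstoD(2)) auto
      then obtain N where N: "\<And>n. n \<ge> N \<Longrightarrow> Q2 * (4 * a n) < \<epsilon>" by (auto simp: eventually_sequentially)
      have "sqdist MO (vn m) (vn n) < \<epsilon>" if "m \<ge> N" "n \<ge> N" for m n
        using le[of m n] N[OF that(1)] N[OF that(2)] by (simp add: algebra_simps)
      then show "\<exists>N. \<forall>m\<ge>N. \<forall>n\<ge>N. sqdist MO (vn m) (vn n) < \<epsilon>" by blast
    qed
    obtain un u H t where sol: "solves g un u H t" by (rule solves_exists[OF g(1)])
    then have limu: "H1lim un u H t" by (simp add: solves_def)
    have un: "\<And>n. un n \<in> C1" and squ: "sqint M\<Omega> H" "sqint M\<Gamma> t" and tendu: "(\<lambda>n. sqdist M\<Gamma> (un n) t) \<longlonglongrightarrow> 0"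
      using limu by (auto simp: H1lim_def)
    have "(\<lambda>n. bil G \<tau> (gr (un n)) (un n)) \<longlonglongrightarrow> bil G \<tau> H t" by (rule bil_tendsto_right[OF limu sq(2,3)])
    moreover have "(\<lambda>n. \<integral>x. un n x \<bullet> f x \<partial>M\<Gamma>) \<longlonglongrightarrow> (\<integral>x. t x \<bullet> f x \<partial>M\<Gamma>)"
      by (intro sqdist_inner_tendsto sqint_C1_M\<Gamma> un squ f tendu)
    moreover have "bil G \<tau> (gr (un n)) (un n) = (\<integral>x. un n x \<bullet> f x \<partial>M\<Gamma>)" for n using eq[OF un] by (simp add: mult.commute)
    ultimately have "bil G \<tau> H t = (\<integral>x. t x \<bullet> f x \<partial>M\<Gamma>)" using LIMSEQ_unique by simp
    also have "\<dots> = 0" using orth[OF sol] by (simp add: mult.commute)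
    finally have b0: "bil G \<tau> H t = 0" .
    have "(\<lambda>n. bil (gr (vn n)) (vn n) H t) \<longlonglongrightarrow> bil G \<tau> H t" by (rule bil_tendsto_left[OF lim squ])
    moreover have "bil (gr (vn n)) (vn n) H t = (\<integral>x. vn n x \<bullet> g x \<partial>MO)" for n
      using sol vn[of n] unfolding bil_sym[of "gr (vn n)"] by (simp add: solves_def mult.commute)
    moreover have "(\<lambda>n. \<integral>x. vn n x \<bullet> g x \<partial>MO) \<longlonglongrightarrow> (\<integral>x. g x \<bullet> g x \<partial>MO)"
      by (rule sqdist_inner_tendsto[OF sqint_C1_MO[OF vn] g(1) g(1) g(2)])
    ultimately have "(\<integral>x. g x \<bullet> g x \<partial>MO) = 0" using LIMSEQ_unique b0 by simp
    then have gg: "sqdist MO g (\<lambda>_. 0) = 0" by (simp add: power2_eq_square)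
    have z: "sqint MO (\<lambda>_. 0 :: real)" by (simp add: sqint_def)
    show ?thesis
    proof (rule tendsto_sandwich[OF _ _ tendsto_const])
      show "(\<lambda>n. 2 * sqdist MO (vn n) g) \<longlonglongrightarrow> 0" using tendsto_mult[OF tendsto_const g(2), of 2] by simp
      show "\<forall>\<^sub>F n in sequentially. (\<integral>x. (vn n x)\<^sup>2 \<partial>MO) \<le> 2 * sqdist MO (vn n) g"
        using sqdist_triangle[OF sqint_C1_MO[OF vn] g(1) z] gg by simp
    qed (auto intro!: always_eventually integral_nonneg_AE)
  qed
  \<comment> \<open>Both interface integrals drop out of the equation for \<open>v\<close>, since
    \<open>\<phi>\<close> is 0 on the frontier of the inclusion.\<close>
  have harmonic: "(\<integral>x. s x * (G x \<bullet> gr \<phi> x) \<partial>M\<Omega>) = 0" if \<phi>: "\<phi> \<in> C1" and z: "\<And>x. x \<in> closure \<Omega>1 \<Longrightarrow> \<phi> x = 0" for \<phi>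
  proof -
    have z': "\<phi> x = 0" if "x \<in> space M\<Gamma>" for x
      using that z by (auto simp: surface_measure_eq space_restrict_space frontier_def)
    have "(\<integral>x. f x * \<phi> x \<partial>M\<Gamma>) = (\<integral>x. 0 \<partial>M\<Gamma>)"
      by (rule Bochner_Integration.integral_cong) (simp_all add: z')
    moreover have "(\<integral>x. \<gamma> x * \<tau> x * \<phi> x \<partial>M\<Gamma>) = (\<integral>x. 0 \<partial>M\<Gamma>)"
      by (rule Bochner_Integration.integral_cong) (simp_all add: z')
    ultimately show ?thesis using eq[OF \<phi>] by (simp add: bil_def)
  qed
  have uc: "AE x in lborel. x \<in> \<Omega> - closure \<Omega>1 \<longrightarrow> v x = 0 \<and> G x = 0"
    by (rule unique_continuation[OF lim zeroO vm harmonic])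
  have v0: "AE x in lborel. x \<in> \<Omega> - closure \<Omega>1 \<longrightarrow> v x = 0" and G0: "AE x in lborel. x \<in> \<Omega> - closure \<Omega>1 \<longrightarrow> G x = 0"
    using uc by (auto elim: eventually_mono)
  obtain Q3 where Q3: "Q3 \<ge> 0" "\<And>\<phi>. \<phi> \<in> C1 \<Longrightarrow> (\<integral>x. (\<phi> x)\<^sup>2 \<partial>M\<Gamma>) \<le> Q3 * ((\<integral>x. (\<phi> x)\<^sup>2 \<partial>lebesgue_on (\<Omega> - closure \<Omega>1)) + (\<integral>x. (norm (gr \<phi> x))\<^sup>2 \<partial>lebesgue_on (\<Omega> - closure \<Omega>1)))"
    using trace_\<Gamma> by blast
  \<comment> \<open>On the outer region \<open>vn\<close> and its gradients tend to 0, and the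
    interface trace is estimated from that side.\<close>
  have zero\<Gamma>: "(\<lambda>n. \<integral>x. (vn n x)\<^sup>2 \<partial>M\<Gamma>) \<longlonglongrightarrow> 0"
  proof (rule tendsto_sandwich[OF _ _ tendsto_const])
    have "(\<lambda>n. Q3 * (sqdist M\<Omega> (vn n) v + sqdist M\<Omega> (gr (vn n)) G)) \<longlonglongrightarrow> Q3 * (0 + 0)" by (intro tendsto_intros tend)
    then show "(\<lambda>n. Q3 * (sqdist M\<Omega> (vn n) v + sqdist M\<Omega> (gr (vn n)) G)) \<longlonglongrightarrow> 0" by simp
    show "\<forall>\<^sub>F n in sequentially. (\<integral>x. (vn n x)\<^sup>2 \<partial>M\<Gamma>) \<le> Q3 * (sqdist M\<Omega> (vn n) v + sqdist M\<Omega> (gr (vn n)) G)"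
    proof (intro always_eventually allI)
      fix n
      note C = C1_gr[OF vn[of n]]
      have "(\<integral>x. (norm (vn n x))\<^sup>2 \<partial>lebesgue_on (\<Omega> - closure \<Omega>1)) \<le> sqdist M\<Omega> (vn n) v"
        by (rule restriction_le_distance[OF C1_continuous[OF C] vm(1) sq(1) v0])
      moreover have "(\<integral>x. (norm (gr (vn n) x))\<^sup>2 \<partial>lebesgue_on (\<Omega> - closure \<Omega>1)) \<le> sqdist M\<Omega> (gr (vn n)) G"
        by (rule restriction_le_distance[OF C1_continuous_grad[OF C] vm(2) sq(2) G0])
      ultimately have "Q3 * ((\<integral>x. (vn n x)\<^sup>2 \<partial>lebesgue_on (\<Omega> - closure \<Omega>1)) + (\<integral>x. (norm (gr (vn n) x))\<^sup>2 \<partial>lebesgue_on (\<Omega> - closure \<Omega>1)))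
          \<le> Q3 * (sqdist M\<Omega> (vn n) v + sqdist M\<Omega> (gr (vn n)) G)"
        using Q3(1) by (intro mult_left_mono add_mono) auto
      with Q3(2)[OF vn[of n]] show "(\<integral>x. (vn n x)\<^sup>2 \<partial>M\<Gamma>) \<le> Q3 * (sqdist M\<Omega> (vn n) v + sqdist M\<Omega> (gr (vn n)) G)" by linarith
    qed
  qed (auto intro!: always_eventually integral_nonneg_AE)
  have \<tau>0: "(\<integral>x. (\<tau> x)\<^sup>2 \<partial>M\<Gamma>) = 0"
  proof -
    have z: "sqint M\<Gamma> (\<lambda>_. 0 :: real)" by (simp add: sqint_def)
    have "(\<lambda>n. 2 * sqdist M\<Gamma> (vn n) \<tau> + 2 * (\<integral>x. (vn n x)\<^sup>2 \<partial>M\<Gamma>)) \<longlonglongrightarrow> 2 * 0 + 2 * 0" by (intro tendsto_intros tend zero\<Gamma>)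
    moreover have "(\<integral>x. (\<tau> x)\<^sup>2 \<partial>M\<Gamma>) \<le> 2 * sqdist M\<Gamma> (vn n) \<tau> + 2 * (\<integral>x. (vn n x)\<^sup>2 \<partial>M\<Gamma>)" for n
      using sqdist_triangle[OF sq(3) sqint_C1_M\<Gamma>[OF vn[of n]] z] unfolding comm[of M\<Gamma> \<tau>] by simp
    ultimately have "(\<integral>x. (\<tau> x)\<^sup>2 \<partial>M\<Gamma>) \<le> 2 * 0 + 2 * 0"
      by (intro LIMSEQ_le_const) auto
    moreover have "0 \<le> (\<integral>x. (\<tau> x)\<^sup>2 \<partial>M\<Gamma>)" by (intro integral_nonneg_AE) auto
    ultimately show ?thesis by simp
  qed
  have \<tau>_inner: "(\<integral>x. \<tau> x * h x \<partial>M\<Gamma>) = 0" if "sqint M\<Gamma> h" for h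
    using sqint_Cauchy_Schwarz[OF sq(3) that] \<tau>0 by simp
  have "(\<lambda>n. bil G \<tau> (gr (vn n)) (vn n)) \<longlonglongrightarrow> bil G \<tau> G \<tau>" by (rule bil_tendsto_right[OF lim sq(2,3)])
  moreover have "(\<lambda>n. \<integral>x. vn n x \<bullet> f x \<partial>M\<Gamma>) \<longlonglongrightarrow> (\<integral>x. \<tau> x \<bullet> f x \<partial>M\<Gamma>)"
    by (intro sqdist_inner_tendsto sqint_C1_M\<Gamma> vn sq f tend)
  moreover have "bil G \<tau> (gr (vn n)) (vn n) = (\<integral>x. vn n x \<bullet> f x \<partial>M\<Gamma>)" for n using eq[OF vn] by (simp add: mult.commute)
  ultimately have "bil G \<tau> G \<tau> = (\<integral>x. \<tau> x \<bullet> f x \<partial>M\<Gamma>)" using LIMSEQ_unique by simp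
  also have "\<dots> = 0" using \<tau>_inner[OF f] by simp
  finally have b0: "bil G \<tau> G \<tau> = 0" .
  obtain m where m: "m > 0" "\<And>G t. sqint M\<Omega> G \<Longrightarrow> sqint M\<Gamma> t \<Longrightarrow>
     m * ((\<integral>x. (norm (G x))\<^sup>2 \<partial>M\<Omega>) + (\<integral>x. (t x)\<^sup>2 \<partial>M\<Gamma>)) \<le> bil G t G t" by (rule bil_lower) (rule that)
  have "m * (\<integral>x. (norm (G x))\<^sup>2 \<partial>M\<Omega>) \<le> 0" using m(2)[OF sq(2,3)] b0 \<tau>0 by simp
  then have "(\<integral>x. (norm (G x))\<^sup>2 \<partial>M\<Omega>) \<le> 0" using m(1) by (simp add: mult_le_0_iff)
  moreover have "0 \<le> (\<integral>x. (norm (G x))\<^sup>2 \<partial>M\<Omega>)" by (intro integral_nonneg_AE) auto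
  ultimately have GG: "(\<integral>x. (norm (G x))\<^sup>2 \<partial>M\<Omega>) = 0" by simp
  have "(\<integral>x. f x * \<phi> x \<partial>M\<Gamma>) = 0" if \<phi>: "\<phi> \<in> C1" for \<phi>
  proof -
    have "(\<integral>x. G x \<bullet> (s x *\<^sub>R gr \<phi> x) \<partial>M\<Omega>)\<^sup>2 \<le> 0"
      using sqint_Cauchy_Schwarz[OF sq(2) sqint_s[OF sqint_C1_M\<Omega>(2)[OF \<phi>]]] unfolding GG by simp
    then have "(\<integral>x. s x * (G x \<bullet> gr \<phi> x) \<partial>M\<Omega>) = 0" by simp
    moreover have "(\<integral>x. \<gamma> x * \<tau> x * \<phi> x \<partial>M\<Gamma>) = 0"
      using \<tau>_inner[OF sqint_\<gamma>[OF sqint_C1_M\<Gamma>[OF \<phi>]]] by (simp add: mult_ac)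
    ultimately show ?thesis using eq[OF \<phi>] by (simp add: bil_def)
  qed
  then show ?thesis by (rule surface_test_zero[OF f])
qed

text \<open>\<open>riesz_sequence\<close> for the product with \<open>f\<close> on the space
  \<open>D\<close> of traces of solutions gives members of \<open>D\<close> that converge to some
  \<open>t0\<close>, the projection of \<open>f\<close> to the closure of \<open>D\<close>. Then
  \<open>f - t0\<close> is orthogonal to \<open>D\<close>, hence 0 by
  \<open>orthogonal_zero\<close>, and the same sequence converges to \<open>f\<close>.\<close>

lemma density:
  assumes f: "L2 M\<Gamma> f"
  shows "\<exists>g u t. (\<forall>n. L2 MO (g n) \<and> weak_solution \<Omega> \<Omega>1 \<sigma>1 \<sigma>2 \<gamma> (g n) (u n) \<and> trace_on \<Omega> (frontier \<Omega>1) (u n) (t n)) \<and>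
           (\<lambda>n. \<integral>\<^sup>+ x. ennreal ((t n x - f x)\<^sup>2) \<partial>M\<Gamma>) \<longlonglongrightarrow> 0"
proof -
  have f: "sqint M\<Gamma> f" using f by (simp add: L2_iff_sqint)
  define D where "D = {t. \<exists>g un u G. solves g un u G t}"
  have D_sq: "sqint M\<Gamma> t" if "t \<in> D" for t using that by (auto simp: D_def solves_def H1lim_def)
  have prod_int: "integrable M\<Gamma> (\<lambda>x. a x * b x)" if "sqint M\<Gamma> a" "sqint M\<Gamma> b" for a b :: "'a \<Rightarrow> real" using sqint_inner[OF that] by simp
  interpret D: semi_inner D "\<lambda>a b. \<integral>x. a x * b x \<partial>M\<Gamma>"
  proof
    have "sqint MO (\<lambda>_. 0 :: real)" by (simp add: sqint_def)
    then obtain un u G t where "solves (\<lambda>_. 0) un u G t" by (rule solves_exists)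
    then have "t \<in> D" unfolding D_def by (intro CollectI exI)
    then show "D \<noteq> {}" by blast
    show "(\<lambda>x. a x + c * b x) \<in> D" if ab: "a \<in> D" "b \<in> D" for a b c
    proof -
      obtain g un u G g' un' u' G' where "solves g un u G a" "solves g' un' u' G' b" using ab unfolding D_def by auto
      from solves_lin[OF this, of c] show ?thesis unfolding D_def by (intro CollectI exI)
    qed
    show "(\<integral>x. (a x + c * b x) * h x \<partial>M\<Gamma>) = (\<integral>x. a x * h x \<partial>M\<Gamma>) + c * (\<integral>x. b x * h x \<partial>M\<Gamma>)" if "a \<in> D" "b \<in> D" "h \<in> D" for a b h c
    proof -
      have "(\<integral>x. a x * h x + c * (b x * h x) \<partial>M\<Gamma>) = (\<integral>x. a x * h x \<partial>M\<Gamma>) + c * (\<integral>x. b x * h x \<partial>M\<Gamma>)"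
        using prod_int D_sq that by simp
      then show ?thesis by (simp add: algebra_simps)
    qed
    show "(\<integral>x. a x * b x \<partial>M\<Gamma>) = (\<integral>x. b x * a x \<partial>M\<Gamma>)" for a b :: "'a \<Rightarrow> real" by (simp add: mult.commute)
    show "0 \<le> (\<integral>x. a x * a x \<partial>M\<Gamma>)" for a :: "'a \<Rightarrow> real" by (intro integral_nonneg_AE) auto
  qed
  have lin: "(\<integral>x. f x * (a x + c * b x) \<partial>M\<Gamma>) = (\<integral>x. f x * a x \<partial>M\<Gamma>) + c * (\<integral>x. f x * b x \<partial>M\<Gamma>)" if "a \<in> D" "b \<in> D" for a b c
  proof -
    have "(\<integral>x. f x * a x + c * (f x * b x) \<partial>M\<Gamma>) = (\<integral>x. f x * a x \<partial>M\<Gamma>) + c * (\<integral>x. f x * b x \<partial>M\<Gamma>)"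
      using prod_int D_sq that f by simp
    then show ?thesis by (simp add: algebra_simps)
  qed
  have bound: "(\<integral>x. f x * a x \<partial>M\<Gamma>)\<^sup>2 \<le> (\<integral>x. (f x)\<^sup>2 \<partial>M\<Gamma>) * (\<integral>x. a x * a x \<partial>M\<Gamma>)" if "a \<in> D" for a
    using sqint_Cauchy_Schwarz[OF f D_sq[OF that]] by (simp add: power2_eq_square mult.commute)
  obtain tn \<delta> where tn: "\<And>n. tn n \<in> D" and \<delta>: "\<delta> \<longlonglongrightarrow> 0"
    and r: "\<And>n a. a \<in> D \<Longrightarrow> ((\<integral>x. tn n x * a x \<partial>M\<Gamma>) - (\<integral>x. f x * a x \<partial>M\<Gamma>))\<^sup>2 \<le> \<delta> n * (\<integral>x. a x * a x \<partial>M\<Gamma>)"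
    by (rule D.riesz_sequence[OF lin bound]) (assumption, assumption, assumption, rule that)
  obtain t0 where t0: "sqint M\<Gamma> t0" "(\<lambda>n. sqdist M\<Gamma> (tn n) t0) \<longlonglongrightarrow> 0"
  proof (rule L2_complete[of M\<Gamma> tn])
    show "sqint M\<Gamma> (tn n)" for n by (rule D_sq[OF tn])
    show "\<exists>N. \<forall>m\<ge>N. \<forall>n\<ge>N. sqdist M\<Gamma> (tn m) (tn n) < \<epsilon>" if "\<epsilon> > 0" for \<epsilon>
      using D.riesz_sequence_Cauchy[OF tn \<delta> r that] by (simp add: power2_eq_square)
  qed
  define h where "h x = f x - t0 x" for x
  have h: "sqint M\<Gamma> h" unfolding h_def by (rule sqint_diff[OF f t0(1)])
  have "(\<integral>x. h x * t x \<partial>M\<Gamma>) = 0" if "solves g un u G t" for g un u G t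
  proof -
    have tD: "t \<in> D" using that by (auto simp: D_def)
    have "(\<lambda>n. ((\<integral>x. tn n x * t x \<partial>M\<Gamma>) - (\<integral>x. f x * t x \<partial>M\<Gamma>))\<^sup>2) \<longlonglongrightarrow> 0"
    proof (rule tendsto_sandwich[OF _ _ tendsto_const])
      show "(\<lambda>n. \<delta> n * (\<integral>x. t x * t x \<partial>M\<Gamma>)) \<longlonglongrightarrow> 0" using tendsto_mult[OF \<delta> tendsto_const, of "\<integral>x. t x * t x \<partial>M\<Gamma>"] by simp
    qed (use r[OF tD] in auto)
    from tendsto_real_sqrt[OF this] have "(\<lambda>n. (\<integral>x. tn n x * t x \<partial>M\<Gamma>) - (\<integral>x. f x * t x \<partial>M\<Gamma>)) \<longlonglongrightarrow> 0"
      by (simp add: tendsto_rabs_zero_iff)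
    then have "(\<lambda>n. \<integral>x. tn n x * t x \<partial>M\<Gamma>) \<longlonglongrightarrow> (\<integral>x. f x * t x \<partial>M\<Gamma>)" by (rule LIM_zero_cancel)
    moreover have "(\<lambda>n. \<integral>x. tn n x \<bullet> t x \<partial>M\<Gamma>) \<longlonglongrightarrow> (\<integral>x. t0 x \<bullet> t x \<partial>M\<Gamma>)"
      by (rule sqdist_inner_tendsto[OF D_sq[OF tn] t0(1) D_sq[OF tD] t0(2)])
    ultimately have eq: "(\<integral>x. f x * t x \<partial>M\<Gamma>) = (\<integral>x. t0 x * t x \<partial>M\<Gamma>)" using LIMSEQ_unique by simp
    have "(\<integral>x. h x * t x \<partial>M\<Gamma>) = (\<integral>x. f x * t x - t0 x * t x \<partial>M\<Gamma>)" by (simp add: h_def left_diff_distrib)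
    also have "\<dots> = 0" using prod_int[OF f D_sq[OF tD]] prod_int[OF t0(1) D_sq[OF tD]] eq by simp
    finally show ?thesis .
  qed
  then have "AE x in M\<Gamma>. h x = 0" by (rule orthogonal_zero[OF h])
  then have "AE x in M\<Gamma>. (norm (t0 x - f x))\<^sup>2 = 0" by eventually_elim (simp add: h_def)
  then have z: "sqdist M\<Gamma> t0 f = 0"
    using sqint_integrable[OF sqint_diff[OF t0(1) f]] by (subst integral_nonneg_eq_0_iff_AE) auto
  have lim: "(\<lambda>n. sqdist M\<Gamma> (tn n) f) \<longlonglongrightarrow> 0"
  proof (rule tendsto_sandwich[OF _ _ tendsto_const])
    show "(\<lambda>n. 2 * sqdist M\<Gamma> (tn n) t0) \<longlonglongrightarrow> 0" using tendsto_mult[OF tendsto_const t0(2), of 2] by simp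
    show "\<forall>\<^sub>F n in sequentially. sqdist M\<Gamma> (tn n) f \<le> 2 * sqdist M\<Gamma> (tn n) t0"
      using sqdist_triangle[OF D_sq[OF tn] t0(1) f] z by simp
  qed (auto intro!: always_eventually integral_nonneg_AE)
  have nn: "(\<integral>\<^sup>+ x. ennreal ((tn n x - f x)\<^sup>2) \<partial>M\<Gamma>) = ennreal (sqdist M\<Gamma> (tn n) f)" for n
    using sqint_nn[OF sqint_diff[OF D_sq[OF tn] f], of n] by simp
  have lim': "(\<lambda>n. \<integral>\<^sup>+ x. ennreal ((tn n x - f x)\<^sup>2) \<partial>M\<Gamma>) \<longlonglongrightarrow> 0"
    unfolding nn using tendsto_ennrealI[OF lim] by simp
  have "\<exists>g u. L2 MO g \<and> weak_solution \<Omega> \<Omega>1 \<sigma>1 \<sigma>2 \<gamma> g u \<and> trace_on \<Omega> (frontier \<Omega>1) u (tn n)" for n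
  proof -
    obtain g un u G where s: "solves g un u G (tn n)" using tn[of n] by (auto simp: D_def)
    then have l: "H1lim un u G (tn n)" and g: "sqint MO g" by (auto simp: solves_def)
    have "weak_solution \<Omega> \<Omega>1 \<sigma>1 \<sigma>2 \<gamma> g u" by (rule weak_solutionI[OF l g]) (use s in \<open>simp add: solves_def\<close>)
    then show ?thesis using trace_limit[OF l] g by (auto simp: L2_iff_sqint)
  qed
  then obtain g u where "\<And>n. L2 MO (g n) \<and> weak_solution \<Omega> \<Omega>1 \<sigma>1 \<sigma>2 \<gamma> (g n) (u n) \<and> trace_on \<Omega> (frontier \<Omega>1) (u n) (tn n)"
    by metis
  then show ?thesis using lim' by blast
qed

end

text \<open>If the inclusion is empty or \<open>hausdorff_ok\<close> fails, the surface integral over the interface vanishes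
  identically. (\<open>measure_of\<close> yields the zero measure for a set function that is not countably additive;
  the second case is vacuous, but ruling it out would take a proof that Hausdorff measure is a measure.)\<close>

lemma trivial_solution:
  fixes \<Omega> \<Omega>1 :: "'a::euclidean_space set"
  assumes triv: "\<not> hausdorff_ok TYPE('a) \<or> \<Omega>1 = {}"
  shows "L2 (surface_measure S) (\<lambda>_. 0)" "weak_solution \<Omega> \<Omega>1 \<sigma>1 \<sigma>2 \<gamma> (\<lambda>_. 0) (\<lambda>_. 0)"
    "trace_on \<Omega> S (\<lambda>_. 0) (\<lambda>_. 0)" "(\<integral>\<^sup>+ x. f x \<partial>surface_measure (frontier \<Omega>1)) = 0"
proof -
  show L: "L2 (surface_measure S) (\<lambda>_. 0)" for S :: "'a set" by (simp add: L2_def)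
  have w: "weak_grad \<Omega> (\<lambda>_. 0) (\<lambda>_. 0)" by (simp add: weak_grad_def L2_def)
  have "\<exists>\<phi> d\<phi>. (\<forall>n. C1_grad (\<phi> n) (d\<phi> n)) \<and>
        (\<lambda>n. \<integral>\<^sup>+ x. ennreal ((\<phi> n x - 0)\<^sup>2 + (norm (d\<phi> n x - 0))\<^sup>2) \<partial>lebesgue_on \<Omega>) \<longlonglongrightarrow> 0 \<and>
        (\<lambda>n. \<integral>\<^sup>+ x. ennreal ((\<phi> n x - 0)\<^sup>2) \<partial>surface_measure S) \<longlonglongrightarrow> 0" for S :: "'a set"
    by (rule exI[of _ "\<lambda>_ _. 0"], rule exI[of _ "\<lambda>_ _. 0"]) (simp add: C1_const)
  then show t: "trace_on \<Omega> S (\<lambda>_. 0) (\<lambda>_. 0)" for S :: "'a set" unfolding trace_on_def using w L by blast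
  show "weak_solution \<Omega> \<Omega>1 \<sigma>1 \<sigma>2 \<gamma> (\<lambda>_. 0) (\<lambda>_. 0)"
    unfolding weak_solution_def by (rule exI[of _ "\<lambda>_. 0"], rule exI[of _ "\<lambda>_. 0"]) (simp add: w t)
  have "emeasure (surface_measure (frontier \<Omega>1)) (space (surface_measure (frontier \<Omega>1))) = 0"
  proof (cases "\<Omega>1 = {}")
    case True
    then show ?thesis by (simp add: surface_measure_eq space_restrict_space)
  next
    case False
    then have "\<not> hausdorff_ok TYPE('a)" using triv by blast
    moreover have "frontier \<Omega>1 \<in> sets borel" by (intro borel_closed frontier_closed)
    ultimately show ?thesis
      by (simp add: surface_measure_eq space_restrict_space emeasure_restrict_space hmeasure_null)
  qed
  then have "AE x in surface_measure (frontier \<Omega>1). f x = 0" by (intro AE_I[where N = "space (surface_measure (frontier \<Omega>1))"]) auto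
  then have "(\<integral>\<^sup>+ x. f x \<partial>surface_measure (frontier \<Omega>1)) = (\<integral>\<^sup>+ x. 0 \<partial>surface_measure (frontier \<Omega>1))" by (rule nn_integral_cong_AE)
  then show "(\<integral>\<^sup>+ x. f x \<partial>surface_measure (frontier \<Omega>1)) = 0" by simp
qed

theorem theorem3p1:
  fixes \<Omega> \<Omega>1 :: "'a::euclidean_space set" and \<sigma>1 \<sigma>2 :: real and \<gamma> f :: "'a \<Rightarrow> real"
  assumes "DIM('a) \<ge> 2"
    and "lipschitz_open \<Omega>" and "connected \<Omega>" and "\<Omega> \<noteq> {}"
    and "open \<Omega>1" and "closure \<Omega>1 \<subseteq> \<Omega>" and "lipschitz_open \<Omega>1"
    and "connected (\<Omega> - closure \<Omega>1)"
    and "\<sigma>1 > 0" and "\<sigma>2 > 0"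
    and "Linf_pos (surface_measure (frontier \<Omega>1)) \<gamma>"
    and "L2 (surface_measure (frontier \<Omega>1)) f"
  shows "\<exists>g u t. (\<forall>n. L2 (surface_measure (frontier \<Omega>)) (g n) \<and>
                     weak_solution \<Omega> \<Omega>1 \<sigma>1 \<sigma>2 \<gamma> (g n) (u n) \<and>
                     trace_on \<Omega> (frontier \<Omega>1) (u n) (t n)) \<and>
           (\<lambda>n. \<integral>\<^sup>+ x. ennreal ((t n x - f x)\<^sup>2) \<partial>surface_measure (frontier \<Omega>1)) \<longlonglongrightarrow> 0"
proof (cases "hausdorff_ok TYPE('a) \<and> \<Omega>1 \<noteq> {}")
  case True
  then interpret transmission \<Omega> \<Omega>1 \<sigma>1 \<sigma>2 \<gamma>
    by unfold_locales (use assms in blast)+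
  show ?thesis by (rule density[OF assms(12)])
next
  case False
  then have "\<not> hausdorff_ok TYPE('a) \<or> \<Omega>1 = {}" by blast
  note t = trivial_solution[OF this]
  show ?thesis
    by (rule exI[of _ "\<lambda>_ _. 0"], rule exI[of _ "\<lambda>_ _. 0"], rule exI[of _ "\<lambda>_ _. 0"]) (simp add: t)
qed

end
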